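(* Let $\Omega\subset\mathbb{R}^n$ be a domain, $P\in L^\infty(\Omega)$, $x_0\in\Omega$, $0<r_1<r_2<d(x_0,\partial\Omega)$ and $B_j=B(x_0,r_j)$ for $j=1,2$. Then there exist $\kappa\in(0,1)$ and a constant $C(P)>0$ such that for all $u\in H^1(\Omega)$ $$\|u\|_{H^1(B_2)}\le C(P)\left(\|u\|_{L^2(B_1)}+\|-\Delta u+Pu\|_{H^{-1}(\Omega)}\right)^{\kappa}\left(\|u\|_{L^2(\Omega)}+\|-\Delta u+Pu\|_{H^{-1}(\Omega)}\right)^{1-\kappa}.$$ Furthermore, if $P\ge 0$ on $\Omega$, then one may take $C(P)=\exp\left(C\kappa^{1-\epsilon}\left(\|P\|_{L^\infty(\Omega)}^{2/3}+1\right)\right)$, where $\epsilon\in(0,1)$ is arbitrary and $C>0$ depends on $\epsilon$ and the geometry ($\Omega,x_0,r_1,r_2$), but not on $P$ or $u$.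
   Context: $B(x_0,r)$ is the open ball of radius $r$ centred at $x_0$; $d(x_0,\partial\Omega)$ is the distance from $x_0$ to the boundary of $\Omega$. $P$ is a real-valued potential. $H^{-1}(\Omega)$ is the dual of $H^1_0(\Omega)$. The exponent $\kappa$ depends only on the geometry ($\Omega,x_0,r_1,r_2$), not on $P$, $u$ or $\epsilon$; $C(P)$ is independent of $u$. *)

theory Defs
  imports "HOL-Analysis.Analysis" "HOL-Probability.Essential_Supremum"
begin

text \<open>
  Functions are complex-valued representatives of a.e.-classes. All spaces over a set \<open>\<Omega>\<close> are
  taken with respect to Lebesgue measure on \<open>\<Omega>\<close>; values outside \<open>\<Omega>\<close> are irrelevant, so
  \<open>\<parallel>u\<parallel>\<close> over a smaller set is the norm of the restriction.
\<close>

text \<open>Extended-valued, so that the distance to an empty boundary is \<open>\<infinity>\<close>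
  (\<open>infdist\<close> and \<open>setdist\<close> would give \<open>0\<close>).\<close>

definition boundary_dist :: "'a::metric_space \<Rightarrow> 'a set \<Rightarrow> ereal" where
  "boundary_dist x \<Omega> = (INF y\<in>frontier \<Omega>. ereal (dist x y))"

definition L2 :: "(real^'n) set \<Rightarrow> ((real^'n) \<Rightarrow> complex) set" where
  "L2 \<Omega> = {u. u \<in> borel_measurable (lebesgue_on \<Omega>) \<and>
              integrable (lebesgue_on \<Omega>) (\<lambda>x. (cmod (u x))\<^sup>2)}"

definition L2_norm :: "(real^'n) set \<Rightarrow> ((real^'n) \<Rightarrow> complex) \<Rightarrow> real" where
  "L2_norm \<Omega> u = sqrt (\<integral>x. (cmod (u x))\<^sup>2 \<partial>lebesgue_on \<Omega>)"

definition Linf :: "(real^'n) set \<Rightarrow> ((real^'n) \<Rightarrow> real) set" where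
  "Linf \<Omega> = {P. P \<in> borel_measurable (lebesgue_on \<Omega>) \<and>
                esssup (lebesgue_on \<Omega>) (\<lambda>x. ennreal \<bar>P x\<bar>) < \<infinity>}"

definition Linf_norm :: "(real^'n) set \<Rightarrow> ((real^'n) \<Rightarrow> real) \<Rightarrow> real" where
  "Linf_norm \<Omega> P = enn2real (esssup (lebesgue_on \<Omega>) (\<lambda>x. ennreal \<bar>P x\<bar>))"

definition partial :: "'n \<Rightarrow> ((real^'n) \<Rightarrow> complex) \<Rightarrow> (real^'n) \<Rightarrow> complex" where
  "partial i f x = frechet_derivative f (at x) (axis i 1)"

primrec Ck :: "nat \<Rightarrow> ((real^'n) \<Rightarrow> complex) \<Rightarrow> bool" where
  "Ck 0 f \<longleftrightarrow> continuous_on UNIV f"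
| "Ck (Suc k) f \<longleftrightarrow> (\<forall>x. f differentiable at x) \<and> (\<forall>i. Ck k (partial i f))"

text \<open>\<open>C\<^sub>c\<^sup>\<infinity>(\<Omega>)\<close>, each function being extended by zero to the whole space.\<close>

definition test_functions :: "(real^'n) set \<Rightarrow> ((real^'n) \<Rightarrow> complex) set" where
  "test_functions \<Omega> = {\<phi>. (\<forall>k. Ck k \<phi>) \<and>
      compact (closure {x. \<phi> x \<noteq> 0}) \<and> closure {x. \<phi> x \<noteq> 0} \<subseteq> \<Omega>}"

definition locally_integrable :: "(real^'n) set \<Rightarrow> ((real^'n) \<Rightarrow> complex) \<Rightarrow> bool" where
  "locally_integrable \<Omega> u \<longleftrightarrow> (\<forall>K. compact K \<and> K \<subseteq> \<Omega> \<longrightarrow> integrable (lebesgue_on K) u)"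

definition has_weak_partial ::
    "(real^'n) set \<Rightarrow> 'n \<Rightarrow> ((real^'n) \<Rightarrow> complex) \<Rightarrow> ((real^'n) \<Rightarrow> complex) \<Rightarrow> bool" where
  "has_weak_partial \<Omega> i u g \<longleftrightarrow> locally_integrable \<Omega> u \<and> locally_integrable \<Omega> g \<and>
     (\<forall>\<phi>\<in>test_functions \<Omega>.
        (\<integral>x. u x * partial i \<phi> x \<partial>lebesgue_on \<Omega>) = - (\<integral>x. g x * \<phi> x \<partial>lebesgue_on \<Omega>))"

text \<open>Determined up to null sets on an open \<open>\<Omega>\<close>, hence usable under integrals.\<close>

definition weak_partial ::
    "(real^'n) set \<Rightarrow> 'n \<Rightarrow> ((real^'n) \<Rightarrow> complex) \<Rightarrow> (real^'n) \<Rightarrow> complex" where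
  "weak_partial \<Omega> i u = (SOME g. has_weak_partial \<Omega> i u g)"

definition H1 :: "(real^'n) set \<Rightarrow> ((real^'n) \<Rightarrow> complex) set" where
  "H1 \<Omega> = {u \<in> L2 \<Omega>. \<forall>i. \<exists>g\<in>L2 \<Omega>. has_weak_partial \<Omega> i u g}"

definition H1_norm :: "(real^'n) set \<Rightarrow> ((real^'n) \<Rightarrow> complex) \<Rightarrow> real" where
  "H1_norm \<Omega> u = sqrt ((L2_norm \<Omega> u)\<^sup>2 + (\<Sum>i\<in>UNIV. (L2_norm \<Omega> (weak_partial \<Omega> i u))\<^sup>2))"

text \<open>The closure of \<open>C\<^sub>c\<^sup>\<infinity>(\<Omega>)\<close> in \<open>H\<^sup>1(\<Omega>)\<close>.\<close>

definition H10 :: "(real^'n) set \<Rightarrow> ((real^'n) \<Rightarrow> complex) set" where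
  "H10 \<Omega> = {v \<in> H1 \<Omega>. \<forall>e>0. \<exists>\<phi>\<in>test_functions \<Omega>. H1_norm \<Omega> (\<lambda>x. v x - \<phi> x) < e}"

text \<open>The dual norm of a functional on \<open>H\<^sup>1\<^sub>0(\<Omega>)\<close>; meaningful for bounded linear functionals.\<close>

definition Hm1_norm :: "(real^'n) set \<Rightarrow> (((real^'n) \<Rightarrow> complex) \<Rightarrow> complex) \<Rightarrow> real" where
  "Hm1_norm \<Omega> F = (SUP v\<in>{v \<in> H10 \<Omega>. H1_norm \<Omega> v \<le> 1}. cmod (F v))"

text \<open>The element \<open>-\<Delta>u + Pu\<close> of \<open>H\<^sup>-\<^sup>1(\<Omega>)\<close> for \<open>u \<in> H\<^sup>1(\<Omega>)\<close>. The pairing is the bilinear one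
  (no conjugation), so this is a complex-linear functional of \<open>v\<close>.\<close>

definition schroedinger ::
    "(real^'n) set \<Rightarrow> ((real^'n) \<Rightarrow> real) \<Rightarrow> ((real^'n) \<Rightarrow> complex)
      \<Rightarrow> ((real^'n) \<Rightarrow> complex) \<Rightarrow> complex" where
  "schroedinger \<Omega> P u v =
     (\<integral>x. (\<Sum>i\<in>UNIV. weak_partial \<Omega> i u x * weak_partial \<Omega> i v x) + of_real (P x) * u x * v x
        \<partial>lebesgue_on \<Omega>)"

end

theory Submission
  imports Defs
begin

text \<open>
  The proof is a Carleman estimate for smooth functions, transferred to \<open>H\<^sup>1\<close> by mollification.

  On the annulus the weight is \<open>exp (s (q - A ln q))\<close> with \<open>q = \<bar>x - x\<^sub>0\<bar>\<^sup>2\<close> and \<open>A > R\<^sup>2\<close>. It is radially decreasing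
  and convex as a function of \<open>ln \<bar>x - x\<^sub>0\<bar>\<close>. Since the angular part of the Laplacian commutes with radial
  functions, the commutator of the conjugated operator controls \<open>s\<^sup>3\<close> times the weighted norm, so that \<open>s\<close> of size
  \<open>\<parallel>P\<parallel>\<^sub>\<infinity>\<^sup>2\<^sup>/\<^sup>3\<close> absorbs the potential, whatever its sign. Cut-offs, the Caccioppoli inequality and a choice of \<open>s\<close> give
  the three-ball inequality for smooth functions.

  For \<open>u \<in> H\<^sup>1\<close> the right-hand side \<open>F = - \<Delta>u + Pu\<close> is represented up to a small error by \<open>- \<Delta>w + w\<close> with a test
  function \<open>w\<close> of norm at most \<open>\<parallel>F\<parallel> + \<eta>\<close>. Then \<open>u - w\<close> solves \<open>\<Delta>(u - w) = Pu - w\<close> up to that error, which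
  mollification at a fixed scale turns into a small bounded function. The mollification scale is chosen
  before \<open>w\<close>, hence only the norm of \<open>w\<close> enters. As \<open>\<kappa>\<close> is fixed by the geometry, the factor \<open>\<kappa>\<^sup>1\<^sup>-\<^sup>\<epsilon>\<close> is absorbed
  into the constant \<open>C\<close>.
\<close>

text \<open>In the variables t = ln |x - a| and angle, |x - a|^2 times the Laplacian is, after
  conjugation with a power of |x - a|, the sum of d^2/dt^2, the spherical Laplacian and a constant.
  The natural density |x - a|^(-n) has a pole at a, so cut-offs must avoid the centre, and the data
  on the inner ball pay for the missing part. The exponent 2/3 is the balance of s^3 against the
  square of the bound on P. The shape of the weight is fixed and only s varies; \<kappa> is
  therefore a quotient of differences of the weight's exponent at three radii, independent of P.

  The obstacle is that F lies only in the dual space, while the Carleman estimate needs a Laplacian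
  in L2. Subtracting w removes F: u - w has a right-hand side in L2, and in the H1 norm w costs
  little more than the dual norm of F. An approximate representation suffices because its error is
  only ever tested against translates of one kernel, whose H1 norm is a number fixed
  beforehand.\<close>

section \<open>Divergence theorem and functions of class \<open>C\<^sup>2\<close>\<close>

text \<open>Difference quotients along \<open>b\<close> have integral zero because
  \<open>lborel\<close> is translation invariant. The mean value theorem bounds them by the maximum
  of the derivative, and they vanish off a ball enlarged by \<open>norm b\<close>, so dominated
  convergence passes to the limit.\<close>

lemma integral_directional_derivative_eq_0:
  fixes f :: "'a::euclidean_space \<Rightarrow> real"
  assumes der: "\<And>x. (f has_derivative D x) (at x)"
    and cont: "continuous_on UNIV (\<lambda>x. D x b)"
    and K: "compact K" "\<And>x. x \<notin> K \<Longrightarrow> f x = 0"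
  shows "integrable lborel (\<lambda>x. D x b)" and "(\<integral>x. D x b \<partial>lborel) = 0"
proof -
  have fcont: "continuous_on UNIV f"
    by (intro continuous_at_imp_continuous_on ballI has_derivative_continuous[OF der])
  obtain r where r: "r > 0" "K \<subseteq> cball 0 r"
    using bounded_subset_ballD[OF compact_imp_bounded[OF K(1)], of 0] ball_subset_cball by blast
  let ?S = "cball 0 (r + norm b) :: 'a set"
  have KS: "K \<subseteq> ?S"
    using r(2) subset_cball[of r "r + norm b" 0] by auto
  have D0: "D x b = 0" if "x \<notin> K" for x
  proof -
    have "open (-K)" using K(1) by (simp add: compact_imp_closed open_Compl)
    then have "((\<lambda>x. 0) has_derivative D x) (at x)"
      using has_derivative_transform_within_open[OF der[of x], of "-K" "\<lambda>x. 0"] that K(2) by auto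
    then have "D x = (\<lambda>h. 0)"
      by (rule has_derivative_unique[OF _ has_derivative_const])
    then show ?thesis by simp
  qed
  have DS: "D x b = indicator ?S x *\<^sub>R D x b" for x
    using D0[of x] subsetD[OF KS, of x] by (auto simp: indicator_def)
  show intD: "integrable lborel (\<lambda>x. D x b)"
    using borel_integrable_compact[OF compact_cball continuous_on_subset[OF cont subset_UNIV], of 0 "r + norm b"]
    unfolding DS[symmetric] .
  have fS: "f x = indicator ?S x *\<^sub>R f x" for x
    using K(2)[of x] subsetD[OF KS, of x] by (auto simp: indicator_def)
  have intf: "integrable lborel f"
    using borel_integrable_compact[OF compact_cball continuous_on_subset[OF fcont subset_UNIV], of 0 "r + norm b"]
    unfolding fS[symmetric] .
  have "bounded ((\<lambda>x. D x b) ` ?S)"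
    by (intro compact_imp_bounded compact_continuous_image continuous_on_subset[OF cont]) auto
  then obtain M0 where M0: "\<And>x. x \<in> ?S \<Longrightarrow> \<bar>D x b\<bar> \<le> M0"
    unfolding bounded_iff by (metis imageI real_norm_def)
  define M where "M = max M0 0"
  have M: "\<bar>D x b\<bar> \<le> M" for x
    using M0[of x] DS[of x] by (cases "x \<in> ?S") (auto simp: M_def indicator_def)
  \<comment> \<open>Step lengths of at most 1 keep the shifted supports inside
    \<open>?S\<close>.\<close>
  define t where "t n = inverse (real (Suc n))" for n
  have t: "0 < t n" "t n \<le> 1" for n by (auto simp: t_def inverse_le_1_iff)
  define d where "d n x = (f (x + t n *\<^sub>R b) - f x) / t n" for n x
  have line: "((\<lambda>u. f (x + u *\<^sub>R b)) has_derivative (\<lambda>h. D (x + u *\<^sub>R b) (h *\<^sub>R b))) (at u)" for x u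
    by (rule has_derivative_compose[of "\<lambda>u. x + u *\<^sub>R b" "\<lambda>h. h *\<^sub>R b" u UNIV f, OF _ der])
       (auto intro!: derivative_eq_intros)
  have lineD: "((\<lambda>u. f (x + u *\<^sub>R b)) has_real_derivative D (x + u *\<^sub>R b) b) (at u)" for x u
  proof -
    have "linear (D (x + u *\<^sub>R b))" by (rule has_derivative_linear[OF der])
    then show ?thesis unfolding has_field_derivative_def
      using line[of x u] by (simp add: linear_cmul mult_commute_abs)
  qed
  have "(\<lambda>n. \<integral>x. d n x \<partial>lborel) \<longlonglongrightarrow> (\<integral>x. D x b \<partial>lborel)"
  proof (rule integral_dominated_convergence[where w="\<lambda>x. indicator ?S x *\<^sub>R M"])
    show "(\<lambda>x. D x b) \<in> borel_measurable lborel" using intD by auto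
    show "d n \<in> borel_measurable lborel" for n
    proof -
      have "continuous_on UNIV (\<lambda>x. f (x + t n *\<^sub>R b))"
        by (rule continuous_on_compose2[OF fcont]) (auto intro!: continuous_intros)
      then have "continuous_on UNIV (d n)" unfolding d_def using fcont t[of n]
        by (intro continuous_intros) auto
      then show ?thesis by (simp add: borel_measurable_continuous_onI)
    qed
    show "integrable lborel (\<lambda>x. indicator ?S x *\<^sub>R M)"
      by (intro borel_integrable_compact) auto
    show "AE x in lborel. (\<lambda>n. d n x) \<longlonglongrightarrow> D x b"
    proof (rule AE_I2)
      fix x
      have "((\<lambda>h. (f (x + h *\<^sub>R b) - f x) / h) \<longlongrightarrow> D x b) (at 0)"
        using lineD[of x 0] by (simp add: DERIV_def)
      moreover have "filterlim t (at 0) sequentially"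
        unfolding filterlim_at t_def using LIMSEQ_inverse_real_of_nat
        by (auto simp del: of_nat_Suc)
      ultimately show "(\<lambda>n. d n x) \<longlonglongrightarrow> D x b"
        unfolding d_def by (rule filterlim_compose)
    qed
    show "AE x in lborel. norm (d n x) \<le> indicator ?S x *\<^sub>R M" for n
    proof (rule AE_I2)
      fix x
      show "norm (d n x) \<le> indicator ?S x *\<^sub>R M"
      proof (cases "x \<in> ?S")
        case True
        have "\<exists>z>0. z < t n \<and> f (x + t n *\<^sub>R b) - f (x + 0 *\<^sub>R b) = (t n - 0) * D (x + z *\<^sub>R b) b"
          using t[of n] by (intro MVT2) (auto intro!: lineD)
        then obtain z where "f (x + t n *\<^sub>R b) - f x = t n * D (x + z *\<^sub>R b) b" by auto
        then have "d n x = D (x + z *\<^sub>R b) b" using t[of n] by (simp add: d_def)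
        then show ?thesis using M True by simp
      next
        case False
        then have nx: "norm x > r + norm b" by simp
        have "norm (x + t n *\<^sub>R b) \<ge> norm x - norm (t n *\<^sub>R b)"
          using norm_diff_ineq by blast
        moreover have "norm (t n *\<^sub>R b) \<le> norm b"
          using t[of n] by (simp add: mult_left_le_one_le)
        ultimately have "norm (x + t n *\<^sub>R b) > r" "norm x > r" using nx norm_ge_zero[of b] by linarith+
        then have "x + t n *\<^sub>R b \<notin> K" "x \<notin> K"
          using subsetD[OF r(2), of x] subsetD[OF r(2), of "x + t n *\<^sub>R b"] by auto
        then show ?thesis using K(2) False by (simp add: d_def)
      qed
    qed
  qed
  moreover have "(\<integral>x. d n x \<partial>lborel) = 0" for n
  proof -
    have "integrable lborel (\<lambda>x. f (t n *\<^sub>R b + x))"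
      using integrable_distr_eq[of "\<lambda>x. t n *\<^sub>R b + x" lborel borel f] intf lborel_distr_plus[of "t n *\<^sub>R b"] by auto
    moreover have "(\<integral>x. f (t n *\<^sub>R b + x) \<partial>lborel) = (\<integral>x. f x \<partial>lborel)"
      using integral_distr[of "\<lambda>x. t n *\<^sub>R b + x" lborel borel f] intf lborel_distr_plus[of "t n *\<^sub>R b"] by auto
    ultimately show ?thesis using intf by (simp add: d_def add.commute)
  qed
  ultimately show "(\<integral>x. D x b \<partial>lborel) = 0"
    by (simp add: LIMSEQ_const_iff)
qed

text \<open>Differentiability is asked only on an open set around the support, which admits
  coefficients with a pole off \<open>K\<close>. The derivative is extended by zero; uniqueness of
  derivatives makes this extension agree with \<open>D\<close> on all of \<open>U\<close>, whence it
  is continuous.\<close>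

lemma integral_divergence_eq_0:
  fixes F :: "'a::euclidean_space \<Rightarrow> 'a"
  assumes U: "open U" "compact K" "K \<subseteq> U"
    and der: "\<And>x. x \<in> U \<Longrightarrow> (F has_derivative D x) (at x)"
    and cont: "\<And>b. continuous_on U (\<lambda>x. D x b)"
    and zero: "\<And>x. x \<notin> K \<Longrightarrow> F x = 0"
  shows "integrable lborel (\<lambda>x. indicator K x * (\<Sum>b\<in>Basis. D x b \<bullet> b))"
    and "(\<integral>x. indicator K x * (\<Sum>b\<in>Basis. D x b \<bullet> b) \<partial>lborel) = 0"
proof -
  define E where "E x = (if x \<in> K then D x else (\<lambda>h. 0))" for x
  have oK: "open (-K)" using U by (simp add: compact_imp_closed open_Compl)
  have z: "(F has_derivative (\<lambda>h. 0)) (at x)" if "x \<notin> K" for x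
    using has_derivative_transform_within_open[of "\<lambda>x. 0" "\<lambda>h. 0" x UNIV "-K" F] oK that zero by auto
  have ED: "E x = D x" if "x \<in> U" for x
  proof (cases "x \<in> K")
    case False
    then show ?thesis using has_derivative_unique[OF der[OF that] z[OF False]] by (simp add: E_def)
  qed (simp add: E_def)
  have derE: "(F has_derivative E x) (at x)" for x
    using z[of x] der[of x] U by (auto simp: E_def)
  have contE: "continuous_on UNIV (\<lambda>x. E x b)" for b
  proof -
    have "continuous_on U (\<lambda>x. E x b)" 
      using continuous_on_cong[of U U "\<lambda>x. E x b" "\<lambda>x. D x b"] cont[of b] ED by auto
    moreover have "continuous_on (-K) (\<lambda>x. E x b)"
      by (rule continuous_on_eq[of _ "\<lambda>_. 0"]) (auto simp: E_def)
    ultimately have "continuous_on (U \<union> -K) (\<lambda>x. E x b)"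
      using U(1) oK by (intro continuous_on_open_Un)
    moreover have "U \<union> -K = UNIV" using U(3) by auto
    ultimately show ?thesis by simp
  qed
  have comp: "((\<lambda>x. F x \<bullet> b) has_derivative (\<lambda>h. E x h \<bullet> b)) (at x)" for x b
    by (intro derivative_intros derE)
  have "continuous_on UNIV (\<lambda>x. E x b \<bullet> b)" for b
    by (intro continuous_intros contE)
  then have *: "integrable lborel (\<lambda>x. E x b \<bullet> b)" "(\<integral>x. E x b \<bullet> b \<partial>lborel) = 0" for b
    using integral_directional_derivative_eq_0[of "\<lambda>x. F x \<bullet> b" "\<lambda>x h. E x h \<bullet> b" b K]
      comp contE zero U(2) by (auto intro!: continuous_intros)
  have eq: "indicator K x * (\<Sum>b\<in>Basis. D x b \<bullet> b) = (\<Sum>b\<in>Basis. E x b \<bullet> b)" for x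
    by (auto simp: E_def indicator_def)
  show "integrable lborel (\<lambda>x. indicator K x * (\<Sum>b\<in>Basis. D x b \<bullet> b))"
    unfolding eq using * by auto
  show "(\<integral>x. indicator K x * (\<Sum>b\<in>Basis. D x b \<bullet> b) \<partial>lborel) = 0"
    unfolding eq using * by (subst Bochner_Integration.integral_sum) auto
qed

lemma sum_linear_inner_Basis:
  fixes D :: "'a::euclidean_space \<Rightarrow> real"
  assumes "linear D"
  shows "(\<Sum>b\<in>Basis. D b * (v \<bullet> b)) = D v"
proof -
  have "D v = D (\<Sum>b\<in>Basis. (v \<bullet> b) *\<^sub>R b)" by (simp add: euclidean_representation)
  also have "\<dots> = (\<Sum>b\<in>Basis. D b * (v \<bullet> b))"
    using assms by (simp add: linear_sum linear_cmul mult.commute)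
  finally show ?thesis by simp
qed

lemma sum_inner_Basis_mult:
  fixes u v :: "'a::euclidean_space"
  shows "(\<Sum>b\<in>Basis. (u \<bullet> b) * (v \<bullet> b)) = u \<bullet> v"
  by (simp add: euclidean_inner[of u v])

text \<open>Gradient and Hessian are arguments, not chosen derivatives, so that products and
  conjugations come with explicit formulas. Symmetry of the Hessian is built in; for concrete
  functions it is inherited from the bump function.\<close>

definition C2_on :: "'a::euclidean_space set \<Rightarrow> ('a \<Rightarrow> real) \<Rightarrow> ('a \<Rightarrow> 'a) \<Rightarrow> ('a \<Rightarrow> 'a \<Rightarrow> 'a) \<Rightarrow> bool" where
  "C2_on U f g H \<longleftrightarrow>
    (\<forall>x\<in>U. (f has_derivative (\<lambda>h. g x \<bullet> h)) (at x) \<and> (g has_derivative H x) (at x) \<and>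
           (\<forall>a b. H x a \<bullet> b = a \<bullet> H x b)) \<and>
    (\<forall>b. continuous_on U (\<lambda>x. H x b))"

definition lap :: "('a::euclidean_space \<Rightarrow> 'a \<Rightarrow> 'a) \<Rightarrow> 'a \<Rightarrow> real" where
  "lap H x = (\<Sum>b\<in>Basis. H x b \<bullet> b)"

lemma C2_onD:
  assumes "C2_on U f g H"
  shows "x \<in> U \<Longrightarrow> (f has_derivative (\<lambda>h. g x \<bullet> h)) (at x)"
    and "x \<in> U \<Longrightarrow> (g has_derivative H x) (at x)"
    and "x \<in> U \<Longrightarrow> H x a \<bullet> b = a \<bullet> H x b"
    and "continuous_on U (\<lambda>x. H x b)"
    and "continuous_on U f" and "continuous_on U g" and "continuous_on U (lap H)"
proof -
  show "x \<in> U \<Longrightarrow> (f has_derivative (\<lambda>h. g x \<bullet> h)) (at x)"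
    and "x \<in> U \<Longrightarrow> (g has_derivative H x) (at x)"
    and "x \<in> U \<Longrightarrow> H x a \<bullet> b = a \<bullet> H x b"
    and c: "continuous_on U (\<lambda>x. H x b)" for b
    using assms unfolding C2_on_def by auto
  show "continuous_on U f" "continuous_on U g"
    using assms unfolding C2_on_def
    by (meson has_derivative_continuous continuous_at_imp_continuous_on)+
  show "continuous_on U (lap H)" unfolding lap_def
    by (intro continuous_intros c)
qed

lemma C2_on_subset: "C2_on U f g H \<Longrightarrow> V \<subseteq> U \<Longrightarrow> C2_on V f g H"
  unfolding C2_on_def by (auto intro: continuous_on_subset)

lemma C2_on_mult:
  assumes "C2_on U f g H" "C2_on U f' g' H'"
  shows "C2_on U (\<lambda>x. f x * f' x) (\<lambda>x. f x *\<^sub>R g' x + f' x *\<^sub>R g x)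
    (\<lambda>x h. f x *\<^sub>R H' x h + (g x \<bullet> h) *\<^sub>R g' x + f' x *\<^sub>R H x h + (g' x \<bullet> h) *\<^sub>R g x)"
  unfolding C2_on_def
proof (intro conjI ballI allI)
  fix x assume x: "x \<in> U"
  note d = C2_onD[OF assms(1)] C2_onD[OF assms(2)]
  show "((\<lambda>x. f x * f' x) has_derivative (\<lambda>h. (f x *\<^sub>R g' x + f' x *\<^sub>R g x) \<bullet> h)) (at x)"
    using d(1,8) x by (auto intro!: derivative_eq_intros simp: inner_simps)
  show "((\<lambda>x. f x *\<^sub>R g' x + f' x *\<^sub>R g x) has_derivative
      (\<lambda>h. f x *\<^sub>R H' x h + (g x \<bullet> h) *\<^sub>R g' x + f' x *\<^sub>R H x h + (g' x \<bullet> h) *\<^sub>R g x)) (at x)"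
    using d(1,2,8,9) x by (auto intro!: derivative_eq_intros simp: inner_simps)
  show "(f x *\<^sub>R H' x a + (g x \<bullet> a) *\<^sub>R g' x + f' x *\<^sub>R H x a + (g' x \<bullet> a) *\<^sub>R g x) \<bullet> b =
      a \<bullet> (f x *\<^sub>R H' x b + (g x \<bullet> b) *\<^sub>R g' x + f' x *\<^sub>R H x b + (g' x \<bullet> b) *\<^sub>R g x)" for a b
    using d(3,10)[OF x, of a b] by (simp add: inner_simps inner_commute)
next
  fix b
  show "continuous_on U (\<lambda>x. f x *\<^sub>R H' x b + (g x \<bullet> b) *\<^sub>R g' x + f' x *\<^sub>R H x b + (g' x \<bullet> b) *\<^sub>R g x)"
    by (intro continuous_intros C2_onD(4-6)[OF assms(1)] C2_onD(4-6)[OF assms(2)])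
qed

lemma lap_mult:
  "lap (\<lambda>x h. f x *\<^sub>R H' x h + (g x \<bullet> h) *\<^sub>R g' x + f' x *\<^sub>R H x h + (g' x \<bullet> h) *\<^sub>R g x) x =
    f x * lap H' x + f' x * lap H x + 2 * (g x \<bullet> g' x)"
proof -
  have "lap (\<lambda>x h. f x *\<^sub>R H' x h + (g x \<bullet> h) *\<^sub>R g' x + f' x *\<^sub>R H x h + (g' x \<bullet> h) *\<^sub>R g x) x =
      f x * lap H' x + f' x * lap H x +
      ((\<Sum>b\<in>Basis. (g x \<bullet> b) * (g' x \<bullet> b)) + (\<Sum>b\<in>Basis. (g' x \<bullet> b) * (g x \<bullet> b)))"
    unfolding lap_def sum_distrib_left sum.distrib[symmetric] by (simp add: inner_simps algebra_simps)
  then show ?thesis unfolding sum_inner_Basis_mult by (simp add: inner_commute)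
qed

text \<open>The divergence theorem for \<open>k x *\<^sub>R g x - f x *\<^sub>R g' x\<close>, in
  which the mixed gradient terms cancel. The support of \<open>k\<close> alone localises the field,
  since its gradient vanishes off \<open>K\<close> too.\<close>

lemma green_identity:
  fixes f k :: "'a::euclidean_space \<Rightarrow> real"
  assumes "C2_on UNIV f g H" "C2_on UNIV k g' H'" and K: "compact K" "\<And>x. x \<notin> K \<Longrightarrow> k x = 0"
  shows "(\<integral>x. indicator K x * (k x * lap H x) \<partial>lborel) = (\<integral>x. indicator K x * (f x * lap H' x) \<partial>lborel)"
proof -
  note d = C2_onD[OF assms(1)] C2_onD[OF assms(2)]
  have g'0: "g' x = 0" if "x \<notin> K" for x
  proof -
    have "(k has_derivative (\<lambda>h. 0)) (at x)"
      using has_derivative_transform_within_open[of "\<lambda>x. 0" "\<lambda>h. 0" x UNIV "-K" k] K that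
      by (auto simp: compact_imp_closed open_Compl)
    then have "(\<lambda>h. g' x \<bullet> h) = (\<lambda>h. 0)" using has_derivative_unique[OF d(8)[of x]] by simp
    then show ?thesis by (metis inner_eq_zero_iff)
  qed
  let ?D = "\<lambda>x h. (k x *\<^sub>R H x h + (g' x \<bullet> h) *\<^sub>R g x) - (f x *\<^sub>R H' x h + (g x \<bullet> h) *\<^sub>R g' x)"
  have "(\<integral>x. indicator K x * (\<Sum>b\<in>Basis. ?D x b \<bullet> b) \<partial>lborel) = 0"
    by (rule integral_divergence_eq_0(2)[where U=UNIV and F="\<lambda>x. k x *\<^sub>R g x - f x *\<^sub>R g' x"])
      (use K g'0 in \<open>auto intro!: derivative_eq_intros d continuous_intros\<close>)
  moreover have "(\<Sum>b\<in>Basis. ?D x b \<bullet> b) = k x * lap H x - f x * lap H' x" for x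
  proof -
    have "(\<Sum>b\<in>Basis. ?D x b \<bullet> b) = k x * lap H x - f x * lap H' x +
      ((\<Sum>b\<in>Basis. (g' x \<bullet> b) * (g x \<bullet> b)) - (\<Sum>b\<in>Basis. (g x \<bullet> b) * (g' x \<bullet> b)))"
      unfolding lap_def sum_distrib_left sum.distrib[symmetric] sum_subtractf[symmetric]
      by (intro sum.cong refl) (simp add: inner_simps algebra_simps)
    then show ?thesis unfolding sum_inner_Basis_mult by (simp add: inner_commute)
  qed
  moreover have "integrable lborel (\<lambda>x. indicator K x *\<^sub>R (k x * lap H x))"
    "integrable lborel (\<lambda>x. indicator K x *\<^sub>R (f x * lap H' x))"
    by (intro borel_integrable_compact continuous_intros continuous_on_subset[OF d(5)] continuous_on_subset[OF d(12)]
      continuous_on_subset[OF d(7)] continuous_on_subset[OF d(14)] K; simp)+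
  ultimately show ?thesis by (simp add: right_diff_distrib)
qed

section \<open>Carleman estimate\<close>

text \<open>The divergence of \<open>k\<^sub>1 \<nabla>w + k\<^sub>2 (x - a)\<close>. The coefficients are chosen such that it is \<open>\<sigma> Z S\<close> minus a positive
  quantity, where \<open>S\<close> and \<open>Z\<close> are the symmetric and the antisymmetric part of the conjugated operator applied
  to \<open>w\<close>. The second derivatives \<open>\<alpha>\<close> along \<open>x - a\<close> and the full gradient \<open>G\<close> cancel.\<close>

lemma carleman_algebra:
  fixes \<sigma> q p s e G L \<alpha> w c n Z dZg De_g Dk1g k1 k2 Dk2y :: real
  assumes "n = 2 * c + 2"
    and "Z = - (2 * p * e + 2 * s * q * w)"
    and "dZg = - (2 * p * (G + \<alpha>) + 2 * e * (2 * s * e) + 2 * s * q * G + 2 * s * w * (2 * e))"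
    and "k1 = \<sigma> * q * Z"
    and "Dk1g = \<sigma> * q * dZg + (- n * \<sigma> * e + \<sigma> * (2 * e)) * Z"
    and "k2 = \<sigma> * (q * p * G + 2 * s * q * w\<^sup>2 - (p\<^sup>2 - c\<^sup>2) * p * w\<^sup>2)"
    and "Dk2y = - n * k2 + \<sigma> * (q * p * (2 * \<alpha>) + q * G * (2 * s * q) + p * G * (2 * q)
          + 2 * s * (q * (2 * w * e) + w\<^sup>2 * (2 * q))
          - ((p\<^sup>2 - c\<^sup>2) * (p * (2 * w * e) + w\<^sup>2 * (2 * s * q)) + p * w\<^sup>2 * (2 * p * (2 * s * q))))"
  shows "k1 * L + Dk1g + n * k2 + Dk2y =
    \<sigma> * Z * (q * L - 2 * c * e + (p\<^sup>2 - c\<^sup>2) * w) - 4 * \<sigma> * s * q * (e\<^sup>2 + (p\<^sup>2 - 1) * w\<^sup>2)"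
  unfolding assms by (simp add: power2_eq_square algebra_simps)

text \<open>The product rule for a divergence: \<open>G\<close> is the Jacobian of a field with
  value \<open>v\<close>, and \<open>D\<close> is the derivative of its scalar factor.\<close>

lemma trace_scaleR_derivative:
  fixes G :: "'a::euclidean_space \<Rightarrow> 'a"
  assumes "linear D"
  shows "(\<Sum>b\<in>Basis. (k *\<^sub>R G b + D b *\<^sub>R v) \<bullet> b) = k * (\<Sum>b\<in>Basis. G b \<bullet> b) + D v"
  using sum_linear_inner_Basis[OF assms, of v] by (simp add: inner_simps sum.distrib sum_distrib_left)

text \<open>With t = ln |x - a|, the operator on the right is S + Z. Here S is d^2/dt^2 plus the
  spherical Laplacian plus p^2 - c^2, symmetric for the density \<open>\<sigma>\<close>, whose
  derivative is that of |x - a|^(-n); and Z = -(2 p d/dt + dp/dt) is antisymmetric. Pairing them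
  yields 4 s q (e^2 + (p^2 - 1) w^2) with e = dw/dt; the -1 comes from the third t-derivative of p,
  which is 8 s q.\<close>

lemma carleman_conjugated:
  fixes w :: "'a::euclidean_space \<Rightarrow> real" and a :: 'a and s A :: real
  defines "n \<equiv> real DIM('a)" and "q \<equiv> \<lambda>x. (x - a) \<bullet> (x - a)"
  defines "c \<equiv> (n - 2) / 2" and "p \<equiv> \<lambda>x. s * (q x - A)"
  assumes w: "C2_on (-{a}) w g H" and K: "compact K" "a \<notin> K" "\<And>x. x \<notin> K \<Longrightarrow> w x = 0"
    and \<sigma>: "\<And>x. x \<noteq> a \<Longrightarrow> (\<sigma> has_derivative (\<lambda>h. - n * \<sigma> x * ((x - a) \<bullet> h) / q x)) (at x)"
      "\<And>x. x \<noteq> a \<Longrightarrow> \<sigma> x \<ge> 0"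
    and s: "s \<ge> 0"
  shows "(\<integral>x. indicator K x * (16 * \<sigma> x * s * q x * ((p x)\<^sup>2 - 1) * (w x)\<^sup>2) \<partial>lborel)
      \<le> (\<integral>x. indicator K x * (\<sigma> x *
          (q x * lap H x - 2 * (p x + c) * ((x - a) \<bullet> g x) + ((p x)\<^sup>2 - c\<^sup>2 - 2 * s * q x) * w x)\<^sup>2) \<partial>lborel)"
proof -
  let ?U = "-{a}"
  note d = C2_onD[OF w]
  have q0: "q x > 0" if "x \<noteq> a" for x using that by (simp add: q_def)
  define e where "e x = (x - a) \<bullet> g x" for x
  define Z where "Z x = - (2 * p x * e x + 2 * s * q x * w x)" for x
  define S where "S x = q x * lap H x - 2 * c * e x + ((p x)\<^sup>2 - c\<^sup>2) * w x" for x
  define k1 where "k1 x = \<sigma> x * q x * Z x" for x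
  define r2 where "r2 x = q x * p x * (g x \<bullet> g x) + 2 * s * q x * (w x)\<^sup>2
    - ((p x)\<^sup>2 - c\<^sup>2) * p x * (w x)\<^sup>2" for x
  define k2 where "k2 x = \<sigma> x * r2 x" for x
  define Dq where "Dq x h = 2 * ((x - a) \<bullet> h)" for x h
  define D\<sigma> where "D\<sigma> x h = - n * \<sigma> x * ((x - a) \<bullet> h) / q x" for x h
  define De where "De x h = h \<bullet> g x + (x - a) \<bullet> H x h" for x h
  define DZ where "DZ x h = - (2 * p x * De x h + 2 * e x * (s * Dq x h) + 2 * s * q x * (g x \<bullet> h)
    + 2 * s * w x * Dq x h)" for x h
  define Dk1 where "Dk1 x h = \<sigma> x * q x * DZ x h + (D\<sigma> x h * q x + \<sigma> x * Dq x h) * Z x" for x h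
  define Dr2 where "Dr2 x h = q x * p x * (2 * (g x \<bullet> H x h)) + q x * (g x \<bullet> g x) * (s * Dq x h)
      + p x * (g x \<bullet> g x) * Dq x h + 2 * s * (q x * (2 * w x * (g x \<bullet> h)) + (w x)\<^sup>2 * Dq x h)
      - (((p x)\<^sup>2 - c\<^sup>2) * (p x * (2 * w x * (g x \<bullet> h)) + (w x)\<^sup>2 * (s * Dq x h))
         + p x * (w x)\<^sup>2 * (2 * p x * (s * Dq x h)))" for x h
  define Dk2 where "Dk2 x h = D\<sigma> x h * r2 x + \<sigma> x * Dr2 x h" for x h
  define V where "V x = k1 x *\<^sub>R g x + k2 x *\<^sub>R (x - a)" for x
  define DV where "DV x h = (k1 x *\<^sub>R H x h + Dk1 x h *\<^sub>R g x) + (k2 x *\<^sub>R h + Dk2 x h *\<^sub>R (x - a))" for x h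

  have dq: "(q has_derivative Dq x) (at x)" for x
    unfolding q_def Dq_def by (auto intro!: derivative_eq_intros simp: inner_commute)
  have dp: "(p has_derivative (\<lambda>h. s * Dq x h)) (at x)" for x
    unfolding p_def by (auto intro!: derivative_eq_intros dq)
  have d\<sigma>: "(\<sigma> has_derivative D\<sigma> x) (at x)" if "x \<in> ?U" for x
    using \<sigma>(1)[of x] that unfolding D\<sigma>_def by simp
  have dw: "(w has_derivative (\<lambda>h. g x \<bullet> h)) (at x)" "(g has_derivative H x) (at x)" if "x \<in> ?U" for x
    using d(1,2) that by auto
  have de: "(e has_derivative De x) (at x)" if "x \<in> ?U" for x
    unfolding e_def De_def by (auto intro!: derivative_eq_intros dw that)
  have dZ: "(Z has_derivative DZ x) (at x)" if "x \<in> ?U" for x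
    unfolding Z_def DZ_def
    by (rule derivative_eq_intros dp de dq dw that refl)+ (simp add: algebra_simps)
  have dk1: "(k1 has_derivative Dk1 x) (at x)" if "x \<in> ?U" for x
    unfolding k1_def Dk1_def
    by (rule derivative_eq_intros d\<sigma> dq dZ that refl)+ (simp add: algebra_simps)
  have dr2: "(r2 has_derivative Dr2 x) (at x)" if "x \<in> ?U" for x
    unfolding r2_def Dr2_def power2_eq_square
    by (rule derivative_eq_intros dq dp dw that refl)+ (simp add: algebra_simps inner_commute)
  have dk2: "(k2 has_derivative Dk2 x) (at x)" if "x \<in> ?U" for x
    unfolding k2_def Dk2_def
    by (rule derivative_eq_intros d\<sigma> dr2 that refl)+ (simp add: algebra_simps)
  have dV: "(V has_derivative DV x) (at x)" if "x \<in> ?U" for x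
    unfolding V_def DV_def
    by (rule derivative_eq_intros dk1 dk2 dw that refl)+ (simp add: algebra_simps)
  have cq: "continuous_on ?U q" and cp: "continuous_on ?U p"
    unfolding p_def q_def by (intro continuous_intros)+
  have c\<sigma>: "continuous_on ?U \<sigma>"
    by (intro continuous_at_imp_continuous_on ballI has_derivative_continuous[OF d\<sigma>])
  have cD\<sigma>: "continuous_on ?U (\<lambda>x. D\<sigma> x b)" for b
    unfolding D\<sigma>_def using q0 by (intro continuous_intros c\<sigma> cq) (auto simp: order_less_imp_not_eq2)
  have ce: "continuous_on ?U e" unfolding e_def by (intro continuous_intros d)
  have cZ: "continuous_on ?U Z" unfolding Z_def by (intro continuous_intros d cp ce cq)
  have cDV: "continuous_on ?U (\<lambda>x. DV x b)" for b
    unfolding DV_def k1_def k2_def Dk1_def Dk2_def Dr2_def r2_def DZ_def De_def Dq_def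
    by (intro continuous_intros d c\<sigma> cD\<sigma> cZ cp cq ce)
  have g0: "g x = 0" if "x \<notin> K" "x \<noteq> a" for x
  proof -
    have "(w has_derivative (\<lambda>h. 0)) (at x)"
      using has_derivative_transform_within_open[of "\<lambda>x. 0" "\<lambda>h. 0" x UNIV "-K" w] K that
      by (auto simp: compact_imp_closed open_Compl)
    then have "(\<lambda>h. g x \<bullet> h) = (\<lambda>h. 0)" using has_derivative_unique[OF dw(1)[of x]] that by simp
    then show ?thesis by (metis inner_eq_zero_iff)
  qed
  have V0: "V x = 0" if "x \<notin> K" for x
  proof (cases "x = a")
    case True
    then show ?thesis by (simp add: V_def k1_def q_def)
  next
    case False
    then show ?thesis using g0[OF that] K(3)[OF that] by (simp add: V_def k2_def r2_def)
  qed
  have div: "(\<Sum>b\<in>Basis. DV x b \<bullet> b) =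
      \<sigma> x * Z x * S x - 4 * \<sigma> x * s * q x * ((e x)\<^sup>2 + ((p x)\<^sup>2 - 1) * (w x)\<^sup>2)" if x: "x \<in> ?U" for x
  proof -
    have lin: "linear (Dk1 x)" "linear (Dk2 x)"
      by (rule has_derivative_linear[OF dk1[OF x]] has_derivative_linear[OF dk2[OF x]])+
    have "(\<Sum>b\<in>Basis. DV x b \<bullet> b) = (\<Sum>b\<in>Basis. (k1 x *\<^sub>R H x b + Dk1 x b *\<^sub>R g x) \<bullet> b)
       + (\<Sum>b\<in>Basis. (k2 x *\<^sub>R b + Dk2 x b *\<^sub>R (x - a)) \<bullet> b)"
      unfolding DV_def by (simp add: inner_add_left sum.distrib)
    also have "\<dots> = k1 x * lap H x + Dk1 x (g x) + n * k2 x + Dk2 x (x - a)"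
      unfolding trace_scaleR_derivative[OF lin(1)] trace_scaleR_derivative[OF lin(2), of _ "\<lambda>b. b"]
      by (simp add: lap_def n_def)
    also have "\<dots> = \<sigma> x * Z x * (q x * lap H x - 2 * c * e x + ((p x)\<^sup>2 - c\<^sup>2) * w x)
      - 4 * \<sigma> x * s * q x * ((e x)\<^sup>2 + ((p x)\<^sup>2 - 1) * (w x)\<^sup>2)"
    proof (rule carleman_algebra[where G="g x \<bullet> g x" and \<alpha>="(x - a) \<bullet> H x (g x)" and dZg="DZ x (g x)"])
      have qx: "q x \<noteq> 0" "(x - a) \<bullet> (x - a) = q x" using q0[of x] x by (auto simp: q_def)
      have sym: "g x \<bullet> H x (x - a) = (x - a) \<bullet> H x (g x)"
        using d(3)[OF x, of "x - a" "g x"] by (simp add: inner_commute)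
      show "n = 2 * c + 2" by (simp add: c_def diff_divide_distrib)
      show "Z x = - (2 * p x * e x + 2 * s * q x * w x)" by (simp add: Z_def)
      show "DZ x (g x) = - (2 * p x * (g x \<bullet> g x + (x - a) \<bullet> H x (g x)) + 2 * e x * (2 * s * e x)
          + 2 * s * q x * (g x \<bullet> g x) + 2 * s * w x * (2 * e x))"
        by (simp add: DZ_def De_def Dq_def e_def algebra_simps)
      show "k1 x = \<sigma> x * q x * Z x" by (simp add: k1_def)
      show "Dk1 x (g x) = \<sigma> x * q x * DZ x (g x) + (- n * \<sigma> x * e x + \<sigma> x * (2 * e x)) * Z x"
        using qx by (simp add: Dk1_def D\<sigma>_def Dq_def e_def)
      show "k2 x = \<sigma> x * (q x * p x * (g x \<bullet> g x) + 2 * s * q x * (w x)\<^sup>2 - ((p x)\<^sup>2 - c\<^sup>2) * p x * (w x)\<^sup>2)"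
        by (simp add: k2_def r2_def)
      have "g x \<bullet> (x - a) = e x" by (simp add: e_def inner_commute)
      then show "Dk2 x (x - a) = - n * k2 x + \<sigma> x * (q x * p x * (2 * ((x - a) \<bullet> H x (g x)))
          + q x * (g x \<bullet> g x) * (2 * s * q x) + p x * (g x \<bullet> g x) * (2 * q x)
          + 2 * s * (q x * (2 * w x * e x) + (w x)\<^sup>2 * (2 * q x))
          - (((p x)\<^sup>2 - c\<^sup>2) * (p x * (2 * w x * e x) + (w x)\<^sup>2 * (2 * s * q x))
             + p x * (w x)\<^sup>2 * (2 * p x * (2 * s * q x))))"
        using qx by (simp add: Dk2_def Dr2_def D\<sigma>_def Dq_def sym k2_def)
    qed
    finally show ?thesis by (simp add: S_def)
  qed
  let ?B = "\<lambda>x. 4 * \<sigma> x * s * q x * ((e x)\<^sup>2 + ((p x)\<^sup>2 - 1) * (w x)\<^sup>2)"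
  have KU: "K \<subseteq> ?U" using K(2) by auto
  have cS: "continuous_on ?U S" unfolding S_def by (intro continuous_intros d cp ce cq)
  have int: "integrable lborel (\<lambda>x. indicator K x * f x)" if "continuous_on ?U f" for f :: "'a \<Rightarrow> real"
    using borel_integrable_compact[OF K(1) continuous_on_subset[OF that KU]] by simp
  have "(\<integral>x. indicator K x * (\<Sum>b\<in>Basis. DV x b \<bullet> b) \<partial>lborel) = 0"
    by (rule integral_divergence_eq_0(2)[OF _ K(1) KU dV cDV V0]) auto
  also have "(\<lambda>x. indicator K x * (\<Sum>b\<in>Basis. DV x b \<bullet> b)) =
      (\<lambda>x. indicator K x * (\<sigma> x * Z x * S x) - indicator K x * ?B x)"
    using div K(2) by (fastforce simp: indicator_def)
  also have "(\<integral>x. indicator K x * (\<sigma> x * Z x * S x) - indicator K x * ?B x \<partial>lborel)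
      = (\<integral>x. indicator K x * (\<sigma> x * Z x * S x) \<partial>lborel) - (\<integral>x. indicator K x * ?B x \<partial>lborel)"
    by (intro Bochner_Integration.integral_diff int continuous_intros c\<sigma> cZ cS cq ce cp d)
  finally have eq: "(\<integral>x. indicator K x * (\<sigma> x * Z x * S x) \<partial>lborel) = (\<integral>x. indicator K x * ?B x \<partial>lborel)"
    by simp
  \<comment> \<open>The nonnegative term with \<open>e\<close> is dropped. The factor 4 prepares 4 S
    Z \<le> (S + Z)^2.\<close>
  have "(\<integral>x. indicator K x * (16 * \<sigma> x * s * q x * ((p x)\<^sup>2 - 1) * (w x)\<^sup>2) \<partial>lborel)
      \<le> (\<integral>x. 4 * (indicator K x * ?B x) \<partial>lborel)"
  proof (rule integral_mono)
    fix x
    have "0 \<le> \<sigma> x * s * q x * (e x)\<^sup>2" if "x \<in> K"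
      using \<sigma>(2)[of x] s that K(2) by (cases "x = a") (auto simp: q_def intro!: mult_nonneg_nonneg)
    then show "indicator K x * (16 * \<sigma> x * s * q x * ((p x)\<^sup>2 - 1) * (w x)\<^sup>2) \<le> 4 * (indicator K x * ?B x)"
      by (auto simp: indicator_def algebra_simps)
  qed (intro int integrable_mult_right continuous_intros c\<sigma> cZ cS cq ce cp d)+
  also have "\<dots> = (\<integral>x. 4 * (indicator K x * (\<sigma> x * Z x * S x)) \<partial>lborel)"
    unfolding integral_mult_right_zero eq ..
  also have "\<dots> \<le> (\<integral>x. indicator K x * (\<sigma> x * (S x + Z x)\<^sup>2) \<partial>lborel)"
  proof (rule integral_mono)
    fix x
    have "0 \<le> \<sigma> x * (S x - Z x)\<^sup>2" if "x \<in> K"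
      using \<sigma>(2)[of x] that K(2) by (cases "x = a") auto
    then show "4 * (indicator K x * (\<sigma> x * Z x * S x)) \<le> indicator K x * (\<sigma> x * (S x + Z x)\<^sup>2)"
      by (auto simp: indicator_def algebra_simps power2_eq_square)
  qed (intro int integrable_mult_right continuous_intros c\<sigma> cZ cS cq ce cp d)+
  also have "(\<lambda>x. indicator K x * (\<sigma> x * (S x + Z x)\<^sup>2)) = (\<lambda>x. indicator K x * (\<sigma> x *
          (q x * lap H x - 2 * (p x + c) * ((x - a) \<bullet> g x) + ((p x)\<^sup>2 - c\<^sup>2 - 2 * s * q x) * w x)\<^sup>2))"
    by (simp add: S_def Z_def e_def algebra_simps)
  finally show ?thesis .
qed

text \<open>The exponent has gradient \<open>(s + B / q x) *\<^sub>R (x - a)\<close>, and this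
  coefficient varies by -2 B / q^2 along x - a; the rank-one part of the Hessian collects both
  contributions.\<close>

lemma C2_on_radial_exp:
  fixes a :: "'a::euclidean_space" and s B :: real
  defines "q \<equiv> \<lambda>x. (x - a) \<bullet> (x - a)"
  defines "\<omega> \<equiv> \<lambda>x. exp ((s * q x + B * ln (q x)) / 2)"
  shows "C2_on (-{a}) \<omega> (\<lambda>x. (\<omega> x * (s + B / q x)) *\<^sub>R (x - a))
    (\<lambda>x h. (\<omega> x * (s + B / q x)) *\<^sub>R h +
       (\<omega> x * ((s + B / q x)\<^sup>2 - 2 * B / (q x)\<^sup>2) * ((x - a) \<bullet> h)) *\<^sub>R (x - a))"
  unfolding C2_on_def
proof (intro conjI ballI allI)
  fix x assume "x \<in> -{a}"
  then have q0: "q x > 0" by (simp add: q_def)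
  have dq: "(q has_derivative (\<lambda>h. 2 * ((x - a) \<bullet> h))) (at x)"
    unfolding q_def by (auto intro!: derivative_eq_intros simp: inner_commute)
  have d\<omega>: "(\<omega> has_derivative (\<lambda>h. (\<omega> x * (s + B / q x)) * ((x - a) \<bullet> h))) (at x)"
    unfolding \<omega>_def using q0
    by (auto intro!: derivative_eq_intros dq simp: field_simps)
  then show "(\<omega> has_derivative (\<lambda>h. (\<omega> x * (s + B / q x)) *\<^sub>R (x - a) \<bullet> h)) (at x)" by simp
  have "((\<lambda>x. \<omega> x * (s + B / q x)) has_derivative
      (\<lambda>h. \<omega> x * ((s + B / q x)\<^sup>2 - 2 * B / (q x)\<^sup>2) * ((x - a) \<bullet> h))) (at x)"
    using q0 by (auto intro!: derivative_eq_intros d\<omega> dq simp: field_simps power2_eq_square)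
  then show "((\<lambda>x. (\<omega> x * (s + B / q x)) *\<^sub>R (x - a)) has_derivative
     (\<lambda>h. (\<omega> x * (s + B / q x)) *\<^sub>R h +
       (\<omega> x * ((s + B / q x)\<^sup>2 - 2 * B / (q x)\<^sup>2) * ((x - a) \<bullet> h)) *\<^sub>R (x - a))) (at x)"
    by (rule has_derivative_eq_rhs[OF has_derivative_scaleR]) (auto intro!: derivative_eq_intros)
next
  fix b
  have "q x \<noteq> 0" if "x \<in> -{a}" for x using that by (simp add: q_def)
  moreover have "continuous_on (-{a}) q" unfolding q_def by (intro continuous_intros)
  ultimately show "continuous_on (- {a}) (\<lambda>x. (\<omega> x * (s + B / q x)) *\<^sub>R b +
       (\<omega> x * ((s + B / q x)\<^sup>2 - 2 * B / (q x)\<^sup>2) * ((x - a) \<bullet> b)) *\<^sub>R (x - a))"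
    unfolding \<omega>_def by (intro continuous_intros) auto
qed (simp add: inner_simps inner_commute)

text \<open>The conjugated estimate is applied to w = \<open>\<omega>\<close> v, where
  \<open>\<omega>\<close>^2 is the weight times |x - a|^(n - 2). This power makes the second-order
  part symmetric, and together with \<open>\<sigma>\<close> all powers of q cancel on the left,
  while one factor q remains on the right.\<close>

theorem carleman_estimate:
  fixes v :: "'a::euclidean_space \<Rightarrow> real" and a :: 'a and s A :: real
  defines "q \<equiv> \<lambda>x. (x - a) \<bullet> (x - a)" and "\<theta> \<equiv> \<lambda>t. t - A * ln t"
  assumes v: "C2_on (-{a}) v g H" and K: "compact K" "a \<notin> K" "\<And>x. x \<notin> K \<Longrightarrow> v x = 0"
    and A: "\<And>x. x \<in> K \<Longrightarrow> q x + 1 \<le> A" and s: "s \<ge> 0" "s\<^sup>2 \<ge> 2"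
  shows "(\<integral>x. indicator K x * (8 * s ^ 3 * exp (s * \<theta> (q x)) * (v x)\<^sup>2) \<partial>lborel)
    \<le> (\<integral>x. indicator K x * (exp (s * \<theta> (q x)) * q x * (lap H x)\<^sup>2) \<partial>lborel)"
proof -
  define n where "n = real DIM('a)"
  define c where "c = (n - 2) / 2"
  \<comment> \<open>The coefficient of ln q in twice the logarithm of \<open>\<omega>\<close>: - s A
    belongs to the weight, c removes the first-order term (n - 2) d/dt.\<close>
  define B where "B = c - s * A"
  define p where "p x = s * (q x - A)" for x
  define \<omega> where "\<omega> x = exp ((s * q x + B * ln (q x)) / 2)" for x
  define g\<omega> where "g\<omega> x = (\<omega> x * (s + B / q x)) *\<^sub>R (x - a)" for x
  define H\<omega> where "H\<omega> x h = (\<omega> x * (s + B / q x)) *\<^sub>R h +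
       (\<omega> x * ((s + B / q x)\<^sup>2 - 2 * B / (q x)\<^sup>2) * ((x - a) \<bullet> h)) *\<^sub>R (x - a)" for x h
  define \<sigma> where "\<sigma> x = exp (- (n / 2) * ln (q x))" for x
  have C\<omega>: "C2_on (-{a}) \<omega> g\<omega> H\<omega>"
    using C2_on_radial_exp[of a s B] unfolding \<omega>_def g\<omega>_def H\<omega>_def q_def .
  have q0: "q x > 0" if "x \<noteq> a" for x using that by (simp add: q_def)
  define w where "w x = \<omega> x * v x" for x
  define gw where "gw x = \<omega> x *\<^sub>R g x + v x *\<^sub>R g\<omega> x" for x
  define Hw where "Hw x h = \<omega> x *\<^sub>R H x h + (g\<omega> x \<bullet> h) *\<^sub>R g x + v x *\<^sub>R H\<omega> x h + (g x \<bullet> h) *\<^sub>R g\<omega> x" for x h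
  have Cw: "C2_on (-{a}) w gw Hw"
    using C2_on_mult[OF C\<omega> v] unfolding w_def gw_def Hw_def .
  have \<sigma>': "(\<sigma> has_derivative (\<lambda>h. - n * \<sigma> x * ((x - a) \<bullet> h) / q x)) (at x)" if "x \<noteq> a" for x
  proof -
    have "(q has_derivative (\<lambda>h. 2 * ((x - a) \<bullet> h))) (at x)"
      unfolding q_def by (auto intro!: derivative_eq_intros simp: inner_commute)
    then show ?thesis
      unfolding \<sigma>_def using q0[OF that] by (auto intro!: derivative_eq_intros simp: field_simps)
  qed
  have "(\<integral>x. indicator K x * (16 * \<sigma> x * s * q x * ((p x)\<^sup>2 - 1) * (w x)\<^sup>2) \<partial>lborel)
      \<le> (\<integral>x. indicator K x * (\<sigma> x *
          (q x * lap Hw x - 2 * (p x + c) * ((x - a) \<bullet> gw x) + ((p x)\<^sup>2 - c\<^sup>2 - 2 * s * q x) * w x)\<^sup>2) \<partial>lborel)"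
    unfolding p_def c_def n_def q_def
    by (rule carleman_conjugated[OF Cw K(1,2) _ \<sigma>'[unfolded n_def q_def]])
      (use K(3) s in \<open>auto simp: w_def \<sigma>_def\<close>)
  also have "(\<lambda>x. indicator K x * (\<sigma> x *
          (q x * lap Hw x - 2 * (p x + c) * ((x - a) \<bullet> gw x) + ((p x)\<^sup>2 - c\<^sup>2 - 2 * s * q x) * w x)\<^sup>2))
      = (\<lambda>x. indicator K x * (exp (s * \<theta> (q x)) * q x * (lap H x)\<^sup>2))"
  proof
    fix x
    show "indicator K x * (\<sigma> x *
          (q x * lap Hw x - 2 * (p x + c) * ((x - a) \<bullet> gw x) + ((p x)\<^sup>2 - c\<^sup>2 - 2 * s * q x) * w x)\<^sup>2)
      = indicator K x * (exp (s * \<theta> (q x)) * q x * (lap H x)\<^sup>2)"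
    proof (cases "x \<in> K")
      case True
      then have qx: "q x > 0" and xa: "(x - a) \<bullet> (x - a) = q x" using q0 K(2) by (auto simp: q_def)
      define m where "m = s * q x + B"
      have m: "s + B / q x = m / q x" using qx by (simp add: m_def field_simps)
      have lw: "lap Hw x = \<omega> x * lap H x + v x * lap H\<omega> x + 2 * (g\<omega> x \<bullet> g x)"
        unfolding Hw_def by (rule lap_mult)
      have e\<omega>: "(x - a) \<bullet> g\<omega> x = \<omega> x * m" using qx by (simp add: g\<omega>_def m xa)
      have "lap H\<omega> x = \<omega> x * m / q x * n + \<omega> x * ((m / q x)\<^sup>2 - 2 * B / (q x)\<^sup>2) * q x"
      proof -
        let ?k = "\<omega> x * ((s + B / q x)\<^sup>2 - 2 * B / (q x)\<^sup>2)"
        have "lap H\<omega> x = \<omega> x * (s + B / q x) * n +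
            ?k * (\<Sum>b\<in>Basis. ((x - a) \<bullet> b) * ((x - a) \<bullet> b))"
          unfolding lap_def H\<omega>_def
          by (simp add: inner_add_left sum.distrib n_def sum_distrib_left mult.assoc)
        then show ?thesis unfolding sum_inner_Basis_mult xa m by simp
      qed
      then have "q x * (q x * lap H\<omega> x) = q x * (\<omega> x * (n * m + m\<^sup>2 - 2 * B))"
        using qx by (simp add: field_simps power2_eq_square)
      then have lap\<omega>: "q x * lap H\<omega> x = \<omega> x * (n * m + m\<^sup>2 - 2 * B)"
        using qx by simp
      have g\<omega>g: "q x * (g\<omega> x \<bullet> g x) = \<omega> x * m * ((x - a) \<bullet> g x)"
        using qx by (simp add: g\<omega>_def m)
      \<comment> \<open>The logarithmic derivative \<open>m\<close> of \<open>\<omega>\<close> along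
        x - a is exactly p + c, the first-order coefficient in the conjugated operator.\<close>
      have pc: "p x + c = m" "n = 2 * c + 2" "p x = m - c" "s * q x = m - B"
        by (auto simp: p_def m_def B_def c_def algebra_simps diff_divide_distrib)
      have qlap: "q x * lap Hw x = q x * \<omega> x * lap H x + v x * (\<omega> x * (n * m + m\<^sup>2 - 2 * B))
          + 2 * (\<omega> x * m * ((x - a) \<bullet> g x))"
        unfolding lap\<omega>[symmetric] g\<omega>g[symmetric] lw by (simp add: ring_distribs)
      have egw: "(x - a) \<bullet> gw x = \<omega> x * ((x - a) \<bullet> g x) + v x * (\<omega> x * m)"
        by (simp add: gw_def inner_add_right e\<omega>)
      have "q x * lap Hw x - 2 * (p x + c) * ((x - a) \<bullet> gw x)
          + ((p x)\<^sup>2 - c\<^sup>2 - 2 * (s * q x)) * w x = q x * \<omega> x * lap H x"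
        unfolding pc(1) qlap egw unfolding pc(2-4) w_def by (simp add: algebra_simps power2_eq_square)
      moreover have "\<sigma> x * (\<omega> x)\<^sup>2 * (q x)\<^sup>2 = exp (s * \<theta> (q x)) * q x"
      proof -
        have "(\<omega> x)\<^sup>2 = exp (s * q x + B * ln (q x))"
          unfolding \<omega>_def by (simp add: power2_eq_square flip: exp_add)
        moreover have "(q x)\<^sup>2 = exp (ln (q x)) * q x" using qx by (simp add: power2_eq_square)
        moreover have "\<sigma> x = exp (- (c + 1) * ln (q x))"
          unfolding \<sigma>_def c_def by (simp add: diff_divide_distrib)
        ultimately have "\<sigma> x * (\<omega> x)\<^sup>2 * (q x)\<^sup>2 =
            exp (- (c + 1) * ln (q x)) * exp (s * q x + B * ln (q x)) * exp (ln (q x)) * q x"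
          by simp
        also have "\<dots> = exp (s * \<theta> (q x)) * q x"
          unfolding exp_add[symmetric] by (simp add: B_def \<theta>_def algebra_simps)
        finally show ?thesis .
      qed
      ultimately show ?thesis by (simp add: power_mult_distrib mult_ac)
    qed simp
  qed
  finally have *: "(\<integral>x. indicator K x * (16 * \<sigma> x * s * q x * ((p x)\<^sup>2 - 1) * (w x)\<^sup>2) \<partial>lborel)
    \<le> (\<integral>x. indicator K x * (exp (s * \<theta> (q x)) * q x * (lap H x)\<^sup>2) \<partial>lborel)" .
  have KU: "K \<subseteq> -{a}" using K(2) by auto
  have int: "integrable lborel (\<lambda>x. indicator K x * f x)" if "continuous_on (-{a}) f" for f :: "'a \<Rightarrow> real"
    using borel_integrable_compact[OF K(1) continuous_on_subset[OF that KU]] by simp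
  have cq: "continuous_on (-{a}) q" unfolding q_def by (intro continuous_intros)
  have "(\<integral>x. indicator K x * (8 * s ^ 3 * exp (s * \<theta> (q x)) * (v x)\<^sup>2) \<partial>lborel)
    \<le> (\<integral>x. indicator K x * (16 * \<sigma> x * s * q x * ((p x)\<^sup>2 - 1) * (w x)\<^sup>2) \<partial>lborel)"
  proof (rule integral_mono)
    show "integrable lborel (\<lambda>x. indicator K x * (8 * s ^ 3 * exp (s * \<theta> (q x)) * (v x)\<^sup>2))"
      using q0 unfolding \<theta>_def by (intro int continuous_intros cq C2_onD(5)[OF v]) force+
    show "integrable lborel (\<lambda>x. indicator K x * (16 * \<sigma> x * s * q x * ((p x)\<^sup>2 - 1) * (w x)\<^sup>2))"
      using q0 unfolding \<sigma>_def p_def by (intro int continuous_intros cq C2_onD(5)[OF Cw]) force+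
    fix x
    show "indicator K x * (8 * s ^ 3 * exp (s * \<theta> (q x)) * (v x)\<^sup>2)
      \<le> indicator K x * (16 * \<sigma> x * s * q x * ((p x)\<^sup>2 - 1) * (w x)\<^sup>2)"
    proof (cases "x \<in> K")
      case True
      then have qx: "q x > 0" using q0[of x] K(2) by (cases "x = a") auto
      have "\<sigma> x * q x * (\<omega> x)\<^sup>2 = exp (s * \<theta> (q x))"
      proof -
        have "(\<omega> x)\<^sup>2 = exp (s * q x + B * ln (q x))"
          unfolding \<omega>_def by (simp add: power2_eq_square flip: exp_add)
        moreover have "q x = exp (ln (q x))" using qx by simp
        moreover have "\<sigma> x = exp (- (c + 1) * ln (q x))"
          unfolding \<sigma>_def c_def by (simp add: diff_divide_distrib)
        ultimately have "\<sigma> x * q x * (\<omega> x)\<^sup>2 = exp (- (c + 1) * ln (q x)) * exp (ln (q x)) * exp (s * q x + B * ln (q x))"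
          by simp
        also have "\<dots> = exp (s * \<theta> (q x))"
          unfolding exp_add[symmetric] by (simp add: B_def \<theta>_def algebra_simps)
        finally show ?thesis .
      qed
      then have eq: "16 * \<sigma> x * s * q x * ((p x)\<^sup>2 - 1) * (w x)\<^sup>2 =
          16 * s * ((p x)\<^sup>2 - 1) * (exp (s * \<theta> (q x)) * (v x)\<^sup>2)"
        by (simp add: w_def power_mult_distrib mult_ac)
      \<comment> \<open>The margin A - q \<ge> 1 gives p^2 \<ge> s^2, and s^2 \<ge> 2 then lets half
        of p^2 absorb the -1.\<close>
      have le: "8 * s ^ 3 \<le> 16 * s * ((p x)\<^sup>2 - 1)"
      proof -
        have "(q x - A)\<^sup>2 \<ge> 1" 
          using A[OF True] power_mono[of 1 "A - q x" 2] by (simp add: power2_commute)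
        then have "(p x)\<^sup>2 \<ge> s\<^sup>2" by (simp add: p_def power_mult_distrib mult_le_cancel_left1)
        then have "s\<^sup>2 / 2 \<le> (p x)\<^sup>2 - 1" using s by linarith
        then have "16 * s * (s\<^sup>2 / 2) \<le> 16 * s * ((p x)\<^sup>2 - 1)" using s by (intro mult_left_mono) auto
        then show ?thesis by (simp add: power2_eq_square power3_eq_cube mult.assoc)
      qed
      show ?thesis
        using mult_right_mono[OF le, of "exp (s * \<theta> (q x)) * (v x)\<^sup>2"] True
        unfolding eq by (simp add: mult.assoc)
    qed simp
  qed
  with * show ?thesis by linarith
qed

section \<open>Caccioppoli inequality and the smooth three-ball inequality\<close>

text \<open>The smooth part has continuous integrands and works with Borel integrals against
  indicators; \<open>int_on_cmod\<close> translates to the Lebesgue norms of the statement.\<close>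

definition int_on :: "'a::euclidean_space set \<Rightarrow> ('a \<Rightarrow> real) \<Rightarrow> real" where
  "int_on S f = (\<integral>x. indicator S x * f x \<partial>lborel)"

lemma integrable_int_on:
  fixes f :: "'a::euclidean_space \<Rightarrow> real"
  assumes "continuous_on UNIV f" "bounded S" "S \<in> sets borel"
  shows "integrable lborel (\<lambda>x. indicator S x * f x)"
proof -
  have "integrable lborel (\<lambda>x. indicator (closure S) x *\<^sub>R f x)"
    using assms by (intro borel_integrable_compact) (auto intro: continuous_on_subset simp: compact_closure)
  moreover have "(\<lambda>x. indicator S x * f x) \<in> borel_measurable lborel"
    using assms borel_measurable_continuous_onI[OF assms(1)] by measurable
  ultimately show ?thesis
    by (rule Bochner_Integration.integrable_bound)
      (use closure_subset[of S] in \<open>auto simp: indicator_def\<close>)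
qed

lemma int_on_mono:
  assumes "continuous_on UNIV f" "bounded S" "S \<in> sets borel"
    and "continuous_on UNIV g" "bounded T" "T \<in> sets borel"
    and "\<And>x. indicator S x * f x \<le> indicator T x * g x"
  shows "int_on S f \<le> int_on T g"
  unfolding int_on_def using assms by (intro integral_mono integrable_int_on) auto

lemma int_on_add:
  assumes "continuous_on UNIV f" "continuous_on UNIV g" "bounded S" "S \<in> sets borel"
  shows "int_on S (\<lambda>x. f x + g x) = int_on S f + int_on S g"
  unfolding int_on_def ring_distribs
  using assms by (intro Bochner_Integration.integral_add integrable_int_on)

lemma int_on_cmult: "int_on S (\<lambda>x. c * f x) = c * int_on S f"
  unfolding int_on_def mult.left_commute[of _ c] by simp

lemma int_on_nonneg: "(\<And>x. x \<in> S \<Longrightarrow> 0 \<le> f x) \<Longrightarrow> 0 \<le> int_on S f"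
  unfolding int_on_def by (intro integral_nonneg_AE AE_I2) (auto simp: indicator_def)

text \<open>Green's identity for h^2, whose Laplacian is 2 h \<open>lap H\<close> + 2 |g|^2, moves
  both derivatives onto the cut-off. So the gradient is controlled by h and its Laplacian, and
  \<open>\<psi>\<close> enters only through its values and its own Laplacian.\<close>

lemma caccioppoli:
  fixes h G :: "'a::euclidean_space \<Rightarrow> real"
  assumes h: "C2_on UNIV h g H" and \<psi>: "C2_on UNIV \<psi> g\<psi> H\<psi>"
    and K: "compact K" "\<And>x. x \<notin> K \<Longrightarrow> \<psi> x = 0"
    and B: "\<And>x. x \<in> K \<Longrightarrow> 0 \<le> \<psi> x \<and> \<psi> x \<le> B" "\<And>x. x \<in> K \<Longrightarrow> \<bar>lap H\<psi> x\<bar> \<le> B"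
    and G: "continuous_on UNIV G" "\<And>x. 0 \<le> G x" and M: "0 \<le> M"
    and le: "\<And>x. x \<in> K \<Longrightarrow> \<bar>lap H x\<bar> \<le> M * \<bar>h x\<bar> + G x"
  shows "int_on K (\<lambda>x. \<psi> x * (g x \<bullet> g x)) \<le> B * (1 + M) * int_on K (\<lambda>x. (h x)\<^sup>2 + (G x)\<^sup>2)"
proof -
  note dh = C2_onD[OF h] note d\<psi> = C2_onD[OF \<psi>]
  note [continuous_intros] = dh(5-7) d\<psi>(5-7) G(1)
  have bK: "bounded K" "K \<in> sets borel" using K(1) by (auto simp: compact_imp_bounded borel_compact)
  let ?H = "\<lambda>x d. h x *\<^sub>R H x d + (g x \<bullet> d) *\<^sub>R g x + h x *\<^sub>R H x d + (g x \<bullet> d) *\<^sub>R g x"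
  have "int_on K (\<lambda>x. \<psi> x * lap ?H x) = int_on K (\<lambda>x. (h x * h x) * lap H\<psi> x)"
    unfolding int_on_def by (rule green_identity[OF C2_on_mult[OF h h] \<psi> K])
  moreover have "(\<lambda>x. \<psi> x * lap ?H x) = (\<lambda>x. 2 * (\<psi> x * h x * lap H x) + 2 * (\<psi> x * (g x \<bullet> g x)))"
    unfolding lap_mult by (simp add: algebra_simps)
  moreover have "int_on K (\<lambda>x. 2 * (\<psi> x * h x * lap H x) + 2 * (\<psi> x * (g x \<bullet> g x)))
     = 2 * int_on K (\<lambda>x. \<psi> x * h x * lap H x) + 2 * int_on K (\<lambda>x. \<psi> x * (g x \<bullet> g x))"
    by (subst int_on_add) (auto simp: int_on_cmult bK intro!: continuous_intros)
  ultimately have "2 * int_on K (\<lambda>x. \<psi> x * (g x \<bullet> g x)) =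
      int_on K (\<lambda>x. (h x * h x) * lap H\<psi> x) + (-2) * int_on K (\<lambda>x. \<psi> x * h x * lap H x)"
    by simp
  also have "\<dots> = int_on K (\<lambda>x. (h x * h x) * lap H\<psi> x + (-2) * (\<psi> x * h x * lap H x))"
    unfolding int_on_cmult[symmetric]
    by (subst int_on_add) (auto simp: int_on_cmult bK intro!: continuous_intros)
  also have "\<dots> \<le> int_on K (\<lambda>x. 2 * B * (1 + M) * ((h x)\<^sup>2 + (G x)\<^sup>2))"
  proof (rule int_on_mono)
    fix x
    have "(h x * h x) * lap H\<psi> x + (-2) * (\<psi> x * h x * lap H x) \<le> 2 * B * (1 + M) * ((h x)\<^sup>2 + (G x)\<^sup>2)"
      if x: "x \<in> K"
    proof -
      have B0: "B \<ge> 0" using B(1)[OF x] by linarith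
      have 1: "(h x * h x) * lap H\<psi> x \<le> (h x * h x) * B"
        using B(2)[OF x] by (intro mult_left_mono) auto
      have "(-2) * (\<psi> x * h x * lap H x) \<le> 2 * (\<psi> x * (\<bar>h x\<bar> * \<bar>lap H x\<bar>))"
        using B(1)[OF x] abs_ge_minus_self[of "h x * lap H x"] mult_left_mono[of "- (h x * lap H x)" "\<bar>h x\<bar> * \<bar>lap H x\<bar>" "\<psi> x"]
        by (simp add: abs_mult mult_ac)
      also have "\<dots> \<le> 2 * (B * (\<bar>h x\<bar> * (M * \<bar>h x\<bar> + G x)))"
        using B(1)[OF x] le[OF x] by (intro mult_left_mono mult_mono) auto
      also have "\<bar>h x\<bar> * (M * \<bar>h x\<bar> + G x) \<le> M * (h x)\<^sup>2 + ((h x)\<^sup>2 + (G x)\<^sup>2) / 2"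
        using sum_squares_bound[of "\<bar>h x\<bar>" "G x"] by (simp add: power2_eq_square algebra_simps)
      finally have "(-2) * (\<psi> x * h x * lap H x) \<le> 2 * (B * (M * (h x)\<^sup>2 + ((h x)\<^sup>2 + (G x)\<^sup>2) / 2))"
        using B0 by (smt (verit) mult_left_mono)
      then have 2: "(-2) * (\<psi> x * h x * lap H x) \<le> 2 * (B * (M * (h x)\<^sup>2)) + B * (h x)\<^sup>2 + B * (G x)\<^sup>2"
        by (simp add: field_simps)
      have 3: "0 \<le> B * (G x)\<^sup>2" "0 \<le> B * M * (G x)\<^sup>2" using B0 M by auto
      show ?thesis using 1 2 3 by (simp add: power2_eq_square algebra_simps)
    qed
    then show "indicator K x * ((h x * h x) * lap H\<psi> x + (-2) * (\<psi> x * h x * lap H x))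
      \<le> indicator K x * (2 * B * (1 + M) * ((h x)\<^sup>2 + (G x)\<^sup>2))" by (simp add: indicator_def)
  qed (auto intro!: continuous_intros bK)
  also have "\<dots> = 2 * (B * (1 + M) * int_on K (\<lambda>x. (h x)\<^sup>2 + (G x)\<^sup>2))"
    unfolding int_on_cmult by simp
  finally show ?thesis by simp
qed

section \<open>Cut-off functions and localised estimates\<close>

definition C2_cutoff :: "'a::euclidean_space set \<Rightarrow> 'a set \<Rightarrow> ('a \<Rightarrow> real) \<Rightarrow> ('a \<Rightarrow> 'a) \<Rightarrow> ('a \<Rightarrow> 'a \<Rightarrow> 'a) \<Rightarrow> 'a set \<Rightarrow> bool" where
  "C2_cutoff K U \<psi> g H S \<longleftrightarrow> C2_on UNIV \<psi> g H \<and> compact S \<and> S \<subseteq> U \<and>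
    (\<forall>x. 0 \<le> \<psi> x \<and> \<psi> x \<le> 1) \<and> (\<forall>x\<in>K. \<psi> x = 1) \<and> (\<forall>x. x \<notin> S \<longrightarrow> \<psi> x = 0)"

lemma C2_cutoff_bound:
  assumes "C2_cutoff K U \<psi> g H S"
  obtains B where "B \<ge> 1" "\<And>x. x \<in> S \<Longrightarrow> norm (g x) \<le> B \<and> \<bar>lap H x\<bar> \<le> B"
proof -
  have c: "continuous_on UNIV g" "continuous_on UNIV (lap H)" and S: "compact S"
    using assms C2_onD(6,7)[of UNIV \<psi> g H] unfolding C2_cutoff_def by auto
  have "bounded (g ` S)" "bounded (lap H ` S)"
    using c S by (auto intro!: compact_imp_bounded compact_continuous_image intro: continuous_on_subset)
  then obtain b1 b2 where b: "\<forall>x\<in>S. norm (g x) \<le> b1" "\<forall>x\<in>S. norm (lap H x) \<le> b2"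
    unfolding bounded_iff by auto
  show ?thesis
    by (rule that[of "max 1 (max b1 b2)"]) (use b in \<open>auto simp: le_max_iff_disj\<close>)
qed

text \<open>The order of quantifiers is the point: the constant comes from the cut-off before
  \<open>h\<close>, \<open>G\<close> and \<open>M\<close> are given.\<close>

lemma interior_caccioppoli:
  fixes a :: "'a::euclidean_space"
  assumes cut: "C2_cutoff (cball a r) (ball a r') \<psi> g\<psi> H\<psi> S"
  shows "\<exists>B\<ge>1. \<forall>h g H G M. C2_on UNIV h g H \<longrightarrow> continuous_on UNIV G \<longrightarrow> (\<forall>x. 0 \<le> G x) \<longrightarrow> 0 \<le> M \<longrightarrow>
    (\<forall>x\<in>ball a r'. \<bar>lap H x\<bar> \<le> M * \<bar>h x\<bar> + G x) \<longrightarrow>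
    int_on (cball a r) (\<lambda>x. g x \<bullet> g x) \<le> B * (1 + M) * int_on (ball a r') (\<lambda>x. (h x)\<^sup>2 + (G x)\<^sup>2)"
proof -
  obtain B where B: "B \<ge> 1" "\<And>x. x \<in> S \<Longrightarrow> norm (g\<psi> x) \<le> B \<and> \<bar>lap H\<psi> x\<bar> \<le> B"
    using C2_cutoff_bound[OF cut] by metis
  note c = cut[unfolded C2_cutoff_def]
  have bS: "bounded S" "S \<in> sets borel" using c by (auto simp: compact_imp_bounded borel_compact)
  show ?thesis
  proof (intro exI[of _ B] conjI allI impI)
    fix h G :: "'a \<Rightarrow> real" and g H and M :: real
    assume h: "C2_on UNIV h g H" and G: "continuous_on UNIV G" "\<forall>x. 0 \<le> G x" and M: "0 \<le> M"
      and le: "\<forall>x\<in>ball a r'. \<bar>lap H x\<bar> \<le> M * \<bar>h x\<bar> + G x"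
    have \<psi>: "C2_on UNIV \<psi> g\<psi> H\<psi>" using c by blast
    note [continuous_intros] = C2_onD(5-7)[OF h] C2_onD(5-7)[OF \<psi>] G(1)
    have "int_on (cball a r) (\<lambda>x. g x \<bullet> g x) \<le> int_on S (\<lambda>x. \<psi> x * (g x \<bullet> g x))"
    proof (rule int_on_mono)
      fix x show "indicator (cball a r) x * (g x \<bullet> g x) \<le> indicator S x * (\<psi> x * (g x \<bullet> g x))"

        using c by (cases "x \<in> S") (auto simp: indicator_def)
    qed (auto intro!: continuous_intros bS)
    also have "\<dots> \<le> B * (1 + M) * int_on S (\<lambda>x. (h x)\<^sup>2 + (G x)\<^sup>2)"
      by (rule caccioppoli[OF h \<psi>]) (use c B G M le in \<open>auto simp: order_trans[of _ 1 B]\<close>)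
    also have "\<dots> \<le> B * (1 + M) * int_on (ball a r') (\<lambda>x. (h x)\<^sup>2 + (G x)\<^sup>2)"
    proof (intro mult_left_mono int_on_mono)
      fix x show "indicator S x * ((h x)\<^sup>2 + (G x)\<^sup>2) \<le> indicator (ball a r') x * ((h x)\<^sup>2 + (G x)\<^sup>2)"
        using c by (auto simp: indicator_def)
    qed (use B M in \<open>auto intro!: continuous_intros bS\<close>)
    finally show "int_on (cball a r) (\<lambda>x. g x \<bullet> g x) \<le> B * (1 + M) * int_on (ball a r') (\<lambda>x. (h x)\<^sup>2 + (G x)\<^sup>2)" .
  qed (rule B)
qed

text \<open>The derivative 1 - A / t is negative below A; this is the radial decrease of the weight
  in the variable t = |x - a|^2.\<close>

lemma diff_ln_strict_antimono:
  fixes A :: real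
  assumes "0 < t" "t < u" "u < A"
  shows "u - A * ln u < t - A * ln t"
proof (rule DERIV_neg_imp_decreasing[where f="\<lambda>t. t - A * ln t"])
  fix x assume x: "t \<le> x" "x \<le> u"
  then have "((\<lambda>t. t - A * ln t) has_real_derivative (1 - A / x)) (at x)"
    using assms by (auto intro!: derivative_eq_intros)
  moreover have "1 - A / x < 0" using x assms by (simp add: field_simps)
  ultimately show "\<exists>y. ((\<lambda>t. t - A * ln t) has_real_derivative y) (at x) \<and> y < 0" by blast
qed (use assms in simp)

lemma power2_sum3_le: "(x + y + z)\<^sup>2 \<le> 3 * (x\<^sup>2 + y\<^sup>2 + z\<^sup>2)" for x y z :: real
proof -
  have "0 \<le> (x - y)\<^sup>2 + (y - z)\<^sup>2 + (x - z)\<^sup>2" by simp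
  then show ?thesis by (simp add: power2_eq_square algebra_simps)
qed

lemma power2_sum2_le: "(x + y)\<^sup>2 \<le> 2 * (x\<^sup>2 + y\<^sup>2)" for x y :: real
proof -
  have "0 \<le> (x - y)\<^sup>2" by simp
  then show ?thesis by (simp add: power2_eq_square algebra_simps)
qed

text \<open>The cut-off produces the terms that carry no factor \<open>\<psi>\<close>; they live where \<open>\<psi>\<close> is not locally constant.\<close>

lemma carleman_cutoff:
  fixes a :: "'a::euclidean_space" and s A R M B :: real
  defines "q \<equiv> \<lambda>x. (x - a) \<bullet> (x - a)"
  assumes r: "0 < a0" "a0 < b0" "b0 < r3" "r3 < r4" "r4 < R"
    and \<rho>: "b0 < \<rho>" "\<rho> < r3"
    and A: "A = R\<^sup>2 + 1"
    and cut: "C2_cutoff (cball a r3 - ball a b0) (ball a r4 - cball a a0) \<psi> g\<psi> H\<psi> S"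
    and B: "B \<ge> 1" "\<And>x. x \<in> S \<Longrightarrow> norm (g\<psi> x) \<le> B \<and> \<bar>lap H\<psi> x\<bar> \<le> B"
    and h: "C2_on UNIV h g H" and G: "continuous_on UNIV G" "\<And>x. 0 \<le> G x" and M: "0 \<le> M"
    and le: "\<And>x. x \<in> ball a R \<Longrightarrow> \<bar>lap H x\<bar> \<le> M * \<bar>h x\<bar> + G x"
    and s: "s \<ge> 0" "s\<^sup>2 \<ge> 2" "s ^ 3 \<ge> 2 * R\<^sup>2 * M\<^sup>2"
  shows "exp (s * (\<rho>\<^sup>2 - A * ln (\<rho>\<^sup>2))) * int_on (cball a \<rho> - ball a b0) (\<lambda>x. (h x)\<^sup>2)
    \<le> exp (s * (a0\<^sup>2 - A * ln (a0\<^sup>2))) * (12 * R\<^sup>2 * B\<^sup>2) *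
        (int_on (ball a R) (\<lambda>x. (G x)\<^sup>2) + int_on (cball a b0) (\<lambda>x. g x \<bullet> g x + (h x)\<^sup>2))
     + exp (s * (r3\<^sup>2 - A * ln (r3\<^sup>2))) * (12 * R\<^sup>2 * B\<^sup>2) *
        int_on (cball a r4) (\<lambda>x. g x \<bullet> g x + (h x)\<^sup>2)"
proof -
  define \<theta> where "\<theta> t = t - A * ln t" for t :: real
  define E where "E x = exp (s * \<theta> (q x))" for x
  \<comment> \<open>A factor 3 from squaring the three terms of the Laplacian of
    \<open>\<psi>\<close> h, a factor 4 from the doubled gradient product, and q \<le> R^2.\<close>
  define D where "D = 12 * R\<^sup>2 * B\<^sup>2"
  define Ea where "Ea = exp (s * \<theta> (a0\<^sup>2))"
  define E3 where "E3 = exp (s * \<theta> (r3\<^sup>2))"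
  define E\<rho> where "E\<rho> = exp (s * \<theta> (\<rho>\<^sup>2))"
  note c = cut[unfolded C2_cutoff_def]
  have C\<psi>: "C2_on UNIV \<psi> g\<psi> H\<psi>" and S: "compact S" "S \<subseteq> ball a r4 - cball a a0" using c by auto
  have bS: "bounded S" "S \<in> sets borel" using S by (auto simp: compact_imp_bounded borel_compact)
  have qd: "q x = (dist a x)\<^sup>2" for x
    unfolding q_def dist_commute[of a x] by (simp add: dist_norm power2_norm_eq_inner)
  have R: "R > 0" using r by auto
  have \<theta>mono: "\<theta> (u\<^sup>2) \<le> \<theta> (t\<^sup>2)" if "0 < t" "t \<le> u" "u \<le> R" for t u
  proof (cases "t = u")
    case False
    have "u\<^sup>2 < A" using that by (simp add: A power_mono le_imp_less_Suc less_add_one order_le_less_trans[of _ "R\<^sup>2"])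
    moreover have "t\<^sup>2 < u\<^sup>2" using that False by (simp add: power_strict_mono)
    ultimately show ?thesis using diff_ln_strict_antimono[of "t\<^sup>2" "u\<^sup>2" A] that by (simp add: \<theta>_def)
  qed simp
  have Emono: "E x \<le> exp (s * \<theta> (t\<^sup>2))" if "0 < t" "t \<le> dist a x" "dist a x \<le> R" for t x
    unfolding E_def qd using \<theta>mono[OF that] s by (simp add: mult_left_mono)
  have Emono': "exp (s * \<theta> (t\<^sup>2)) \<le> E x" if "0 < dist a x" "dist a x \<le> t" "t \<le> R" for t x
    unfolding E_def qd using \<theta>mono[OF that] s by (simp add: mult_left_mono)
  have E0: "E x > 0" for x by (simp add: E_def)
  define v where "v x = \<psi> x * h x" for x
  define gv where "gv x = \<psi> x *\<^sub>R g x + h x *\<^sub>R g\<psi> x" for x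
  define Hv where "Hv x d = \<psi> x *\<^sub>R H x d + (g\<psi> x \<bullet> d) *\<^sub>R g x + h x *\<^sub>R H\<psi> x d + (g x \<bullet> d) *\<^sub>R g\<psi> x" for x d
  have Cv: "C2_on UNIV v gv Hv" unfolding v_def gv_def Hv_def by (rule C2_on_mult[OF C\<psi> h])
  have lv: "lap Hv x = \<psi> x * lap H x + h x * lap H\<psi> x + 2 * (g\<psi> x \<bullet> g x)" for x
    unfolding Hv_def by (rule lap_mult)
  note [continuous_intros] = C2_onD(5-7)[OF h] C2_onD(5-7)[OF Cv] C2_onD(5-7)[OF C\<psi>] G(1)
  have cq: "continuous_on UNIV q" unfolding q_def by (intro continuous_intros)
  have const: "g\<psi> x = 0" "lap H\<psi> x = 0" if x: "x \<in> ball a r3 - cball a b0" for x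
  proof -
    have o: "open (ball a r3 - cball a b0)" by auto
    have one: "\<psi> z = 1" if "z \<in> ball a r3 - cball a b0" for z using c that by auto
    have g0: "g\<psi> z = 0" if "z \<in> ball a r3 - cball a b0" for z
    proof -
      have "(\<psi> has_derivative (\<lambda>h. 0)) (at z)"
        using has_derivative_transform_within_open[of "\<lambda>x. 1" "\<lambda>h. 0" z UNIV "ball a r3 - cball a b0" \<psi>] o one that by auto
      then have "(\<lambda>h. g\<psi> z \<bullet> h) = (\<lambda>h. 0)" using has_derivative_unique[OF C2_onD(1)[OF C\<psi>]] by simp
      then show ?thesis by (metis inner_eq_zero_iff)
    qed
    show "g\<psi> x = 0" by (rule g0[OF x])
    have "(g\<psi> has_derivative (\<lambda>h. 0)) (at x)"
      using has_derivative_transform_within_open[of "\<lambda>x. 0" "\<lambda>h. 0" x UNIV "ball a r3 - cball a b0" g\<psi>] o g0 x by auto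
    then have "H\<psi> x = (\<lambda>h. 0)" using has_derivative_unique[OF C2_onD(2)[OF C\<psi>]] by simp
    then show "lap H\<psi> x = 0" by (simp add: lap_def)
  qed
  have carl: "int_on S (\<lambda>x. 8 * s ^ 3 * E x * (v x)\<^sup>2) \<le> int_on S (\<lambda>x. E x * q x * (lap Hv x)\<^sup>2)"
    unfolding int_on_def E_def \<theta>_def q_def
  proof (rule carleman_estimate)
    show "C2_on (-{a}) v gv Hv" using C2_on_subset[OF Cv] by auto
    show "a \<notin> S" using S r by auto
    show "v x = 0" if "x \<notin> S" for x using c that by (auto simp: v_def)
    fix x assume "x \<in> S"
    then have "dist a x \<le> R" using S r by auto
    then have "q x \<le> R\<^sup>2" unfolding qd by (simp add: power_mono)
    then show "(x - a) \<bullet> (x - a) + 1 \<le> A" by (simp add: A q_def)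
  qed (use S s in auto)
  let ?L = "\<lambda>x. D * Ea * (indicator S x * (G x)\<^sup>2) + D * Ea * (indicator (cball a b0) x * (g x \<bullet> g x + (h x)\<^sup>2))
      + D * E3 * (indicator (cball a r4) x * (g x \<bullet> g x + (h x)\<^sup>2))"
  \<comment> \<open>Half of the factor 8 s^3 of the Carleman estimate is spent here on the
    potential; the other half remains as the lower bound.\<close>
  have pt: "E x * q x * (lap Hv x)\<^sup>2 - 4 * s ^ 3 * E x * (v x)\<^sup>2 \<le> ?L x" if x: "x \<in> S" for x
  proof -
    have dx: "a0 < dist a x" "dist a x < r4" using x S by auto
    have xR: "x \<in> ball a R" using dx r by auto
    have q: "0 < q x" "q x \<le> R\<^sup>2" using dx r by (auto simp: qd power_mono)
    have \<psi>: "0 \<le> \<psi> x" "\<psi> x \<le> 1" using c by auto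
    have \<psi>2: "(\<psi> x)\<^sup>2 \<le> 1" using \<psi> by (simp add: power_le_one)
    have "(lap H x)\<^sup>2 \<le> (M * \<bar>h x\<bar> + G x)\<^sup>2"
      using le[OF xR] by (metis abs_ge_zero power2_abs power_mono)
    also have "\<dots> \<le> 2 * (M\<^sup>2 * (h x)\<^sup>2 + (G x)\<^sup>2)"
      using power2_sum2_le[of "M * \<bar>h x\<bar>" "G x"] by (simp add: power_mult_distrib)
    finally have lH: "(\<psi> x * lap H x)\<^sup>2 \<le> 2 * M\<^sup>2 * (v x)\<^sup>2 + 2 * (G x)\<^sup>2"
      using mult_left_mono[of "(lap H x)\<^sup>2" "2 * (M\<^sup>2 * (h x)\<^sup>2 + (G x)\<^sup>2)" "(\<psi> x)\<^sup>2"]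
        mult_right_mono[OF \<psi>2, of "(G x)\<^sup>2"]
      by (simp add: v_def power_mult_distrib algebra_simps)
    define cu where "cu = (h x * lap H\<psi> x)\<^sup>2 + (2 * (g\<psi> x \<bullet> g x))\<^sup>2"
    have cu: "cu \<le> 4 * B\<^sup>2 * (g x \<bullet> g x + (h x)\<^sup>2)"
    proof -
      have "(h x * lap H\<psi> x)\<^sup>2 \<le> (h x)\<^sup>2 * B\<^sup>2"
        using B(2)[OF x] unfolding power_mult_distrib by (intro mult_left_mono) (auto simp: abs_le_square_iff[symmetric])
      moreover have "(g\<psi> x \<bullet> g x)\<^sup>2 \<le> (norm (g\<psi> x))\<^sup>2 * (norm (g x))\<^sup>2"
        using Cauchy_Schwarz_ineq2[of "g\<psi> x" "g x"] by (metis abs_ge_zero power2_abs power_mono power_mult_distrib)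
      moreover have "(norm (g\<psi> x))\<^sup>2 * (norm (g x))\<^sup>2 \<le> B\<^sup>2 * (norm (g x))\<^sup>2"
        using B(2)[OF x] by (intro mult_right_mono power_mono) auto
      moreover have "0 \<le> B\<^sup>2 * (h x)\<^sup>2" by simp
      moreover have "cu = (h x * lap H\<psi> x)\<^sup>2 + 4 * (g\<psi> x \<bullet> g x)\<^sup>2"
        by (simp add: cu_def power_mult_distrib)
      moreover have "4 * B\<^sup>2 * (g x \<bullet> g x + (h x)\<^sup>2) = 4 * (B\<^sup>2 * (norm (g x))\<^sup>2) + 4 * ((h x)\<^sup>2 * B\<^sup>2)"
        unfolding power2_norm_eq_inner by (simp add: algebra_simps)
      ultimately show ?thesis by (smt (verit) mult.commute)
    qed
    have gh: "0 \<le> g x \<bullet> g x + (h x)\<^sup>2" by simp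
    have "(lap Hv x)\<^sup>2 \<le> 3 * ((\<psi> x * lap H x)\<^sup>2 + cu)"
      unfolding lv cu_def using power2_sum3_le[of "\<psi> x * lap H x" "h x * lap H\<psi> x" "2 * (g\<psi> x \<bullet> g x)"]
      by (simp only: add.assoc)
    also have "\<dots> \<le> 6 * M\<^sup>2 * (v x)\<^sup>2 + 6 * (G x)\<^sup>2 + 3 * cu" using lH by simp
    finally have "E x * q x * (lap Hv x)\<^sup>2 \<le> E x * (q x * (6 * M\<^sup>2 * (v x)\<^sup>2 + 6 * (G x)\<^sup>2 + 3 * cu))"
      using E0[of x] q by (simp add: mult.assoc)
    also have "\<dots> \<le> E x * (R\<^sup>2 * (6 * M\<^sup>2 * (v x)\<^sup>2 + 6 * (G x)\<^sup>2 + 3 * cu))"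
      using E0[of x] q by (intro mult_left_mono mult_right_mono) (auto simp: cu_def)
    also have "\<dots> = E x * (3 * (2 * R\<^sup>2 * M\<^sup>2) * (v x)\<^sup>2) + E x * (6 * R\<^sup>2 * (G x)\<^sup>2) + E x * (3 * R\<^sup>2 * cu)"
      by (simp add: algebra_simps)
    \<comment> \<open>Three copies of 2 R^2 M^2 \<le> s^3 stay below the 4 s^3 set aside for the
      potential.\<close>
    also have "E x * (3 * (2 * R\<^sup>2 * M\<^sup>2) * (v x)\<^sup>2) \<le> E x * (4 * s ^ 3 * (v x)\<^sup>2)"
    proof (intro mult_left_mono mult_right_mono)
      have "0 \<le> s ^ 3" using s(1) by simp
      then show "3 * (2 * R\<^sup>2 * M\<^sup>2) \<le> 4 * s ^ 3" using s(3) by linarith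
    qed (use E0[of x] in auto)
    also have "E x * (6 * R\<^sup>2 * (G x)\<^sup>2) \<le> D * Ea * (indicator S x * (G x)\<^sup>2)"
    proof -
      have "E x \<le> Ea" unfolding Ea_def using Emono[of a0 x] r dx by auto
      moreover have "6 * R\<^sup>2 \<le> D" using B(1) power_mono[of 1 B 2] R unfolding D_def
        by (smt (verit) mult_le_cancel_left1 mult_right_mono one_power2 zero_less_power)
      ultimately have "E x * (6 * R\<^sup>2 * (G x)\<^sup>2) \<le> Ea * (D * (G x)\<^sup>2)"
        using E0[of x] by (intro mult_mono) (auto simp: D_def)
      then show ?thesis using x by (simp add: mult_ac)
    qed
    also have "E x * (3 * R\<^sup>2 * cu) \<le> D * Ea * (indicator (cball a b0) x * (g x \<bullet> g x + (h x)\<^sup>2))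
      + D * E3 * (indicator (cball a r4) x * (g x \<bullet> g x + (h x)\<^sup>2))"
    proof -
      have D: "3 * R\<^sup>2 * cu \<le> D * (g x \<bullet> g x + (h x)\<^sup>2)"
        using mult_left_mono[OF cu, of "3 * R\<^sup>2"] by (simp add: D_def mult_ac)
      have D0: "0 \<le> D" by (simp add: D_def)
      have cu0: "0 \<le> 3 * R\<^sup>2 * cu" by (simp add: cu_def)
      have Epos: "0 \<le> Ea" "0 \<le> E3" by (auto simp: Ea_def E3_def)
      \<comment> \<open>The cut-off is constant for distances between \<open>b0\<close> and
        \<open>r3\<close>. On the inner and outer shells the decreasing weight is at most its value
        at \<open>a0\<close> and at \<open>r3\<close>, respectively.\<close>
      consider "dist a x \<le> b0" | "b0 < dist a x" "dist a x < r3" | "r3 \<le> dist a x" by linarith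
      then show ?thesis
      proof cases
        case 1
        have "E x \<le> Ea" unfolding Ea_def using Emono[of a0 x] r dx by auto
        then have "E x * (3 * R\<^sup>2 * cu) \<le> Ea * (D * (g x \<bullet> g x + (h x)\<^sup>2))"
          using D Epos cu0 by (intro mult_mono[OF _ D]) auto
        moreover have "0 \<le> D * E3 * (indicator (cball a r4) x * (g x \<bullet> g x + (h x)\<^sup>2))"
          using D0 Epos gh by (simp add: indicator_def)
        ultimately show ?thesis using 1 by (simp add: mult_ac)
      next
        case 2
        then have "cu = 0" using const[of x] by (simp add: cu_def)
        then show ?thesis using D0 Epos gh by (simp add: indicator_def)
      next
        case 3
        have "E x \<le> E3" unfolding E3_def using Emono[of r3 x] r dx 3 by auto
        then have "E x * (3 * R\<^sup>2 * cu) \<le> E3 * (D * (g x \<bullet> g x + (h x)\<^sup>2))"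
          using D Epos cu0 by (intro mult_mono[OF _ D]) auto
        moreover have "0 \<le> D * Ea * (indicator (cball a b0) x * (g x \<bullet> g x + (h x)\<^sup>2))"
          using D0 Epos gh by (simp add: indicator_def)
        ultimately show ?thesis using dx by (simp add: mult_ac)
      qed
    qed
    finally show ?thesis by (simp add: mult_ac)
  qed
  \<comment> \<open>The weight is continuous only away from a, hence on \<open>S\<close>.\<close>
  have cE: "continuous_on S (\<lambda>x. E x * f x)" if "continuous_on UNIV f" for f :: "'a \<Rightarrow> real"
  proof -
    have "q x \<noteq> 0" if "x \<in> S" for x using that S r by (auto simp: qd)
    then show ?thesis
      unfolding E_def \<theta>_def
      by (intro continuous_intros continuous_on_subset[OF cq] continuous_on_subset[OF that]) auto
  qed
  have iE: "integrable lborel (\<lambda>x. indicator S x * (E x * f x))" if "continuous_on UNIV f" for f :: "'a \<Rightarrow> real"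
    using borel_integrable_compact[OF S(1) cE[OF that]] by simp
  have iv: "integrable lborel (\<lambda>x. indicator S x * (4 * s ^ 3 * E x * (v x)\<^sup>2))"
    using iE[of "\<lambda>x. 4 * s ^ 3 * (v x)\<^sup>2"] by (simp add: continuous_intros mult_ac)
  have il: "integrable lborel (\<lambda>x. indicator S x * (E x * q x * (lap Hv x)\<^sup>2))"
    using iE[of "\<lambda>x. q x * (lap Hv x)\<^sup>2"] by (simp add: continuous_intros cq mult_ac)
  have iG: "integrable lborel (\<lambda>x. indicator S x * (G x)\<^sup>2)"
    and ib: "integrable lborel (\<lambda>x. indicator (cball a b0) x * (g x \<bullet> g x + (h x)\<^sup>2))"
    and i4: "integrable lborel (\<lambda>x. indicator (cball a r4) x * (g x \<bullet> g x + (h x)\<^sup>2))"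
    by (intro integrable_int_on continuous_intros bS; simp)+
  have "2 * int_on S (\<lambda>x. 4 * s ^ 3 * E x * (v x)\<^sup>2) \<le> int_on S (\<lambda>x. E x * q x * (lap Hv x)\<^sup>2)"
    using carl unfolding int_on_cmult[symmetric] by (simp add: mult_ac)
  then have "int_on S (\<lambda>x. 4 * s ^ 3 * E x * (v x)\<^sup>2) \<le>
      int_on S (\<lambda>x. E x * q x * (lap Hv x)\<^sup>2) - int_on S (\<lambda>x. 4 * s ^ 3 * E x * (v x)\<^sup>2)" by simp
  also have "\<dots> = (\<integral>x. indicator S x * (E x * q x * (lap Hv x)\<^sup>2) - indicator S x * (4 * s ^ 3 * E x * (v x)\<^sup>2) \<partial>lborel)"
    unfolding int_on_def using il iv by simp
  also have "\<dots> \<le> (\<integral>x. ?L x \<partial>lborel)"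
  proof (rule integral_mono)
    fix x
    have "0 \<le> ?L x" by (simp add: D_def Ea_def E3_def indicator_def)
    then show "indicator S x * (E x * q x * (lap Hv x)\<^sup>2) - indicator S x * (4 * s ^ 3 * E x * (v x)\<^sup>2) \<le> ?L x"
      using pt[of x] by (cases "x \<in> S") auto
  qed (use il iv iG ib i4 in auto)
  also have "\<dots> = D * Ea * int_on S (\<lambda>x. (G x)\<^sup>2) + D * Ea * int_on (cball a b0) (\<lambda>x. g x \<bullet> g x + (h x)\<^sup>2)
      + D * E3 * int_on (cball a r4) (\<lambda>x. g x \<bullet> g x + (h x)\<^sup>2)"
    unfolding int_on_def using iG ib i4 by simp
  also have "\<dots> \<le> D * Ea * int_on (ball a R) (\<lambda>x. (G x)\<^sup>2) + D * Ea * int_on (cball a b0) (\<lambda>x. g x \<bullet> g x + (h x)\<^sup>2)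
      + D * E3 * int_on (cball a r4) (\<lambda>x. g x \<bullet> g x + (h x)\<^sup>2)"
  proof (intro add_right_mono mult_left_mono int_on_mono)
    fix x show "indicator S x * (G x)\<^sup>2 \<le> indicator (ball a R) x * (G x)\<^sup>2"
      using S r by (auto simp: indicator_def)
  qed (auto intro!: continuous_intros bS simp: D_def Ea_def)
  finally have up: "int_on S (\<lambda>x. 4 * s ^ 3 * E x * (v x)\<^sup>2) \<le> \<dots>" .
  have "E\<rho> * int_on (cball a \<rho> - ball a b0) (\<lambda>x. (h x)\<^sup>2) = int_on (cball a \<rho> - ball a b0) (\<lambda>x. E\<rho> * (h x)\<^sup>2)"
    by (simp add: int_on_cmult)
  also have "\<dots> \<le> int_on S (\<lambda>x. 4 * s ^ 3 * E x * (v x)\<^sup>2)"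
    unfolding int_on_def
  proof (rule integral_mono)
    show "integrable lborel (\<lambda>x. indicator (cball a \<rho> - ball a b0) x * (E\<rho> * (h x)\<^sup>2))"
      by (intro integrable_int_on continuous_intros) auto
    fix x
    \<comment> \<open>Once s \<ge> 1, the power of s has done its work and may be dropped from the
      lower bound.\<close>
    have s3: "4 * s ^ 3 \<ge> 1"
    proof -
      have "s \<ge> 1" using s(1,2) by (smt (verit) one_power2 power_mono)
      then have "s ^ 3 \<ge> 1" by (rule one_le_power)
      then show ?thesis by simp
    qed
    show "indicator (cball a \<rho> - ball a b0) x * (E\<rho> * (h x)\<^sup>2) \<le> indicator S x * (4 * s ^ 3 * E x * (v x)\<^sup>2)"
    proof (cases "x \<in> cball a \<rho> - ball a b0")
      case True
      then have "\<psi> x = 1" using c \<rho> by auto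
      then have xS: "x \<in> S" using c by force
      have "E\<rho> \<le> E x" unfolding E\<rho>_def using Emono'[of x \<rho>] True \<rho> r by (cases "x = a") auto
      then have "1 * E\<rho> \<le> 4 * s ^ 3 * E x" using s3 s(1) by (intro mult_mono[OF s3]) (auto simp: E\<rho>_def)
      then have "E\<rho> * (h x)\<^sup>2 \<le> 4 * s ^ 3 * E x * (h x)\<^sup>2" by (intro mult_right_mono) auto
      then show ?thesis using True xS by (simp add: v_def \<open>\<psi> x = 1\<close>)
    next
      case False
      have "0 \<le> 4 * s ^ 3 * E x * (v x)\<^sup>2" using s E0[of x] by simp
      then show ?thesis using False by (auto simp: indicator_def)
    qed
  qed (rule iv)
  also note up
  finally show ?thesis unfolding E\<rho>_def Ea_def E3_def D_def \<theta>_def by (simp add: algebra_simps)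
qed

text \<open>The two exponentials balance at s = ln (\<beta> / \<alpha>) / (X + Y), where both terms
  equal the weighted geometric mean. If this s is below the admissible range, then \<beta> /
  \<alpha> is at most exp (\<open>s\<^sub>1 * (X + Y)\<close>) and the trivial bound N \<le> \<beta>
  suffices. For \<alpha> = 0 let s tend to infinity.\<close>

lemma exponential_interpolation:
  fixes N \<alpha> \<beta> D X Y s\<^sub>1 :: real
  assumes \<alpha>: "0 \<le> \<alpha>" "\<alpha> \<le> \<beta>" and N: "N \<le> \<beta>" and D: "1 \<le> D" and XY: "0 < X" "0 < Y" and s\<^sub>1: "0 \<le> s\<^sub>1"
    and le: "\<And>s. s\<^sub>1 \<le> s \<Longrightarrow> N \<le> D * (exp (s * X) * \<alpha> + exp (- (s * Y)) * \<beta>)"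
  shows "N \<le> 2 * D * exp (s\<^sub>1 * (X + Y)) * (\<alpha> powr (Y / (X + Y)) * \<beta> powr (1 - Y / (X + Y)))"
proof (cases "\<alpha> = 0")
  case True
  have "((\<lambda>s. D * (exp (- (s * Y)) * \<beta>)) \<longlongrightarrow> D * (0 * \<beta>)) at_top"
  proof (intro tendsto_intros)
    have "filterlim (\<lambda>s. s * Y) at_top at_top"
      by (rule filterlim_at_top_mult_tendsto_pos[OF tendsto_const XY(2) filterlim_ident])
    then show "((\<lambda>s. exp (- (s * Y))) \<longlongrightarrow> 0) at_top"
      by (intro filterlim_compose[OF exp_at_bot]) (simp add: filterlim_uminus_at_bot)
  qed
  moreover have "eventually (\<lambda>s. N \<le> D * (exp (- (s * Y)) * \<beta>)) at_top"
    by (rule eventually_mono[OF eventually_ge_at_top[of s\<^sub>1]]) (use le True in auto)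
  ultimately have "N \<le> D * (0 * \<beta>)" by (intro tendsto_lowerbound) auto
  then show ?thesis using True by simp
next
  case False
  then have pos: "\<alpha> > 0" "\<beta> > 0" using \<alpha> by auto
  define \<kappa> where "\<kappa> = Y / (X + Y)"
  have \<kappa>: "0 < \<kappa>" "\<kappa> < 1" using XY by (auto simp: \<kappa>_def)
  define P where "P = \<alpha> powr \<kappa> * \<beta> powr (1 - \<kappa>)"
  have P0: "P > 0" using pos by (simp add: P_def)
  have e1: "1 \<le> exp (s\<^sub>1 * (X + Y))" using s\<^sub>1 XY by simp
  define s where "s = ln (\<beta> / \<alpha>) / (X + Y)"
  have "N \<le> 2 * D * exp (s\<^sub>1 * (X + Y)) * P"
  proof (cases "s\<^sub>1 \<le> s")
    case True
    have sX: "s * X = (1 - \<kappa>) * (ln \<beta> - ln \<alpha>)" and sY: "s * Y = \<kappa> * (ln \<beta> - ln \<alpha>)"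
      using XY pos by (auto simp: s_def \<kappa>_def ln_div field_simps)
    have "exp (s * X) * \<alpha> = exp (s * X + ln \<alpha>)" using pos by (simp add: exp_add)
    also have "\<dots> = P" unfolding sX P_def powr_def using pos by (simp add: algebra_simps flip: exp_add)
    finally have 1: "exp (s * X) * \<alpha> = P" .
    have "exp (- (s * Y)) * \<beta> = exp (- (s * Y) + ln \<beta>)" unfolding exp_add using pos by simp
    also have "\<dots> = P" unfolding sY P_def powr_def using pos by (simp add: algebra_simps flip: exp_add)
    finally have 2: "exp (- (s * Y)) * \<beta> = P" .
    have "N \<le> D * (P + P)" using le[OF True] unfolding 1 2 .
    also have "\<dots> = 2 * D * 1 * P" by simp
    also have "\<dots> \<le> 2 * D * exp (s\<^sub>1 * (X + Y)) * P"
      using e1 D P0 by (intro mult_right_mono mult_left_mono) auto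
    finally show ?thesis .
  next
    case False
    then have "ln (\<beta> / \<alpha>) < s\<^sub>1 * (X + Y)" using XY by (simp add: s_def field_simps)
    then have ba: "\<beta> / \<alpha> < exp (s\<^sub>1 * (X + Y))" using pos by (metis divide_pos_pos exp_less_cancel_iff exp_ln)
    have "\<beta> = (\<beta> / \<alpha>) powr \<kappa> * P"
      unfolding P_def using pos by (simp add: powr_divide flip: powr_add)
    also have "(\<beta> / \<alpha>) powr \<kappa> \<le> (\<beta> / \<alpha>) powr 1"
      using \<kappa> pos \<alpha> by (intro powr_mono) auto
    also have "(\<beta> / \<alpha>) powr 1 \<le> exp (s\<^sub>1 * (X + Y))" using ba pos by simp
    finally have "\<beta> \<le> 1 * exp (s\<^sub>1 * (X + Y)) * P" using P0 by simp
    also have "\<dots> \<le> 2 * D * exp (s\<^sub>1 * (X + Y)) * P"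
      using D P0 by (intro mult_right_mono) auto
    finally show ?thesis using N by linarith
  qed
  then show ?thesis unfolding P_def \<kappa>_def .
qed

lemma powr_two_thirds_cube: "(M powr (2/3)) ^ 3 = M\<^sup>2" if "0 \<le> M" for M :: real
proof (cases "M = 0")
  case False
  with that have M: "M > 0" by simp
  then have "(M powr (2/3)) ^ 3 = (M powr (2/3)) powr (real 3)" by (intro powr_realpow[symmetric]) simp
  also have "\<dots> = M powr (real 2)" by (simp add: powr_powr)
  also have "\<dots> = M\<^sup>2" using M by (rule powr_realpow)
  finally show ?thesis .
qed simp

text \<open>This brings the polynomial factors 1 + M of the Caccioppoli inequality into the
  exponential form of the final constant. With t = M^(2/3) one has t^3 = M^2, and M \<le> 1 +
  M^2.\<close>

lemma one_plus_le_exp_powr: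
  fixes M :: real
  assumes "0 \<le> M"
  shows "1 + M \<le> exp (3 * (M powr (2/3)) + 2)"
proof -
  define t where "t = M powr (2/3)"
  have t: "t \<ge> 0" by (simp add: t_def)
  have t3: "t ^ 3 = M\<^sup>2"
    using powr_two_thirds_cube assms by (simp add: t_def)
  have "M \<le> 1 + M\<^sup>2" using zero_le_power2[of "M - 1"] assms by (simp add: power2_eq_square algebra_simps)
  moreover have "t ^ 3 \<le> exp (3 * t)"
  proof -
    have "t \<le> exp t" using exp_ge_add_one_self[of t] by linarith
    then have "t ^ 3 \<le> exp t ^ 3" using t by (intro power_mono) auto
    then show ?thesis by (simp add: exp_of_nat_mult[of 3, simplified])
  qed
  moreover have "1 \<le> exp (3 * t)" using t by simp
  ultimately have "1 + M \<le> 3 * exp (3 * t)" using t3 by linarith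
  also have "\<dots> \<le> exp 2 * exp (3 * t)" using exp_ge_add_one_self[of 2] by (intro mult_right_mono) auto
  finally show ?thesis by (simp add: t_def exp_add mult.commute)
qed

text \<open>A predicate on the constant allows the constants for three pairs of radii to be fixed
  before any function is considered.\<close>

definition caccioppoli_const :: "'a::euclidean_space \<Rightarrow> real \<Rightarrow> real \<Rightarrow> real \<Rightarrow> bool" where
  "caccioppoli_const a r r' B \<longleftrightarrow> B \<ge> 1 \<and> (\<forall>h g H G M. C2_on UNIV h g H \<longrightarrow> continuous_on UNIV G \<longrightarrow>
    (\<forall>x. 0 \<le> G x) \<longrightarrow> 0 \<le> M \<longrightarrow> (\<forall>x\<in>ball a r'. \<bar>lap H x\<bar> \<le> M * \<bar>h x\<bar> + G x) \<longrightarrow>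
    int_on (cball a r) (\<lambda>x. g x \<bullet> g x) \<le> B * (1 + M) * int_on (ball a r') (\<lambda>x. (h x)\<^sup>2 + (G x)\<^sup>2))"

lemma caccioppoli_constD:
  assumes "caccioppoli_const a r r' B" "C2_on UNIV h g H" "continuous_on UNIV G" "\<And>x. 0 \<le> G x" "0 \<le> M"
    "\<And>x. x \<in> ball a r' \<Longrightarrow> \<bar>lap H x\<bar> \<le> M * \<bar>h x\<bar> + G x"
  shows "int_on (cball a r) (\<lambda>x. g x \<bullet> g x) \<le> B * (1 + M) * int_on (ball a r') (\<lambda>x. (h x)\<^sup>2 + (G x)\<^sup>2)"
  using assms unfolding caccioppoli_const_def by blast

text \<open>The cut-off estimate bounds h on an annulus by exp (s X) times inner data plus exp (- s
  Y) times outer data, with X and Y the gaps of the weight's exponent. Interpolation gives \<kappa>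
  = Y / (X + Y), and the lower limit for s, of order M^(2/3), produces the exponential constant.
  Cut-offs are a hypothesis here and are constructed later by mollification.\<close>

theorem three_ball_smooth:
  fixes a :: "'a::euclidean_space"
  assumes r: "0 < r\<^sub>1" "r\<^sub>1 < r\<^sub>2" "r\<^sub>2 < R"
    and cut: "\<And>K U. compact K \<Longrightarrow> open U \<Longrightarrow> K \<subseteq> U \<Longrightarrow> \<exists>\<psi> g H S. C2_cutoff K (U :: 'a set) \<psi> g H S"
  shows "\<exists>\<kappa> C. 0 < \<kappa> \<and> \<kappa> < 1 \<and> 0 < C \<and> (\<forall>(h :: 'a \<Rightarrow> real) g H G M.
    C2_on UNIV h g H \<longrightarrow> continuous_on UNIV G \<longrightarrow> (\<forall>x. 0 \<le> G x) \<longrightarrow> 0 \<le> M \<longrightarrow>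
    (\<forall>x\<in>ball a R. \<bar>lap H x\<bar> \<le> M * \<bar>h x\<bar> + G x) \<longrightarrow>
    int_on (ball a r\<^sub>2) (\<lambda>x. (h x)\<^sup>2 + g x \<bullet> g x) \<le> exp (C * (M powr (2/3) + 1)) *
      ((int_on (ball a r\<^sub>1) (\<lambda>x. (h x)\<^sup>2) + int_on (ball a R) (\<lambda>x. (G x)\<^sup>2)) powr \<kappa> *
       (int_on (ball a R) (\<lambda>x. (h x)\<^sup>2) + int_on (ball a R) (\<lambda>x. (G x)\<^sup>2)) powr (1 - \<kappa>)))"
proof -
  \<comment> \<open>The cut-off rises between \<open>a0\<close> and \<open>b0\<close>, inside the
    ball of radius \<open>r\<^sub>1\<close>, and falls between \<open>r3\<close> and
    \<open>r4\<close>, inside that of radius \<open>R\<close>. The gaps from \<open>b0\<close> to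
    \<open>r\<^sub>1\<close>, from \<open>r4\<close> to \<open>R\<close> and from
    \<open>r\<^sub>2\<close> to \<open>\<rho>\<close> leave room for three Caccioppoli
    inequalities.\<close>
  define a0 b0 \<rho> r3 r4 where radii: "a0 = r\<^sub>1 / 4" "b0 = r\<^sub>1 / 2" "\<rho> = (3 * r\<^sub>2 + R) / 4"
    "r3 = (r\<^sub>2 + R) / 2" "r4 = (r\<^sub>2 + 3 * R) / 4"
  have ord: "0 < a0" "a0 < b0" "b0 < r\<^sub>1" "r\<^sub>1 < r\<^sub>2" "r\<^sub>2 < \<rho>" "\<rho> < r3" "r3 < r4" "r4 < R"
    using r by (auto simp: radii)
  have cballcut: "\<exists>\<psi> g H S. C2_cutoff (cball a t) (ball a t') \<psi> g H S" if "t < t'" for t t'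
    by (rule cut) (use that in auto)
  have "\<exists>B. caccioppoli_const a t t' B" if "t < t'" for t t'
    using cballcut[OF that] interior_caccioppoli[of a t t'] unfolding caccioppoli_const_def by blast
  then obtain B1 B2 B3 where "caccioppoli_const a b0 r\<^sub>1 B1" "caccioppoli_const a r4 R B2"
      "caccioppoli_const a r\<^sub>2 \<rho> B3"
    using ord by metis
  note B123 = this
  have B1: "B1 \<ge> 1" and B2: "B2 \<ge> 1" and B3: "B3 \<ge> 1"
    using B123 unfolding caccioppoli_const_def by auto
  have "\<exists>\<psi> g H S. C2_cutoff (cball a r3 - ball a b0) (ball a r4 - cball a a0) \<psi> g H S"
    by (rule cut) (use ord in \<open>auto intro: compact_diff\<close>)
  then obtain \<psi> g\<psi> H\<psi> S where \<psi>: "C2_cutoff (cball a r3 - ball a b0) (ball a r4 - cball a a0) \<psi> g\<psi> H\<psi> S" by auto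
  obtain B where B: "B \<ge> 1" "\<And>x. x \<in> S \<Longrightarrow> norm (g\<psi> x) \<le> B \<and> \<bar>lap H\<psi> x\<bar> \<le> B"
    using C2_cutoff_bound[OF \<psi>] by metis
  define A where "A = R\<^sup>2 + 1"
  define \<theta> where "\<theta> t = t - A * ln t" for t :: real
  have \<theta>: "\<theta> (u\<^sup>2) < \<theta> (t\<^sup>2)" if "0 < t" "t < u" "u < R" for t u
  proof -
    have "u\<^sup>2 < R\<^sup>2" using that by (simp add: power_strict_mono)
    then have "u\<^sup>2 < A" by (simp add: A_def)
    then show ?thesis
      unfolding \<theta>_def using that by (intro diff_ln_strict_antimono) (auto simp: power_strict_mono)
  qed
  define X where "X = \<theta> (a0\<^sup>2) - \<theta> (\<rho>\<^sup>2)"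
  define Y where "Y = \<theta> (\<rho>\<^sup>2) - \<theta> (r3\<^sup>2)"
  have X: "X > 0" using \<theta>[of a0 \<rho>] ord by (simp add: X_def)
  have Y: "Y > 0" using \<theta>[of \<rho> r3] ord by (simp add: Y_def)
  define \<kappa> where "\<kappa> = Y / (X + Y)"
  have \<kappa>: "0 < \<kappa>" "\<kappa> < 1" using X Y by (auto simp: \<kappa>_def)
  define D0 where "D0 = 12 * R\<^sup>2 * B\<^sup>2"
  define D where "D = 1 + D0 * (B1 + B2 + 2)"
  have D0: "D0 \<ge> 0" by (simp add: D0_def)
  have D1: "D \<ge> 1" using D0 B1 B2 by (simp add: D_def)
  \<comment> \<open>With k \<ge> 1, s \<ge> k t implies s^3 \<ge> k t^3 \<ge> 2 R^2 M^2, as t^3 =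
    M^2.\<close>
  define k where "k = 1 + 2 * R\<^sup>2"
  \<comment> \<open>\<open>C\<close> dominates the exponents collected at the end: B3 and 2 D from
    the constants, 2 (3 t + 2) from two factors 1 + M, and (2 + k t) (X + Y) from the least
    admissible s.\<close>
  define C where "C = B3 + 2 * D + 6 + (2 + k) * (X + Y)"
  have k1: "k \<ge> 1" by (simp add: k_def)
  have C0: "C > 0" using B3 D1 X Y k1 by (simp add: C_def add_pos_nonneg)
  show ?thesis
  proof (rule exI[of _ \<kappa>], rule exI[of _ C], intro conjI allI impI \<kappa> C0)
    fix h G :: "'a \<Rightarrow> real" and g H and M :: real
    assume h: "C2_on UNIV h g H" and G: "continuous_on UNIV G" "\<forall>x. 0 \<le> G x" and M: "0 \<le> M"
      and le: "\<forall>x\<in>ball a R. \<bar>lap H x\<bar> \<le> M * \<bar>h x\<bar> + G x"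
    note [continuous_intros] = C2_onD(5-7)[OF h] G(1)
    have bb: "bounded (ball a t)" "ball a t \<in> sets borel" "bounded (cball a t)" "cball a t \<in> sets borel"
      "bounded (cball a t - ball a t')" "cball a t - ball a t' \<in> sets borel" for t t' by auto
    have ball_mono: "int_on (ball a t) f \<le> int_on (ball a t') f'"
      if "t \<le> t'" "continuous_on UNIV f" "continuous_on UNIV f'" "\<And>x. f x \<le> f' x" "\<And>x. 0 \<le> f' x" for t t' f f'
      by (rule int_on_mono) (use that bb in \<open>auto simp: indicator_def\<close>)
    let ?h2 = "\<lambda>x. (h x)\<^sup>2" and ?G2 = "\<lambda>x. (G x)\<^sup>2" and ?g2 = "\<lambda>x. g x \<bullet> g x"
    have cont: "continuous_on UNIV ?h2" "continuous_on UNIV ?G2" "continuous_on UNIV ?g2"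
      by (intro continuous_intros)+
    define \<gamma> where "\<gamma> = int_on (ball a R) ?G2"
    define \<alpha> where "\<alpha> = int_on (ball a r\<^sub>1) ?h2 + \<gamma>"
    define \<beta> where "\<beta> = int_on (ball a R) ?h2 + \<gamma>"
    define N where "N = int_on (ball a \<rho>) ?h2"
    have \<gamma>0: "0 \<le> \<gamma>" unfolding \<gamma>_def by (rule int_on_nonneg) simp
    have \<alpha>0: "\<gamma> \<le> \<alpha>" "0 \<le> \<alpha>" using \<gamma>0 int_on_nonneg[of "ball a r\<^sub>1" ?h2] by (auto simp: \<alpha>_def)
    have \<alpha>\<beta>: "\<alpha> \<le> \<beta>" unfolding \<alpha>_def \<beta>_def using ball_mono[of r\<^sub>1 R ?h2 ?h2] ord cont by simp
    have N\<beta>: "N \<le> \<beta>" unfolding N_def \<beta>_def using ball_mono[of \<rho> R ?h2 ?h2] ord cont \<gamma>0 by simp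
    have split: "int_on (ball a t) (\<lambda>x. (h x)\<^sup>2 + (G x)\<^sup>2) \<le> int_on (ball a t) ?h2 + \<gamma>" if "t \<le> R" for t
      using ball_mono[of t R ?G2 ?G2] that cont bb
      by (subst int_on_add) (auto simp: \<gamma>_def)
    define Q where "Q = 1 + M"
    have Q: "Q \<ge> 1" using M by (simp add: Q_def)
    have c1: "int_on (cball a b0) (\<lambda>x. g x \<bullet> g x + (h x)\<^sup>2) \<le> (B1 + 1) * Q * \<alpha>"
    proof -
      have "int_on (cball a b0) ?g2 \<le> B1 * Q * int_on (ball a r\<^sub>1) (\<lambda>x. (h x)\<^sup>2 + (G x)\<^sup>2)"
        unfolding Q_def by (rule caccioppoli_constD[OF B123(1) h]) (use G M le ord in auto)
      also have "\<dots> \<le> B1 * Q * \<alpha>" unfolding \<alpha>_def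
        using split[of r\<^sub>1] ord B1 Q by (intro mult_left_mono) auto
      finally have "int_on (cball a b0) ?g2 \<le> B1 * Q * \<alpha>" .
      moreover have "int_on (cball a b0) ?h2 \<le> int_on (ball a r\<^sub>1) ?h2"
        by (rule int_on_mono) (use cont bb ord in \<open>auto simp: indicator_def\<close>)
      moreover have "\<alpha> \<le> Q * \<alpha>" using Q \<alpha>0 by (simp add: mult_le_cancel_right1)
      ultimately show ?thesis using cont bb \<gamma>0
        by (subst int_on_add) (auto simp: \<alpha>_def algebra_simps)
    qed
    have c2: "int_on (cball a r4) (\<lambda>x. g x \<bullet> g x + (h x)\<^sup>2) \<le> (B2 + 1) * Q * \<beta>"
    proof -
      have "int_on (cball a r4) ?g2 \<le> B2 * Q * int_on (ball a R) (\<lambda>x. (h x)\<^sup>2 + (G x)\<^sup>2)"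
        unfolding Q_def by (rule caccioppoli_constD[OF B123(2) h]) (use G M le ord in auto)
      also have "\<dots> \<le> B2 * Q * \<beta>" unfolding \<beta>_def
        using split[of R] ord B2 Q by (intro mult_left_mono) auto
      finally have "int_on (cball a r4) ?g2 \<le> B2 * Q * \<beta>" .
      moreover have "int_on (cball a r4) ?h2 \<le> int_on (ball a R) ?h2"
        by (rule int_on_mono) (use cont bb ord in \<open>auto simp: indicator_def\<close>)
      moreover have "\<beta> \<le> Q * \<beta>" using Q \<alpha>0 \<alpha>\<beta> by (simp add: mult_le_cancel_right1)
      ultimately show ?thesis using cont bb \<gamma>0
        by (subst int_on_add) (auto simp: \<beta>_def algebra_simps)
    qed
    define t where "t = M powr (2/3)"
    have t: "t \<ge> 0" by (simp add: t_def)
    have t3: "t ^ 3 = M\<^sup>2"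
    using powr_two_thirds_cube M by (simp add: t_def)
    define s\<^sub>1 where "s\<^sub>1 = 2 + k * t"
    have s1: "s\<^sub>1 \<ge> 2" using k1 t by (simp add: s\<^sub>1_def)
    have main: "N \<le> (D * Q) * (exp (s * X) * \<alpha> + exp (- (s * Y)) * \<beta>)" if s: "s\<^sub>1 \<le> s" for s
    proof -
      have s2: "s \<ge> 2" using s s1 by simp
      have "s ^ 3 \<ge> (k * t) ^ 3" using s k1 t by (intro power_mono) (auto simp: s\<^sub>1_def)
      moreover have "k ^ 3 \<ge> k" using k1 by (simp add: self_le_power)
      then have "k ^ 3 * t ^ 3 \<ge> (2 * R\<^sup>2) * t ^ 3" using t by (intro mult_right_mono) (auto simp: k_def)
      ultimately have s3: "s ^ 3 \<ge> 2 * R\<^sup>2 * M\<^sup>2" using t3 by (simp add: power_mult_distrib)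
      have s22: "s\<^sup>2 \<ge> 2" using power_mono[of 2 s 2] s2 by simp
      let ?I = "int_on (cball a \<rho> - ball a b0) ?h2"
      have "exp (s * \<theta> (\<rho>\<^sup>2)) * ?I \<le> exp (s * \<theta> (a0\<^sup>2)) * D0 *
        (\<gamma> + int_on (cball a b0) (\<lambda>x. g x \<bullet> g x + (h x)\<^sup>2))
        + exp (s * \<theta> (r3\<^sup>2)) * D0 * int_on (cball a r4) (\<lambda>x. g x \<bullet> g x + (h x)\<^sup>2)"
        unfolding \<theta>_def D0_def \<gamma>_def
        by (rule carleman_cutoff[OF _ _ _ _ _ _ _ A_def \<psi> B h G(1) _ M]) (use ord G le s2 s22 s3 in auto)
      also have "\<dots> \<le> exp (s * \<theta> (a0\<^sup>2)) * D0 * (Q * \<alpha> + (B1 + 1) * Q * \<alpha>)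
        + exp (s * \<theta> (r3\<^sup>2)) * D0 * ((B2 + 1) * Q * \<beta>)"
      proof (intro add_mono mult_left_mono c1 c2)
        show "\<gamma> \<le> Q * \<alpha>" using \<alpha>0 Q mult_right_mono[of 1 Q \<alpha>] by simp
      qed (use D0 in auto)
      finally have "exp (- (s * \<theta> (\<rho>\<^sup>2))) * (exp (s * \<theta> (\<rho>\<^sup>2)) * ?I) \<le>
        exp (- (s * \<theta> (\<rho>\<^sup>2))) * (exp (s * \<theta> (a0\<^sup>2)) * D0 * (Q * \<alpha> + (B1 + 1) * Q * \<alpha>)
        + exp (s * \<theta> (r3\<^sup>2)) * D0 * ((B2 + 1) * Q * \<beta>))"
        by (rule mult_left_mono) simp
      moreover have "exp (- (s * \<theta> (\<rho>\<^sup>2))) * exp (s * \<theta> (a0\<^sup>2)) = exp (s * X)"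
        "exp (- (s * \<theta> (\<rho>\<^sup>2))) * exp (s * \<theta> (r3\<^sup>2)) = exp (- (s * Y))"
        unfolding exp_add[symmetric] by (simp_all add: X_def Y_def algebra_simps)
      moreover have "exp (- (s * \<theta> (\<rho>\<^sup>2))) * exp (s * \<theta> (\<rho>\<^sup>2)) = 1" unfolding exp_add[symmetric] by simp
      ultimately have I: "?I \<le> exp (s * X) * D0 * (Q * \<alpha> + (B1 + 1) * Q * \<alpha>) + exp (- (s * Y)) * D0 * ((B2 + 1) * Q * \<beta>)"
        unfolding distrib_left mult.assoc[symmetric] by simp
      \<comment> \<open>The Carleman estimate leaves out the neighbourhood of the centre; it is
        returned through the data on the inner ball.\<close>
      have "N \<le> ?I + int_on (ball a r\<^sub>1) ?h2"
      proof -
        have I: "integrable lborel (\<lambda>x. indicator (cball a \<rho> - ball a b0) x * (h x)\<^sup>2)"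
          "integrable lborel (\<lambda>x. indicator (ball a r\<^sub>1) x * (h x)\<^sup>2)"
          "integrable lborel (\<lambda>x. indicator (ball a \<rho>) x * (h x)\<^sup>2)"
          by (intro integrable_int_on cont bb)+
        have "N \<le> (\<integral>x. indicator (cball a \<rho> - ball a b0) x * (h x)\<^sup>2 + indicator (ball a r\<^sub>1) x * (h x)\<^sup>2 \<partial>lborel)"
          unfolding N_def int_on_def
          by (rule integral_mono[OF I(3) Bochner_Integration.integrable_add[OF I(1,2)]])
            (use ord in \<open>auto simp: indicator_def\<close>)
        then show ?thesis unfolding int_on_def Bochner_Integration.integral_add[OF I(1,2)] .
      qed
      also have "\<dots> \<le> exp (s * X) * D0 * (Q * \<alpha> + (B1 + 1) * Q * \<alpha>) + exp (- (s * Y)) * D0 * ((B2 + 1) * Q * \<beta>)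
          + exp (s * X) * (Q * \<alpha>)"
      proof -
        have "int_on (ball a r\<^sub>1) ?h2 \<le> 1 * (1 * \<alpha>)" using \<gamma>0 by (simp add: \<alpha>_def)
        also have "\<dots> \<le> exp (s * X) * (Q * \<alpha>)"
          using X s2 Q \<alpha>0 by (intro mult_mono mult_right_mono) auto
        finally show ?thesis using I by linarith
      qed
      also have "\<dots> = (1 + D0 * (B1 + 2)) * (Q * (exp (s * X) * \<alpha>)) + D0 * (B2 + 1) * (Q * (exp (- (s * Y)) * \<beta>))"
        by (simp add: algebra_simps)
      also have "\<dots> \<le> D * (Q * (exp (s * X) * \<alpha>)) + D * (Q * (exp (- (s * Y)) * \<beta>))"
      proof (intro add_mono mult_right_mono)
        show "1 + D0 * (B1 + 2) \<le> D" "D0 * (B2 + 1) \<le> D"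
          using D0 B1 B2 by (auto simp: D_def algebra_simps intro: add_nonneg_nonneg)
      qed (use Q \<alpha>0 \<alpha>\<beta> in auto)
      finally show ?thesis by (simp add: algebra_simps)
    qed
    define P where "P = \<alpha> powr \<kappa> * \<beta> powr (1 - \<kappa>)"
    define Z where "Z = exp (s\<^sub>1 * (X + Y))"
    have DQ: "1 \<le> D * Q" using mult_mono[of 1 D 1 Q] D1 Q by simp
    have P0: "0 \<le> P" by (simp add: P_def)
    have Z1: "1 \<le> Z" using s1 X Y by (simp add: Z_def)
    have NP: "N \<le> 2 * (D * Q) * Z * P"
      unfolding Z_def P_def \<kappa>_def
      by (rule exponential_interpolation[OF \<alpha>0(2) \<alpha>\<beta> N\<beta> DQ X Y _ main]) (use s1 in auto)
    \<comment> \<open>As \<gamma> \<le> \<alpha> \<le> \<beta>, the geometric mean also dominates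
      the source term, which the last Caccioppoli step brings in again.\<close>
    have \<gamma>P: "\<gamma> \<le> P"
    proof (cases "\<alpha> = 0")
      case True
      then show ?thesis using \<alpha>0 P0 by simp
    next
      case False
      then have p: "\<alpha> > 0" using \<alpha>0 by simp
      have "\<alpha> = \<alpha> powr \<kappa> * \<alpha> powr (1 - \<kappa>)" using p by (simp flip: powr_add)
      also have "\<dots> \<le> P" unfolding P_def using \<kappa> p \<alpha>\<beta> by (intro mult_left_mono powr_mono2) auto
      finally show ?thesis using \<alpha>0 by simp
    qed
    have "int_on (ball a r\<^sub>2) (\<lambda>x. (h x)\<^sup>2 + g x \<bullet> g x) = int_on (ball a r\<^sub>2) ?h2 + int_on (ball a r\<^sub>2) ?g2"
      by (rule int_on_add) (use cont bb in auto)
    also have "int_on (ball a r\<^sub>2) ?h2 \<le> N + \<gamma>" unfolding N_def using ball_mono[of r\<^sub>2 \<rho> ?h2 ?h2] ord cont \<gamma>0 by simp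
    also have "int_on (ball a r\<^sub>2) ?g2 \<le> int_on (cball a r\<^sub>2) ?g2"
      by (rule int_on_mono) (use cont bb in \<open>auto simp: indicator_def\<close>)
    also have "\<dots> \<le> B3 * Q * int_on (ball a \<rho>) (\<lambda>x. (h x)\<^sup>2 + (G x)\<^sup>2)"
      unfolding Q_def by (rule caccioppoli_constD[OF B123(3) h]) (use G M le ord in auto)
    also have "\<dots> \<le> B3 * Q * (N + \<gamma>)" unfolding N_def
      using split[of \<rho>] ord B3 Q by (intro mult_left_mono) auto
    also have "N + \<gamma> + B3 * Q * (N + \<gamma>) = (1 + B3 * Q) * (N + \<gamma>)" by (simp add: algebra_simps)
    also have "\<dots> \<le> ((1 + B3) * Q) * ((1 + 2 * D) * Q * Z * P)"
    proof (rule mult_mono)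
      show "1 + B3 * Q \<le> (1 + B3) * Q" using Q by (simp add: algebra_simps)
      have "1 * P \<le> (Q * Z) * P" using mult_mono[of 1 Q 1 Z] Q Z1 P0 by (intro mult_right_mono) auto
      then show "N + \<gamma> \<le> (1 + 2 * D) * Q * Z * P" using NP \<gamma>P by (simp add: algebra_simps)
      show "0 \<le> N + \<gamma>" using \<gamma>0 int_on_nonneg[of "ball a \<rho>" ?h2] by (simp add: N_def)
    qed (use B3 Q in auto)
    also have "\<dots> = (1 + B3) * (1 + 2 * D) * (Q * Q) * Z * P" by (simp add: mult_ac)
    also have "\<dots> \<le> exp B3 * exp (2 * D) * (exp (3 * t + 2) * exp (3 * t + 2)) * Z * P"
    proof (intro mult_right_mono mult_mono)
      show "1 + B3 \<le> exp B3" "1 + 2 * D \<le> exp (2 * D)" by (simp_all add: exp_ge_add_one_self)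
      show "Q \<le> exp (3 * t + 2)" "Q \<le> exp (3 * t + 2)"
        using one_plus_le_exp_powr[OF M] by (simp_all add: Q_def t_def)
    qed (use B3 Q D1 P0 Z1 in auto)
    also have "\<dots> = exp (B3 + 2 * D + 2 * (3 * t + 2) + s\<^sub>1 * (X + Y)) * P"
      unfolding Z_def exp_add[symmetric] by (simp add: algebra_simps)
    also have "\<dots> \<le> exp (C * (t + 1)) * P"
    proof (intro mult_right_mono P0)
      have "B3 + 2 * D + 2 * (3 * t + 2) + s\<^sub>1 * (X + Y) \<le> C * (t + 1)"
      proof -
        have "0 \<le> t * B3" "0 \<le> t * D" "0 \<le> t * X" "0 \<le> t * Y" "0 \<le> k * X" "0 \<le> k * Y"
          using t B3 D1 X Y k1 by auto
        then show ?thesis by (simp add: C_def s\<^sub>1_def algebra_simps)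
      qed
      then show "exp (B3 + 2 * D + 2 * (3 * t + 2) + s\<^sub>1 * (X + Y)) \<le> exp (C * (t + 1))" by simp
    qed
    finally show "int_on (ball a r\<^sub>2) (\<lambda>x. (h x)\<^sup>2 + g x \<bullet> g x) \<le> exp (C * (M powr (2/3) + 1)) *
      ((int_on (ball a r\<^sub>1) (\<lambda>x. (h x)\<^sup>2) + int_on (ball a R) (\<lambda>x. (G x)\<^sup>2)) powr \<kappa> *
       (int_on (ball a R) (\<lambda>x. (h x)\<^sup>2) + int_on (ball a R) (\<lambda>x. (G x)\<^sup>2)) powr (1 - \<kappa>))"
      unfolding t_def P_def \<alpha>_def \<beta>_def \<gamma>_def by simp
  qed
qed

section \<open>Smooth bump functions\<close>

lemma frechet_derivative_eq_sum_partial: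
  assumes "f differentiable at x"
  shows "frechet_derivative f (at x) h = (\<Sum>i\<in>UNIV. h $ i *\<^sub>R partial i f x)"
proof -
  have lin: "linear (frechet_derivative f (at x))" using assms by (rule linear_frechet_derivative)
  have "h = (\<Sum>i\<in>UNIV. h $ i *\<^sub>R axis i 1)"
    by (simp add: vec_eq_iff axis_def if_distrib cong: if_cong)
  then have "frechet_derivative f (at x) h = frechet_derivative f (at x) (\<Sum>i\<in>UNIV. h $ i *\<^sub>R axis i 1)" by simp
  then show ?thesis by (simp add: linear_sum[OF lin] linear_cmul[OF lin] partial_def)
qed

lemma has_derivative_partial:
  assumes "f differentiable at x"
  shows "(f has_derivative (\<lambda>h. \<Sum>i\<in>UNIV. h $ i *\<^sub>R partial i f x)) (at x)"
proof -
  have "(f has_derivative frechet_derivative f (at x)) (at x)"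
    using assms by (simp add: frechet_derivative_works)
  moreover have "frechet_derivative f (at x) = (\<lambda>h. \<Sum>i\<in>UNIV. h $ i *\<^sub>R partial i f x)"
    using frechet_derivative_eq_sum_partial[OF assms] by blast
  ultimately show ?thesis by simp
qed

lemma partial_eqI: "(f has_derivative f') (at x) \<Longrightarrow> partial i f x = f' (axis i 1)"
  using frechet_derivative_at[of f f' x] by (simp add: partial_def)

lemma partial_add:
  "f differentiable at x \<Longrightarrow> g differentiable at x \<Longrightarrow> partial i (\<lambda>x. f x + g x) x = partial i f x + partial i g x"
  unfolding frechet_derivative_works
  by (subst partial_eqI[OF has_derivative_add]) (auto simp: partial_def)

lemma partial_mult:
  "f differentiable at x \<Longrightarrow> g differentiable at x \<Longrightarrow>
    partial i (\<lambda>x. f x * g x) x = f x * partial i g x + partial i f x * g x"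
  unfolding frechet_derivative_works
  by (subst partial_eqI[OF has_derivative_mult]) (auto simp: partial_def)

lemma partial_const [simp]: "partial i (\<lambda>x. c) = (\<lambda>x. 0)"
  by (rule ext, subst partial_eqI[OF has_derivative_const]) simp

text \<open>The recursion asks for continuity only at the last level; below it, differentiability
  supplies continuity.\<close>

lemma Ck_Suc_imp: "Ck (Suc k) f \<Longrightarrow> Ck k f"
proof (induction k arbitrary: f)
  case 0
  then show ?case
    by (auto intro!: continuous_at_imp_continuous_on differentiable_imp_continuous_within)
next
  case (Suc k)
  then show ?case using Ck.simps(2) by blast
qed

lemma Ck_const: "Ck k (\<lambda>x. c)"
  by (induction k arbitrary: c) auto

lemma Ck_add: "Ck k f \<Longrightarrow> Ck k g \<Longrightarrow> Ck k (\<lambda>x. f x + g x)"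
proof (induction k arbitrary: f g)
  case 0
  then show ?case by (auto intro: continuous_intros)
next
  case (Suc k)
  then have "partial i (\<lambda>x. f x + g x) = (\<lambda>x. partial i f x + partial i g x)" for i
    by (intro ext partial_add) auto
  with Suc show ?case by auto
qed

lemma Ck_mult: "Ck k f \<Longrightarrow> Ck k g \<Longrightarrow> Ck k (\<lambda>x. f x * g x)"
proof (induction k arbitrary: f g)
  case 0
  then show ?case by (auto intro: continuous_intros)
next
  case (Suc k)
  have "partial i (\<lambda>x. f x * g x) = (\<lambda>x. f x * partial i g x + partial i f x * g x)" for i
    using Suc.prems by (intro ext partial_mult) auto
  moreover have "Ck k f" "Ck k g" using Suc.prems Ck_Suc_imp by auto
  ultimately show ?case using Suc by (auto intro!: Ck_add)
qed

lemma Ck_coordinate: "Ck k (\<lambda>x::real^'n. complex_of_real (x $ i))"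
proof -
  have d: "((\<lambda>x::real^'n. complex_of_real (x $ i)) has_derivative (\<lambda>h. complex_of_real (h $ i))) (at x)" for x
    by (intro has_derivative_of_real bounded_linear_imp_has_derivative bounded_linear_vec_nth)
  have "partial j (\<lambda>x::real^'n. complex_of_real (x $ i)) = (\<lambda>x. complex_of_real (axis j 1 $ i))" for j
    by (intro ext partial_eqI[OF d])
  then show ?thesis using d by (cases k) (auto simp: Ck_const differentiable_def intro!: continuous_intros)
qed

text \<open>The functions \<open>t\<^sup>-\<^sup>m exp (- 1 / t)\<close> are closed under differentiation up to linear combinations.\<close>

definition flat_exp :: "nat \<Rightarrow> real \<Rightarrow> real" where
  "flat_exp m t = (if t > 0 then exp (- inverse t) * inverse t ^ m else 0)"

text \<open>From the right, the substitution of 1 / t reduces to a power against an exponential at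
  infinity.\<close>

lemma flat_exp_tendsto_0: "(flat_exp m \<longlongrightarrow> 0) (at 0)"
proof -
  have "((\<lambda>t. inverse t ^ m / exp (inverse t)) \<longlongrightarrow> 0) (at_right (0::real))"
    by (rule filterlim_compose[OF tendsto_power_div_exp_0 filterlim_inverse_at_top_right])
  then have "(flat_exp m \<longlongrightarrow> 0) (at_right 0)"
    by (rule Lim_transform_eventually)
      (auto simp: flat_exp_def eventually_at_right_field exp_minus field_simps intro!: exI[of _ 1])
  moreover have "(flat_exp m \<longlongrightarrow> 0) (at_left 0)"
    by (rule tendsto_eventually) (auto simp: flat_exp_def eventually_at_left_field intro!: exI[of _ "-1"])
  ultimately show ?thesis by (simp add: filterlim_split_at)
qed

text \<open>At 0 the difference quotient of \<open>flat_exp m\<close> is the next member of the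
  family, which tends to 0.\<close>

lemma DERIV_flat_exp: "(flat_exp m has_real_derivative flat_exp (m + 2) t - real m * flat_exp (m + 1) t) (at t)"
proof -
  consider "t > 0" | "t < 0" | "t = 0" by linarith
  then show ?thesis
  proof cases
    case 1
    have i: "((\<lambda>t. inverse t ^ m) has_real_derivative - real m * inverse t ^ (m + 1)) (at t)"
      by (rule DERIV_cong[OF DERIV_power[OF DERIV_inverse]]) (use 1 in \<open>cases m; simp add: algebra_simps\<close>)+
    have e: "((\<lambda>t. exp (- inverse t)) has_real_derivative exp (- inverse t) * inverse t ^ 2) (at t)"
      using 1 by (auto intro!: derivative_eq_intros simp: power2_eq_square)
    have "((\<lambda>t. exp (- inverse t) * inverse t ^ m) has_real_derivative
        flat_exp (m + 2) t - real m * flat_exp (m + 1) t) (at t)"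
      by (rule DERIV_cong[OF DERIV_mult[OF e i]])
        (use 1 in \<open>simp add: flat_exp_def power2_eq_square algebra_simps\<close>)
    then show ?thesis
      by (rule has_field_derivative_transform_within_open[of _ _ _ "{0<..}"]) (use 1 in \<open>auto simp: flat_exp_def\<close>)
  next
    case 2
    have "((\<lambda>t. 0) has_real_derivative flat_exp (m + 2) t - real m * flat_exp (m + 1) t) (at t)"
      using 2 by (simp add: flat_exp_def)
    then show ?thesis
      by (rule has_field_derivative_transform_within_open[of _ _ _ "{..<0}"]) (use 2 in \<open>auto simp: flat_exp_def\<close>)
  next
    case 3
    have "((\<lambda>h. (flat_exp m (0 + h) - flat_exp m 0) / h) \<longlongrightarrow> 0) (at 0)"
      by (rule Lim_transform_eventually[OF flat_exp_tendsto_0[of "Suc m"]])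
        (auto simp: flat_exp_def divide_inverse intro!: always_eventually)
    then show ?thesis using 3 by (simp add: DERIV_def flat_exp_def)
  qed
qed

lemma flat_exp_nonneg: "0 \<le> flat_exp m t" and flat_exp_pos_iff: "0 < flat_exp m t \<longleftrightarrow> 0 < t"
  by (auto simp: flat_exp_def)

text \<open>The index \<open>m\<close> is kept because partial derivatives stay in the span of this
  family times coordinate polynomials; smoothness is then an induction with \<open>m\<close>
  generalised.\<close>

definition bump :: "nat \<Rightarrow> real \<Rightarrow> real^'n \<Rightarrow> real^'n \<Rightarrow> complex" where
  "bump m \<delta> a x = complex_of_real (flat_exp m (\<delta>\<^sup>2 - (x - a) \<bullet> (x - a)))"

lemma has_derivative_bump:
  "(bump m \<delta> a has_derivative (\<lambda>h. (bump (m + 2) \<delta> a x - of_nat m * bump (m + 1) \<delta> a x) *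
      of_real (- 2 * ((x - a) \<bullet> h)))) (at x)"
proof -
  let ?q = "\<lambda>x. \<delta>\<^sup>2 - (x - a) \<bullet> (x - a)"
  have "(?q has_derivative (\<lambda>h. - 2 * ((x - a) \<bullet> h))) (at x)"
    by (auto intro!: derivative_eq_intros simp: inner_commute)
  from has_derivative_compose[OF this DERIV_flat_exp[of m "?q x", unfolded has_field_derivative_def]]
  have "((\<lambda>x. complex_of_real (flat_exp m (?q x))) has_derivative
    (\<lambda>h. of_real ((flat_exp (m + 2) (?q x) - real m * flat_exp (m + 1) (?q x)) * (- 2 * ((x - a) \<bullet> h))))) (at x)"
    by (rule has_derivative_of_real)
  then show ?thesis by (simp add: bump_def [abs_def])
qed

lemma Ck_bump: "Ck k (bump m \<delta> a)"
proof (induction k arbitrary: m)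
  case 0
  show ?case
    using has_derivative_continuous[OF has_derivative_bump]
    by (auto intro!: continuous_at_imp_continuous_on)
next
  case (Suc k)
  have "partial i (bump m \<delta> a) = (\<lambda>x. (bump (m + 2) \<delta> a x + (- of_nat m) * bump (m + 1) \<delta> a x) *
      ((-2) * (of_real (x $ i) + (- of_real (a $ i)))))" for i
    by (rule ext, subst partial_eqI[OF has_derivative_bump]) (simp add: inner_axis algebra_simps)
  moreover have "Ck k (\<lambda>x. (bump (m + 2) \<delta> a x + (- of_nat m) * bump (m + 1) \<delta> a x) *
      ((-2) * (of_real (x $ i) + (- of_real (a $ i)))))" for i
    by (intro Ck_mult Ck_add Ck_const Ck_coordinate Suc)
  ultimately show ?case
    using has_derivative_bump[of m \<delta> a] by (auto simp del: One_nat_def intro: differentiableI)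
qed

text \<open>The second derivatives are computed explicitly, and the result is visibly symmetric.
  This is the source of every symmetric Hessian in the development, since mollified functions put
  their derivatives on the kernel.\<close>

lemma symmetric_partial_bump:
  "partial i (partial j (bump m \<delta> a)) = partial j (partial i (bump m \<delta> a))"
proof -
  have 1: "partial i (bump m \<delta> a) = (\<lambda>x. (bump (m + 2) \<delta> a x - of_nat m * bump (m + 1) \<delta> a x) *
      of_real (- 2 * (x $ i - a $ i)))" for i m
    by (rule ext, subst partial_eqI[OF has_derivative_bump]) (simp add: inner_axis)
  let ?c = "\<lambda>x. bump (m + 2) \<delta> a x - of_nat m * bump (m + 1) \<delta> a x"
  let ?d = "\<lambda>x. (bump (m + 2 + 2) \<delta> a x - of_nat (m + 2) * bump (m + 2 + 1) \<delta> a x)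
    - of_nat m * (bump (m + 1 + 2) \<delta> a x - of_nat (m + 1) * bump (m + 1 + 1) \<delta> a x)"
  have D: "((\<lambda>x. ?c x * of_real (- 2 * (x $ i - a $ i))) has_derivative
      (\<lambda>h. ?c x * of_real (- 2 * h $ i) + (?d x * of_real (- 2 * ((x - a) \<bullet> h))) * of_real (- 2 * (x $ i - a $ i)))) (at x)" for i x
    by (rule has_derivative_bump derivative_eq_intros bounded_linear_imp_has_derivative bounded_linear_vec_nth refl)+
      (simp add: algebra_simps)
  have 2: "partial j (partial i (bump m \<delta> a)) x = ?c x * of_real (- 2 * axis j 1 $ i)
      + (?d x * of_real (- 2 * (x $ j - a $ j))) * of_real (- 2 * (x $ i - a $ i))" for i j x
    unfolding 1 by (rule trans[OF partial_eqI[OF D]]) (simp add: inner_axis)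
  show ?thesis
    by (rule ext, unfold 2) (auto simp: axis_def)
qed

section \<open>Test functions and convolution\<close>

lemma test_functionsI:
  assumes "\<And>k. Ck k \<phi>" "compact K" "K \<subseteq> \<Omega>" "\<And>x. x \<notin> K \<Longrightarrow> \<phi> x = 0"
  shows "\<phi> \<in> test_functions \<Omega>"
proof -
  have "closure {x. \<phi> x \<noteq> 0} \<subseteq> K"
    using assms by (intro closure_minimal) (auto simp: compact_imp_closed)
  then show ?thesis
    using assms compact_Int_closed[OF assms(2), of "closure {x. \<phi> x \<noteq> 0}"]
    by (auto simp: test_functions_def inf_absorb2)
qed

lemma test_functions_Ck: "\<phi> \<in> test_functions \<Omega> \<Longrightarrow> Ck k \<phi>"
  by (simp add: test_functions_def)

lemma test_functions_support:
  assumes "\<phi> \<in> test_functions \<Omega>"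
  obtains K where "compact K" "K \<subseteq> \<Omega>" "\<And>x. x \<notin> K \<Longrightarrow> \<phi> x = 0"
proof -
  have *: "x \<notin> closure {x. \<phi> x \<noteq> 0} \<Longrightarrow> \<phi> x = 0" for x
    using closure_subset[of "{x. \<phi> x \<noteq> 0}"] by blast
  show ?thesis
  proof (rule that)
    show "compact (closure {x. \<phi> x \<noteq> 0})" "closure {x. \<phi> x \<noteq> 0} \<subseteq> \<Omega>"
      using assms by (auto simp: test_functions_def)
  qed (rule *)
qed

lemma test_functions_differentiable: "\<phi> \<in> test_functions \<Omega> \<Longrightarrow> \<phi> differentiable at x"
  using test_functions_Ck[of \<phi> \<Omega> "Suc 0"] by simp

lemma test_functions_continuous: "\<phi> \<in> test_functions \<Omega> \<Longrightarrow> continuous_on S \<phi>"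
  using test_functions_Ck[of \<phi> \<Omega> 0] by (auto intro: continuous_on_subset)

lemma partial_eq_0_outside:
  assumes "compact K" "\<And>x. x \<notin> K \<Longrightarrow> \<phi> x = 0" "x \<notin> K"
  shows "partial i \<phi> x = 0"
proof -
  have "(\<phi> has_derivative (\<lambda>h. 0)) (at x)"
    using has_derivative_transform_within_open[of "\<lambda>x. 0" "\<lambda>h. 0" x UNIV "-K" \<phi>] assms
    by (auto simp: compact_imp_closed open_Compl)
  then show ?thesis by (rule partial_eqI)
qed

lemma test_functions_partial:
  assumes "\<phi> \<in> test_functions \<Omega>" shows "partial i \<phi> \<in> test_functions \<Omega>"
proof -
  obtain K where K: "compact K" "K \<subseteq> \<Omega>" "\<And>x. x \<notin> K \<Longrightarrow> \<phi> x = 0"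
    by (rule test_functions_support[OF assms]) blast
  have "Ck k (partial i \<phi>)" for k
    using test_functions_Ck[OF assms, of "Suc k"] by simp
  then show ?thesis using K partial_eq_0_outside[OF K(1,3)] by (intro test_functionsI)
qed

lemma test_functions_mono: "\<phi> \<in> test_functions \<Omega> \<Longrightarrow> \<Omega> \<subseteq> \<Omega>' \<Longrightarrow> \<phi> \<in> test_functions \<Omega>'"
  by (auto simp: test_functions_def)

lemma test_functions_add:
  assumes "\<phi> \<in> test_functions \<Omega>" "\<psi> \<in> test_functions \<Omega>"
  shows "(\<lambda>x. \<phi> x + \<psi> x) \<in> test_functions \<Omega>"
proof -
  obtain K K' where K: "compact K" "K \<subseteq> \<Omega>" "\<And>x. x \<notin> K \<Longrightarrow> \<phi> x = 0"
    and K': "compact K'" "K' \<subseteq> \<Omega>" "\<And>x. x \<notin> K' \<Longrightarrow> \<psi> x = 0"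
    by (rule test_functions_support[OF assms(1)], rule test_functions_support[OF assms(2)]) blast
  show ?thesis
    by (rule test_functionsI[of _ "K \<union> K'"]) (use K K' assms in \<open>auto intro: Ck_add test_functions_Ck\<close>)
qed

lemma test_functions_mult:
  assumes "\<phi> \<in> test_functions \<Omega>" "\<And>k. Ck k f"
  shows "(\<lambda>x. f x * \<phi> x) \<in> test_functions \<Omega>"
proof -
  obtain K where K: "compact K" "K \<subseteq> \<Omega>" "\<And>x. x \<notin> K \<Longrightarrow> \<phi> x = 0"
    by (rule test_functions_support[OF assms(1)]) blast
  show ?thesis
    by (rule test_functionsI[OF _ K(1,2)]) (use K assms in \<open>auto intro: Ck_mult test_functions_Ck\<close>)
qed

lemma test_functions_cmult: "\<phi> \<in> test_functions \<Omega> \<Longrightarrow> (\<lambda>x. c * \<phi> x) \<in> test_functions \<Omega>"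
  by (rule test_functions_mult) (auto intro: Ck_const)

lemma partial_translate: "partial i (\<lambda>y. \<kappa> (y - x)) = (\<lambda>y. partial i \<kappa> (y - x))" if "\<And>x. \<kappa> differentiable at x"
proof
  fix y
  have "((\<lambda>y. \<kappa> (y - x)) has_derivative (\<lambda>h. frechet_derivative \<kappa> (at (y - x)) h)) (at y)"
    using has_derivative_diff[OF has_derivative_ident has_derivative_const, of x "at y"]
      has_derivative_compose[of "\<lambda>y. y - x" "\<lambda>h. h" y UNIV \<kappa> "frechet_derivative \<kappa> (at (y - x))"] that[of "y - x"]
    by (simp add: frechet_derivative_works)
  then show "partial i (\<lambda>y. \<kappa> (y - x)) y = partial i \<kappa> (y - x)"
    by (subst partial_eqI) (auto simp: partial_def)
qed

lemma Ck_translate: "Ck k \<kappa> \<Longrightarrow> Ck k (\<lambda>y. \<kappa> (y - x))"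
proof (induction k arbitrary: \<kappa>)
  case 0
  then show ?case by (auto intro!: continuous_on_compose2[of UNIV \<kappa> UNIV "\<lambda>y. y - x"] continuous_on_diff continuous_on_id continuous_on_const)
next
  case (Suc k)
  have d: "\<kappa> differentiable at z" and p: "Ck k (partial i \<kappa>)" for z i
    using Suc.prems by auto
  have "((\<lambda>y. \<kappa> (y - x)) has_derivative (\<lambda>h. \<Sum>i\<in>UNIV. h $ i *\<^sub>R partial i \<kappa> (y - x))) (at y)" for y
    using has_derivative_diff[OF has_derivative_ident has_derivative_const, of x "at y"]
      has_derivative_compose[of "\<lambda>y. y - x" "\<lambda>h. h" y UNIV, OF _ has_derivative_partial[OF d]] by simp
  then have "(\<lambda>y. \<kappa> (y - x)) differentiable at y" for y
    by (rule differentiableI)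
  moreover have "Ck k (partial i (\<lambda>y. \<kappa> (y - x)))" for i
    unfolding partial_translate[OF d] by (rule Suc.IH[OF p])
  ultimately show ?case by simp
qed

lemma test_functions_translate:
  assumes "\<kappa> \<in> test_functions UNIV" "\<And>z. \<kappa> z \<noteq> 0 \<Longrightarrow> norm z \<le> r" "cball x r \<subseteq> \<Omega>"
  shows "(\<lambda>y. \<kappa> (y - x)) \<in> test_functions \<Omega>"
  by (rule test_functionsI[OF Ck_translate compact_cball assms(3)])
    (use assms in \<open>auto intro: test_functions_Ck simp: dist_norm norm_minus_commute\<close>)

lemma norm_integral_le:
  fixes f :: "'a \<Rightarrow> 'b::{banach, second_countable_topology}"
  assumes "integrable M g" "\<And>x. norm (f x) \<le> g x"
  shows "norm (\<integral>x. f x \<partial>M) \<le> (\<integral>x. g x \<partial>M)"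
proof -
  have "norm (\<integral>x. f x \<partial>M) \<le> (\<integral>x. norm (f x) \<partial>M)" by (rule integral_norm_bound)
  also have "\<dots> \<le> (\<integral>x. g x \<partial>M)"
    using assms order_trans[OF norm_ge_zero assms(2)] by (intro integral_mono') auto
  finally show ?thesis .
qed

text \<open>The condition that convolution with a compactly supported kernel requires on the whole
  space. \<open>locally_integrable\<close> is the corresponding notion on a domain.\<close>

definition loc_int :: "(real^'n \<Rightarrow> complex) \<Rightarrow> bool" where
  "loc_int f \<longleftrightarrow> (\<forall>r. integrable lebesgue (\<lambda>y. indicator (cball 0 r) y *\<^sub>R f y))"

text \<open>The kernel is taken at y - x, not x - y, so that the function paired with
  \<open>f\<close> is itself a translated test function. The price is a sign in each
  derivative.\<close>

definition conv :: "(real^'n \<Rightarrow> complex) \<Rightarrow> (real^'n \<Rightarrow> complex) \<Rightarrow> real^'n \<Rightarrow> complex" where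
  "conv \<kappa> f x = (\<integral>y. \<kappa> (y - x) * f y \<partial>lebesgue)"

lemma lebesgue_measurable_continuous: "continuous_on UNIV f \<Longrightarrow> f \<in> borel_measurable lebesgue"
  for f :: "'a::euclidean_space \<Rightarrow> 'b::topological_space"
  by (intro measurable_completion) (simp add: borel_measurable_continuous_onI)

lemma integrable_bounded_mult_loc_int:
  assumes f: "loc_int f" and k: "continuous_on UNIV k" "\<And>y. y \<notin> cball 0 r \<Longrightarrow> k y = 0"
  shows "integrable lebesgue (\<lambda>y. k y * f y)"
proof -
  have "bounded (k ` cball 0 r)"
    by (intro compact_imp_bounded compact_continuous_image continuous_on_subset[OF k(1)]) auto
  then obtain C where C: "\<And>y. y \<in> cball 0 r \<Longrightarrow> norm (k y) \<le> C" unfolding bounded_iff by blast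
  have i: "integrable lebesgue (\<lambda>y. indicator (cball 0 r) y *\<^sub>R f y)" using f by (simp add: loc_int_def)
  have eq: "k y * f y = k y * (indicator (cball 0 r) y *\<^sub>R f y)" for y
    using k(2)[of y] by (auto simp: indicator_def)
  have "integrable lebesgue (\<lambda>y. k y * (indicator (cball 0 r) y *\<^sub>R f y))"
  proof (rule Bochner_Integration.integrable_bound)
    show "integrable lebesgue (\<lambda>y. C *\<^sub>R (indicator (cball 0 r) y *\<^sub>R f y))"
      by (rule integrable_scaleR_right) (rule i)
    show "(\<lambda>y. k y * (indicator (cball 0 r) y *\<^sub>R f y)) \<in> borel_measurable lebesgue"
      using i lebesgue_measurable_continuous[OF k(1)] by (intro borel_measurable_times) auto
    show "AE y in lebesgue. norm (k y * (indicator (cball 0 r) y *\<^sub>R f y)) \<le> norm (C *\<^sub>R (indicator (cball 0 r) y *\<^sub>R f y))"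
    proof (rule AE_I2)
      fix y
      show "norm (k y * (indicator (cball 0 r) y *\<^sub>R f y)) \<le> norm (C *\<^sub>R (indicator (cball 0 r) y *\<^sub>R f y))"
        using C[of y] by (cases "y \<in> cball 0 r") (auto simp: norm_mult intro!: mult_right_mono)
    qed
  qed
  then show ?thesis unfolding eq[symmetric] .
qed

lemma test_functions_bounded_support:
  assumes "\<kappa> \<in> test_functions UNIV"
  obtains r where "r > 0" "\<And>z. z \<notin> cball 0 r \<Longrightarrow> \<kappa> z = 0"
proof -
  obtain K where K: "compact K" "\<And>x. x \<notin> K \<Longrightarrow> \<kappa> x = 0"
    by (rule test_functions_support[OF assms]) blast
  obtain r where "r > 0" "K \<subseteq> ball 0 r"
    using bounded_subset_ballD[OF compact_imp_bounded[OF K(1)], of 0] by blast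
  then show ?thesis
    using ball_subset_cball[of 0 r] by (intro that[of r] K(2)) auto
qed

lemma integrable_conv:
  assumes "loc_int f" "\<kappa> \<in> test_functions UNIV"
  shows "integrable lebesgue (\<lambda>y. \<kappa> (y - x) * f y)"
proof -
  obtain r where r: "\<And>z. z \<notin> cball 0 r \<Longrightarrow> \<kappa> z = 0"
    by (rule test_functions_bounded_support[OF assms(2)]) blast
  show ?thesis
  proof (rule integrable_bounded_mult_loc_int[OF assms(1)])
    show "continuous_on UNIV (\<lambda>y. \<kappa> (y - x))"
      by (rule continuous_on_compose2[OF test_functions_continuous[OF assms(2), of UNIV]]) (auto intro!: continuous_intros)
    show "\<kappa> (y - x) = 0" if "y \<notin> cball 0 (r + norm x)" for y
      using that norm_triangle_ineq2[of y x] by (intro r) auto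
  qed
qed

text \<open>Points at distance less than 1 lie together in the ball of radius r + 1 or both outside
  the support, so uniform continuity on one compact ball suffices.\<close>

lemma compact_support_uniformly_continuous:
  fixes k :: "real^'n \<Rightarrow> complex"
  assumes k: "continuous_on UNIV k" "\<And>z. z \<notin> cball 0 r \<Longrightarrow> k z = 0" and e: "e > 0"
  obtains d where "d > 0" "\<And>z z'. dist z z' < d \<Longrightarrow> norm (k z - k z') \<le> e"
proof -
  have "uniformly_continuous_on (cball 0 (r + 1)) k"
    by (intro compact_uniformly_continuous continuous_on_subset[OF k(1)]) auto
  then obtain d where d: "d > 0" "\<And>z z'. z \<in> cball 0 (r + 1) \<Longrightarrow> z' \<in> cball 0 (r + 1) \<Longrightarrow> dist z' z < d \<Longrightarrow> dist (k z') (k z) < e"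
    using e unfolding uniformly_continuous_on_def by blast
  show ?thesis
  proof (rule that[of "min d 1"])
    fix z z' :: "real^'n" assume zz: "dist z z' < min d 1"
    show "norm (k z - k z') \<le> e"
    proof (cases "z \<in> cball 0 (r + 1) \<and> z' \<in> cball 0 (r + 1)")
      case True
      then show ?thesis using d(2)[of z' z] zz by (simp add: dist_norm)
    next
      case False
      have "\<bar>norm z - norm z'\<bar> \<le> dist z z'" by (simp add: dist_norm norm_triangle_ineq3)
      then have "z \<notin> cball 0 r" "z' \<notin> cball 0 r" using False zz by auto
      then show ?thesis using k(2) e by simp
    qed
  qed (use d in simp)
qed

lemma test_functions_uniformly_continuous:
  assumes "\<kappa> \<in> test_functions UNIV" "e > 0"
  obtains d where "d > 0" "\<And>z z'. dist z z' < d \<Longrightarrow> norm (\<kappa> z - \<kappa> z') \<le> e"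
proof -
  obtain r where "\<And>z. z \<notin> cball 0 r \<Longrightarrow> \<kappa> z = 0"
    by (rule test_functions_bounded_support[OF assms(1)]) blast
  from compact_support_uniformly_continuous[OF test_functions_continuous[OF assms(1)] this assms(2)] that
  show ?thesis by blast
qed

text \<open>Uniform continuity of the partial derivatives makes the first-order remainder of the
  kernel small uniformly in y; integrating it against |f| over one ball gives the
  derivative.\<close>

lemma has_derivative_conv:
  fixes f :: "real^'n \<Rightarrow> complex"
  assumes f: "loc_int f" and \<kappa>: "\<kappa> \<in> test_functions UNIV"
  shows "(conv \<kappa> f has_derivative (\<lambda>h. \<Sum>i\<in>UNIV. h $ i *\<^sub>R (- conv (partial i \<kappa>) f x))) (at x)"
  unfolding has_derivative_at_alt
proof (intro conjI allI impI)
  show "bounded_linear (\<lambda>h. \<Sum>i\<in>UNIV. h $ i *\<^sub>R (- conv (partial i \<kappa>) f x))"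
    by (intro bounded_linear_sum bounded_linear_scaleR_const bounded_linear_vec_nth)
  fix e :: real assume e: "e > 0"
  obtain r where r: "r > 0" "\<And>z. z \<notin> cball 0 r \<Longrightarrow> \<kappa> z = 0"
    by (rule test_functions_bounded_support[OF \<kappa>]) blast
  \<comment> \<open>This ball contains the supports of all kernels centred within distance 1 of
    x.\<close>
  define R where "R = norm x + r + 1"
  have iR: "integrable lebesgue (\<lambda>y. indicator (cball 0 R) y *\<^sub>R f y)" using f by (simp add: loc_int_def)
  define I where "I = (\<integral>y. norm (indicator (cball 0 R) y *\<^sub>R f y) \<partial>lebesgue)"
  have I0: "I \<ge> 0" unfolding I_def by (rule integral_nonneg_AE) auto
  \<comment> \<open>The remainder is summed over the coordinates and multiplied by \<open>I\<close>;
    the added 1 covers \<open>I\<close> = 0.\<close>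
  define e' where "e' = e / (I + 1) / real CARD('n)"
  have e': "e' > 0" using e I0 by (simp add: e'_def)
  have "\<forall>i. \<exists>d. d > 0 \<and> (\<forall>z z'. dist z z' < d \<longrightarrow> norm (partial i \<kappa> z - partial i \<kappa> z') \<le> e')"
  proof
    fix i
    show "\<exists>d. d > 0 \<and> (\<forall>z z'. dist z z' < d \<longrightarrow> norm (partial i \<kappa> z - partial i \<kappa> z') \<le> e')"
      by (rule test_functions_uniformly_continuous[OF test_functions_partial[OF \<kappa>] e', of i]) blast
  qed
  from choice[OF this] obtain dd where
    dd: "\<And>i. dd i > 0" "\<And>i z z'. dist z z' < dd i \<Longrightarrow> norm (partial i \<kappa> z - partial i \<kappa> z') \<le> e'"
    by blast
  define d where "d = min 1 (Min (range dd))"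
  have d: "d > 0" "d \<le> 1" "\<And>i. d \<le> dd i" using dd(1) by (auto simp: d_def min_le_iff_disj Min_gr_iff)
  have der: "(\<kappa> has_derivative (\<lambda>h. \<Sum>i\<in>UNIV. h $ i *\<^sub>R partial i \<kappa> z)) (at z within S)" for z S
    by (rule has_derivative_at_withinI[OF has_derivative_partial[OF test_functions_differentiable[OF \<kappa>]]])
  have lin: "norm (\<kappa> (z - h) - \<kappa> z + (\<Sum>i\<in>UNIV. h $ i *\<^sub>R partial i \<kappa> z)) \<le> norm h * (e / (I + 1))"
    if h: "norm h < d" for z h
  proof -
    have "norm (\<kappa> (z - h) - \<kappa> z - (\<Sum>i\<in>UNIV. (z - h - z) $ i *\<^sub>R partial i \<kappa> z)) \<le> norm (z - h - z) * (e / (I + 1))"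
    proof (rule differentiable_bound_linearization[where S="ball z d" and f'="\<lambda>z h. \<Sum>i\<in>UNIV. h $ i *\<^sub>R partial i \<kappa> z", OF _ der])
      show "z + t *\<^sub>R (z - h - z) \<in> ball z d" if "t \<in> {0..1}" for t
      proof -
        have "norm (t *\<^sub>R h) \<le> norm h" using that by (simp add: mult_left_le_one_le)
        then show ?thesis using h by (simp add: dist_norm)
      qed
      show "z \<in> ball z d" using d by simp
      fix w assume w: "w \<in> ball z d"
      show "onorm ((\<lambda>h. \<Sum>i\<in>UNIV. h $ i *\<^sub>R partial i \<kappa> w) - (\<lambda>h. \<Sum>i\<in>UNIV. h $ i *\<^sub>R partial i \<kappa> z)) \<le> e / (I + 1)"
        unfolding fun_diff_def
      proof (rule onorm_le)
        fix u :: "real^'n"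
        have "norm ((\<Sum>i\<in>UNIV. u $ i *\<^sub>R partial i \<kappa> w) - (\<Sum>i\<in>UNIV. u $ i *\<^sub>R partial i \<kappa> z))
            = norm (\<Sum>i\<in>UNIV. u $ i *\<^sub>R (partial i \<kappa> w - partial i \<kappa> z))"
          by (simp add: sum_subtractf scaleR_diff_right)
        also have "\<dots> \<le> (\<Sum>i\<in>(UNIV::'n set). norm u * e')"
        proof (rule sum_norm_le)
          fix i
          have "dist w z < dd i" using w d(3)[of i] by (simp add: dist_commute)
          then show "norm (u $ i *\<^sub>R (partial i \<kappa> w - partial i \<kappa> z)) \<le> norm u * e'"
            using dd(2)[of w z i] component_le_norm_cart[of u i] by (auto intro: mult_mono)
        qed
        also have "\<dots> = e / (I + 1) * norm u" by (simp add: e'_def)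
        finally show "norm ((\<Sum>i\<in>UNIV. u $ i *\<^sub>R partial i \<kappa> w) - (\<Sum>i\<in>UNIV. u $ i *\<^sub>R partial i \<kappa> z)) \<le> e / (I + 1) * norm u" .
      qed
    qed
    then show ?thesis by (simp add: sum_negf)
  qed
  show "\<exists>d>0. \<forall>x'. norm (x' - x) < d \<longrightarrow> norm (conv \<kappa> f x' - conv \<kappa> f x -
      (\<Sum>i\<in>UNIV. (x' - x) $ i *\<^sub>R (- conv (partial i \<kappa>) f x))) \<le> e * norm (x' - x)"
  proof (intro exI[of _ d] conjI allI impI d)
    fix x' assume x': "norm (x' - x) < d"
    define h where "h = x' - x"
    let ?r = "\<lambda>y. \<kappa> (y - x') - \<kappa> (y - x) + (\<Sum>i\<in>UNIV. h $ i *\<^sub>R partial i \<kappa> (y - x))"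
    note int = integrable_conv[OF f \<kappa>] integrable_conv[OF f test_functions_partial[OF \<kappa>]]
    have "conv \<kappa> f x' - conv \<kappa> f x - (\<Sum>i\<in>UNIV. h $ i *\<^sub>R (- conv (partial i \<kappa>) f x)) =
       conv \<kappa> f x' - conv \<kappa> f x + (\<Sum>i\<in>UNIV. h $ i *\<^sub>R conv (partial i \<kappa>) f x)"
      by (simp add: sum_negf)
    also have "\<dots> = (\<integral>y. \<kappa> (y - x') * f y - \<kappa> (y - x) * f y + (\<Sum>i\<in>UNIV. h $ i *\<^sub>R (partial i \<kappa> (y - x) * f y)) \<partial>lebesgue)"
      unfolding conv_def using int by simp
    also have "\<dots> = (\<integral>y. ?r y * f y \<partial>lebesgue)"
      by (intro Bochner_Integration.integral_cong refl) (simp add: algebra_simps sum_distrib_left)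
    also have "norm \<dots> \<le> (\<integral>y. (norm h * (e / (I + 1))) * norm (indicator (cball 0 R) y *\<^sub>R f y) \<partial>lebesgue)"
    proof (rule norm_integral_le)
      show "integrable lebesgue (\<lambda>y. (norm h * (e / (I + 1))) * norm (indicator (cball 0 R) y *\<^sub>R f y))"
        using iR by (intro integrable_mult_right integrable_norm)
      fix y
      show "norm (?r y * f y) \<le> (norm h * (e / (I + 1))) * norm (indicator (cball 0 R) y *\<^sub>R f y)"
      proof (cases "y \<in> cball 0 R")
        case True
        have le: "norm (?r y) \<le> norm h * (e / (I + 1))"
          using lin[of h "y - x"] x' by (simp add: h_def)
        show ?thesis using mult_right_mono[OF le, of "norm (f y)"] True by (simp add: norm_mult)
      next
        case False
        have "norm y - norm x' \<le> norm (y - x')" "norm y - norm x \<le> norm (y - x)" by (rule norm_triangle_ineq2)+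
        moreover have "norm x' \<le> norm x + 1" using x' d(2) norm_triangle_ineq2[of x' x] by linarith
        ultimately have "y - x' \<notin> cball 0 r" "y - x \<notin> cball 0 r" using False r(1) by (auto simp: R_def)
        then have "?r y = 0"
          using r(2) partial_eq_0_outside[of "cball 0 r" \<kappa>] by simp
        then show ?thesis using False by simp
      qed
    qed
    also have "\<dots> = norm h * (e / (I + 1)) * I" unfolding I_def by (rule integral_mult_right_zero)
    also have "\<dots> \<le> e * norm h"
    proof -
      have "e / (I + 1) * I \<le> e" using I0 e by (simp add: field_simps)
      then show ?thesis using mult_left_mono[of "e / (I + 1) * I" e "norm h"] by (simp add: mult_ac)
    qed
    finally show "norm (conv \<kappa> f x' - conv \<kappa> f x -
      (\<Sum>i\<in>UNIV. (x' - x) $ i *\<^sub>R (- conv (partial i \<kappa>) f x))) \<le> e * norm (x' - x)" unfolding h_def .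
  qed
qed

lemma sum_axis_scaleR: "(\<Sum>j\<in>UNIV. axis i 1 $ j *\<^sub>R c j) = (c i :: complex)"
proof -
  have "(\<Sum>j\<in>UNIV. axis i 1 $ j *\<^sub>R c j) = (\<Sum>j\<in>UNIV. if j = i then c j else 0)"
    by (intro sum.cong) (auto simp: axis_def)
  then show ?thesis by simp
qed

lemma partial_conv:
  assumes "loc_int f" "\<kappa> \<in> test_functions UNIV"
  shows "partial i (conv \<kappa> f) = (\<lambda>x. - conv (partial i \<kappa>) f x)"
  by (rule ext, subst partial_eqI[OF has_derivative_conv[OF assms]]) (rule sum_axis_scaleR)

lemma Ck_conv:
  assumes "loc_int f" "\<kappa> \<in> test_functions UNIV"
  shows "Ck k (conv \<kappa> f)"
  using assms(2)
proof (induction k arbitrary: \<kappa>)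
  case 0
  then show ?case
    using has_derivative_continuous[OF has_derivative_conv[OF assms(1)]]
    by (auto intro!: continuous_at_imp_continuous_on)
next
  case (Suc k)
  have "Ck k (\<lambda>x. (-1) * conv (partial i \<kappa>) f x)" for i
    by (intro Ck_mult Ck_const Suc.IH test_functions_partial Suc.prems)
  then show ?case
    using has_derivative_conv[OF assms(1) Suc.prems] by (auto simp: partial_conv[OF assms(1) Suc.prems] intro: differentiableI)
qed

section \<open>The space \<open>L\<^sup>2\<close>\<close>

lemma integrable_mult_square:
  fixes f g :: "'a \<Rightarrow> real"
  assumes "f \<in> borel_measurable M" "g \<in> borel_measurable M"
    and "integrable M (\<lambda>x. (f x)\<^sup>2)" "integrable M (\<lambda>x. (g x)\<^sup>2)"
  shows "integrable M (\<lambda>x. f x * g x)"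
proof (rule Bochner_Integration.integrable_bound)
  show "integrable M (\<lambda>x. (f x)\<^sup>2 + (g x)\<^sup>2)" using assms by simp
  have "\<bar>f x * g x\<bar> \<le> (f x)\<^sup>2 + (g x)\<^sup>2" for x
  proof -
    have "0 \<le> \<bar>f x\<bar> * \<bar>g x\<bar>" by simp
    then show ?thesis using sum_squares_bound[of "\<bar>f x\<bar>" "\<bar>g x\<bar>"] unfolding abs_mult power2_abs by linarith
  qed
  then show "AE x in M. norm (f x * g x) \<le> norm ((f x)\<^sup>2 + (g x)\<^sup>2)" by simp
qed (use assms in measurable)

text \<open>The square of s f - t g has nonnegative integral; s = B and t = A give the claim after
  division by A B. The case of a zero norm is treated apart.\<close>

lemma integral_Cauchy_Schwarz:
  fixes f g :: "'a \<Rightarrow> real"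
  assumes m: "f \<in> borel_measurable M" "g \<in> borel_measurable M"
    and i: "integrable M (\<lambda>x. (f x)\<^sup>2)" "integrable M (\<lambda>x. (g x)\<^sup>2)"
  shows "(\<integral>x. f x * g x \<partial>M) \<le> sqrt (\<integral>x. (f x)\<^sup>2 \<partial>M) * sqrt (\<integral>x. (g x)\<^sup>2 \<partial>M)"
proof -
  define A B where "A = sqrt (\<integral>x. (f x)\<^sup>2 \<partial>M)" and "B = sqrt (\<integral>x. (g x)\<^sup>2 \<partial>M)"
  have A: "A \<ge> 0" "A\<^sup>2 = (\<integral>x. (f x)\<^sup>2 \<partial>M)" and B: "B \<ge> 0" "B\<^sup>2 = (\<integral>x. (g x)\<^sup>2 \<partial>M)"
    by (auto simp: A_def B_def)
  have key: "2 * (s * t) * (\<integral>x. f x * g x \<partial>M) \<le> s\<^sup>2 * A\<^sup>2 + t\<^sup>2 * B\<^sup>2" for s t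
  proof -
    have "0 \<le> (\<integral>x. (s * f x - t * g x)\<^sup>2 \<partial>M)" by (rule integral_nonneg_AE) simp
    also have "(\<lambda>x. (s * f x - t * g x)\<^sup>2) = (\<lambda>x. s\<^sup>2 * (f x)\<^sup>2 - 2 * (s * t) * (f x * g x) + t\<^sup>2 * (g x)\<^sup>2)"
      by (auto simp: power2_eq_square algebra_simps)
    finally show ?thesis
      using integrable_mult_square[OF m i] i A(2) B(2) by simp
  qed
  show ?thesis
  proof (cases "A = 0 \<or> B = 0")
    case True
    have "(\<integral>x. f x * g x \<partial>M) \<le> 0"
    proof (rule ccontr)
      assume n: "\<not> ?thesis"
      \<comment> \<open>For A = 0 the choice s = B^2 + 1, t = J would give 2 (B^2 + 1) J^2 \<le> B^2
        J^2, which is impossible for J > 0; B = 0 is symmetric.\<close>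
      define J where "J = (\<integral>x. f x * g x \<partial>M)"
      have J: "J > 0" using n by (simp add: J_def)
      show False
        using True
      proof
        assume "A = 0"
        then have "2 * ((B\<^sup>2 + 1) * J) * J \<le> J\<^sup>2 * B\<^sup>2" using key[of "B\<^sup>2 + 1" J] by (simp add: J_def)
        then have "J\<^sup>2 * (2 * (B\<^sup>2 + 1) - B\<^sup>2) \<le> 0" by (simp add: power2_eq_square algebra_simps)
        moreover have "J\<^sup>2 * (2 * (B\<^sup>2 + 1) - B\<^sup>2) > 0" using J by (intro mult_pos_pos) (auto simp: add_nonneg_pos)
        ultimately show False by simp
      next
        assume "B = 0"
        then have "2 * (J * (A\<^sup>2 + 1)) * J \<le> J\<^sup>2 * A\<^sup>2" using key[of J "A\<^sup>2 + 1"] by (simp add: J_def)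
        then have "J\<^sup>2 * (2 * (A\<^sup>2 + 1) - A\<^sup>2) \<le> 0" by (simp add: power2_eq_square algebra_simps)
        moreover have "J\<^sup>2 * (2 * (A\<^sup>2 + 1) - A\<^sup>2) > 0" using J by (intro mult_pos_pos) (auto simp: add_nonneg_pos)
        ultimately show False by simp
      qed
    qed
    then show ?thesis using A(1) B(1) unfolding A_def[symmetric] B_def[symmetric]
      by (meson mult_nonneg_nonneg order_trans)
  next
    case False
    then have pos: "A > 0" "B > 0" using A B by auto
    have "2 * (B * A) * (\<integral>x. f x * g x \<partial>M) \<le> 2 * (B * A) * (A * B)"
      using key[of B A] by (simp add: power2_eq_square algebra_simps)
    then show ?thesis using pos unfolding A_def[symmetric] B_def[symmetric] by simp
  qed
qed

lemma integrable_norm_add_square: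
  fixes f g :: "'a \<Rightarrow> complex"
  assumes "f \<in> borel_measurable M" "g \<in> borel_measurable M"
    and "integrable M (\<lambda>x. (norm (f x))\<^sup>2)" "integrable M (\<lambda>x. (norm (g x))\<^sup>2)"
  shows "integrable M (\<lambda>x. (norm (f x + g x))\<^sup>2)"
proof (rule Bochner_Integration.integrable_bound)
  show "integrable M (\<lambda>x. 2 * (norm (f x))\<^sup>2 + 2 * (norm (g x))\<^sup>2)" using assms by simp
  have "(norm (f x + g x))\<^sup>2 \<le> 2 * (norm (f x))\<^sup>2 + 2 * (norm (g x))\<^sup>2" for x
  proof -
    have "(norm (f x + g x))\<^sup>2 \<le> (norm (f x) + norm (g x))\<^sup>2" by (intro power_mono norm_triangle_ineq) auto
    then show ?thesis using sum_squares_bound[of "norm (f x)" "norm (g x)"] by (simp add: power2_sum)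
  qed
  then show "AE x in M. norm ((norm (f x + g x))\<^sup>2) \<le> norm (2 * (norm (f x))\<^sup>2 + 2 * (norm (g x))\<^sup>2)" by simp
qed (use assms in measurable)

lemma integral_Minkowski:
  fixes f g :: "'a \<Rightarrow> complex"
  assumes m: "f \<in> borel_measurable M" "g \<in> borel_measurable M"
    and i: "integrable M (\<lambda>x. (norm (f x))\<^sup>2)" "integrable M (\<lambda>x. (norm (g x))\<^sup>2)"
  shows "sqrt (\<integral>x. (norm (f x + g x))\<^sup>2 \<partial>M) \<le> sqrt (\<integral>x. (norm (f x))\<^sup>2 \<partial>M) + sqrt (\<integral>x. (norm (g x))\<^sup>2 \<partial>M)"
proof -
  define A B where "A = sqrt (\<integral>x. (norm (f x))\<^sup>2 \<partial>M)" and "B = sqrt (\<integral>x. (norm (g x))\<^sup>2 \<partial>M)"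
  have A: "A \<ge> 0" "A\<^sup>2 = (\<integral>x. (norm (f x))\<^sup>2 \<partial>M)" and B: "B \<ge> 0" "B\<^sup>2 = (\<integral>x. (norm (g x))\<^sup>2 \<partial>M)"
    by (auto simp: A_def B_def)
  have m': "(\<lambda>x. norm (f x)) \<in> borel_measurable M" "(\<lambda>x. norm (g x)) \<in> borel_measurable M"
    using m by auto
  have "(\<integral>x. (norm (f x + g x))\<^sup>2 \<partial>M) \<le> (\<integral>x. (norm (f x))\<^sup>2 + 2 * (norm (f x) * norm (g x)) + (norm (g x))\<^sup>2 \<partial>M)"
  proof (rule integral_mono)
    show "integrable M (\<lambda>x. (norm (f x))\<^sup>2 + 2 * (norm (f x) * norm (g x)) + (norm (g x))\<^sup>2)"
      using integrable_mult_square[OF m' i] i by simp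
    fix x
    have "(norm (f x + g x))\<^sup>2 \<le> (norm (f x) + norm (g x))\<^sup>2" by (intro power_mono norm_triangle_ineq) auto
    then show "(norm (f x + g x))\<^sup>2 \<le> (norm (f x))\<^sup>2 + 2 * (norm (f x) * norm (g x)) + (norm (g x))\<^sup>2"
      by (simp add: power2_sum algebra_simps)
  qed (rule integrable_norm_add_square[OF m i])
  also have "\<dots> = A\<^sup>2 + 2 * (\<integral>x. norm (f x) * norm (g x) \<partial>M) + B\<^sup>2"
    using integrable_mult_square[OF m' i] i A(2) B(2) by simp
  also have "\<dots> \<le> A\<^sup>2 + 2 * (A * B) + B\<^sup>2"
    using integral_Cauchy_Schwarz[OF m' i] unfolding A_def B_def by simp
  also have "\<dots> = (A + B)\<^sup>2" by (simp add: power2_sum algebra_simps)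
  finally show ?thesis
    using A B real_sqrt_le_mono[of _ "(A + B)\<^sup>2"] unfolding A_def[symmetric] B_def[symmetric] by fastforce
qed

section \<open>The norm on subsets and extension by zero\<close>

lemma L2_D:
  assumes "u \<in> L2 \<Omega>"
  shows "u \<in> borel_measurable (lebesgue_on \<Omega>)" "integrable (lebesgue_on \<Omega>) (\<lambda>x. (cmod (u x))\<^sup>2)"
  using assms by (auto simp: L2_def)

lemma L2_add: "u \<in> L2 \<Omega> \<Longrightarrow> v \<in> L2 \<Omega> \<Longrightarrow> (\<lambda>x. u x + v x) \<in> L2 \<Omega>"
  using integrable_norm_add_square unfolding L2_def by auto

lemma L2_norm_triangle: "u \<in> L2 \<Omega> \<Longrightarrow> v \<in> L2 \<Omega> \<Longrightarrow> L2_norm \<Omega> (\<lambda>x. u x + v x) \<le> L2_norm \<Omega> u + L2_norm \<Omega> v"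
  using integral_Minkowski unfolding L2_def L2_norm_def by auto

lemma L2_cmult: "u \<in> L2 \<Omega> \<Longrightarrow> (\<lambda>x. c * u x) \<in> L2 \<Omega>"
  unfolding L2_def by (auto simp: norm_mult power_mult_distrib)

lemma L2_norm_cmult: "L2_norm \<Omega> (\<lambda>x. c * u x) = cmod c * L2_norm \<Omega> u"
  unfolding L2_norm_def by (simp add: norm_mult power_mult_distrib real_sqrt_mult)

lemma L2_norm_nonneg: "0 \<le> L2_norm \<Omega> u"
  unfolding L2_norm_def by (simp add: integral_nonneg_AE)

lemma L2_norm_square: "(L2_norm \<Omega> u)\<^sup>2 = (\<integral>x. (cmod (u x))\<^sup>2 \<partial>lebesgue_on \<Omega>)"
  unfolding L2_norm_def by (simp add: integral_nonneg_AE)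

lemma L2_diff: "u \<in> L2 \<Omega> \<Longrightarrow> v \<in> L2 \<Omega> \<Longrightarrow> (\<lambda>x. u x - v x) \<in> L2 \<Omega>"
  using L2_add[of u \<Omega> "\<lambda>x. (-1) * v x"] L2_cmult[of v \<Omega> "-1"] by simp

lemma L2_norm_diff: "L2_norm \<Omega> (\<lambda>x. u x - v x) \<le> L2_norm \<Omega> u + L2_norm \<Omega> v" if "u \<in> L2 \<Omega>" "v \<in> L2 \<Omega>"
  using L2_norm_triangle[OF that(1) L2_cmult[OF that(2), of "-1"]] L2_norm_cmult[of \<Omega> "-1" v] by simp

lemma L2_norm_mono:
  assumes "v \<in> L2 \<Omega>" "\<And>x. cmod (u x) \<le> cmod (v x)"
  shows "L2_norm \<Omega> u \<le> L2_norm \<Omega> v"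
  unfolding L2_norm_def using L2_D(2)[OF assms(1)]
  by (intro real_sqrt_le_mono integral_mono') (auto intro: power_mono assms)

lemma L2_UNIV_iff: "f \<in> L2 UNIV \<longleftrightarrow> f \<in> borel_measurable lebesgue \<and> integrable lebesgue (\<lambda>x. (cmod (f x))\<^sup>2)"
  by (simp add: L2_def lebesgue_on_UNIV_eq)

lemma L2_norm_UNIV: "L2_norm UNIV f = sqrt (\<integral>x. (cmod (f x))\<^sup>2 \<partial>lebesgue)"
  by (simp add: L2_norm_def lebesgue_on_UNIV_eq)

text \<open>Extension by zero lets mollification act on functions given on a domain, and reduces
  every norm over a set to one over the whole space.\<close>

definition zext :: "(real^'n) set \<Rightarrow> (real^'n \<Rightarrow> complex) \<Rightarrow> real^'n \<Rightarrow> complex" where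
  "zext S u x = indicator S x *\<^sub>R u x"

lemma norm_zext_square: "(cmod (zext S u x))\<^sup>2 = indicator S x *\<^sub>R (cmod (u x))\<^sup>2"
  by (simp add: zext_def indicator_def)

lemma zext_L2_UNIV_iff: "S \<in> sets lebesgue \<Longrightarrow> zext S u \<in> L2 UNIV \<longleftrightarrow> u \<in> L2 S"
  unfolding L2_UNIV_iff norm_zext_square unfolding L2_def
  using integrable_restrict_space[of S lebesgue "\<lambda>x. (cmod (u x))\<^sup>2"]
    borel_measurable_restrict_space_iff[of S lebesgue u]
  by (simp add: zext_def [abs_def])

lemma L2_norm_zext: "S \<in> sets lebesgue \<Longrightarrow> L2_norm UNIV (zext S u) = L2_norm S u"
  unfolding L2_norm_UNIV norm_zext_square unfolding L2_norm_def
  using integral_restrict_space[of S lebesgue "\<lambda>x. (cmod (u x))\<^sup>2"] by simp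

lemma L2_subset:
  assumes "u \<in> L2 T" "S \<subseteq> T" "S \<in> sets lebesgue" "T \<in> sets lebesgue"
  shows "u \<in> L2 S" "L2_norm S u \<le> L2_norm T u"
proof -
  have T: "zext T u \<in> L2 UNIV" using assms by (simp add: zext_L2_UNIV_iff)
  have eq: "zext S u = (\<lambda>x. indicator S x *\<^sub>R zext T u x)"
    using assms(2) by (intro ext) (auto simp: zext_def split: split_indicator)
  have le: "cmod (zext S u x) \<le> cmod (zext T u x)" for x
    using assms(2) by (auto simp: zext_def indicator_def)
  have "zext S u \<in> L2 UNIV"
    unfolding L2_UNIV_iff
  proof (intro conjI)
    show m: "zext S u \<in> borel_measurable lebesgue"
      unfolding eq using T assms(3) by (auto simp: L2_UNIV_iff)
    show "integrable lebesgue (\<lambda>x. (cmod (zext S u x))\<^sup>2)"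
      by (rule Bochner_Integration.integrable_bound[of _ "\<lambda>x. (cmod (zext T u x))\<^sup>2"])
        (use T m le in \<open>auto simp: L2_UNIV_iff power_mono\<close>)
  qed
  then show "u \<in> L2 S" using assms by (simp add: zext_L2_UNIV_iff)
  show "L2_norm S u \<le> L2_norm T u"
    using L2_norm_mono[OF T le] assms by (simp add: L2_norm_zext)
qed

lemma continuous_L2:
  assumes "continuous_on UNIV f" "bounded S" "S \<in> sets lebesgue"
  shows "f \<in> L2 S"
proof -
  obtain r where r: "S \<subseteq> cball 0 r"
    using bounded_subset_ballD[OF assms(2), of 0] ball_subset_cball by blast
  have "zext (cball 0 r) f \<in> L2 UNIV"
    unfolding L2_UNIV_iff norm_zext_square
  proof (intro conjI)
    show "zext (cball 0 r) f \<in> borel_measurable lebesgue"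
      unfolding zext_def [abs_def]
      by (intro borel_measurable_scaleR borel_measurable_indicator lebesgue_measurable_continuous[OF assms(1)]) auto
    have "integrable lborel (\<lambda>x. indicator (cball 0 r) x *\<^sub>R (cmod (f x))\<^sup>2)"
      by (intro borel_integrable_compact continuous_intros continuous_on_subset[OF assms(1)]) auto
    then show "integrable lebesgue (\<lambda>x. indicator (cball 0 r) x *\<^sub>R (cmod (f x))\<^sup>2)"
      by (subst integrable_completion) auto
  qed
  then show ?thesis using L2_subset(1)[OF _ r assms(3)] by (simp add: zext_L2_UNIV_iff)
qed

text \<open>On a set of finite measure |f| \<le> 1 + |f|^2 is integrable.\<close>

lemma integrable_indicator_L2:
  assumes f: "f \<in> L2 UNIV" and S: "bounded S" "S \<in> sets lebesgue"
  shows "integrable lebesgue (\<lambda>y. indicator S y *\<^sub>R f y)"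
proof (rule Bochner_Integration.integrable_bound)
  have "S \<in> lmeasurable" using S bounded_set_imp_lmeasurable by blast
  then show "integrable lebesgue (\<lambda>y. indicator S y + (cmod (f y))\<^sup>2)"
    using f lmeasurable_iff_integrable[of S] by (intro Bochner_Integration.integrable_add) (auto simp: L2_UNIV_iff)
  show "(\<lambda>y. indicator S y *\<^sub>R f y) \<in> borel_measurable lebesgue"
    using f S(2) by (auto simp: L2_UNIV_iff)
  have "cmod (f y) \<le> 1 + (cmod (f y))\<^sup>2" for y
    using sum_squares_bound[of "cmod (f y)" 1] by (simp; smt (verit) norm_ge_zero)
  then show "AE y in lebesgue. norm (indicator S y *\<^sub>R f y) \<le> norm (indicator S y + (cmod (f y))\<^sup>2)"
    by (intro AE_I2) (auto simp: indicator_def)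
qed

lemma loc_int_L2: "f \<in> L2 UNIV \<Longrightarrow> loc_int f"
  unfolding loc_int_def by (intro allI integrable_indicator_L2) auto

section \<open>Mollification\<close>

text \<open>The \<open>itself\<close> argument records the dimension, which the radius does not
  determine.\<close>

definition bump_mass :: "'n::finite itself \<Rightarrow> real \<Rightarrow> real" where
  "bump_mass T \<delta> = integral\<^sup>L lborel (\<lambda>z::real^'n. flat_exp 0 (\<delta>\<^sup>2 - z \<bullet> z))"

definition eta :: "real \<Rightarrow> real^'n \<Rightarrow> real" where
  "eta \<delta> z = flat_exp 0 (\<delta>\<^sup>2 - z \<bullet> z) / bump_mass TYPE('n) \<delta>"

definition mollifier :: "real \<Rightarrow> real^'n \<Rightarrow> complex" where
  "mollifier \<delta> z = of_real (eta \<delta> z)"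

lemma mollifier_eq: "mollifier \<delta> = (\<lambda>z::real^'n. of_real (inverse (bump_mass TYPE('n) \<delta>)) * bump 0 \<delta> 0 z)"
  by (rule ext) (simp add: mollifier_def eta_def bump_def divide_inverse)

lemma continuous_flat_exp: "continuous_on UNIV (\<lambda>z::real^'n. flat_exp 0 (\<delta>\<^sup>2 - z \<bullet> z))"
proof -
  have "continuous_on UNIV (flat_exp 0)"
    by (intro continuous_at_imp_continuous_on ballI DERIV_isCont[OF DERIV_flat_exp])
  then show ?thesis by (rule continuous_on_compose2) (auto intro!: continuous_intros)
qed

lemma flat_exp_outside: "flat_exp m (\<delta>\<^sup>2 - z \<bullet> z) = 0" if "0 < \<delta>" "\<delta> \<le> norm z" for z :: "real^'n"
proof -
  have "\<delta>\<^sup>2 \<le> (norm z)\<^sup>2" using that by (intro power_mono) auto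
  then show ?thesis by (simp add: flat_exp_def power2_norm_eq_inner)
qed

lemma integrable_flat_exp: "0 < \<delta> \<Longrightarrow> integrable lborel (\<lambda>z::real^'n. flat_exp 0 (\<delta>\<^sup>2 - z \<bullet> z))"
proof -
  assume d: "0 < \<delta>"
  have eq: "indicator (cball 0 \<delta>) z *\<^sub>R flat_exp 0 (\<delta>\<^sup>2 - z \<bullet> z) = flat_exp 0 (\<delta>\<^sup>2 - z \<bullet> z)" for z :: "real^'n"
    using flat_exp_outside[OF d, of z 0] by (auto simp: indicator_def)
  show "integrable lborel (\<lambda>z::real^'n. flat_exp 0 (\<delta>\<^sup>2 - z \<bullet> z))"
  proof -
    have "integrable lborel (\<lambda>z::real^'n. indicator (cball 0 \<delta>) z *\<^sub>R flat_exp 0 (\<delta>\<^sup>2 - z \<bullet> z))"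
      by (intro borel_integrable_compact continuous_on_subset[OF continuous_flat_exp]) auto
    then show ?thesis unfolding eq .
  qed
qed

lemma bump_mass_pos: "0 < \<delta> \<Longrightarrow> 0 < bump_mass TYPE('n::finite) \<delta>"
proof -
  assume d: "0 < \<delta>"
  define c where "c = flat_exp 0 (\<delta>\<^sup>2 - (\<delta> / 2)\<^sup>2)"
  have c: "c > 0" using d by (simp add: c_def flat_exp_pos_iff power_divide field_simps)
  have ge: "c * indicator (ball 0 (\<delta> / 2)) z \<le> flat_exp 0 (\<delta>\<^sup>2 - z \<bullet> z)" for z :: "real^'n"
  proof (cases "norm z < \<delta> / 2")
    case True
    then have "(norm z)\<^sup>2 \<le> (\<delta> / 2)\<^sup>2" by (intro power_mono) auto
    moreover have "(\<delta> / 2)\<^sup>2 < \<delta>\<^sup>2" using d by (intro power_strict_mono) auto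
    ultimately have "0 < \<delta>\<^sup>2 - (\<delta> / 2)\<^sup>2" "\<delta>\<^sup>2 - (\<delta> / 2)\<^sup>2 \<le> \<delta>\<^sup>2 - z \<bullet> z"
      by (auto simp: power2_norm_eq_inner)
    then have "c \<le> flat_exp 0 (\<delta>\<^sup>2 - z \<bullet> z)"
      by (auto simp: c_def flat_exp_def le_imp_inverse_le)
    then show ?thesis using True by simp
  qed (simp add: flat_exp_nonneg)
  have "0 < c * measure lborel (ball (0::real^'n) (\<delta> / 2))"
    using c d content_ball_pos[of "\<delta> / 2" "0::real^'n"] by simp
  also have "\<dots> = integral\<^sup>L lborel (\<lambda>z::real^'n. c * indicator (ball 0 (\<delta> / 2)) z)" by simp
  also have "\<dots> \<le> bump_mass TYPE('n) \<delta>" unfolding bump_mass_def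
    using emeasure_bounded_finite[of "ball (0::real^'n) (\<delta> / 2)"]
    by (intro integral_mono integrable_flat_exp d ge integrable_mult_right integrable_real_indicator) auto
  finally show ?thesis .
qed

lemma eta_nonneg: "0 < \<delta> \<Longrightarrow> 0 \<le> eta \<delta> (z :: real^'n)"
  using bump_mass_pos[of \<delta>, where 'n='n] by (simp add: eta_def flat_exp_nonneg)

lemma eta_minus: "eta \<delta> (- z) = eta \<delta> z" by (simp add: eta_def)

lemma eta_outside: "0 < \<delta> \<Longrightarrow> \<delta> \<le> norm z \<Longrightarrow> eta \<delta> z = 0"
  by (simp add: eta_def flat_exp_outside)

lemma continuous_eta: "0 < \<delta> \<Longrightarrow> continuous_on UNIV (eta \<delta> :: real^'n \<Rightarrow> real)"
  unfolding eta_def [abs_def] using bump_mass_pos[of \<delta>, where 'n='n]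
  by (intro continuous_intros continuous_flat_exp) auto

lemma integrable_eta: "0 < \<delta> \<Longrightarrow> integrable lborel (eta \<delta> :: real^'n \<Rightarrow> real)"
  unfolding eta_def [abs_def] by (intro integrable_divide integrable_flat_exp)

lemma integral_eta: "0 < \<delta> \<Longrightarrow> (\<integral>z. eta \<delta> (z :: real^'n) \<partial>lborel) = 1"
  using bump_mass_pos[of \<delta>, where 'n='n] unfolding eta_def by (simp flip: bump_mass_def[of "TYPE('n)"])

lemma
  fixes x :: "real^'n"
  assumes "0 < \<delta>"
  shows integrable_eta_shift: "integrable lborel (\<lambda>y. eta \<delta> (y - x))"
    and integral_eta_shift: "(\<integral>y. eta \<delta> (y - x) \<partial>lborel) = 1"
proof -
  have m: "(eta \<delta> :: real^'n \<Rightarrow> real) \<in> borel_measurable borel" using continuous_eta[OF assms] by (rule borel_measurable_continuous_onI)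
  have i: "integrable lborel (eta \<delta> :: real^'n \<Rightarrow> real)" "integral\<^sup>L lborel (eta \<delta> :: real^'n \<Rightarrow> real) = 1"
    using integrable_eta[OF assms] integral_eta[OF assms] by auto
  have d: "distr lborel borel ((+) (- x)) = (lborel :: (real^'n) measure)" by (rule lborel_distr_plus)
  show "integrable lborel (\<lambda>y. eta \<delta> (y - x))"
    using integrable_distr_eq[of "(+) (- x)" lborel borel "eta \<delta>"] m i unfolding d by simp
  show "(\<integral>y. eta \<delta> (y - x) \<partial>lborel) = 1"
    using integral_distr[of "(+) (- x)" lborel borel "eta \<delta>"] m i unfolding d by simp
qed

lemma mollifier_test_function:
  assumes "0 < \<delta>" shows "(mollifier \<delta> :: real^'n \<Rightarrow> complex) \<in> test_functions UNIV"
proof (rule test_functionsI)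
  show "Ck k (mollifier \<delta> :: real^'n \<Rightarrow> complex)" for k
    unfolding mollifier_eq by (intro Ck_mult Ck_const Ck_bump)
  show "mollifier \<delta> z = 0" if "z \<notin> cball 0 \<delta>" for z :: "real^'n"
    using that eta_outside[OF assms, of z] by (simp add: mollifier_def)
qed auto

lemma symmetric_partial_mollifier:
  "partial i (partial j (mollifier \<delta>)) = partial j (partial i (mollifier \<delta> :: real^'n \<Rightarrow> complex))"
proof -
  have 1: "partial j (\<lambda>x. c * f x) = (\<lambda>x. c * partial j f x)" if "Ck (Suc 0) f" for c j and f :: "real^'n \<Rightarrow> complex"
    using that by (intro ext) (simp add: partial_mult)
  have "partial i (partial j (\<lambda>x. c * bump 0 \<delta> 0 x)) = (\<lambda>x::real^'n. c * partial i (partial j (bump 0 \<delta> 0)) x)" for c i j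
  proof -
    have "Ck (Suc 0) (partial j (bump 0 \<delta> (0::real^'n)))"
      using Ck_bump[of "Suc (Suc 0)" 0 \<delta> "0::real^'n"] by simp
    then show ?thesis unfolding 1[OF Ck_bump] by (rule 1)
  qed
  then show ?thesis unfolding mollifier_eq by (simp add: symmetric_partial_bump[of i j])
qed

abbreviation moll :: "real \<Rightarrow> (real^'n \<Rightarrow> complex) \<Rightarrow> real^'n \<Rightarrow> complex" where
  "moll \<delta> \<equiv> conv (mollifier \<delta>)"

lemma continuous_moll: "loc_int f \<Longrightarrow> 0 < \<delta> \<Longrightarrow> continuous_on UNIV (moll \<delta> f)"
  using Ck_conv[of f "mollifier \<delta>" 0] mollifier_test_function by auto

lemma continuous_shift: "continuous_on UNIV (\<kappa> :: real^'n \<Rightarrow> 'b::topological_space) \<Longrightarrow> continuous_on UNIV (\<lambda>y. \<kappa> (y - x))"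
  by (rule continuous_on_compose2[of UNIV \<kappa>]) (auto intro!: continuous_intros)

text \<open>Jensen's inequality for the probability density \<open>eta\<close>, obtained from the
  nonnegative variance of |f| about its weighted mean \<open>m\<close>.\<close>

lemma norm_moll_square_le:
  fixes f :: "real^'n \<Rightarrow> complex"
  assumes f: "f \<in> L2 UNIV" and d: "0 < \<delta>"
  shows "integrable lebesgue (\<lambda>y. eta \<delta> (y - x) * (cmod (f y))\<^sup>2)"
    and "(cmod (moll \<delta> f x))\<^sup>2 \<le> (\<integral>y. eta \<delta> (y - x) * (cmod (f y))\<^sup>2 \<partial>lebesgue)"
proof -
  have fm: "f \<in> borel_measurable lebesgue" and fi: "integrable lebesgue (\<lambda>x. (cmod (f x))\<^sup>2)"
    using f by (auto simp: L2_UNIV_iff)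
  let ?e = "\<lambda>y. eta \<delta> (y - x)"
  have ce: "continuous_on UNIV ?e" by (rule continuous_shift[OF continuous_eta[OF d]])
  have em: "?e \<in> borel_measurable lebesgue" by (rule lebesgue_measurable_continuous[OF ce])
  have emb: "?e \<in> borel_measurable lborel" using ce by (simp add: borel_measurable_continuous_onI)
  have e0: "0 \<le> ?e y" for y by (rule eta_nonneg[OF d])
  have ei: "integrable lebesgue ?e" "(\<integral>y. ?e y \<partial>lebesgue) = 1"
    using integrable_completion[OF emb] integral_completion[OF emb] integrable_eta_shift[OF d] integral_eta_shift[OF d] by auto
  obtain C where C: "\<And>z::real^'n. eta \<delta> z \<le> C"
  proof -
    have "bounded (eta \<delta> ` cball (0::real^'n) \<delta>)"
      by (intro compact_imp_bounded compact_continuous_image continuous_on_subset[OF continuous_eta[OF d]]) auto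
    then obtain C where C: "\<And>z. z \<in> cball (0::real^'n) \<delta> \<Longrightarrow> \<bar>eta \<delta> z\<bar> \<le> C" unfolding bounded_iff by (metis imageI real_norm_def)
    have "eta \<delta> z \<le> max C 0" for z :: "real^'n"
      using C[of z] eta_outside[OF d, of z] by (cases "norm z \<le> \<delta>") (auto simp: le_max_iff_disj)
    then show ?thesis by (rule that)
  qed
  show i2: "integrable lebesgue (\<lambda>y. ?e y * (cmod (f y))\<^sup>2)"
  proof (rule Bochner_Integration.integrable_bound)
    show "integrable lebesgue (\<lambda>y. C * (cmod (f y))\<^sup>2)" using fi by simp
    show "(\<lambda>y. ?e y * (cmod (f y))\<^sup>2) \<in> borel_measurable lebesgue" using em fm by simp
    show "AE y in lebesgue. norm (?e y * (cmod (f y))\<^sup>2) \<le> norm (C * (cmod (f y))\<^sup>2)"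
    proof (rule AE_I2)
      fix y
      have "?e y * (cmod (f y))\<^sup>2 \<le> C * (cmod (f y))\<^sup>2" using C by (intro mult_right_mono) auto
      then show "norm (?e y * (cmod (f y))\<^sup>2) \<le> norm (C * (cmod (f y))\<^sup>2)"
        using e0[of y] by (smt (verit) mult_nonneg_nonneg real_norm_def zero_le_power2)
    qed
  qed
  have i1: "integrable lebesgue (\<lambda>y. ?e y * cmod (f y))"
  proof (rule Bochner_Integration.integrable_bound)
    show "integrable lebesgue (\<lambda>y. ?e y + ?e y * (cmod (f y))\<^sup>2)" using ei i2 by simp
    show "(\<lambda>y. ?e y * cmod (f y)) \<in> borel_measurable lebesgue" using em fm by simp
    show "AE y in lebesgue. norm (?e y * cmod (f y)) \<le> norm (?e y + ?e y * (cmod (f y))\<^sup>2)"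
    proof (rule AE_I2)
      fix y
      have "cmod (f y) \<le> 1 + (cmod (f y))\<^sup>2"
        using sum_squares_bound[of "cmod (f y)" 1] by (simp; smt (verit) norm_ge_zero)
      then have "?e y * cmod (f y) \<le> ?e y * (1 + (cmod (f y))\<^sup>2)" using e0 by (intro mult_left_mono) auto
      then show "norm (?e y * cmod (f y)) \<le> norm (?e y + ?e y * (cmod (f y))\<^sup>2)"
        using e0[of y] by (simp add: distrib_left)
    qed
  qed
  define m where "m = (\<integral>y. ?e y * cmod (f y) \<partial>lebesgue)"
  define A where "A = (\<integral>y. ?e y * (cmod (f y))\<^sup>2 \<partial>lebesgue)"
  have "0 \<le> (\<integral>y. ?e y * (cmod (f y) - m)\<^sup>2 \<partial>lebesgue)"
    using e0 by (intro integral_nonneg_AE) auto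
  also have "(\<lambda>y. ?e y * (cmod (f y) - m)\<^sup>2) = (\<lambda>y. ?e y * (cmod (f y))\<^sup>2 - 2 * m * (?e y * cmod (f y)) + m\<^sup>2 * ?e y)"
    by (auto simp: power2_eq_square algebra_simps)
  also have "(\<integral>y. ?e y * (cmod (f y))\<^sup>2 - 2 * m * (?e y * cmod (f y)) + m\<^sup>2 * ?e y \<partial>lebesgue) = A - 2 * m * m + m\<^sup>2 * 1"
    using i1 i2 ei unfolding A_def m_def by simp
  finally have "m\<^sup>2 \<le> A" by (simp add: power2_eq_square)
  moreover have "cmod (moll \<delta> f x) \<le> m"
    unfolding conv_def m_def
    by (rule norm_integral_le[OF i1]) (use e0 in \<open>simp add: mollifier_def norm_mult\<close>)
  then have "(cmod (moll \<delta> f x))\<^sup>2 \<le> m\<^sup>2" by (intro power_mono) auto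
  ultimately show "(cmod (moll \<delta> f x))\<^sup>2 \<le> (\<integral>y. ?e y * (cmod (f y))\<^sup>2 \<partial>lebesgue)" unfolding A_def by linarith
qed

text \<open>Jensen's bound is integrated in x and the integrals are exchanged; since
  \<open>eta\<close> is even, it also has mass 1 as a function of x.\<close>

lemma moll_contraction:
  fixes f :: "real^'n \<Rightarrow> complex"
  assumes f: "f \<in> L2 UNIV" and d: "0 < \<delta>"
  shows "moll \<delta> f \<in> L2 UNIV" "L2_norm UNIV (moll \<delta> f) \<le> L2_norm UNIV f"
proof -
  have fm: "f \<in> borel_measurable lebesgue" and fi: "integrable lebesgue (\<lambda>x. (cmod (f x))\<^sup>2)"
    using f by (auto simp: L2_UNIV_iff)
  have "(\<lambda>x. ennreal ((cmod (f x))\<^sup>2)) \<in> borel_measurable lebesgue" using fm by simp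
  \<comment> \<open>Tonelli is used for the Borel product measure, but |f|^2 is only Lebesgue
    measurable; it is replaced by a Borel function that agrees with it almost everywhere.\<close>
  from completion_ex_borel_measurable[OF this] obtain g where
    g: "g \<in> borel_measurable lborel" "AE x in lborel. ennreal ((cmod (f x))\<^sup>2) = g x" by auto
  have g': "AE x in lebesgue. ennreal ((cmod (f x))\<^sup>2) = g x" using g(2) by (rule AE_completion)
  have eb: "(\<lambda>p. eta \<delta> (snd p - fst p)) \<in> borel_measurable (borel :: ((real^'n) \<times> (real^'n)) measure)"
    by (intro borel_measurable_continuous_onI continuous_on_compose2[OF continuous_eta[OF d]]) (auto intro!: continuous_intros)
  have pm: "(\<lambda>(x, y). ennreal (eta \<delta> (y - x)) * g y) \<in> borel_measurable (lborel \<Otimes>\<^sub>M (lborel :: (real^'n) measure))"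
  proof -
    have "(\<lambda>p. eta \<delta> (snd p - fst p)) \<in> borel_measurable (lborel \<Otimes>\<^sub>M (lborel :: (real^'n) measure))"
      unfolding lborel_prod using eb by simp
    moreover have "(\<lambda>p. g (snd p)) \<in> borel_measurable (lborel \<Otimes>\<^sub>M (lborel :: (real^'n) measure))"
      by (rule measurable_compose[OF measurable_snd g(1)])
    ultimately show ?thesis unfolding split_def
      by (intro borel_measurable_times_ennreal measurable_compose[OF _ measurable_ennreal])
  qed
  have sq: "ennreal ((cmod (moll \<delta> f x))\<^sup>2) \<le> (\<integral>\<^sup>+y. ennreal (eta \<delta> (y - x)) * g y \<partial>lborel)" for x
  proof -
    have "ennreal ((cmod (moll \<delta> f x))\<^sup>2) \<le> ennreal (\<integral>y. eta \<delta> (y - x) * (cmod (f y))\<^sup>2 \<partial>lebesgue)"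
      by (intro ennreal_leI norm_moll_square_le(2)[OF f d])
    also have "\<dots> = (\<integral>\<^sup>+y. ennreal (eta \<delta> (y - x) * (cmod (f y))\<^sup>2) \<partial>lebesgue)"
      by (intro nn_integral_eq_integral[symmetric] norm_moll_square_le(1)[OF f d]) (simp add: eta_nonneg[OF d])
    also have "\<dots> = (\<integral>\<^sup>+y. ennreal (eta \<delta> (y - x)) * g y \<partial>lebesgue)"
      using g' by (intro nn_integral_cong_AE) (auto simp: ennreal_mult eta_nonneg[OF d])
    finally show ?thesis by (simp add: nn_integral_completion)
  qed
  have cm: "continuous_on UNIV (moll \<delta> f)" by (rule continuous_moll[OF loc_int_L2[OF f] d])
  have "(\<integral>\<^sup>+x. ennreal ((cmod (moll \<delta> f x))\<^sup>2) \<partial>lebesgue) = (\<integral>\<^sup>+x. ennreal ((cmod (moll \<delta> f x))\<^sup>2) \<partial>lborel)"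
    by (rule nn_integral_completion)
  also have "\<dots> \<le> (\<integral>\<^sup>+x. (\<integral>\<^sup>+y. ennreal (eta \<delta> (y - x)) * g y \<partial>lborel) \<partial>lborel)"
    by (intro nn_integral_mono sq)
  also have "\<dots> = (\<integral>\<^sup>+y. (\<integral>\<^sup>+x. ennreal (eta \<delta> (y - x)) * g y \<partial>lborel) \<partial>lborel)"
    by (rule lborel_pair.Fubini'[OF pm, symmetric])
  also have "\<dots> = (\<integral>\<^sup>+y. g y \<partial>lborel)"
  proof (rule nn_integral_cong)
    fix y :: "real^'n"
    have sym: "eta \<delta> (y - x) = eta \<delta> (x - y)" for x using eta_minus[of \<delta> "y - x"] by simp
    have "(\<lambda>x. ennreal (eta \<delta> (x - y))) \<in> borel_measurable lborel"
      using integrable_eta_shift[OF d, of y] by (intro measurable_compose[OF _ measurable_ennreal]) auto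
    then have "(\<integral>\<^sup>+x. ennreal (eta \<delta> (y - x)) * g y \<partial>lborel) = (\<integral>\<^sup>+x. ennreal (eta \<delta> (x - y)) \<partial>lborel) * g y"
      unfolding sym by (rule nn_integral_multc)
    also have "(\<integral>\<^sup>+x. ennreal (eta \<delta> (x - y)) \<partial>lborel) = 1"
      using nn_integral_eq_integral[OF integrable_eta_shift[OF d, of y]] integral_eta_shift[OF d, of y]
      by (simp add: eta_nonneg[OF d])
    finally show "(\<integral>\<^sup>+x. ennreal (eta \<delta> (y - x)) * g y \<partial>lborel) = g y" by simp
  qed
  also have "\<dots> = (\<integral>\<^sup>+y. ennreal ((cmod (f y))\<^sup>2) \<partial>lebesgue)"
    using g' by (subst nn_integral_completion[symmetric]) (auto intro!: nn_integral_cong_AE)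
  also have "\<dots> = ennreal (\<integral>y. (cmod (f y))\<^sup>2 \<partial>lebesgue)"
    by (intro nn_integral_eq_integral fi) simp
  finally have le: "(\<integral>\<^sup>+x. ennreal ((cmod (moll \<delta> f x))\<^sup>2) \<partial>lebesgue) \<le> ennreal (\<integral>y. (cmod (f y))\<^sup>2 \<partial>lebesgue)" .
  have mm: "moll \<delta> f \<in> borel_measurable lebesgue" by (rule lebesgue_measurable_continuous[OF cm])
  have int: "integrable lebesgue (\<lambda>x. (cmod (moll \<delta> f x))\<^sup>2)"
    using le mm by (intro integrableI_bounded) (auto intro: le_less_trans)
  show "moll \<delta> f \<in> L2 UNIV" using int mm by (simp add: L2_UNIV_iff)
  have "ennreal (\<integral>x. (cmod (moll \<delta> f x))\<^sup>2 \<partial>lebesgue) \<le> ennreal (\<integral>y. (cmod (f y))\<^sup>2 \<partial>lebesgue)"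
    using le nn_integral_eq_integral[OF int] by simp
  then show "L2_norm UNIV (moll \<delta> f) \<le> L2_norm UNIV f"
    unfolding L2_norm_UNIV by (intro real_sqrt_le_mono) (simp add: ennreal_le_iff integral_nonneg_AE)
qed

section \<open>Density of continuous functions with compact support\<close>

lemma L2_norm_less_of_integral:
  assumes "(\<integral>x. (cmod (f x))\<^sup>2 \<partial>lebesgue) < e\<^sup>2" "0 < e"
  shows "L2_norm UNIV f < e"
  unfolding L2_norm_UNIV using assms real_sqrt_less_mono[OF assms(1)] by simp

text \<open>Restriction to the points where both |f| and |x| are at most k; the error tends to 0 by
  dominated convergence with |f|^2.\<close>

lemma L2_truncation:
  assumes f: "f \<in> L2 UNIV" and e: "0 < e"
  obtains m :: real and g where "0 < m" "g \<in> L2 UNIV" "\<And>x. cmod (g x) \<le> m" "\<And>x. x \<notin> cball 0 m \<Longrightarrow> g x = 0"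
    "L2_norm UNIV (\<lambda>x. f x - g x) < e"
proof -
  have fm: "f \<in> borel_measurable lebesgue" and fi: "integrable lebesgue (\<lambda>x. (cmod (f x))\<^sup>2)"
    using f by (auto simp: L2_UNIV_iff)
  define S where "S k = {x. cmod (f x) \<le> real k} \<inter> cball 0 (real k)" for k
  define g where "g k x = indicator (S k) x *\<^sub>R f x" for k x
  have Sm: "S k \<in> sets lebesgue" for k
  proof -
    have "{x \<in> space lebesgue. cmod (f x) \<le> real k} \<in> sets lebesgue" using fm by measurable
    then show ?thesis by (auto simp: S_def)
  qed
  have gm: "g k \<in> borel_measurable lebesgue" for k
    unfolding g_def [abs_def] using Sm fm by (intro borel_measurable_scaleR borel_measurable_indicator)
  have "(\<lambda>k. \<integral>x. (cmod (f x - g k x))\<^sup>2 \<partial>lebesgue) \<longlonglongrightarrow> (\<integral>x. 0 \<partial>(lebesgue :: (real^'a) measure))"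
  proof (rule integral_dominated_convergence[where w="\<lambda>x. (cmod (f x))\<^sup>2"])
    show "AE x in lebesgue. (\<lambda>k. (cmod (f x - g k x))\<^sup>2) \<longlonglongrightarrow> 0"
    proof (rule AE_I2)
      fix x
      obtain k0 :: nat where k0: "max (cmod (f x)) (norm x) \<le> real k0" using real_arch_simple by blast
      have "(cmod (f x - g k x))\<^sup>2 = 0" if "k0 \<le> k" for k
        using that k0 by (auto simp: g_def S_def)
      then show "(\<lambda>k. (cmod (f x - g k x))\<^sup>2) \<longlonglongrightarrow> 0"
        by (intro tendsto_eventually eventually_sequentiallyI[of k0])
    qed
    show "AE x in lebesgue. norm ((cmod (f x - g k x))\<^sup>2) \<le> (cmod (f x))\<^sup>2" for k
      by (intro AE_I2) (auto simp: g_def indicator_def)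
  qed (use fm gm fi in auto)
  then have "eventually (\<lambda>k. (\<integral>x. (cmod (f x - g k x))\<^sup>2 \<partial>lebesgue) < e\<^sup>2) sequentially"
    using e by (intro order_tendstoD(2)) auto
  then obtain k0 where "\<And>k. k \<ge> k0 \<Longrightarrow> (\<integral>x. (cmod (f x - g k x))\<^sup>2 \<partial>lebesgue) < e\<^sup>2"
    unfolding eventually_sequentially by blast
  then have k: "(\<integral>x. (cmod (f x - g (Suc k0) x))\<^sup>2 \<partial>lebesgue) < e\<^sup>2" by simp
  show ?thesis
  proof (rule that)
    show "0 < real (Suc k0)" by simp
    have "integrable lebesgue (\<lambda>x. (cmod (g (Suc k0) x))\<^sup>2)"
    proof (rule Bochner_Integration.integrable_bound[OF fi])
      show "(\<lambda>x. (cmod (g (Suc k0) x))\<^sup>2) \<in> borel_measurable lebesgue" using gm[of "Suc k0"] by simp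
    qed (auto simp: g_def indicator_def)
    then show "g (Suc k0) \<in> L2 UNIV" using gm by (simp add: L2_UNIV_iff)
    show "cmod (g (Suc k0) x) \<le> real (Suc k0)" for x by (auto simp: g_def S_def indicator_def)
    show "g (Suc k0) x = 0" if "x \<notin> cball 0 (real (Suc k0))" for x
      using that by (auto simp: g_def S_def indicator_def)
    show "L2_norm UNIV (\<lambda>x. f x - g (Suc k0) x) < e" by (rule L2_norm_less_of_integral[OF k e])
  qed
qed

text \<open>A measurable function is almost everywhere a limit of continuous ones. These are
  modified so as to be uniformly bounded with common support, and dominated convergence
  applies.\<close>

lemma L2_bounded_approx:
  fixes f :: "real^'n \<Rightarrow> complex"
  assumes f: "f \<in> borel_measurable lebesgue" and b: "\<And>x. cmod (f x) \<le> m" "\<And>x. x \<notin> cball 0 m \<Longrightarrow> f x = 0"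
    and m: "0 < m" and e: "0 < e"
  obtains k where "continuous_on UNIV k" "\<And>x. x \<notin> cball 0 (m + 1) \<Longrightarrow> k x = 0"
    "L2_norm UNIV (\<lambda>x. f x - k x) < e"
proof -
  have "f measurable_on UNIV" using f by (intro lebesgue_measurable_imp_measurable_on) auto
  then obtain N g where N: "negligible N" and gc: "\<And>n. continuous_on UNIV (g n)"
    and g: "\<And>x. x \<notin> N \<Longrightarrow> (\<lambda>n. g n x) \<longlonglongrightarrow> f x"
    unfolding measurable_on_def by auto
  \<comment> \<open>\<open>z\<close> cuts the support off continuously between radius m and m + 1,
    and the projection to the disc of radius m caps the values. Neither operation moves the limit
    \<open>f\<close>.\<close>
  define z where "z x = max 0 (min 1 (m + 1 - norm x))" for x :: "real^'n"
  define k where "k n x = z x *\<^sub>R closest_point (cball 0 m) (g n x)" for n x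
  have cpc: "continuous_on UNIV (closest_point (cball (0::complex) m))"
    using m by (intro continuous_on_closest_point) auto
  have kc: "continuous_on UNIV (k n)" for n
    unfolding k_def [abs_def] z_def [abs_def]
    by (intro continuous_intros continuous_on_compose2[OF cpc gc]) auto
  have cp: "cmod (closest_point (cball 0 m) w) \<le> m" for w
    using closest_point_in_set[of "cball (0::complex) m" w] m by auto
  have z01: "0 \<le> z x" "z x \<le> 1" for x by (auto simp: z_def)
  have kb: "cmod (k n x) \<le> m" for n x
    using mult_mono[of "z x" 1 "cmod (closest_point (cball 0 m) (g n x))" m] z01[of x] cp[of "g n x"] m
    by (simp add: k_def)
  have k0: "k n x = 0" if "x \<notin> cball 0 (m + 1)" for n x using that by (simp add: k_def z_def)
  have "(\<lambda>n. \<integral>x. (cmod (f x - k n x))\<^sup>2 \<partial>lebesgue) \<longlonglongrightarrow> (\<integral>x. 0 \<partial>(lebesgue :: (real^'n) measure))"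
  proof (rule integral_dominated_convergence[where w="\<lambda>x. indicator (cball 0 (m + 1)) x * (2 * m)\<^sup>2"])
    show "(\<lambda>x. (cmod (f x - k n x))\<^sup>2) \<in> borel_measurable lebesgue" for n
      using f lebesgue_measurable_continuous[OF kc] by simp
    have "cball (0::real^'n) (m + 1) \<in> lmeasurable" by simp
    then show "integrable lebesgue (\<lambda>x::real^'n. indicator (cball 0 (m + 1)) x * (2 * m)\<^sup>2)"
      using lmeasurable_iff_integrable by (intro integrable_mult_left) blast
    show "AE x in lebesgue. norm ((cmod (f x - k n x))\<^sup>2) \<le> indicator (cball 0 (m + 1)) x * (2 * m)\<^sup>2" for n
    proof (rule AE_I2)
      fix x :: "real^'n"
      show "norm ((cmod (f x - k n x))\<^sup>2) \<le> indicator (cball 0 (m + 1)) x * (2 * m)\<^sup>2"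
      proof (cases "x \<in> cball 0 (m + 1)")
        case True
        have "cmod (f x - k n x) \<le> cmod (f x) + cmod (k n x)" by (rule norm_triangle_ineq4)
        also have "\<dots> \<le> 2 * m" using b(1)[of x] kb[of n x] by linarith
        finally show ?thesis using True power_mono[OF _ norm_ge_zero, of "f x - k n x" "2 * m" 2] by simp
      next
        case False
        then have "f x = 0" using b(2)[of x] by auto
        then show ?thesis using k0[OF False] False by simp
      qed
    qed
    show "AE x in lebesgue. (\<lambda>n. (cmod (f x - k n x))\<^sup>2) \<longlonglongrightarrow> 0"
    proof -
      have "AE x in lebesgue. x \<notin> N" using N by (simp add: negligible_iff_null_sets AE_not_in)
      then show ?thesis
      proof eventually_elim
        case (elim x)
        have "isCont (closest_point (cball 0 m)) (f x)" using cpc by (simp add: continuous_on_eq_continuous_at)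
        then have "(\<lambda>n. closest_point (cball 0 m) (g n x)) \<longlonglongrightarrow> closest_point (cball 0 m) (f x)"
          using g[OF elim] by (rule isCont_tendsto_compose)
        moreover have "closest_point (cball 0 m) (f x) = f x" using b(1)[of x] by (intro closest_point_self) auto
        ultimately have "(\<lambda>n. k n x) \<longlonglongrightarrow> z x *\<^sub>R f x" unfolding k_def by (intro tendsto_intros) auto
        moreover have "z x *\<^sub>R f x = f x" using b(2)[of x] by (cases "norm x \<le> m") (auto simp: z_def)
        ultimately have "(\<lambda>n. (cmod (f x - k n x))\<^sup>2) \<longlonglongrightarrow> (cmod (f x - f x))\<^sup>2" by (intro tendsto_intros) auto
        then show ?case by simp
      qed
    qed
  qed simp
  then have "eventually (\<lambda>n. (\<integral>x. (cmod (f x - k n x))\<^sup>2 \<partial>lebesgue) < e\<^sup>2) sequentially"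
    using e by (intro order_tendstoD(2)) auto
  then obtain n where n: "(\<integral>x. (cmod (f x - k n x))\<^sup>2 \<partial>lebesgue) < e\<^sup>2"
    unfolding eventually_sequentially by blast
  show ?thesis
    by (rule that[OF kc k0 L2_norm_less_of_integral[OF n e]])
qed

section \<open>Convergence of mollifications\<close>

lemma moll_diff: "loc_int f \<Longrightarrow> loc_int g \<Longrightarrow> 0 < \<delta> \<Longrightarrow> moll \<delta> (\<lambda>x. f x - g x) x = moll \<delta> f x - moll \<delta> g x"
  unfolding conv_def
  using integrable_conv[OF _ mollifier_test_function, of f \<delta> x] integrable_conv[OF _ mollifier_test_function, of g \<delta> x]
  by (simp add: right_diff_distrib)

lemma moll_const:
  fixes x :: "real^'n"
  assumes d: "0 < \<delta>" and c: "\<And>y. y \<in> ball x \<delta> \<Longrightarrow> f y = c"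
  shows "moll \<delta> f x = c"
proof -
  have eq: "mollifier \<delta> (y - x) * f y = eta \<delta> (y - x) *\<^sub>R c" for y
    using c[of y] eta_outside[OF d, of "y - x"]
    by (cases "dist x y < \<delta>") (auto simp: mollifier_def scaleR_conv_of_real dist_norm norm_minus_commute)
  have "(\<lambda>y. eta \<delta> (y - x)) \<in> borel_measurable lborel"
    using integrable_eta_shift[OF d] by blast
  then show ?thesis unfolding conv_def eq
    using integral_completion[of "\<lambda>y. eta \<delta> (y - x) *\<^sub>R c" lborel] integral_eta_shift[OF d, of x] integrable_eta_shift[OF d, of x]
    by simp
qed

lemma norm_moll_le:
  assumes d: "0 < \<delta>" and c: "\<And>y. y \<in> ball x \<delta> \<Longrightarrow> cmod (f y) \<le> C"
  shows "cmod (moll \<delta> f x) \<le> C"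
proof -
  have "(\<lambda>y. eta \<delta> (y - x)) \<in> borel_measurable lborel"
    by (rule borel_measurable_integrable[OF integrable_eta_shift[OF d]])
  then have m: "(\<lambda>y. eta \<delta> (y - x) * C) \<in> borel_measurable lborel" by simp
  have i: "integrable lebesgue (\<lambda>y. eta \<delta> (y - x) * C)" "(\<integral>y. eta \<delta> (y - x) * C \<partial>lebesgue) = C"
    using integrable_completion[OF m] integral_completion[OF m] integral_eta_shift[OF d, of x] integrable_eta_shift[OF d, of x]
    by auto
  have "cmod (mollifier \<delta> (y - x) * f y) \<le> eta \<delta> (y - x) * C" for y
    using c[of y] eta_outside[OF d, of "y - x"] eta_nonneg[OF d, of "y - x"]
    by (cases "dist x y < \<delta>") (auto simp: mollifier_def norm_mult dist_norm norm_minus_commute mult_left_mono)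
  from norm_integral_le[OF i(1) this] show ?thesis unfolding conv_def i(2) .
qed

text \<open>For a continuous compactly supported function the convergence is uniform on a fixed
  ball; the contraction property carries over the error of approximating \<open>f\<close>. Three
  errors of size e / 4 stay below e.\<close>

lemma moll_converges:
  fixes f :: "real^'n \<Rightarrow> complex"
  assumes f: "f \<in> L2 UNIV" and e: "0 < e"
  shows "\<exists>d>0. \<forall>\<delta>. 0 < \<delta> \<and> \<delta> < d \<longrightarrow> L2_norm UNIV (\<lambda>x. moll \<delta> f x - f x) < e"
proof -
  obtain m g where m: "0 < (m::real)" and g: "g \<in> L2 UNIV" "\<And>x. cmod (g x) \<le> m" "\<And>x. x \<notin> cball 0 m \<Longrightarrow> g x = 0"
    and fg: "L2_norm UNIV (\<lambda>x. f x - g x) < e / 8"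
    by (rule L2_truncation[OF f, of "e / 8"]) (use e in auto)
  have gm: "g \<in> borel_measurable lebesgue" using g(1) by (simp add: L2_UNIV_iff)
  obtain k where k: "continuous_on UNIV k" "\<And>x. x \<notin> cball 0 (m + 1) \<Longrightarrow> k x = 0"
    and gk: "L2_norm UNIV (\<lambda>x. g x - k x) < e / 8"
    by (rule L2_bounded_approx[OF gm g(2,3) m, of "e / 8"]) (use e in auto)
  have kL: "k \<in> L2 UNIV"
  proof -
    have "k = zext (cball 0 (m + 1)) k" using k(2) by (auto simp: zext_def indicator_def)
    moreover have "k \<in> L2 (cball 0 (m + 1))" using k(1) by (intro continuous_L2) auto
    ultimately show ?thesis using zext_L2_UNIV_iff[of "cball 0 (m + 1)" k] by simp
  qed
  have fk: "L2_norm UNIV (\<lambda>x. f x - k x) < e / 4"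
    using L2_norm_triangle[OF L2_diff[OF f g(1)] L2_diff[OF g(1) kL]] fg gk by simp
  define V where "V = measure lebesgue (cball (0::real^'n) (m + 2))"
  have V: "V \<ge> 0" by (simp add: V_def)
  \<comment> \<open>Uniform closeness e' on the ball that holds both supports costs the factor sqrt
    V in the norm; the added 1 avoids a division by zero.\<close>
  define e' where "e' = e / (4 * (sqrt V + 1))"
  have e': "e' > 0" using e V by (simp add: e'_def add_nonneg_pos)
  obtain d where d: "d > 0" "\<And>z z'. dist z z' < d \<Longrightarrow> norm (k z - k z') \<le> e'"
    by (rule compact_support_uniformly_continuous[OF k e']) auto
  show ?thesis
  proof (intro exI[of _ "min d 1"] conjI allI impI)
    fix \<delta> assume "0 < \<delta> \<and> \<delta> < min d 1"
    then have \<delta>: "0 < \<delta>" "\<delta> < d" "\<delta> < 1" by auto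
    have li: "loc_int f" "loc_int k" using loc_int_L2 f kL by auto
    have mk: "cmod (moll \<delta> k x - k x) \<le> e' * indicator (cball 0 (m + 2)) x" for x
    proof -
      have kx: "moll \<delta> (\<lambda>y::real^'n. k x) x = k x" by (rule moll_const[OF \<delta>(1)]) simp
      have "loc_int (\<lambda>y::real^'n. k x)"
        unfolding loc_int_def
      proof
        fix r
        have "cball (0::real^'n) r \<in> lmeasurable" by simp
        then show "integrable lebesgue (\<lambda>y::real^'n. indicator (cball 0 r) y *\<^sub>R k x)"
          using lmeasurable_iff_integrable by (intro integrable_scaleR_left) blast
      qed
      then have "moll \<delta> k x - k x = moll \<delta> (\<lambda>y. k y - k x) x" using moll_diff[OF li(2) _ \<delta>(1)] kx by simp
      moreover have "cmod (moll \<delta> (\<lambda>y. k y - k x) x) \<le> e'"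
        by (rule norm_moll_le[OF \<delta>(1)]) (use d(2) \<delta> in \<open>auto simp: dist_commute\<close>)
      moreover have "moll \<delta> k x - k x = 0" if "x \<notin> cball 0 (m + 2)"
      proof -
        have "k y = 0" if "y \<in> ball x \<delta>" for y
        proof -
          have "norm x \<le> norm y + dist x y" by (simp add: dist_norm norm_triangle_sub)
          then show ?thesis using that \<delta>(3) \<open>x \<notin> cball 0 (m + 2)\<close> by (intro k(2)) auto
        qed
        then have "moll \<delta> k x = 0" by (rule moll_const[OF \<delta>(1)])
        moreover have "k x = 0" using that by (intro k(2)) auto
        ultimately show ?thesis by simp
      qed
      ultimately show ?thesis by (auto simp: indicator_def)
    qed
    have mkL: "moll \<delta> k \<in> L2 UNIV" by (rule moll_contraction(1)[OF kL \<delta>(1)])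
    have "L2_norm UNIV (\<lambda>x. moll \<delta> k x - k x) \<le> e' * sqrt V"
    proof -
      have cb: "cball (0::real^'n) (m + 2) \<in> lmeasurable" by simp
      have i: "integrable lebesgue (\<lambda>x::real^'n. e'\<^sup>2 * indicator (cball 0 (m + 2)) x)"
        using cb lmeasurable_iff_integrable by (intro integrable_mult_right) blast
      have "(\<integral>x. (cmod (moll \<delta> k x - k x))\<^sup>2 \<partial>lebesgue) \<le> (\<integral>x. e'\<^sup>2 * indicator (cball 0 (m + 2)) x \<partial>(lebesgue :: (real^'n) measure))"
      proof (rule integral_mono'[OF i])
        fix x
        have "(cmod (moll \<delta> k x - k x))\<^sup>2 \<le> (e' * indicator (cball 0 (m + 2)) x)\<^sup>2"
          by (intro power_mono mk) simp
        then show "(cmod (moll \<delta> k x - k x))\<^sup>2 \<le> e'\<^sup>2 * indicator (cball 0 (m + 2)) x"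
          by (auto simp: power_mult_distrib split: split_indicator)
      qed auto
      also have "\<dots> = e'\<^sup>2 * V" by (simp add: V_def)
      finally have "L2_norm UNIV (\<lambda>x. moll \<delta> k x - k x) \<le> sqrt (e'\<^sup>2 * V)"
        unfolding L2_norm_UNIV by (rule real_sqrt_le_mono)
      then show ?thesis using e' by (simp add: real_sqrt_mult)
    qed
    also have "e' * sqrt V \<le> e / 4"
    proof -
      have "e' * sqrt V \<le> e' * (sqrt V + 1)" using e' by simp
      also have "\<dots> = e / 4" using real_sqrt_ge_zero[OF V] by (simp add: e'_def field_simps add_nonneg_eq_0_iff)
      finally show ?thesis .
    qed
    finally have 2: "L2_norm UNIV (\<lambda>x. moll \<delta> k x - k x) \<le> e / 4" .
    have 1: "L2_norm UNIV (\<lambda>x. moll \<delta> f x - moll \<delta> k x) \<le> L2_norm UNIV (\<lambda>x. f x - k x)"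
    proof -
      have "moll \<delta> (\<lambda>x. f x - k x) = (\<lambda>x. moll \<delta> f x - moll \<delta> k x)"
        by (rule ext) (rule moll_diff[OF li \<delta>(1)])
      then show ?thesis using moll_contraction(2)[OF L2_diff[OF f kL] \<delta>(1)] by simp
    qed
    have mfL: "moll \<delta> f \<in> L2 UNIV" by (rule moll_contraction(1)[OF f \<delta>(1)])
    have "L2_norm UNIV (\<lambda>x. moll \<delta> f x - k x) \<le> e / 4 + L2_norm UNIV (\<lambda>x. f x - k x)"
      using L2_norm_triangle[OF L2_diff[OF mfL mkL] L2_diff[OF mkL kL]] 1 2 by simp
    moreover have "L2_norm UNIV (\<lambda>x. moll \<delta> f x - f x) \<le> L2_norm UNIV (\<lambda>x. moll \<delta> f x - k x) + L2_norm UNIV (\<lambda>x. f x - k x)"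
      using L2_norm_diff[OF L2_diff[OF mfL kL] L2_diff[OF f kL]] by simp
    ultimately show "L2_norm UNIV (\<lambda>x. moll \<delta> f x - f x) < e" using fk e by linarith
  qed (use d in simp)
qed

text \<open>The cut-off is the mollified indicator function of a neighbourhood of \<open>K\<close>.\<close>

lemma smooth_cutoff:
  fixes K U :: "(real^'n) set"
  assumes K: "compact K" and U: "open U" "K \<subseteq> U"
  obtains \<delta> f S where "0 < \<delta>" "loc_int f" "compact S" "S \<subseteq> U"
    "\<And>x. moll \<delta> f x \<in> \<real>" "\<And>x. 0 \<le> Re (moll \<delta> f x) \<and> Re (moll \<delta> f x) \<le> 1"
    "\<And>x. x \<in> K \<Longrightarrow> moll \<delta> f x = 1" "\<And>x. x \<notin> S \<Longrightarrow> moll \<delta> f x = 0"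
\<comment> \<open>The empty set is split off because \<open>infdist\<close> to it is 0 by
  convention, which would make every neighbourhood the whole space.\<close>
proof (cases "K = {}")
  case True
  have z: "moll 1 (\<lambda>_. 0) x = 0" for x :: "real^'n" by (simp add: conv_def)
  show ?thesis
    by (rule that[of 1 "\<lambda>_. 0" "{}"]) (use True in \<open>auto simp: z loc_int_def\<close>)
next
  case False
  have "closed (- U)" "K \<inter> - U = {}" using U by auto
  then obtain d where d: "d > 0" "\<And>x y. x \<in> K \<Longrightarrow> y \<in> - U \<Longrightarrow> d \<le> dist x y"
    using separate_compact_closed[OF K, of "- U"] by blast
  \<comment> \<open>The indicator lives on the \<delta>-neighbourhood of \<open>K\<close> and
    mollification enlarges its support to at most the 2 \<delta>-neighbourhood, still at distance
    from the complement of \<open>U\<close>.\<close>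
  define \<delta> where "\<delta> = d / 4"
  have \<delta>: "\<delta> > 0" using d by (simp add: \<delta>_def)
  define V where "V = {x. infdist x K \<le> \<delta>}"
  define S where "S = {x. infdist x K \<le> 2 * \<delta>}"
  have cV: "compact V" and cS: "compact S"
    unfolding V_def S_def using compact_infdist_le[OF False K] \<delta> by auto
  have SU: "S \<subseteq> U"
  proof
    fix x assume "x \<in> S"
    then have "infdist x K < d" using d(1) by (simp add: S_def \<delta>_def)
    moreover obtain y where "y \<in> K" "infdist x K = dist x y"
      using infdist_attains_inf[OF compact_imp_closed[OF K] False] by blast
    ultimately show "x \<in> U" using d(2)[of y x] by (auto simp: dist_commute)
  qed
  define f :: "real^'n \<Rightarrow> complex" where "f x = of_real (indicator V x)" for x
  have f: "f \<in> L2 UNIV"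
  proof -
    have "f = zext V (\<lambda>_. 1)" by (auto simp: f_def zext_def scaleR_conv_of_real)
    moreover have "(\<lambda>_. 1) \<in> L2 V" using cV by (intro continuous_L2) (auto simp: compact_imp_bounded compact_imp_closed)
    ultimately show ?thesis using cV zext_L2_UNIV_iff[of V "\<lambda>_. 1"] by (simp add: compact_imp_closed)
  qed
  show ?thesis
  proof (rule that[of \<delta> f S])
    show "loc_int f" by (rule loc_int_L2[OF f])
    have re: "moll \<delta> f x = of_real (\<integral>y. eta \<delta> (y - x) * indicator V y \<partial>lebesgue)" for x
      unfolding conv_def mollifier_def f_def of_real_mult[symmetric] by (rule integral_complex_of_real)
    show "moll \<delta> f x \<in> \<real>" for x unfolding re by simp
    have "cmod (moll \<delta> f x) \<le> 1" for x
      by (rule norm_moll_le[OF \<delta>]) (simp add: f_def indicator_def)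
    moreover have "0 \<le> Re (moll \<delta> f x)" for x
      unfolding re Re_complex_of_real
      by (intro integral_nonneg_AE AE_I2 mult_nonneg_nonneg eta_nonneg \<delta>) auto
    ultimately show "0 \<le> Re (moll \<delta> f x) \<and> Re (moll \<delta> f x) \<le> 1" for x
      using complex_Re_le_cmod order_trans by blast
    show "moll \<delta> f x = 1" if "x \<in> K" for x
    proof (rule moll_const[OF \<delta>])
      fix y assume "y \<in> ball x \<delta>"
      then have "infdist y K \<le> \<delta>" using infdist_le[OF that, of y] by (simp add: dist_commute)
      then show "f y = 1" by (simp add: f_def V_def)
    qed
    show "moll \<delta> f x = 0" if "x \<notin> S" for x
    proof (rule moll_const[OF \<delta>])
      fix y assume "y \<in> ball x \<delta>"
      then have "infdist x K < infdist y K + \<delta>" using infdist_triangle[of x K y] by simp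
      then show "f y = 0" using that by (simp add: f_def V_def S_def)
    qed
  qed (use \<delta> cS SU in auto)
qed

lemma test_functions_moll_cutoff:
  assumes "0 < \<delta>" "loc_int f" "compact S" "S \<subseteq> U" "\<And>x. x \<notin> S \<Longrightarrow> moll \<delta> f x = 0"
  shows "moll \<delta> f \<in> test_functions U"
  by (rule test_functionsI[OF Ck_conv[OF assms(2) mollifier_test_function[OF assms(1)]] assms(3-5)])

text \<open>Each derivative falls on the kernel with a sign, and the two signs cancel.\<close>

lemma partial_partial_moll:
  assumes "loc_int f" "0 < \<delta>"
  shows "partial i (partial j (moll \<delta> f)) = conv (partial i (partial j (mollifier \<delta>))) f"
proof -
  note t = mollifier_test_function[OF assms(2)]
  have "partial i (\<lambda>x. (-1) * conv (partial j (mollifier \<delta>)) f x) =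
      (\<lambda>x. (-1) * partial i (conv (partial j (mollifier \<delta>)) f) x)"
    using has_derivative_conv[OF assms(1) test_functions_partial[OF t]]
    by (intro ext, subst partial_mult) (auto intro: differentiableI)
  then show ?thesis
    by (simp add: partial_conv[OF assms(1) t] partial_conv[OF assms(1) test_functions_partial[OF t]])
qed

lemma symmetric_partial_moll:
  assumes "loc_int f" "0 < \<delta>"
  shows "partial i (partial j (moll \<delta> f)) = partial j (partial i (moll \<delta> f))"
  unfolding partial_partial_moll[OF assms] by (simp add: symmetric_partial_mollifier[of i j])

section \<open>Weak derivatives\<close>

lemma open_lebesgue: "open S \<Longrightarrow> S \<in> sets lebesgue" and compact_lebesgue: "compact K \<Longrightarrow> K \<in> sets lebesgue"
  for S K :: "(real^'n) set"
  by (auto simp: compact_imp_closed)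

lemma integral_lebesgue_on_zero_outside:
  fixes f :: "real^'n \<Rightarrow> 'b::{banach, second_countable_topology}"
  assumes "S \<in> sets lebesgue" "\<And>x. x \<notin> S \<Longrightarrow> f x = 0"
  shows "(\<integral>x. f x \<partial>lebesgue_on S) = (\<integral>x. f x \<partial>lebesgue)"
proof -
  have "(\<lambda>x. indicator S x *\<^sub>R f x) = f" using assms(2) by (auto simp: indicator_def)
  then show ?thesis using integral_restrict_space[of S lebesgue f] assms(1) by simp
qed

lemma integrable_lebesgue_on_iff:
  fixes f :: "real^'n \<Rightarrow> 'b::{banach, second_countable_topology}"
  assumes "S \<in> sets lebesgue"
  shows "integrable (lebesgue_on S) f \<longleftrightarrow> integrable lebesgue (\<lambda>x. indicator S x *\<^sub>R f x)"
  using integrable_restrict_space[of S lebesgue f] assms by simp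

lemma integrable_locally_integrable_mult_test:
  fixes f :: "real^'n \<Rightarrow> complex"
  assumes f: "locally_integrable \<Omega> f" and \<phi>: "\<phi> \<in> test_functions \<Omega>"
  shows "integrable lebesgue (\<lambda>x. f x * \<phi> x)"
proof -
  obtain K where K: "compact K" "K \<subseteq> \<Omega>" "\<And>x. x \<notin> K \<Longrightarrow> \<phi> x = 0"
    by (rule test_functions_support[OF \<phi>]) blast
  have i: "integrable lebesgue (\<lambda>x. indicator K x *\<^sub>R f x)"
    using f K integrable_lebesgue_on_iff[OF compact_lebesgue[OF K(1)], of f] by (simp add: locally_integrable_def)
  have c: "continuous_on UNIV \<phi>" by (rule test_functions_continuous[OF \<phi>])
  have "bounded (\<phi> ` K)" using K(1) c by (intro compact_imp_bounded compact_continuous_image) (auto intro: continuous_on_subset)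
  then obtain C where C: "\<And>y. y \<in> K \<Longrightarrow> norm (\<phi> y) \<le> C" unfolding bounded_iff by blast
  have "integrable lebesgue (\<lambda>x. \<phi> x * (indicator K x *\<^sub>R f x))"
  proof (rule Bochner_Integration.integrable_bound)
    show "integrable lebesgue (\<lambda>x. C *\<^sub>R (indicator K x *\<^sub>R f x))"
      by (rule integrable_scaleR_right) (rule i)
    show "(\<lambda>x. \<phi> x * (indicator K x *\<^sub>R f x)) \<in> borel_measurable lebesgue"
      using i lebesgue_measurable_continuous[OF c] by (intro borel_measurable_times) auto
    show "AE x in lebesgue. norm (\<phi> x * (indicator K x *\<^sub>R f x)) \<le> norm (C *\<^sub>R (indicator K x *\<^sub>R f x))"
    proof (rule AE_I2)
      fix x
      show "norm (\<phi> x * (indicator K x *\<^sub>R f x)) \<le> norm (C *\<^sub>R (indicator K x *\<^sub>R f x))"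
        using C[of x] by (cases "x \<in> K") (auto simp: norm_mult intro!: mult_right_mono)
    qed
  qed
  moreover have "\<phi> x * (indicator K x *\<^sub>R f x) = f x * \<phi> x" for x
    using K(3)[of x] by (auto simp: indicator_def)
  ultimately show ?thesis by simp
qed

text \<open>Cut-offs that are 1 on \<open>K\<close> and whose supports shrink to \<open>K\<close>
  are test functions; dominated convergence turns their vanishing integrals into that of the
  indicator.\<close>

lemma integral_compact_eq_0:
  fixes f :: "real^'n \<Rightarrow> complex"
  assumes \<Omega>: "open \<Omega>" and f: "locally_integrable \<Omega> f"
    and z: "\<And>\<phi>. \<phi> \<in> test_functions \<Omega> \<Longrightarrow> (\<integral>x. f x * \<phi> x \<partial>lebesgue_on \<Omega>) = 0"
    and K: "compact K" "K \<subseteq> \<Omega>"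
  shows "(\<integral>x. indicator K x *\<^sub>R f x \<partial>lebesgue) = 0"
proof (cases "K = {}")
  case False
  have "closed (- \<Omega>)" "K \<inter> - \<Omega> = {}" using \<Omega> K by auto
  then obtain d where d: "d > 0" "\<And>x y. x \<in> K \<Longrightarrow> y \<in> - \<Omega> \<Longrightarrow> d \<le> dist x y"
    using separate_compact_closed[OF K(1), of "- \<Omega>"] by blast
  define W where "W = {x. infdist x K \<le> d / 2}"
  have cW: "compact W" unfolding W_def by (rule compact_infdist_le[OF False K(1)]) (use d(1) in simp)
  have W\<Omega>: "W \<subseteq> \<Omega>"
  proof
    fix x assume "x \<in> W"
    then have "infdist x K < d" using d(1) by (simp add: W_def)
    moreover obtain y where "y \<in> K" "infdist x K = dist x y"
      using infdist_attains_inf[OF compact_imp_closed[OF K(1)] False] by blast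
    ultimately show "x \<in> \<Omega>" using d(2)[of y x] by (auto simp: dist_commute)
  qed
  \<comment> \<open>The radius tends to 0, so the cut-offs converge pointwise to the indicator of
    \<open>K\<close>; the cap d / 2 keeps all supports in \<open>W\<close>, where \<open>f\<close>
    is integrable.\<close>
  define U where "U k = {x. infdist x K < min (d / 2) (inverse (real (Suc k)))}" for k
  have "\<exists>\<phi>. \<phi> \<in> test_functions (U k) \<and> (\<forall>x. cmod (\<phi> x) \<le> 1) \<and> (\<forall>x\<in>K. \<phi> x = 1)" for k
  proof -
    have o: "open (U k)" unfolding U_def
      by (intro open_Collect_less continuous_intros)
    have s: "K \<subseteq> U k" using d(1) by (auto simp: U_def)
    show ?thesis
    proof (rule smooth_cutoff[OF K(1) o s])
      fix \<delta> f S assume a: "0 < \<delta>" "loc_int f" "compact S" "S \<subseteq> U k"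
        and re: "\<And>x. moll \<delta> f x \<in> \<real>" "\<And>x. 0 \<le> Re (moll \<delta> f x) \<and> Re (moll \<delta> f x) \<le> 1"
        and 1: "\<And>x. x \<in> K \<Longrightarrow> moll \<delta> f x = 1" "\<And>x. x \<notin> S \<Longrightarrow> moll \<delta> f x = 0"
      have "cmod (moll \<delta> f x) \<le> 1" for x
        using re(1)[of x] re(2)[of x] by (auto simp: in_Reals_norm complex_is_Real_iff cmod_eq_Re)
      then show ?thesis using test_functions_moll_cutoff[OF a 1(2)] 1(1) by blast
    qed
  qed
  then obtain \<phi> where \<phi>: "\<And>k. \<phi> k \<in> test_functions (U k)" "\<And>k x. cmod (\<phi> k x) \<le> 1" "\<And>k x. x \<in> K \<Longrightarrow> \<phi> k x = 1"
    by metis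
  have UW: "U k \<subseteq> W" for k by (auto simp: U_def W_def)
  have \<phi>0: "\<phi> k x = 0" if "x \<notin> U k" for k x
    by (rule test_functions_support[OF \<phi>(1)[of k]]) (use that in blast)
  have i: "integrable lebesgue (\<lambda>x. indicator W x *\<^sub>R f x)"
    using f cW W\<Omega> integrable_lebesgue_on_iff[OF compact_lebesgue[OF cW], of f] by (simp add: locally_integrable_def)
  have t\<Omega>: "\<phi> k \<in> test_functions \<Omega>" for k
    using test_functions_mono[OF \<phi>(1)] UW W\<Omega> by blast
  have "(\<lambda>k. \<integral>x. f x * \<phi> k x \<partial>lebesgue) \<longlonglongrightarrow> (\<integral>x. indicator K x *\<^sub>R f x \<partial>lebesgue)"
  proof (rule integral_dominated_convergence[where w="\<lambda>x. norm (indicator W x *\<^sub>R f x)"])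
    have "integrable lebesgue (\<lambda>x. indicator K x *\<^sub>R f x)"
      using f K integrable_lebesgue_on_iff[OF compact_lebesgue[OF K(1)], of f] by (simp add: locally_integrable_def)
    then show "(\<lambda>x. indicator K x *\<^sub>R f x) \<in> borel_measurable lebesgue"
      by (rule borel_measurable_integrable)
    show "(\<lambda>x. f x * \<phi> k x) \<in> borel_measurable lebesgue" for k
      by (rule borel_measurable_integrable[OF integrable_locally_integrable_mult_test[OF f t\<Omega>]])
    show "integrable lebesgue (\<lambda>x. norm (indicator W x *\<^sub>R f x))" using i by (rule integrable_norm)
    show "AE x in lebesgue. norm (f x * \<phi> k x) \<le> norm (indicator W x *\<^sub>R f x)" for k
    proof (rule AE_I2)
      fix x
      show "norm (f x * \<phi> k x) \<le> norm (indicator W x *\<^sub>R f x)"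
      proof (cases "x \<in> W")
        case False
        then have "x \<notin> U k" using UW[of k] by blast
        then show ?thesis using \<phi>0[of x k] by simp
      qed (use \<phi>(2)[of k x] in \<open>auto simp: norm_mult mult_left_le\<close>)
    qed
    show "AE x in lebesgue. (\<lambda>k. f x * \<phi> k x) \<longlonglongrightarrow> indicator K x *\<^sub>R f x"
    proof (rule AE_I2)
      fix x
      show "(\<lambda>k. f x * \<phi> k x) \<longlonglongrightarrow> indicator K x *\<^sub>R f x"
      proof (cases "x \<in> K")
        case False
        have "infdist x K \<noteq> 0" using in_closed_iff_infdist_zero[OF compact_imp_closed[OF K(1)] \<open>K \<noteq> {}\<close>, of x] False by simp
        then have "infdist x K > 0" using infdist_nonneg[of x K] by linarith
        then obtain k0 where k0: "inverse (real (Suc k0)) < infdist x K" using reals_Archimedean by blast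
        have "\<phi> k x = 0" if "k0 \<le> k" for k
        proof (rule \<phi>0)
          have "inverse (real (Suc k)) \<le> inverse (real (Suc k0))" using that by (intro le_imp_inverse_le) auto
          then have "\<not> infdist x K < inverse (real (Suc k))" using k0 by linarith
          then show "x \<notin> U k" by (simp add: U_def)
        qed
        then have "(\<lambda>k. f x * \<phi> k x) \<longlonglongrightarrow> 0"
          by (intro tendsto_eventually eventually_sequentiallyI[of k0]) simp
        then show ?thesis using False by simp
      qed (simp add: \<phi>(3))
    qed
  qed
  moreover have "(\<integral>x. f x * \<phi> k x \<partial>lebesgue) = 0" for k
  proof -
    have "f x * \<phi> k x = 0" if "x \<notin> \<Omega>" for x using \<phi>0[of x k] UW W\<Omega> that by auto
    then show ?thesis using z[OF t\<Omega>] integral_lebesgue_on_zero_outside[OF open_lebesgue[OF \<Omega>], of "\<lambda>x. f x * \<phi> k x"] by simp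
  qed
  ultimately show ?thesis by (simp add: LIMSEQ_const_iff)
qed simp

text \<open>Inner regularity: if {g > 0} had positive measure, it would contain a closed set
  \<open>T\<close> that misses less than this measure. The integral over \<open>T\<close> vanishes,
  so \<open>T\<close> is null, and {g > 0} would have measure smaller than itself.\<close>

lemma AE_nonpos_of_compact_integrals:
  fixes g :: "real^'n \<Rightarrow> real"
  assumes g: "integrable lebesgue g" and W: "compact W" "\<And>x. x \<notin> W \<Longrightarrow> g x = 0"
    and z: "\<And>T. compact T \<Longrightarrow> T \<subseteq> W \<Longrightarrow> (\<integral>x. indicator T x * g x \<partial>lebesgue) = 0"
  shows "AE x in lebesgue. g x \<le> 0"
proof -
  define A where "A = {x. g x > 0}"
  have gm: "g \<in> borel_measurable lebesgue" by (rule borel_measurable_integrable[OF g])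
  have "{x \<in> space lebesgue. g x > 0} \<in> sets lebesgue" using gm by measurable
  then have Am: "A \<in> sets lebesgue" by (simp add: A_def)
  have AW: "A \<subseteq> W" using W(2) by (force simp: A_def)
  have "emeasure lebesgue A = 0"
  proof (rule ccontr)
    assume n0: "emeasure lebesgue A \<noteq> 0"
    have Al: "A \<in> lmeasurable"
      using bounded_set_imp_lmeasurable[OF bounded_subset[OF compact_imp_bounded[OF W(1)] AW] Am] .
    then have Afin: "emeasure lebesgue A \<noteq> \<infinity>" by (auto simp: fmeasurable_def)
    have mpos: "measure lebesgue A > 0"
      using n0 Afin by (metis emeasure_eq_ennreal_measure ennreal_0 infinity_ennreal_def measure_le_0_iff not_less)
    obtain T where T: "closed T" "T \<subseteq> A" and "A - T \<in> lmeasurable"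
      and T3: "emeasure lebesgue (A - T) < ennreal (measure lebesgue A)"
      by (rule sets_lebesgue_inner_closed[OF Am mpos])
    have cT: "compact T" 
      using closed_Int_compact[OF T(1) W(1)] T(2) AW by (simp add: inf_absorb1)
    have Tm: "T \<in> sets lebesgue" by (rule compact_lebesgue[OF cT])
    have i: "integrable lebesgue (\<lambda>x. indicator T x * g x)"
      using integrable_mult_indicator[OF Tm g] by simp
    have nn: "AE x in lebesgue. 0 \<le> indicator T x * g x"
    proof (rule AE_I2)
      fix x show "0 \<le> indicator T x * g x" using T(2) by (cases "x \<in> T") (auto simp: A_def)
    qed
    have "AE x in lebesgue. indicator T x * g x = 0"
      by (rule iffD1[OF integral_nonneg_eq_0_iff_AE[OF i nn] z[OF cT order_trans[OF T(2) AW]]])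
    then have "AE x in lebesgue. x \<notin> T"
    proof eventually_elim
      case (elim x)
      then show ?case using T(2) by (cases "x \<in> T") (auto simp: A_def)
    qed
    then have T0: "emeasure lebesgue T = 0" using Tm by (simp add: AE_iff_measurable[OF Tm])
    have "emeasure lebesgue A \<le> emeasure lebesgue (A - T) + emeasure lebesgue T"
      using emeasure_subadditive[of "A - T" lebesgue T] Am Tm T(2) by (simp add: Un_absorb2)
    also have "\<dots> < ennreal (measure lebesgue A)" using T3 T0 by simp
    also have "\<dots> = emeasure lebesgue A" using Afin by (simp add: emeasure_eq_ennreal_measure)
    finally show False by simp
  qed
  then have "AE x in lebesgue. x \<notin> A" using AE_iff_measurable[OF Am, of "\<lambda>x. x \<notin> A"] by simp
  then show ?thesis by eventually_elim (simp add: A_def)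
qed

text \<open>On one compact set the preceding lemma is used for plus and minus the real and the
  imaginary part; countably many compact sets exhaust the domain.\<close>

lemma fundamental_lemma:
  fixes f :: "real^'n \<Rightarrow> complex"
  assumes \<Omega>: "open \<Omega>" and f: "locally_integrable \<Omega> f"
    and z: "\<And>\<phi>. \<phi> \<in> test_functions \<Omega> \<Longrightarrow> (\<integral>x. f x * \<phi> x \<partial>lebesgue_on \<Omega>) = 0"
  shows "AE x in lebesgue_on \<Omega>. f x = 0"
proof -
  have W0: "AE x in lebesgue. x \<in> W \<longrightarrow> f x = 0" if W: "compact W" "W \<subseteq> \<Omega>" for W
  proof -
    define g where "g x = indicator W x *\<^sub>R f x" for x
    have g: "integrable lebesgue g"
      using f W integrable_lebesgue_on_iff[OF compact_lebesgue[OF W(1)], of f] by (simp add: locally_integrable_def g_def [abs_def])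
    have g0: "g x = 0" if "x \<notin> W" for x using that by (simp add: g_def)
    have gT: "(\<integral>x. indicator T x *\<^sub>R g x \<partial>lebesgue) = 0" "integrable lebesgue (\<lambda>x. indicator T x *\<^sub>R g x)"
      if T: "compact T" "T \<subseteq> W" for T
    proof -
      have eq: "(\<lambda>x. indicator T x *\<^sub>R g x) = (\<lambda>x. indicator T x *\<^sub>R f x)"
        using T(2) by (intro ext) (auto simp: g_def split: split_indicator)
      show "(\<integral>x. indicator T x *\<^sub>R g x \<partial>lebesgue) = 0"
        unfolding eq by (rule integral_compact_eq_0[OF \<Omega> f z T(1)]) (use T(2) W(2) in auto)
      show "integrable lebesgue (\<lambda>x. indicator T x *\<^sub>R g x)"
        by (rule integrable_mult_indicator[OF compact_lebesgue[OF T(1)] g])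
    qed
    have L: "AE x in lebesgue. L (g x) \<le> 0" if L: "bounded_linear L" for L :: "complex \<Rightarrow> real"
    proof (rule AE_nonpos_of_compact_integrals[OF _ W(1)])
      show "integrable lebesgue (\<lambda>x. L (g x))" using integrable_bounded_linear[OF L g] .
      show "L (g x) = 0" if "x \<notin> W" for x using g0[OF that] bounded_linear.linear[OF L] by (simp add: linear_0)
      fix T assume T: "compact T" "T \<subseteq> W"
      have "L (indicator T x *\<^sub>R g x) = indicator T x * L (g x)" for x
        using bounded_linear.linear[OF L] by (simp add: linear_cmul)
      then show "(\<integral>x. indicator T x * L (g x) \<partial>lebesgue) = 0"
        using integral_bounded_linear[OF L gT(2)[OF T]] gT(1)[OF T] bounded_linear.linear[OF L] by (simp add: linear_0)
    qed
    have "AE x in lebesgue. Re (g x) \<le> 0" "AE x in lebesgue. - Re (g x) \<le> 0"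
      "AE x in lebesgue. Im (g x) \<le> 0" "AE x in lebesgue. - Im (g x) \<le> 0"
      by (intro L bounded_linear_minus bounded_linear_Re bounded_linear_Im)+
    then show ?thesis
      by eventually_elim (auto simp: g_def complex_eq_iff)
  qed
  obtain C :: "nat \<Rightarrow> (real^'n) set" where C: "\<And>n. compact (C n)" "\<And>n. C n \<subseteq> \<Omega>" "\<Union>(range C) = \<Omega>"
    using open_Union_compact_subsets[OF \<Omega>] by metis
  have "AE x in lebesgue. \<forall>n. x \<in> C n \<longrightarrow> f x = 0"
    unfolding AE_all_countable using W0[OF C(1,2)] by blast
  then have "AE x in lebesgue. x \<in> \<Omega> \<longrightarrow> f x = 0"
    by eventually_elim (use C(3) in blast)
  then show ?thesis using AE_restrict_space_iff[of \<Omega> lebesgue "\<lambda>x. f x = 0"] open_lebesgue[OF \<Omega>] by simp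
qed

section \<open>Uniqueness and locality of weak derivatives\<close>

lemma has_weak_partialD:
  assumes "has_weak_partial \<Omega> i u g"
  shows "locally_integrable \<Omega> u" "locally_integrable \<Omega> g"
    and "\<phi> \<in> test_functions \<Omega> \<Longrightarrow>
      (\<integral>x. u x * partial i \<phi> x \<partial>lebesgue_on \<Omega>) = - (\<integral>x. g x * \<phi> x \<partial>lebesgue_on \<Omega>)"
  using assms by (auto simp: has_weak_partial_def)

lemma test_functions_zero_outside: "\<phi> \<in> test_functions \<Omega> \<Longrightarrow> x \<notin> \<Omega> \<Longrightarrow> \<phi> x = 0"
  by (rule test_functions_support[of \<phi> \<Omega>]) blast+

lemma integral_mult_test_eq:
  assumes "open \<Omega>" "\<phi> \<in> test_functions \<Omega>"
  shows "(\<integral>x. f x * \<phi> x \<partial>lebesgue_on \<Omega>) = (\<integral>x. f x * \<phi> x \<partial>lebesgue)"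
  using test_functions_zero_outside[OF assms(2)]
  by (intro integral_lebesgue_on_zero_outside open_lebesgue assms(1)) simp

lemma has_weak_partial_unique:
  assumes \<Omega>: "open \<Omega>" and g: "has_weak_partial \<Omega> i u g" and h: "has_weak_partial \<Omega> i u h"
  shows "AE x in lebesgue_on \<Omega>. g x = h x"
proof -
  note g' = has_weak_partialD[OF g] note h' = has_weak_partialD[OF h]
  have "AE x in lebesgue_on \<Omega>. g x - h x = 0"
  proof (rule fundamental_lemma[OF \<Omega>])
    show "locally_integrable \<Omega> (\<lambda>x. g x - h x)" using g'(2) h'(2) by (simp add: locally_integrable_def)
    fix \<phi> assume \<phi>: "\<phi> \<in> test_functions \<Omega>"
    have "integrable lebesgue (\<lambda>x. g x * \<phi> x)" "integrable lebesgue (\<lambda>x. h x * \<phi> x)"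
      using integrable_locally_integrable_mult_test g'(2) h'(2) \<phi> by blast+
    then have "(\<integral>x. (g x - h x) * \<phi> x \<partial>lebesgue) = (\<integral>x. g x * \<phi> x \<partial>lebesgue) - (\<integral>x. h x * \<phi> x \<partial>lebesgue)"
      by (simp add: left_diff_distrib)
    then show "(\<integral>x. (g x - h x) * \<phi> x \<partial>lebesgue_on \<Omega>) = 0"
      using g'(3)[OF \<phi>] h'(3)[OF \<phi>] unfolding integral_mult_test_eq[OF \<Omega> \<phi>] by simp
  qed
  then show ?thesis by simp
qed

text \<open>One witness turns the \<open>SOME\<close> choice into a genuine weak derivative, and
  uniqueness ties it to that witness.\<close>

lemma weak_partial_AE:
  assumes "open \<Omega>" "has_weak_partial \<Omega> i u g"
  shows "has_weak_partial \<Omega> i u (weak_partial \<Omega> i u)" "AE x in lebesgue_on \<Omega>. weak_partial \<Omega> i u x = g x"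
proof -
  show *: "has_weak_partial \<Omega> i u (weak_partial \<Omega> i u)"
    unfolding weak_partial_def by (rule someI[of "has_weak_partial \<Omega> i u", OF assms(2)])
  show "AE x in lebesgue_on \<Omega>. weak_partial \<Omega> i u x = g x"
    by (rule has_weak_partial_unique[OF assms(1) * assms(2)])
qed

lemma L2_AE:
  assumes v: "v \<in> L2 S" and S: "S \<in> sets lebesgue" and ae: "AE x in lebesgue_on S. u x = v x"
  shows "u \<in> L2 S" "L2_norm S u = L2_norm S v"
proof -
  have z: "zext S v \<in> L2 UNIV" using v S by (simp add: zext_L2_UNIV_iff)
  have ae': "AE x in lebesgue. zext S v x = zext S u x"
  proof -
    have "AE x in lebesgue. x \<in> S \<longrightarrow> u x = v x" using ae S by (simp add: AE_restrict_space_iff)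
    then show ?thesis by eventually_elim (auto simp: zext_def indicator_def)
  qed
  have m: "zext S v \<in> borel_measurable lebesgue" "integrable lebesgue (\<lambda>x. (cmod (zext S v x))\<^sup>2)"
    using z by (auto simp: L2_UNIV_iff)
  have mu: "zext S u \<in> borel_measurable lebesgue" by (rule borel_measurable_AE[OF m(1) ae'])
  have sq: "AE x in lebesgue. (cmod (zext S v x))\<^sup>2 = (cmod (zext S u x))\<^sup>2"
    using ae' by eventually_elim simp
  have sm: "(\<lambda>x. (cmod (zext S v x))\<^sup>2) \<in> borel_measurable lebesgue" "(\<lambda>x. (cmod (zext S u x))\<^sup>2) \<in> borel_measurable lebesgue"
    using m(1) mu by auto
  have "integrable lebesgue (\<lambda>x. (cmod (zext S u x))\<^sup>2)"
    using integrable_cong_AE[OF sm sq] m(2) by simp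
  then have "zext S u \<in> L2 UNIV" using mu by (simp add: L2_UNIV_iff)
  then show "u \<in> L2 S" using S by (simp add: zext_L2_UNIV_iff)
  have "L2_norm UNIV (zext S u) = L2_norm UNIV (zext S v)"
    unfolding L2_norm_UNIV using integral_cong_AE[OF sm sq] by simp
  then show "L2_norm S u = L2_norm S v" using S by (simp add: L2_norm_zext)
qed

lemma L2_locally_integrable:
  assumes "u \<in> L2 \<Omega>" "open \<Omega>" shows "locally_integrable \<Omega> u"
  unfolding locally_integrable_def
proof (intro allI impI)
  fix K assume K: "compact K \<and> K \<subseteq> \<Omega>"
  then have Km: "K \<in> sets lebesgue" by (intro compact_lebesgue) simp
  have "zext \<Omega> u \<in> L2 UNIV" using assms open_lebesgue by (simp add: zext_L2_UNIV_iff)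
  then have "integrable lebesgue (\<lambda>y. indicator K y *\<^sub>R zext \<Omega> u y)"
    using K Km by (intro integrable_indicator_L2) (auto simp: compact_imp_bounded)
  moreover have "(\<lambda>y. indicator K y *\<^sub>R zext \<Omega> u y) = (\<lambda>y. indicator K y *\<^sub>R u y)"
    using K by (intro ext) (auto simp: zext_def split: split_indicator)
  ultimately show "integrable (lebesgue_on K) u" using integrable_lebesgue_on_iff[OF Km, of u] by simp
qed

lemma H1_D:
  assumes "u \<in> H1 \<Omega>" "open \<Omega>"
  shows "u \<in> L2 \<Omega>" "has_weak_partial \<Omega> i u (weak_partial \<Omega> i u)" "weak_partial \<Omega> i u \<in> L2 \<Omega>"
proof -
  show "u \<in> L2 \<Omega>" using assms by (simp add: H1_def)
  obtain g where g: "g \<in> L2 \<Omega>" "has_weak_partial \<Omega> i u g" using assms by (auto simp: H1_def)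
  show "has_weak_partial \<Omega> i u (weak_partial \<Omega> i u)" by (rule weak_partial_AE(1)[OF assms(2) g(2)])
  show "weak_partial \<Omega> i u \<in> L2 \<Omega>"
    by (rule L2_AE(1)[OF g(1) open_lebesgue[OF assms(2)] weak_partial_AE(2)[OF assms(2) g(2)]])
qed

lemma has_weak_partial_subset:
  assumes g: "has_weak_partial \<Omega> i u g" and o: "open \<Omega>" "open B" "B \<subseteq> \<Omega>"
  shows "has_weak_partial B i u g"
  unfolding has_weak_partial_def
proof (intro conjI ballI)
  note g' = has_weak_partialD[OF g]
  show "locally_integrable B u" "locally_integrable B g" using g'(1,2) o(3) by (auto simp: locally_integrable_def)
  fix \<phi> assume \<phi>: "\<phi> \<in> test_functions B"
  then have \<phi>': "\<phi> \<in> test_functions \<Omega>" using o(3) by (rule test_functions_mono)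
  show "(\<integral>x. u x * partial i \<phi> x \<partial>lebesgue_on B) = - (\<integral>x. g x * \<phi> x \<partial>lebesgue_on B)"
    using g'(3)[OF \<phi>'] unfolding integral_mult_test_eq[OF o(1) \<phi>'] integral_mult_test_eq[OF o(2) \<phi>]
      integral_mult_test_eq[OF o(1) test_functions_partial[OF \<phi>']] integral_mult_test_eq[OF o(2) test_functions_partial[OF \<phi>]] .
qed

text \<open>The norm on the smaller set uses its own \<open>SOME\<close> choice of weak derivatives.
  The derivative chosen on the large set is also one on the small set, so the two agree almost
  everywhere there.\<close>

lemma H1_norm_subset:
  assumes u: "u \<in> H1 \<Omega>" and o: "open \<Omega>" "open B" "B \<subseteq> \<Omega>"
  shows "H1_norm B u = sqrt ((L2_norm B u)\<^sup>2 + (\<Sum>i\<in>UNIV. (L2_norm B (weak_partial \<Omega> i u))\<^sup>2))"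
proof -
  have "L2_norm B (weak_partial B i u) = L2_norm B (weak_partial \<Omega> i u)" for i
  proof (rule L2_AE(2))
    show "weak_partial \<Omega> i u \<in> L2 B"
      by (rule L2_subset(1)[OF H1_D(3)[OF u o(1)] o(3) open_lebesgue[OF o(2)] open_lebesgue[OF o(1)]])
    show "AE x in lebesgue_on B. weak_partial B i u x = weak_partial \<Omega> i u x"
      by (rule weak_partial_AE(2)[OF o(2) has_weak_partial_subset[OF H1_D(2)[OF u o(1)] o]])
  qed (rule open_lebesgue[OF o(2)])
  then show ?thesis by (simp add: H1_norm_def)
qed

text \<open>The real case is the divergence theorem in one direction; it is applied to real and
  imaginary part.\<close>

lemma integral_partial_test_eq_0:
  assumes \<theta>: "\<theta> \<in> test_functions UNIV"
  shows "(\<integral>x. partial i \<theta> x \<partial>lebesgue) = 0"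
proof -
  obtain K where K: "compact K" "\<And>x. x \<notin> K \<Longrightarrow> \<theta> x = 0"
    by (rule test_functions_support[OF \<theta>]) blast
  have c: "continuous_on UNIV (partial i \<theta>)" by (rule test_functions_continuous[OF test_functions_partial[OF \<theta>]])
  then have bm: "partial i \<theta> \<in> borel_measurable lborel" by (simp add: borel_measurable_continuous_onI)
  have d: "(\<theta> has_derivative (\<lambda>h. \<Sum>i\<in>UNIV. h $ i *\<^sub>R partial i \<theta> x)) (at x)" for x
    by (rule has_derivative_partial[OF test_functions_differentiable[OF \<theta>]])
  have L: "(\<integral>x. L (partial i \<theta> x) \<partial>lborel) = 0" "integrable lborel (\<lambda>x. L (partial i \<theta> x))"
    if L: "bounded_linear L" for L :: "complex \<Rightarrow> real"
  proof -
    have dL: "((\<lambda>x. L (\<theta> x)) has_derivative (\<lambda>h. L (\<Sum>i\<in>UNIV. h $ i *\<^sub>R partial i \<theta> x))) (at x)" for x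
      by (rule bounded_linear.has_derivative[OF L d])
    have e: "L (\<Sum>j\<in>UNIV. axis i 1 $ j *\<^sub>R partial j \<theta> x) = L (partial i \<theta> x)" for x
      by (simp only: sum_axis_scaleR)
    have cL: "continuous_on UNIV (\<lambda>x. L (\<Sum>j\<in>UNIV. axis i 1 $ j *\<^sub>R partial j \<theta> x))"
      unfolding e by (rule bounded_linear.continuous_on[OF L c])
    have z: "L (\<theta> x) = 0" if "x \<notin> K" for x using K(2)[OF that] linear_0[OF bounded_linear.linear[OF L]] by simp
    show "(\<integral>x. L (partial i \<theta> x) \<partial>lborel) = 0" "integrable lborel (\<lambda>x. L (partial i \<theta> x))"
      using integral_directional_derivative_eq_0[OF dL cL K(1) z] unfolding e by auto
  qed
  have "(\<integral>x. partial i \<theta> x \<partial>lebesgue) = (\<integral>x. partial i \<theta> x \<partial>lborel)" by (rule integral_completion[OF bm])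
  also have "\<dots> = 0"
  proof (rule complex_eqI)
    have "(\<lambda>x. indicator K x *\<^sub>R partial i \<theta> x) = partial i \<theta>"
      using partial_eq_0_outside[OF K] by (intro ext) (auto split: split_indicator)
    then have i: "integrable lborel (partial i \<theta>)"
      using borel_integrable_compact[OF K(1) continuous_on_subset[OF c]] by simp
    show "Re (\<integral>x. partial i \<theta> x \<partial>lborel) = Re 0" "Im (\<integral>x. partial i \<theta> x \<partial>lborel) = Im 0"
      using integral_bounded_linear[OF bounded_linear_Re i] integral_bounded_linear[OF bounded_linear_Im i]
        L(1)[OF bounded_linear_Re] L(1)[OF bounded_linear_Im] by simp_all
  qed
  finally show ?thesis .
qed

lemma test_L2_UNIV: "\<phi> \<in> test_functions \<Omega> \<Longrightarrow> \<phi> \<in> L2 UNIV"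
proof -
  assume \<phi>: "\<phi> \<in> test_functions \<Omega>"
  obtain K where K: "compact K" "\<And>x. x \<notin> K \<Longrightarrow> \<phi> x = 0"
    by (rule test_functions_support[OF \<phi>]) blast
  have "\<phi> = zext K \<phi>" using K(2) by (intro ext) (auto simp: zext_def split: split_indicator)
  moreover have "\<phi> \<in> L2 K"
    using K(1) test_functions_continuous[OF \<phi>] by (intro continuous_L2) (auto simp: compact_imp_bounded compact_imp_closed)
  ultimately show ?thesis using zext_L2_UNIV_iff[OF compact_lebesgue[OF K(1)], of \<phi>] by simp
qed

text \<open>Integration by parts: the derivative of the product of two test functions has integral
  zero.\<close>

lemma has_weak_partial_test:
  assumes \<Omega>: "open \<Omega>" and \<phi>: "\<phi> \<in> test_functions \<Omega>"
  shows "has_weak_partial \<Omega> i \<phi> (partial i \<phi>)"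
  unfolding has_weak_partial_def
proof (intro conjI ballI)
  have li: "locally_integrable \<Omega> \<psi>" if "\<psi> \<in> test_functions \<Omega>" for \<psi>
    using L2_locally_integrable[OF L2_subset(1)[OF test_L2_UNIV[OF that] subset_UNIV open_lebesgue[OF \<Omega>]] \<Omega>] by simp
  show "locally_integrable \<Omega> \<phi>" "locally_integrable \<Omega> (partial i \<phi>)"
    using li \<phi> test_functions_partial by blast+
  fix \<psi> assume \<psi>: "\<psi> \<in> test_functions \<Omega>"
  have "(\<lambda>x. \<phi> x * \<psi> x) \<in> test_functions UNIV"
    using test_functions_mono[OF test_functions_mult[OF \<psi> test_functions_Ck[OF \<phi>]]] by simp
  from integral_partial_test_eq_0[OF this, of i]
  have "0 = (\<integral>x. partial i (\<lambda>x. \<phi> x * \<psi> x) x \<partial>lebesgue)" by simp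
  also have "\<dots> = (\<integral>x. \<phi> x * partial i \<psi> x + partial i \<phi> x * \<psi> x \<partial>lebesgue)"
    using partial_mult[OF test_functions_differentiable[OF \<phi>] test_functions_differentiable[OF \<psi>]] by simp
  also have "\<dots> = (\<integral>x. \<phi> x * partial i \<psi> x \<partial>lebesgue) + (\<integral>x. partial i \<phi> x * \<psi> x \<partial>lebesgue)"
    by (intro Bochner_Integration.integral_add integrable_locally_integrable_mult_test[OF li] \<phi> \<psi> test_functions_partial)
  finally show "(\<integral>x. \<phi> x * partial i \<psi> x \<partial>lebesgue_on \<Omega>) = - (\<integral>x. partial i \<phi> x * \<psi> x \<partial>lebesgue_on \<Omega>)"
    unfolding integral_mult_test_eq[OF \<Omega> \<psi>] integral_mult_test_eq[OF \<Omega> test_functions_partial[OF \<psi>]]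
    by (simp add: eq_neg_iff_add_eq_0)
qed

text \<open>On test functions this is the H1 norm over any open set that contains the support.
  Written with classical derivatives on the whole space, it is free of \<open>SOME\<close> and
  visibly invariant under translation.\<close>

definition tnorm :: "(real^'n \<Rightarrow> complex) \<Rightarrow> real" where
  "tnorm \<phi> = sqrt ((L2_norm UNIV \<phi>)\<^sup>2 + (\<Sum>i\<in>UNIV. (L2_norm UNIV (partial i \<phi>))\<^sup>2))"

lemma L2_norm_test: "\<phi> \<in> test_functions \<Omega> \<Longrightarrow> open \<Omega> \<Longrightarrow> L2_norm \<Omega> \<phi> = L2_norm UNIV \<phi>"
proof -
  assume \<phi>: "\<phi> \<in> test_functions \<Omega>" and \<Omega>: "open \<Omega>"
  have "zext \<Omega> \<phi> = \<phi>" using test_functions_zero_outside[OF \<phi>] by (intro ext) (auto simp: zext_def split: split_indicator)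
  then show ?thesis using L2_norm_zext[OF open_lebesgue[OF \<Omega>], of \<phi>] by simp
qed

lemma test_H1:
  assumes \<Omega>: "open \<Omega>" and \<phi>: "\<phi> \<in> test_functions \<Omega>"
  shows "\<phi> \<in> H1 \<Omega>" "H1_norm \<Omega> \<phi> = tnorm \<phi>" "\<phi> \<in> H10 \<Omega>"
proof -
  have L2: "\<psi> \<in> L2 \<Omega>" if "\<psi> \<in> test_functions \<Omega>" for \<psi>
    using L2_subset(1)[OF test_L2_UNIV[OF that] subset_UNIV open_lebesgue[OF \<Omega>]] by simp
  show H1: "\<phi> \<in> H1 \<Omega>"
    using L2 \<phi> test_functions_partial[OF \<phi>] has_weak_partial_test[OF \<Omega> \<phi>] unfolding H1_def by blast
  have n: "H1_norm \<Omega> \<psi> = tnorm \<psi>" if \<psi>: "\<psi> \<in> test_functions \<Omega>" for \<psi>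
  proof -
    have "L2_norm \<Omega> (weak_partial \<Omega> i \<psi>) = L2_norm UNIV (partial i \<psi>)" for i
      using L2_AE(2)[OF L2[OF test_functions_partial[OF \<psi>]] open_lebesgue[OF \<Omega>] weak_partial_AE(2)[OF \<Omega> has_weak_partial_test[OF \<Omega> \<psi>]]]
        L2_norm_test[OF test_functions_partial[OF \<psi>] \<Omega>] by simp
    then show ?thesis by (simp add: H1_norm_def tnorm_def L2_norm_test[OF \<psi> \<Omega>])
  qed
  show "H1_norm \<Omega> \<phi> = tnorm \<phi>" by (rule n[OF \<phi>])
  have "(\<lambda>x. \<phi> x - \<phi> x) \<in> test_functions \<Omega>" by (rule test_functionsI[of _ "{}"]) (auto intro: Ck_const)
  then have "H1_norm \<Omega> (\<lambda>x. \<phi> x - \<phi> x) = 0" using n[of "\<lambda>x. \<phi> x - \<phi> x"] by (simp add: tnorm_def L2_norm_UNIV)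
  then have "H1_norm \<Omega> (\<lambda>x. \<phi> x - \<phi> x) < e" if "e > 0" for e using that by (simp only:)
  then show "\<phi> \<in> H10 \<Omega>"
    unfolding H10_def mem_Collect_eq using H1 \<phi> by (intro conjI allI impI bexI[of _ \<phi>])
qed

section \<open>The Schroedinger functional\<close>

lemma Linf_AE_le:
  assumes "P \<in> Linf \<Omega>"
  shows "AE x in lebesgue_on \<Omega>. \<bar>P x\<bar> \<le> Linf_norm \<Omega> P"
proof -
  have fin: "esssup (lebesgue_on \<Omega>) (\<lambda>x. ennreal \<bar>P x\<bar>) < \<infinity>" using assms by (simp add: Linf_def)
  have "AE x in lebesgue_on \<Omega>. ennreal \<bar>P x\<bar> \<le> esssup (lebesgue_on \<Omega>) (\<lambda>x. ennreal \<bar>P x\<bar>)"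
    by (rule esssup_AE)
  then show ?thesis
  proof eventually_elim
    case (elim x)
    have "enn2real (ennreal \<bar>P x\<bar>) \<le> enn2real (esssup (lebesgue_on \<Omega>) (\<lambda>x. ennreal \<bar>P x\<bar>))"
      using elim fin by (intro enn2real_mono) auto
    then show ?case by (simp add: Linf_norm_def)
  qed
qed

lemma Linf_norm_nonneg: "0 \<le> Linf_norm \<Omega> P" by (simp add: Linf_norm_def)

lemma Linf_mult_L2:
  assumes P: "P \<in> Linf \<Omega>" and u: "u \<in> L2 \<Omega>"
  shows "(\<lambda>x. of_real (P x) * u x) \<in> L2 \<Omega>" "L2_norm \<Omega> (\<lambda>x. of_real (P x) * u x) \<le> Linf_norm \<Omega> P * L2_norm \<Omega> u"
proof -
  let ?M = "Linf_norm \<Omega> P"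
  have m: "(\<lambda>x. of_real (P x) * u x) \<in> borel_measurable (lebesgue_on \<Omega>)"
    using P L2_D(1)[OF u] by (auto simp: Linf_def)
  have i: "integrable (lebesgue_on \<Omega>) (\<lambda>x. ?M\<^sup>2 * (cmod (u x))\<^sup>2)" using L2_D(2)[OF u] by simp
  have ae: "AE x in lebesgue_on \<Omega>. (cmod (of_real (P x) * u x))\<^sup>2 \<le> ?M\<^sup>2 * (cmod (u x))\<^sup>2"
    using Linf_AE_le[OF P]
  proof eventually_elim
    case (elim x)
    then have "\<bar>P x\<bar> * cmod (u x) \<le> ?M * cmod (u x)" by (intro mult_right_mono) auto
    then have "(\<bar>P x\<bar> * cmod (u x))\<^sup>2 \<le> (?M * cmod (u x))\<^sup>2" by (intro power_mono) auto
    then show ?case by (simp add: norm_mult power_mult_distrib)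
  qed
  have int: "integrable (lebesgue_on \<Omega>) (\<lambda>x. (cmod (of_real (P x) * u x))\<^sup>2)"
  proof (rule Bochner_Integration.integrable_bound[OF i])
    show "(\<lambda>x. (cmod (of_real (P x) * u x))\<^sup>2) \<in> borel_measurable (lebesgue_on \<Omega>)" using m by measurable
    show "AE x in lebesgue_on \<Omega>. norm ((cmod (of_real (P x) * u x))\<^sup>2) \<le> norm (?M\<^sup>2 * (cmod (u x))\<^sup>2)"
      using ae by eventually_elim simp
  qed
  show "(\<lambda>x. of_real (P x) * u x) \<in> L2 \<Omega>" unfolding L2_def using m int by simp
  have "(L2_norm \<Omega> (\<lambda>x. of_real (P x) * u x))\<^sup>2 \<le> (?M * L2_norm \<Omega> u)\<^sup>2"
    unfolding power_mult_distrib L2_norm_square integral_mult_right_zero[symmetric]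
    by (rule integral_mono_AE[OF int i ae])
  then show "L2_norm \<Omega> (\<lambda>x. of_real (P x) * u x) \<le> ?M * L2_norm \<Omega> u"
    using Linf_norm_nonneg L2_norm_nonneg by (metis mult_nonneg_nonneg power2_le_imp_le)
qed

lemma L2_pairing:
  assumes u: "u \<in> L2 \<Omega>" and v: "v \<in> L2 \<Omega>"
  shows "integrable (lebesgue_on \<Omega>) (\<lambda>x. u x * v x)"
    and "cmod (\<integral>x. u x * v x \<partial>lebesgue_on \<Omega>) \<le> L2_norm \<Omega> u * L2_norm \<Omega> v"
proof -
  have m: "(\<lambda>x. cmod (u x)) \<in> borel_measurable (lebesgue_on \<Omega>)" "(\<lambda>x. cmod (v x)) \<in> borel_measurable (lebesgue_on \<Omega>)"
    using L2_D(1)[OF u] L2_D(1)[OF v] by auto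
  note i = integrable_mult_square[OF m L2_D(2)[OF u] L2_D(2)[OF v]]
  show "integrable (lebesgue_on \<Omega>) (\<lambda>x. u x * v x)"
    by (rule Bochner_Integration.integrable_bound[OF i])
      (use L2_D(1)[OF u] L2_D(1)[OF v] in \<open>auto simp: norm_mult intro: borel_measurable_times\<close>)
  have "cmod (\<integral>x. u x * v x \<partial>lebesgue_on \<Omega>) \<le> (\<integral>x. cmod (u x) * cmod (v x) \<partial>lebesgue_on \<Omega>)"
    by (rule norm_integral_le[OF i]) (simp add: norm_mult)
  also have "\<dots> \<le> L2_norm \<Omega> u * L2_norm \<Omega> v"
    unfolding L2_norm_def by (rule integral_Cauchy_Schwarz[OF m L2_D(2)[OF u] L2_D(2)[OF v]])
  finally show "cmod (\<integral>x. u x * v x \<partial>lebesgue_on \<Omega>) \<le> L2_norm \<Omega> u * L2_norm \<Omega> v" .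
qed

lemma schroedinger_eq:
  assumes \<Omega>: "open \<Omega>" and P: "P \<in> Linf \<Omega>" and u: "u \<in> H1 \<Omega>" and v: "v \<in> H1 \<Omega>"
  shows "schroedinger \<Omega> P u v = (\<Sum>i\<in>UNIV. \<integral>x. weak_partial \<Omega> i u x * weak_partial \<Omega> i v x \<partial>lebesgue_on \<Omega>)
      + (\<integral>x. of_real (P x) * u x * v x \<partial>lebesgue_on \<Omega>)"
  unfolding schroedinger_def
  using L2_pairing(1)[OF H1_D(3)[OF u \<Omega>] H1_D(3)[OF v \<Omega>]]
    L2_pairing(1)[OF Linf_mult_L2(1)[OF P H1_D(1)[OF u \<Omega>]] H1_D(1)[OF v \<Omega>]]
  by simp

text \<open>Boundedness on the unit ball is what gives the real-valued supremum in
  \<open>Hm1_norm\<close> its meaning.\<close>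

lemma schroedinger_bound:
  assumes \<Omega>: "open \<Omega>" and P: "P \<in> Linf \<Omega>" and u: "u \<in> H1 \<Omega>" and v: "v \<in> H1 \<Omega>"
  shows "cmod (schroedinger \<Omega> P u v) \<le>
    ((\<Sum>i\<in>UNIV. L2_norm \<Omega> (weak_partial \<Omega> i u)) + Linf_norm \<Omega> P * L2_norm \<Omega> u) * H1_norm \<Omega> v"
proof -
  have s: "0 \<le> (\<Sum>i\<in>UNIV. (L2_norm \<Omega> (weak_partial \<Omega> i v))\<^sup>2)" by (intro sum_nonneg) simp
  have v0: "L2_norm \<Omega> v \<le> H1_norm \<Omega> v"
    unfolding H1_norm_def using s by (intro real_le_rsqrt) simp
  have vi: "L2_norm \<Omega> (weak_partial \<Omega> i v) \<le> H1_norm \<Omega> v" for i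
  proof -
    have "(L2_norm \<Omega> (weak_partial \<Omega> i v))\<^sup>2 \<le> (\<Sum>i\<in>UNIV. (L2_norm \<Omega> (weak_partial \<Omega> i v))\<^sup>2)"
      by (rule member_le_sum) auto
    then show ?thesis unfolding H1_norm_def by (intro real_le_rsqrt) (simp add: add_increasing)
  qed
  have "cmod (schroedinger \<Omega> P u v) \<le> (\<Sum>i\<in>UNIV. L2_norm \<Omega> (weak_partial \<Omega> i u) * L2_norm \<Omega> (weak_partial \<Omega> i v))
      + L2_norm \<Omega> (\<lambda>x. of_real (P x) * u x) * L2_norm \<Omega> v"
    unfolding schroedinger_eq[OF assms]
    by (intro norm_triangle_le add_mono sum_norm_le L2_pairing(2) H1_D(3)[OF u \<Omega>] H1_D(3)[OF v \<Omega>]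
      Linf_mult_L2(1)[OF P] H1_D(1)[OF u \<Omega>] H1_D(1)[OF v \<Omega>])
  also have "\<dots> \<le> (\<Sum>i\<in>UNIV. L2_norm \<Omega> (weak_partial \<Omega> i u) * H1_norm \<Omega> v)
      + (Linf_norm \<Omega> P * L2_norm \<Omega> u) * H1_norm \<Omega> v"
    by (intro add_mono sum_mono mult_left_mono mult_mono vi v0 Linf_mult_L2(2)[OF P H1_D(1)[OF u \<Omega>]])
      (auto simp: L2_norm_nonneg Linf_norm_nonneg)
  finally show ?thesis by (simp add: sum_distrib_right distrib_right)
qed

text \<open>The functional with density \<open>f\<close> and flux \<open>g\<close>. It covers both
  the Schroedinger functional on test functions and, for f = w and g = grad w, the functional -
  \<Delta>w + w.\<close>

definition test_form :: "(real^'n \<Rightarrow> complex) \<Rightarrow> ('n \<Rightarrow> real^'n \<Rightarrow> complex) \<Rightarrow> (real^'n \<Rightarrow> complex) \<Rightarrow> complex" where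
  "test_form f g \<phi> = (\<Sum>i\<in>UNIV. \<integral>x. g i x * partial i \<phi> x \<partial>lebesgue) + (\<integral>x. f x * \<phi> x \<partial>lebesgue)"

text \<open>The chosen weak derivatives of the test function are replaced by classical ones under
  the integral; linearity in the test function is then explicit.\<close>

lemma schroedinger_test:
  fixes \<Omega> :: "(real^'n) set"
  assumes \<Omega>: "open \<Omega>" and P: "P \<in> Linf \<Omega>" and u: "u \<in> H1 \<Omega>" and \<phi>: "\<phi> \<in> test_functions \<Omega>"
  shows "schroedinger \<Omega> P u \<phi> =
    test_form (zext \<Omega> (\<lambda>x. of_real (P x) * u x)) (\<lambda>i. zext \<Omega> (weak_partial \<Omega> i u)) \<phi>"
proof -
  have z: "(\<integral>x. f x * \<psi> x \<partial>lebesgue_on \<Omega>) = (\<integral>x. zext \<Omega> f x * \<psi> x \<partial>lebesgue)" for f \<psi> :: "real^'n \<Rightarrow> complex"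
    using integral_restrict_space[of \<Omega> lebesgue "\<lambda>x. f x * \<psi> x"] open_lebesgue[OF \<Omega>]
    by (simp add: zext_def mult_scaleR_left)
  have "(\<integral>x. weak_partial \<Omega> i u x * weak_partial \<Omega> i \<phi> x \<partial>lebesgue_on \<Omega>) =
      (\<integral>x. weak_partial \<Omega> i u x * partial i \<phi> x \<partial>lebesgue_on \<Omega>)" for i
  proof (rule integral_cong_AE)
    have p: "partial i \<phi> \<in> L2 \<Omega>"
      using L2_subset(1)[OF test_L2_UNIV[OF test_functions_partial[OF \<phi>]] subset_UNIV open_lebesgue[OF \<Omega>]] by simp
    show "(\<lambda>x. weak_partial \<Omega> i u x * weak_partial \<Omega> i \<phi> x) \<in> borel_measurable (lebesgue_on \<Omega>)"
      "(\<lambda>x. weak_partial \<Omega> i u x * partial i \<phi> x) \<in> borel_measurable (lebesgue_on \<Omega>)"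
      using L2_D(1)[OF H1_D(3)[OF u \<Omega>]] L2_D(1)[OF H1_D(3)[OF test_H1(1)[OF \<Omega> \<phi>] \<Omega>]] L2_D(1)[OF p]
      by (auto intro: borel_measurable_times)
    show "AE x in lebesgue_on \<Omega>. weak_partial \<Omega> i u x * weak_partial \<Omega> i \<phi> x = weak_partial \<Omega> i u x * partial i \<phi> x"
      using weak_partial_AE(2)[OF \<Omega> has_weak_partial_test[OF \<Omega> \<phi>, of i]] by eventually_elim simp
  qed
  then show ?thesis
    unfolding schroedinger_eq[OF \<Omega> P u test_H1(1)[OF \<Omega> \<phi>]] test_form_def z[symmetric] by simp
qed

lemma tnorm_cmult: "\<phi> \<in> test_functions \<Omega> \<Longrightarrow> tnorm (\<lambda>x. c * \<phi> x) = cmod c * tnorm \<phi>"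
proof -
  assume \<phi>: "\<phi> \<in> test_functions \<Omega>"
  have "partial i (\<lambda>x. c * \<phi> x) = (\<lambda>x. c * partial i \<phi> x)" for i
    by (rule ext, subst partial_mult) (auto intro: test_functions_differentiable[OF \<phi>])
  then have "tnorm (\<lambda>x. c * \<phi> x) = sqrt ((cmod c)\<^sup>2 * ((L2_norm UNIV \<phi>)\<^sup>2 + (\<Sum>i\<in>UNIV. (L2_norm UNIV (partial i \<phi>))\<^sup>2)))"
    by (simp add: tnorm_def L2_norm_cmult power_mult_distrib sum_distrib_left distrib_left)
  then show ?thesis by (simp add: real_sqrt_mult tnorm_def)
qed

lemma test_form_cmult: "\<phi> \<in> test_functions \<Omega> \<Longrightarrow> test_form f g (\<lambda>x. c * \<phi> x) = c * test_form f g \<phi>"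
proof -
  assume \<phi>: "\<phi> \<in> test_functions \<Omega>"
  have "partial i (\<lambda>x. c * \<phi> x) = (\<lambda>x. c * partial i \<phi> x)" for i
    by (rule ext, subst partial_mult) (auto intro: test_functions_differentiable[OF \<phi>])
  then show ?thesis
    by (simp add: test_form_def mult.left_commute[of _ c] distrib_left sum_distrib_left)
qed

lemma tnorm_nonneg: "0 \<le> tnorm \<phi>"
  unfolding tnorm_def by (intro real_sqrt_ge_zero add_nonneg_nonneg sum_nonneg) auto

lemma bdd_above_schroedinger:
  assumes \<Omega>: "open \<Omega>" and P: "P \<in> Linf \<Omega>" and u: "u \<in> H1 \<Omega>"
  shows "bdd_above ((\<lambda>v. cmod (schroedinger \<Omega> P u v)) ` {v \<in> H10 \<Omega>. H1_norm \<Omega> v \<le> 1})"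
proof (rule bdd_aboveI2)
  fix v assume "v \<in> {v \<in> H10 \<Omega>. H1_norm \<Omega> v \<le> 1}"
  then have v: "v \<in> H1 \<Omega>" "H1_norm \<Omega> v \<le> 1" by (auto simp: H10_def)
  define B where "B = (\<Sum>i\<in>UNIV. L2_norm \<Omega> (weak_partial \<Omega> i u)) + Linf_norm \<Omega> P * L2_norm \<Omega> u"
  have "B \<ge> 0" unfolding B_def by (intro add_nonneg_nonneg sum_nonneg mult_nonneg_nonneg L2_norm_nonneg Linf_norm_nonneg)
  then show "cmod (schroedinger \<Omega> P u v) \<le> ((\<Sum>i\<in>UNIV. L2_norm \<Omega> (weak_partial \<Omega> i u)) + Linf_norm \<Omega> P * L2_norm \<Omega> u) * 1"
    using schroedinger_bound[OF \<Omega> P u v(1)] mult_left_mono[OF v(2), of B] by (simp add: B_def)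
qed

text \<open>Normalising the test function makes it a competitor in the supremum; homogeneity of both
  sides does the rest.\<close>

lemma Hm1_norm_test:
  assumes \<Omega>: "open \<Omega>" and P: "P \<in> Linf \<Omega>" and u: "u \<in> H1 \<Omega>" and \<phi>: "\<phi> \<in> test_functions \<Omega>"
  shows "cmod (schroedinger \<Omega> P u \<phi>) \<le> Hm1_norm \<Omega> (schroedinger \<Omega> P u) * tnorm \<phi>"
\<comment> \<open>A function of norm zero cannot be normalised, but
  \<open>schroedinger_bound\<close> shows that the functional vanishes on it.\<close>
proof (cases "tnorm \<phi> = 0")
  case True
  then show ?thesis using schroedinger_bound[OF \<Omega> P u test_H1(1)[OF \<Omega> \<phi>]] test_H1(2)[OF \<Omega> \<phi>] by simp
next
  case False
  then have t: "tnorm \<phi> > 0" using tnorm_nonneg[of \<phi>] by simp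
  define \<psi> where "\<psi> x = of_real (inverse (tnorm \<phi>)) * \<phi> x" for x
  have \<psi>: "\<psi> \<in> test_functions \<Omega>" unfolding \<psi>_def [abs_def] by (rule test_functions_cmult[OF \<phi>])
  have "H1_norm \<Omega> \<psi> = 1"
    using t unfolding test_H1(2)[OF \<Omega> \<psi>] unfolding \<psi>_def tnorm_cmult[OF \<phi>] by (simp add: norm_inverse)
  then have "cmod (schroedinger \<Omega> P u \<psi>) \<le> Hm1_norm \<Omega> (schroedinger \<Omega> P u)"
    unfolding Hm1_norm_def using test_H1(3)[OF \<Omega> \<psi>] by (intro cSUP_upper[OF _ bdd_above_schroedinger[OF \<Omega> P u]]) simp
  moreover have "schroedinger \<Omega> P u \<psi> = of_real (inverse (tnorm \<phi>)) * schroedinger \<Omega> P u \<phi>"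
    unfolding schroedinger_test[OF \<Omega> P u \<psi>] schroedinger_test[OF \<Omega> P u \<phi>]
    unfolding \<psi>_def test_form_cmult[OF \<phi>] ..
  ultimately have "inverse (tnorm \<phi>) * cmod (schroedinger \<Omega> P u \<phi>) \<le> Hm1_norm \<Omega> (schroedinger \<Omega> P u)"
    using t by (simp add: norm_mult norm_inverse)
  then show ?thesis using t by (simp add: field_simps)
qed

lemma Hm1_norm_nonneg:
  assumes \<Omega>: "open \<Omega>" and P: "P \<in> Linf \<Omega>" and u: "u \<in> H1 \<Omega>"
  shows "0 \<le> Hm1_norm \<Omega> (schroedinger \<Omega> P u)"
proof (rule ccontr)
  assume n: "\<not> ?thesis"
  have z: "(\<lambda>x. 0) \<in> test_functions \<Omega>" by (rule test_functionsI[of _ "{}"]) (auto intro: Ck_const)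
  have "H1_norm \<Omega> (\<lambda>x. 0) = 0" unfolding test_H1(2)[OF \<Omega> z] by (simp add: tnorm_def L2_norm_UNIV)
  then have "cmod (schroedinger \<Omega> P u (\<lambda>x. 0)) \<le> Hm1_norm \<Omega> (schroedinger \<Omega> P u)"
    unfolding Hm1_norm_def using test_H1(3)[OF \<Omega> z] by (intro cSUP_upper[OF _ bdd_above_schroedinger[OF \<Omega> P u]]) simp
  then show False using n norm_ge_zero[of "schroedinger \<Omega> P u (\<lambda>x. 0)"] by linarith
qed

section \<open>Approximate Riesz representation\<close>

text \<open>An element that almost minimises \<open>\<parallel>v\<parallel>\<^sup>2 - 2 L v\<close> almost represents \<open>L\<close>; no completeness is needed.\<close>

lemma approximate_Riesz:
  fixes V :: "'v set" and nrm L :: "'v \<Rightarrow> real" and ip :: "'v \<Rightarrow> 'v \<Rightarrow> real"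
  assumes V: "V \<noteq> {}" and nn: "\<And>v. 0 \<le> nrm v" and N: "0 \<le> N"
    and L: "\<And>v. v \<in> V \<Longrightarrow> \<bar>L v\<bar> \<le> N * nrm v"
    and line: "\<And>v z t. v \<in> V \<Longrightarrow> z \<in> V \<Longrightarrow>
      \<exists>z'\<in>V. (nrm z')\<^sup>2 = (nrm v)\<^sup>2 + 2 * t * ip v z + t\<^sup>2 * (nrm z)\<^sup>2 \<and> L z' = L v + t * L z"
    and ip: "\<And>v. v \<in> V \<Longrightarrow> ip v v = (nrm v)\<^sup>2" and \<eta>: "0 < \<eta>"
  shows "\<exists>w\<in>V. nrm w \<le> N + \<eta> \<and> (\<forall>z\<in>V. \<bar>L z - ip w z\<bar> \<le> \<eta> * nrm z)"
proof -
  define J where "J v = (nrm v)\<^sup>2 - 2 * L v" for v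
  have lb: "- N\<^sup>2 \<le> J v" if "v \<in> V" for v
  proof -
    have "0 \<le> (nrm v - N)\<^sup>2" by simp
    then have "- N\<^sup>2 \<le> (nrm v)\<^sup>2 - 2 * (N * nrm v)" by (simp add: power2_eq_square algebra_simps)
    then show ?thesis using L[OF that] by (simp add: J_def)
  qed
  have bdd: "bdd_below (J ` V)" using lb by (intro bdd_belowI2)
  define I where "I = Inf (J ` V)"
  have "I < I + \<eta>\<^sup>2" using \<eta> by simp
  then obtain w where w: "w \<in> V" "J w < I + \<eta>\<^sup>2"
    unfolding I_def using cInf_lessD[of "J ` V" "Inf (J ` V) + \<eta>\<^sup>2"] V by blast
  \<comment> \<open>\<open>w\<close> minimises \<open>J\<close> up to \<eta>^2, so moving along
    \<open>z\<close> by any \<open>t\<close> gains at most \<eta>^2.\<close>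
  have key: "- \<eta>\<^sup>2 \<le> 2 * t * (ip w z - L z) + t\<^sup>2 * (nrm z)\<^sup>2" if z: "z \<in> V" for z t
  proof -
    obtain z' where z': "z' \<in> V" "(nrm z')\<^sup>2 = (nrm w)\<^sup>2 + 2 * t * ip w z + t\<^sup>2 * (nrm z)\<^sup>2" "L z' = L w + t * L z"
      using line[OF w(1) z, of t] by blast
    have "I \<le> J z'" unfolding I_def using z'(1) bdd by (intro cInf_lower) auto
    then show ?thesis using w(2) z'(2,3) by (simp add: J_def algebra_simps)
  qed
  have main: "\<bar>L z - ip w z\<bar> \<le> \<eta> * nrm z" if z: "z \<in> V" for z
  proof -
    define a where "a = ip w z - L z"
    define b where "b = nrm z"
    have b0: "b \<ge> 0" using nn by (simp add: b_def)
    have k: "- \<eta>\<^sup>2 \<le> 2 * t * a + t\<^sup>2 * b\<^sup>2" for t using key[OF z, of t] by (simp add: a_def b_def)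
    have "\<bar>a\<bar> \<le> \<eta> * b"
    proof (cases "b = 0")
      case True
      have "a = 0"
      proof (rule ccontr)
        assume "a \<noteq> 0"
        \<comment> \<open>This t makes the linear term - 2 \<eta>^2, while the quadratic term is
          absent.\<close>
        then show False using k[of "- \<eta>\<^sup>2 / a"] True \<eta> by simp
      qed
      then show ?thesis using True by simp
    next
      case False
      then have b: "b > 0" using b0 by simp
      \<comment> \<open>The value t = - a / b^2 minimises the quadratic.\<close>
      have "- \<eta>\<^sup>2 \<le> - a\<^sup>2 / b\<^sup>2" using k[of "- a / b\<^sup>2"] b by (simp add: power2_eq_square field_simps)
      then have "a\<^sup>2 \<le> (\<eta> * b)\<^sup>2" using b by (simp add: field_simps power_mult_distrib)
      then have "\<bar>a\<bar> \<le> \<bar>\<eta> * b\<bar>" by (simp add: abs_le_square_iff)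
      then show ?thesis using b \<eta> by simp
    qed
    then show ?thesis by (simp add: a_def b_def abs_minus_commute)
  qed
  have "nrm w \<le> N + \<eta>"
  proof (cases "nrm w = 0")
    case False
    then have p: "nrm w > 0" using nn[of w] by simp
    have "(nrm w)\<^sup>2 \<le> N * nrm w + \<eta> * nrm w" using main[OF w(1)] ip[OF w(1)] L[OF w(1)] by linarith
    then have "nrm w * nrm w \<le> (N + \<eta>) * nrm w" by (simp add: power2_eq_square algebra_simps)
    then show ?thesis using p by simp
  qed (use N \<eta> in simp)
  then show ?thesis using w(1) main by blast
qed

section \<open>Conjugation and inner products of test functions\<close>

lemma Ck_cnj: "Ck k \<phi> \<Longrightarrow> Ck k (\<lambda>x. cnj (\<phi> x))"
  and partial_cnj: "\<phi> differentiable at x \<Longrightarrow> partial i (\<lambda>x. cnj (\<phi> x)) x = cnj (partial i \<phi> x)"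
proof -
  have d: "((\<lambda>x. cnj (\<phi> x)) has_derivative (\<lambda>h. cnj (frechet_derivative \<phi> (at x) h))) (at x)"
    if "\<phi> differentiable at x" for \<phi> :: "real^'n \<Rightarrow> complex" and x
    using that bounded_linear.has_derivative[OF bounded_linear_cnj] by (simp add: frechet_derivative_works)
  then have p: "partial i (\<lambda>x. cnj (\<phi> x)) x = cnj (partial i \<phi> x)" if "\<phi> differentiable at x" for \<phi> :: "real^'n \<Rightarrow> complex" and i x
    using partial_eqI[OF d[OF that]] by (simp add: partial_def)
  show "\<phi> differentiable at x \<Longrightarrow> partial i (\<lambda>x. cnj (\<phi> x)) x = cnj (partial i \<phi> x)" by (rule p)
  show "Ck k \<phi> \<Longrightarrow> Ck k (\<lambda>x. cnj (\<phi> x))"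
  proof (induction k arbitrary: \<phi>)
    case 0
    then show ?case by (auto intro: continuous_intros)
  next
    case (Suc k)
    then have "partial i (\<lambda>x. cnj (\<phi> x)) = (\<lambda>x. cnj (partial i \<phi> x))" for i
      by (intro ext p) simp
    with Suc show ?case by (auto intro: differentiableI[OF d])
  qed
qed

lemma test_functions_cnj: "\<phi> \<in> test_functions \<Omega> \<Longrightarrow> (\<lambda>x. cnj (\<phi> x)) \<in> test_functions \<Omega>"
  by (rule test_functions_support[of \<phi> \<Omega>], assumption, rule test_functionsI)
    (auto intro: Ck_cnj test_functions_Ck)

lemma L2_cnj: "f \<in> L2 UNIV \<Longrightarrow> (\<lambda>x. cnj (f x)) \<in> L2 UNIV"
  using measurable_compose[of f lebesgue borel cnj borel] borel_measurable_continuous_onI[of cnj]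
  by (auto simp: L2_UNIV_iff continuous_intros)

lemma L2_pairing_UNIV: "f \<in> L2 UNIV \<Longrightarrow> g \<in> L2 UNIV \<Longrightarrow> integrable lebesgue (\<lambda>x. f x * g x)"
  using L2_pairing(1)[of f UNIV g] by (simp add: lebesgue_on_UNIV_eq)

lemma L2_norm_add_square:
  assumes f: "f \<in> L2 UNIV" and g: "g \<in> L2 UNIV"
  shows "(L2_norm UNIV (\<lambda>x. f x + of_real t * g x))\<^sup>2 =
    (L2_norm UNIV f)\<^sup>2 + 2 * t * Re (\<integral>x. cnj (f x) * g x \<partial>lebesgue) + t\<^sup>2 * (L2_norm UNIV g)\<^sup>2"
proof -
  have i: "integrable lebesgue (\<lambda>x. cnj (f x) * g x)" by (rule L2_pairing_UNIV[OF L2_cnj[OF f] g])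
  have "(cmod (f x + of_real t * g x))\<^sup>2 = (cmod (f x))\<^sup>2 + 2 * t * Re (cnj (f x) * g x) + t\<^sup>2 * (cmod (g x))\<^sup>2" for x
    unfolding cmod_power2 by (simp add: power2_eq_square algebra_simps)
  then have "(L2_norm UNIV (\<lambda>x. f x + of_real t * g x))\<^sup>2 =
      (\<integral>x. (cmod (f x))\<^sup>2 + 2 * t * Re (cnj (f x) * g x) + t\<^sup>2 * (cmod (g x))\<^sup>2 \<partial>lebesgue)"
    by (simp add: L2_norm_square lebesgue_on_UNIV_eq)
  also have "\<dots> = (\<integral>x. (cmod (f x))\<^sup>2 \<partial>lebesgue) + 2 * t * (\<integral>x. Re (cnj (f x) * g x) \<partial>lebesgue) + t\<^sup>2 * (\<integral>x. (cmod (g x))\<^sup>2 \<partial>lebesgue)"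
    using f g integrable_bounded_linear[OF bounded_linear_Re i] by (simp add: L2_UNIV_iff)
  also have "(\<integral>x. Re (cnj (f x) * g x) \<partial>lebesgue) = Re (\<integral>x. cnj (f x) * g x \<partial>lebesgue)"
    by (rule integral_bounded_linear[OF bounded_linear_Re i])
  finally show ?thesis by (simp add: L2_norm_square lebesgue_on_UNIV_eq)
qed

lemma test_form_add:
  assumes f: "f \<in> L2 UNIV" "\<And>i. g i \<in> L2 UNIV" and \<phi>: "\<phi> \<in> test_functions \<Omega>" "\<psi> \<in> test_functions \<Omega>"
  shows "test_form f g (\<lambda>x. \<phi> x + \<psi> x) = test_form f g \<phi> + test_form f g \<psi>"
proof -
  have p: "partial i (\<lambda>x. \<phi> x + \<psi> x) = (\<lambda>x. partial i \<phi> x + partial i \<psi> x)" for i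
    using \<phi> by (intro ext partial_add) (auto intro: test_functions_differentiable)
  have 1: "integrable lebesgue (\<lambda>x. f x * \<theta> x)" "integrable lebesgue (\<lambda>x. g i x * partial i \<theta> x)" if "\<theta> \<in> test_functions \<Omega>" for \<theta> i
    by (rule L2_pairing_UNIV[OF f(1) test_L2_UNIV[OF that]]
        L2_pairing_UNIV[OF f(2) test_L2_UNIV[OF test_functions_partial[OF that]]])+
  show ?thesis
    unfolding test_form_def p using 1[OF \<phi>(1)] 1[OF \<phi>(2)] by (simp add: distrib_left sum.distrib)
qed

text \<open>The abstract lemma is real, so it is applied to the real part of the functional and to
  the real part of the H1 inner product. Multiplying the test function by - i transfers the bound to
  the imaginary part, which accounts for the factor 2.\<close>

lemma test_approximate_Riesz:
  fixes f :: "real^'n \<Rightarrow> complex"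
  assumes f: "f \<in> L2 UNIV" "\<And>i. g i \<in> L2 UNIV" and N: "0 \<le> N"
    and le: "\<And>\<phi>. \<phi> \<in> test_functions \<Omega> \<Longrightarrow> cmod (test_form f g \<phi>) \<le> N * tnorm \<phi>" and \<eta>: "0 < \<eta>"
  shows "\<exists>w\<in>test_functions \<Omega>. tnorm w \<le> N + \<eta> \<and>
    (\<forall>\<phi>\<in>test_functions \<Omega>. cmod (test_form f g \<phi> - test_form w (\<lambda>i. partial i w) \<phi>) \<le> 2 * \<eta> * tnorm \<phi>)"
proof -
  define cj where "cj \<phi> = (\<lambda>x. cnj (\<phi> x))" for \<phi> :: "real^'n \<Rightarrow> complex"
  have cj: "cj \<phi> \<in> test_functions \<Omega>" if "\<phi> \<in> test_functions \<Omega>" for \<phi>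
    unfolding cj_def by (rule test_functions_cnj[OF that])
  have pcj: "partial i (cj \<phi>) = cj (partial i \<phi>)" if "\<phi> \<in> test_functions \<Omega>" for \<phi> i
    unfolding cj_def by (intro ext partial_cnj test_functions_differentiable[OF that])
  define ip where "ip \<phi> \<psi> = Re (test_form (cj \<phi>) (\<lambda>i. cj (partial i \<phi>)) \<psi>)" for \<phi> \<psi>
  have z: "(\<lambda>x. 0) \<in> test_functions \<Omega>" by (rule test_functionsI[of _ "{}"]) (auto intro: Ck_const)
  have line: "(tnorm (\<lambda>x. \<phi> x + of_real t * \<psi> x))\<^sup>2 = (tnorm \<phi>)\<^sup>2 + 2 * t * ip \<phi> \<psi> + t\<^sup>2 * (tnorm \<psi>)\<^sup>2"
    if \<phi>: "\<phi> \<in> test_functions \<Omega>" and \<psi>: "\<psi> \<in> test_functions \<Omega>" for \<phi> \<psi> t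
  proof -
    have p: "partial i (\<lambda>x. \<phi> x + of_real t * \<psi> x) = (\<lambda>x. partial i \<phi> x + of_real t * partial i \<psi> x)" for i
    proof
      fix x
      have "partial i (\<lambda>x. \<phi> x + of_real t * \<psi> x) x = partial i \<phi> x + partial i (\<lambda>x. of_real t * \<psi> x) x"
        by (intro partial_add test_functions_differentiable[OF \<phi>] test_functions_differentiable[OF test_functions_cmult[OF \<psi>]])
      also have "partial i (\<lambda>x. of_real t * \<psi> x) x = of_real t * partial i \<psi> x"
        by (subst partial_mult) (auto intro: test_functions_differentiable[OF \<psi>])
      finally show "partial i (\<lambda>x. \<phi> x + of_real t * \<psi> x) x = partial i \<phi> x + of_real t * partial i \<psi> x" .
    qed
    have sq: "(tnorm \<theta>)\<^sup>2 = (L2_norm UNIV \<theta>)\<^sup>2 + (\<Sum>i\<in>UNIV. (L2_norm UNIV (partial i \<theta>))\<^sup>2)" for \<theta> :: "real^'n \<Rightarrow> complex"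
      unfolding tnorm_def by (intro real_sqrt_pow2 add_nonneg_nonneg sum_nonneg) auto
    show ?thesis
      unfolding sq p L2_norm_add_square[OF test_L2_UNIV[OF \<phi>] test_L2_UNIV[OF \<psi>]]
        L2_norm_add_square[OF test_L2_UNIV[OF test_functions_partial[OF \<phi>]] test_L2_UNIV[OF test_functions_partial[OF \<psi>]]]
      by (simp add: ip_def test_form_def cj_def sum.distrib algebra_simps sum_distrib_left)
  qed
  have "\<exists>w\<in>test_functions \<Omega>. tnorm w \<le> N + \<eta> \<and>
      (\<forall>\<phi>\<in>test_functions \<Omega>. \<bar>Re (test_form f g \<phi>) - ip w \<phi>\<bar> \<le> \<eta> * tnorm \<phi>)"
  proof (rule approximate_Riesz)
    show "test_functions \<Omega> \<noteq> {}" using z by blast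
    show "\<bar>Re (test_form f g \<phi>)\<bar> \<le> N * tnorm \<phi>" if "\<phi> \<in> test_functions \<Omega>" for \<phi>
      using le[OF that] abs_Re_le_cmod order_trans by blast
    \<comment> \<open>Read off from \<open>line\<close> for \<psi> = \<phi> and t = 1, because
      doubling \<phi> doubles the norm.\<close>
    show "ip \<phi> \<phi> = (tnorm \<phi>)\<^sup>2" if \<phi>: "\<phi> \<in> test_functions \<Omega>" for \<phi>
    proof -
      have "(tnorm (\<lambda>x. \<phi> x + of_real 1 * \<phi> x))\<^sup>2 = (tnorm \<phi>)\<^sup>2 + 2 * 1 * ip \<phi> \<phi> + 1\<^sup>2 * (tnorm \<phi>)\<^sup>2"
        by (rule line[OF \<phi> \<phi>])
      moreover have "(\<lambda>x. \<phi> x + of_real 1 * \<phi> x) = (\<lambda>x. 2 * \<phi> x)" by simp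
      ultimately show ?thesis using tnorm_cmult[OF \<phi>, of 2] by (simp add: power_mult_distrib)
    qed
    fix \<phi> \<psi> :: "real^'n \<Rightarrow> complex" and t assume \<phi>: "\<phi> \<in> test_functions \<Omega>" and \<psi>: "\<psi> \<in> test_functions \<Omega>"
    have "Re (test_form f g (\<lambda>x. \<phi> x + of_real t * \<psi> x)) = Re (test_form f g \<phi>) + t * Re (test_form f g \<psi>)"
      unfolding test_form_add[OF f \<phi> test_functions_cmult[OF \<psi>]] test_form_cmult[OF \<psi>] by simp
    then show "\<exists>z'\<in>test_functions \<Omega>. (tnorm z')\<^sup>2 = (tnorm \<phi>)\<^sup>2 + 2 * t * ip \<phi> \<psi> + t\<^sup>2 * (tnorm \<psi>)\<^sup>2 \<and>
        Re (test_form f g z') = Re (test_form f g \<phi>) + t * Re (test_form f g \<psi>)"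
      using line[OF \<phi> \<psi>, of t] test_functions_add[OF \<phi> test_functions_cmult[OF \<psi>, of "of_real t"]]
      by (intro bexI[of _ "\<lambda>x. \<phi> x + of_real t * \<psi> x"]) auto
  qed (use N \<eta> tnorm_nonneg in auto)
  then obtain w0 where w0: "w0 \<in> test_functions \<Omega>" "tnorm w0 \<le> N + \<eta>"
    "\<And>\<phi>. \<phi> \<in> test_functions \<Omega> \<Longrightarrow> \<bar>Re (test_form f g \<phi>) - ip w0 \<phi>\<bar> \<le> \<eta> * tnorm \<phi>" by blast
  \<comment> \<open>The inner product conjugates its first argument, whereas
    \<open>test_form\<close> is bilinear; conjugating the representative reconciles the two.\<close>
  define w where "w = cj w0"
  have w: "w \<in> test_functions \<Omega>" unfolding w_def by (rule cj[OF w0(1)])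
  have "L2_norm UNIV (cj \<phi>) = L2_norm UNIV \<phi>" for \<phi> by (simp add: cj_def L2_norm_UNIV)
  then have tw: "tnorm w = tnorm w0" unfolding w_def tnorm_def pcj[OF w0(1)] by simp
  define E where "E \<phi> = test_form f g \<phi> - test_form w (\<lambda>i. partial i w) \<phi>" for \<phi>
  have ReE: "\<bar>Re (E \<phi>)\<bar> \<le> \<eta> * tnorm \<phi>" if "\<phi> \<in> test_functions \<Omega>" for \<phi>
    using w0(3)[OF that] by (simp add: E_def ip_def w_def pcj[OF w0(1)])
  have "cmod (E \<phi>) \<le> 2 * \<eta> * tnorm \<phi>" if \<phi>: "\<phi> \<in> test_functions \<Omega>" for \<phi>
  proof -
    have "E (\<lambda>x. - \<i> * \<phi> x) = - \<i> * E \<phi>"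
      unfolding E_def test_form_cmult[OF \<phi>] by (simp add: algebra_simps)
    then have "Re (E (\<lambda>x. - \<i> * \<phi> x)) = Im (E \<phi>)" by simp
    moreover have "tnorm (\<lambda>x. - \<i> * \<phi> x) = tnorm \<phi>" using tnorm_cmult[OF \<phi>, of "- \<i>"] by simp
    ultimately have "\<bar>Im (E \<phi>)\<bar> \<le> \<eta> * tnorm \<phi>" using ReE[OF test_functions_cmult[OF \<phi>, of "- \<i>"]] by simp
    then show ?thesis using ReE[OF \<phi>] cmod_le[of "E \<phi>"] by linarith
  qed
  then show ?thesis
    using w0(2) unfolding E_def tw[symmetric] by (intro bexI[OF _ w] conjI ballI)
qed

section \<open>Three-ball inequality for weak solutions\<close>

lemma sum_Basis_vec: "(\<Sum>b\<in>(Basis :: (real^'n) set). f b) = (\<Sum>i\<in>UNIV. f (axis i 1))"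
proof -
  have B: "(Basis :: (real^'n) set) = range (\<lambda>i. axis i 1)" by (auto simp: Basis_vec_def)
  have inj: "inj (\<lambda>i::'n. axis i (1::real))" by (auto simp: inj_on_def axis_eq_axis)
  show ?thesis unfolding B sum.reindex[OF inj] by simp
qed

text \<open>\<open>L\<close> stands for \<open>Re\<close> or \<open>Im\<close>; this and the next
  definition provide the gradient and Hessian that \<open>C2_on\<close> takes as arguments.\<close>

definition grad_of :: "(complex \<Rightarrow> real) \<Rightarrow> (real^'n \<Rightarrow> complex) \<Rightarrow> real^'n \<Rightarrow> real^'n" where
  "grad_of L \<phi> x = (\<chi> i. L (partial i \<phi> x))"

definition hess_of :: "(complex \<Rightarrow> real) \<Rightarrow> (real^'n \<Rightarrow> complex) \<Rightarrow> real^'n \<Rightarrow> real^'n \<Rightarrow> real^'n" where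
  "hess_of L \<phi> x d = (\<chi> j. \<Sum>i\<in>UNIV. d $ i * L (partial i (partial j \<phi>) x))"

definition laplacian :: "(real^'n \<Rightarrow> complex) \<Rightarrow> real^'n \<Rightarrow> complex" where
  "laplacian \<phi> x = (\<Sum>i\<in>UNIV. partial i (partial i \<phi>) x)"

lemma continuous_laplacian: "(\<And>k. Ck k \<phi>) \<Longrightarrow> continuous_on UNIV (laplacian \<phi>)"
proof -
  assume "\<And>k. Ck k \<phi>"
  then have "Ck (Suc (Suc 0)) \<phi>" by blast
  then have "continuous_on UNIV (partial i (partial i \<phi>))" for i by simp
  then show ?thesis unfolding laplacian_def [abs_def] by (intro continuous_on_sum)
qed

lemma C2_on_component:
  fixes \<phi> :: "real^'n \<Rightarrow> complex"
  assumes L: "bounded_linear L" and \<phi>: "\<And>k. Ck k \<phi>"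
    and sym: "\<And>i j. partial i (partial j \<phi>) = partial j (partial i \<phi>)"
  shows "C2_on UNIV (\<lambda>x. L (\<phi> x)) (grad_of L \<phi>) (hess_of L \<phi>)"
    and "lap (hess_of L \<phi>) x = L (laplacian \<phi> x)"
proof -
  note lin = bounded_linear.linear[OF L]
  have d: "f differentiable at x" if "Ck (Suc k) f" for f :: "real^'n \<Rightarrow> complex" and x k using that by simp
  have c1: "Ck k (partial i \<phi>)" and c2: "Ck k (partial j (partial i \<phi>))" for i j k
    using \<phi>[of "Suc k"] \<phi>[of "Suc (Suc k)"] by auto
  have Ld: "((\<lambda>x. L (f x)) has_derivative (\<lambda>h. \<Sum>i\<in>UNIV. h $ i * L (partial i f x))) (at x)"
    if "\<And>k. Ck k f" for f :: "real^'n \<Rightarrow> complex" and x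
  proof -
    have "((\<lambda>x. L (f x)) has_derivative (\<lambda>h. L (\<Sum>i\<in>UNIV. h $ i *\<^sub>R partial i f x))) (at x)"
      by (rule bounded_linear.has_derivative[OF L has_derivative_partial[OF d[OF that[of "Suc 0"]]]])
    then show ?thesis by (simp add: linear_sum[OF lin] linear_cmul[OF lin])
  qed
  show "C2_on UNIV (\<lambda>x. L (\<phi> x)) (grad_of L \<phi>) (hess_of L \<phi>)"
    unfolding C2_on_def
  proof (intro conjI ballI allI)
    fix x
    show "((\<lambda>x. L (\<phi> x)) has_derivative (\<lambda>h. grad_of L \<phi> x \<bullet> h)) (at x)"
      using Ld[OF \<phi>, of x] by (simp add: grad_of_def inner_vec_def mult.commute)
    show "(grad_of L \<phi> has_derivative hess_of L \<phi> x) (at x)"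
    proof (subst has_derivative_componentwise_within, intro ballI)
      fix b :: "real^'n" assume "b \<in> Basis"
      then obtain j where b: "b = axis j 1" by (auto simp: Basis_vec_def)
      show "((\<lambda>x. grad_of L \<phi> x \<bullet> b) has_derivative (\<lambda>h. hess_of L \<phi> x h \<bullet> b)) (at x)"
        using Ld[OF c1, of j x] by (simp add: b inner_axis grad_of_def hess_of_def)
    qed
    fix a b
    have "hess_of L \<phi> x a \<bullet> b = (\<Sum>j\<in>UNIV. \<Sum>i\<in>UNIV. a $ i * L (partial i (partial j \<phi>) x) * b $ j)"
      by (simp add: hess_of_def inner_vec_def sum_distrib_right)
    also have "\<dots> = (\<Sum>i\<in>UNIV. \<Sum>j\<in>UNIV. a $ i * L (partial i (partial j \<phi>) x) * b $ j)" by (rule sum.swap)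
    also have "\<dots> = a \<bullet> hess_of L \<phi> x b"
      by (simp add: hess_of_def inner_vec_def sum_distrib_left sym[of _ "_ :: 'n"] mult_ac)
    finally show "hess_of L \<phi> x a \<bullet> b = a \<bullet> hess_of L \<phi> x b" .
  next
    fix b
    have "continuous_on UNIV (partial i (partial j \<phi>))" for i j using c2[where k=0] by simp
    then show "continuous_on UNIV (\<lambda>x. hess_of L \<phi> x b)"
      unfolding hess_of_def
      by (intro continuous_on_vec_lambda continuous_on_sum continuous_on_mult continuous_on_const bounded_linear.continuous_on[OF L])
  qed
  have "(\<Sum>j\<in>UNIV. axis i (1::real) $ j * L (partial j (partial i \<phi>) x)) = L (partial i (partial i \<phi>) x)" for i
  proof -
    have "(\<Sum>j\<in>UNIV. axis i (1::real) $ j * L (partial j (partial i \<phi>) x))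
        = (\<Sum>j\<in>UNIV. if j = i then L (partial j (partial i \<phi>) x) else 0)"
      by (intro sum.cong) (auto simp: axis_def)
    then show ?thesis by simp
  qed
  then show "lap (hess_of L \<phi>) x = L (laplacian \<phi> x)"
    by (simp add: lap_def sum_Basis_vec inner_axis hess_of_def laplacian_def linear_sum[OF lin])
qed

text \<open>The real part of the mollified indicator discharges the cut-off hypothesis of
  \<open>three_ball_smooth\<close>.\<close>

lemma C2_cutoff_exists:
  fixes K U :: "(real^'n) set"
  assumes "compact K" "open U" "K \<subseteq> U"
  shows "\<exists>\<psi> g H S. C2_cutoff K U \<psi> g H S"
proof (rule smooth_cutoff[OF assms])
  fix \<delta> f S
  assume a: "0 < \<delta>" "loc_int f" "compact S" "S \<subseteq> U"
    and m: "\<And>x. 0 \<le> Re (moll \<delta> f x) \<and> Re (moll \<delta> f x) \<le> 1"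
      "\<And>x. x \<in> K \<Longrightarrow> moll \<delta> f x = 1" "\<And>x. x \<notin> S \<Longrightarrow> moll \<delta> f x = 0"
  have "C2_on UNIV (\<lambda>x. Re (moll \<delta> f x)) (grad_of Re (moll \<delta> f)) (hess_of Re (moll \<delta> f))"
    by (rule C2_on_component(1)[OF bounded_linear_Re Ck_conv[OF a(2) mollifier_test_function[OF a(1)]] symmetric_partial_moll[OF a(2,1)]])
  then have "C2_cutoff K U (\<lambda>x. Re (moll \<delta> f x)) (grad_of Re (moll \<delta> f)) (hess_of Re (moll \<delta> f)) S"
    unfolding C2_cutoff_def using a m by auto
  then show ?thesis by blast
qed

lemma int_on_cmod:
  fixes \<phi> :: "real^'n \<Rightarrow> complex"
  assumes "continuous_on UNIV \<phi>" "S \<in> sets borel"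
  shows "int_on S (\<lambda>x. (cmod (\<phi> x))\<^sup>2) = (L2_norm S \<phi>)\<^sup>2"
proof -
  have S: "S \<in> sets lebesgue" using assms(2) by (simp add: sets_completionI_sets)
  have "continuous_on UNIV (\<lambda>x. (cmod (\<phi> x))\<^sup>2)" by (intro continuous_intros assms(1))
  then have "(\<lambda>x. (cmod (\<phi> x))\<^sup>2) \<in> borel_measurable lborel"
    by (simp add: borel_measurable_continuous_onI)
  then have m: "(\<lambda>x. indicator S x * (cmod (\<phi> x))\<^sup>2) \<in> borel_measurable lborel"
    using assms(2) by (intro borel_measurable_times borel_measurable_indicator) auto
  have "(L2_norm S \<phi>)\<^sup>2 = (\<integral>x. indicator S x * (cmod (\<phi> x))\<^sup>2 \<partial>lebesgue)"
    unfolding L2_norm_square using integral_restrict_space[of S lebesgue "\<lambda>x. (cmod (\<phi> x))\<^sup>2"] S by simp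
  also have "\<dots> = int_on S (\<lambda>x. (cmod (\<phi> x))\<^sup>2)" unfolding int_on_def by (rule integral_completion[OF m])
  finally show ?thesis by simp
qed

lemma L2_norm_mono_AE:
  assumes u: "u \<in> L2 S" and v: "v \<in> L2 S" and ae: "AE x in lebesgue_on S. cmod (u x) \<le> cmod (v x)"
  shows "L2_norm S u \<le> L2_norm S v"
  unfolding L2_norm_def
proof (intro real_sqrt_le_mono integral_mono_AE L2_D(2)[OF u] L2_D(2)[OF v])
  show "AE x in lebesgue_on S. (cmod (u x))\<^sup>2 \<le> (cmod (v x))\<^sup>2"
    using ae by eventually_elim (simp add: power_mono)
qed

text \<open>The Carleman argument yields an inequality between squared norms; this passes to the
  norms themselves.\<close>

lemma powr_add_square_le:
  fixes a b c d \<kappa> :: real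
  assumes "0 \<le> a" "0 \<le> b" "0 \<le> c" "0 \<le> \<kappa>" "\<kappa> \<le> 1"
  shows "(a\<^sup>2 + c\<^sup>2) powr \<kappa> * (b\<^sup>2 + c\<^sup>2) powr (1 - \<kappa>) \<le> ((a + c) powr \<kappa> * (b + c) powr (1 - \<kappa>))\<^sup>2"
proof -
  have e: "((x + c)\<^sup>2) powr k = ((x + c) powr k)\<^sup>2" if "0 \<le> x" for x k
    using that assms(3) by (cases "x + c = 0") (auto simp: power2_eq_square powr_mult)
  have l: "x\<^sup>2 + c\<^sup>2 \<le> (x + c)\<^sup>2" if "0 \<le> x" for x
    using that assms(3) by (simp add: power2_sum)
  have "(a\<^sup>2 + c\<^sup>2) powr \<kappa> * (b\<^sup>2 + c\<^sup>2) powr (1 - \<kappa>) \<le> ((a + c)\<^sup>2) powr \<kappa> * ((b + c)\<^sup>2) powr (1 - \<kappa>)"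
    using assms by (intro mult_mono powr_mono2 l) auto
  then show ?thesis unfolding e[OF assms(1)] e[OF assms(2)] by (simp add: power_mult_distrib)
qed

text \<open>Real and imaginary part solve the same equation because the potential is real.\<close>

lemma three_ball_smooth_complex:
  fixes a :: "real^'n"
  assumes r: "0 < r\<^sub>1" "r\<^sub>1 < r\<^sub>2" "r\<^sub>2 < R"
  shows "\<exists>\<kappa> C. 0 < \<kappa> \<and> \<kappa> < 1 \<and> 0 < C \<and> (\<forall>\<phi> \<Omega> P.
    (\<forall>k. Ck k \<phi>) \<longrightarrow> (\<forall>i j. partial i (partial j \<phi>) = partial j (partial i \<phi>)) \<longrightarrow>
    open \<Omega> \<longrightarrow> ball a R \<subseteq> \<Omega> \<longrightarrow> P \<in> Linf \<Omega> \<longrightarrow>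
    (\<lambda>x. laplacian \<phi> x - of_real (P x) * \<phi> x) \<in> L2 (ball a R) \<and>
    sqrt ((L2_norm (ball a r\<^sub>2) \<phi>)\<^sup>2 + (\<Sum>i\<in>UNIV. (L2_norm (ball a r\<^sub>2) (partial i \<phi>))\<^sup>2)) \<le>
      2 * exp (C * (Linf_norm \<Omega> P powr (2/3) + 1)) *
      ((L2_norm (ball a r\<^sub>1) \<phi> + L2_norm (ball a R) (\<lambda>x. laplacian \<phi> x - of_real (P x) * \<phi> x)) powr \<kappa> *
       (L2_norm (ball a R) \<phi> + L2_norm (ball a R) (\<lambda>x. laplacian \<phi> x - of_real (P x) * \<phi> x)) powr (1 - \<kappa>)))"
proof -
  obtain \<kappa> C where \<kappa>: "0 < \<kappa>" "\<kappa> < 1" and C: "0 < C" and main: "\<And>(h :: real^'n \<Rightarrow> real) g H G M.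
    C2_on UNIV h g H \<Longrightarrow> continuous_on UNIV G \<Longrightarrow> (\<forall>x. 0 \<le> G x) \<Longrightarrow> 0 \<le> M \<Longrightarrow>
    (\<forall>x\<in>ball a R. \<bar>lap H x\<bar> \<le> M * \<bar>h x\<bar> + G x) \<Longrightarrow>
    int_on (ball a r\<^sub>2) (\<lambda>x. (h x)\<^sup>2 + g x \<bullet> g x) \<le> exp (C * (M powr (2/3) + 1)) *
      ((int_on (ball a r\<^sub>1) (\<lambda>x. (h x)\<^sup>2) + int_on (ball a R) (\<lambda>x. (G x)\<^sup>2)) powr \<kappa> *
       (int_on (ball a R) (\<lambda>x. (h x)\<^sup>2) + int_on (ball a R) (\<lambda>x. (G x)\<^sup>2)) powr (1 - \<kappa>))"
    using three_ball_smooth[OF r C2_cutoff_exists] by blast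
  show ?thesis
  proof (rule exI[of _ \<kappa>], rule exI[of _ C], intro conjI allI impI \<kappa> C)
    fix \<phi> :: "real^'n \<Rightarrow> complex" and \<Omega> :: "(real^'n) set" and P :: "real^'n \<Rightarrow> real"
    assume \<phi>: "\<forall>k. Ck k \<phi>" and sym: "\<forall>i j. partial i (partial j \<phi>) = partial j (partial i \<phi>)"
      and \<Omega>: "open \<Omega>" "ball a R \<subseteq> \<Omega>" and P: "P \<in> Linf \<Omega>"
    define M where "M = Linf_norm \<Omega> P"
    have M: "0 \<le> M" by (simp add: M_def Linf_norm_nonneg)
    have c\<phi>: "continuous_on UNIV \<phi>" using \<phi>[rule_format, of 0] by simp
    have cp: "continuous_on UNIV (partial i \<phi>)" for i using \<phi>[rule_format, of "Suc 0"] by simp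
    have cl: "continuous_on UNIV (laplacian \<phi>)" using \<phi> by (intro continuous_laplacian) blast
    have bb: "bounded (ball a t)" "ball a t \<in> sets borel" "ball a t \<in> sets lebesgue" for t by auto
    let ?q = "\<lambda>x. laplacian \<phi> x - of_real (P x) * \<phi> x"
    have bm: "AE x in lebesgue_on (ball a R). \<bar>P x\<bar> \<le> M"
      using Linf_AE_le[OF P] \<Omega> bb(3)[of R] open_lebesgue[OF \<Omega>(1)]
      by (auto simp: AE_restrict_space_iff M_def elim!: eventually_mono)
    have PB: "(\<lambda>x. of_real (P x) * \<phi> x) \<in> L2 (ball a R)"
    proof -
      have "P \<in> borel_measurable (lebesgue_on \<Omega>)" using P by (simp add: Linf_def)
      then have Pm: "P \<in> borel_measurable (lebesgue_on (ball a R))"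
        using measurable_restrict_mono[of P lebesgue \<Omega>] \<Omega>(2) by blast
      have pm: "(\<lambda>x. of_real (P x) * \<phi> x) \<in> borel_measurable (lebesgue_on (ball a R))"
        using Pm L2_D(1)[OF continuous_L2[OF c\<phi> bb(1,3)]] by auto
      have "integrable (lebesgue_on (ball a R)) (\<lambda>x. (cmod (of_real (P x) * \<phi> x))\<^sup>2)"
      proof (rule Bochner_Integration.integrable_bound)
        show "integrable (lebesgue_on (ball a R)) (\<lambda>x. M\<^sup>2 * (cmod (\<phi> x))\<^sup>2)"
          using L2_D(2)[OF continuous_L2[OF c\<phi> bb(1,3)]] by simp
        show "(\<lambda>x. (cmod (of_real (P x) * \<phi> x))\<^sup>2) \<in> borel_measurable (lebesgue_on (ball a R))"
          using pm by measurable
        show "AE x in lebesgue_on (ball a R). norm ((cmod (of_real (P x) * \<phi> x))\<^sup>2) \<le> norm (M\<^sup>2 * (cmod (\<phi> x))\<^sup>2)"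
          using bm
        proof eventually_elim
          case (elim x)
          then have "\<bar>P x\<bar>\<^sup>2 \<le> M\<^sup>2" by (intro power_mono) auto
          then show ?case by (simp add: norm_mult power_mult_distrib mult_right_mono)
        qed
      qed
      then show ?thesis using pm by (simp add: L2_def)
    qed
    show q: "?q \<in> L2 (ball a R)"
      by (rule L2_diff[OF continuous_L2[OF cl bb(1,3)] PB])
    define \<gamma> where "\<gamma> = L2_norm (ball a R) ?q"
    define \<alpha> where "\<alpha> = L2_norm (ball a r\<^sub>1) \<phi>"
    define \<beta> where "\<beta> = L2_norm (ball a R) \<phi>"
    define T where "T = exp (C * (M powr (2/3) + 1)) * ((\<alpha> + \<gamma>) powr \<kappa> * (\<beta> + \<gamma>) powr (1 - \<kappa>))\<^sup>2"
    have nn: "0 \<le> \<alpha>" "0 \<le> \<beta>" "0 \<le> \<gamma>" by (auto simp: \<alpha>_def \<beta>_def \<gamma>_def L2_norm_nonneg)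
    have comp: "int_on (ball a r\<^sub>2) (\<lambda>x. (L (\<phi> x))\<^sup>2 + grad_of L \<phi> x \<bullet> grad_of L \<phi> x) \<le> T"
      if L: "bounded_linear L" and Lc: "\<And>z. \<bar>L z\<bar> \<le> cmod z" for L
    proof -
      note lin = bounded_linear.linear[OF L]
      \<comment> \<open>The smooth theorem needs a continuous source and a pointwise inequality, but
        P is merely measurable. The positive part of |L (\<open>laplacian \<phi>\<close>)| - M |L
        \<phi>| is continuous, satisfies the inequality everywhere, and is almost everywhere at most
        |\<open>laplacian \<phi>\<close> - P \<phi>|.\<close>
      define G where "G x = max 0 (\<bar>L (laplacian \<phi> x)\<bar> - M * \<bar>L (\<phi> x)\<bar>)" for x
      have cG: "continuous_on UNIV G" unfolding G_def [abs_def]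
        by (intro continuous_intros bounded_linear.continuous_on[OF L] cl c\<phi>)
      have cL: "continuous_on UNIV (\<lambda>x. L (\<phi> x))" by (rule bounded_linear.continuous_on[OF L c\<phi>])
      have m: "int_on (ball a r\<^sub>2) (\<lambda>x. (L (\<phi> x))\<^sup>2 + grad_of L \<phi> x \<bullet> grad_of L \<phi> x) \<le> exp (C * (M powr (2/3) + 1)) *
        ((int_on (ball a r\<^sub>1) (\<lambda>x. (L (\<phi> x))\<^sup>2) + int_on (ball a R) (\<lambda>x. (G x)\<^sup>2)) powr \<kappa> *
         (int_on (ball a R) (\<lambda>x. (L (\<phi> x))\<^sup>2) + int_on (ball a R) (\<lambda>x. (G x)\<^sup>2)) powr (1 - \<kappa>))"
        by (rule main[OF C2_on_component(1)[OF L] cG _ M])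
          (use \<phi> sym C2_on_component(2)[OF L, of \<phi>] in \<open>auto simp: G_def\<close>)
      have hL: "int_on (ball a t) (\<lambda>x. (L (\<phi> x))\<^sup>2) \<le> (L2_norm (ball a t) \<phi>)\<^sup>2" for t
        unfolding int_on_cmod[OF c\<phi> bb(2), symmetric]
      proof (rule int_on_mono)
        fix x
        have "(L (\<phi> x))\<^sup>2 \<le> (cmod (\<phi> x))\<^sup>2" using Lc[of "\<phi> x"] by (metis abs_ge_zero power2_abs power_mono)
        then show "indicator (ball a t) x * (L (\<phi> x))\<^sup>2 \<le> indicator (ball a t) x * (cmod (\<phi> x))\<^sup>2"
          by (simp add: indicator_def)
      qed (use bb in \<open>auto intro!: continuous_intros cL c\<phi>\<close>)
      have GL: "int_on (ball a R) (\<lambda>x. (G x)\<^sup>2) \<le> \<gamma>\<^sup>2"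
      proof -
        have cG': "continuous_on UNIV (\<lambda>x. complex_of_real (G x))" by (intro continuous_intros cG)
        have "L2_norm (ball a R) (\<lambda>x. complex_of_real (G x)) \<le> \<gamma>"
          unfolding \<gamma>_def
        proof (rule L2_norm_mono_AE[OF continuous_L2[OF cG' bb(1,3)] q])
          show "AE x in lebesgue_on (ball a R). cmod (complex_of_real (G x)) \<le> cmod (?q x)"
            using bm
          proof eventually_elim
            case (elim x)
            have "L (of_real (P x) * \<phi> x) = P x * L (\<phi> x)"
              using linear_cmul[OF lin, of "P x" "\<phi> x"] by (simp add: scaleR_conv_of_real)
            then have "L (?q x) = L (laplacian \<phi> x) - P x * L (\<phi> x)" by (simp add: linear_diff[OF lin])
            then have "\<bar>L (laplacian \<phi> x)\<bar> \<le> \<bar>L (?q x)\<bar> + \<bar>P x * L (\<phi> x)\<bar>" by linarith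
            moreover have "\<bar>P x * L (\<phi> x)\<bar> \<le> M * \<bar>L (\<phi> x)\<bar>"
              unfolding abs_mult using elim by (intro mult_right_mono) auto
            ultimately have "G x \<le> cmod (?q x)" using Lc[of "?q x"] by (simp add: G_def)
            then show ?case by (simp add: G_def)
          qed
        qed
        then have "(L2_norm (ball a R) (\<lambda>x. complex_of_real (G x)))\<^sup>2 \<le> \<gamma>\<^sup>2"
          by (intro power_mono) (auto simp: L2_norm_nonneg)
        then show ?thesis unfolding int_on_cmod[OF cG' bb(2), symmetric] by simp
      qed
      have "(int_on (ball a r\<^sub>1) (\<lambda>x. (L (\<phi> x))\<^sup>2) + int_on (ball a R) (\<lambda>x. (G x)\<^sup>2)) powr \<kappa> *
         (int_on (ball a R) (\<lambda>x. (L (\<phi> x))\<^sup>2) + int_on (ball a R) (\<lambda>x. (G x)\<^sup>2)) powr (1 - \<kappa>)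
        \<le> (\<alpha>\<^sup>2 + \<gamma>\<^sup>2) powr \<kappa> * (\<beta>\<^sup>2 + \<gamma>\<^sup>2) powr (1 - \<kappa>)"
        using \<kappa> hL[of r\<^sub>1] hL[of R] GL unfolding \<alpha>_def \<beta>_def
        by (intro mult_mono powr_mono2 add_mono add_nonneg_nonneg int_on_nonneg) auto
      also have "\<dots> \<le> ((\<alpha> + \<gamma>) powr \<kappa> * (\<beta> + \<gamma>) powr (1 - \<kappa>))\<^sup>2"
        using nn \<kappa> by (intro powr_add_square_le) auto
      finally show ?thesis using m unfolding T_def by (meson exp_ge_zero mult_left_mono order_trans)
    qed
    let ?S = "(L2_norm (ball a r\<^sub>2) \<phi>)\<^sup>2 + (\<Sum>i\<in>UNIV. (L2_norm (ball a r\<^sub>2) (partial i \<phi>))\<^sup>2)"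
    have "?S = int_on (ball a r\<^sub>2) (\<lambda>x. (cmod (\<phi> x))\<^sup>2) + (\<Sum>i\<in>UNIV. int_on (ball a r\<^sub>2) (\<lambda>x. (cmod (partial i \<phi> x))\<^sup>2))"
      by (simp add: int_on_cmod[OF c\<phi> bb(2)] int_on_cmod[OF cp bb(2)])
    also have "\<dots> = int_on (ball a r\<^sub>2) (\<lambda>x. (cmod (\<phi> x))\<^sup>2 + (\<Sum>i\<in>UNIV. (cmod (partial i \<phi> x))\<^sup>2))"
    proof -
      have i: "integrable lborel (\<lambda>x. indicator (ball a r\<^sub>2) x * (cmod (\<phi> x))\<^sup>2)"
        "integrable lborel (\<lambda>x. indicator (ball a r\<^sub>2) x * (cmod (partial i \<phi> x))\<^sup>2)" for i
        by (intro integrable_int_on continuous_intros c\<phi> cp bb)+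
      show ?thesis
        unfolding int_on_def distrib_left sum_distrib_left
        unfolding Bochner_Integration.integral_add[OF i(1) Bochner_Integration.integrable_sum[OF i(2)]]
          Bochner_Integration.integral_sum[OF i(2)] ..
    qed
    also have "\<dots> = int_on (ball a r\<^sub>2) (\<lambda>x. ((Re (\<phi> x))\<^sup>2 + grad_of Re \<phi> x \<bullet> grad_of Re \<phi> x)
        + ((Im (\<phi> x))\<^sup>2 + grad_of Im \<phi> x \<bullet> grad_of Im \<phi> x))"
    proof -
      have "(cmod (\<phi> x))\<^sup>2 + (\<Sum>i\<in>UNIV. (cmod (partial i \<phi> x))\<^sup>2) = ((Re (\<phi> x))\<^sup>2 + grad_of Re \<phi> x \<bullet> grad_of Re \<phi> x)
        + ((Im (\<phi> x))\<^sup>2 + grad_of Im \<phi> x \<bullet> grad_of Im \<phi> x)" for x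
        unfolding cmod_power2 sum.distrib by (simp add: grad_of_def inner_vec_def power2_eq_square)
      then show ?thesis by simp
    qed
    also have "\<dots> = int_on (ball a r\<^sub>2) (\<lambda>x. (Re (\<phi> x))\<^sup>2 + grad_of Re \<phi> x \<bullet> grad_of Re \<phi> x)
        + int_on (ball a r\<^sub>2) (\<lambda>x. (Im (\<phi> x))\<^sup>2 + grad_of Im \<phi> x \<bullet> grad_of Im \<phi> x)"
      unfolding grad_of_def
      by (intro int_on_add continuous_intros continuous_on_vec_lambda c\<phi> cp bb)
    also have "\<dots> \<le> T + T"
      by (intro add_mono comp bounded_linear_Re bounded_linear_Im abs_Re_le_cmod abs_Im_le_cmod)
    \<comment> \<open>The exponential factor e is at least 1, so 2 e \<le> (2 e)^2 and the whole
      bound becomes a square.\<close>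
    also have "\<dots> \<le> (2 * exp (C * (M powr (2/3) + 1)) * ((\<alpha> + \<gamma>) powr \<kappa> * (\<beta> + \<gamma>) powr (1 - \<kappa>)))\<^sup>2"
    proof -
      define e where "e = exp (C * (M powr (2/3) + 1))"
      have "e \<ge> 1" using C M by (simp add: e_def)
      then have "2 * e \<le> (2 * e)\<^sup>2" by (simp add: power2_eq_square)
      then have "2 * e * ((\<alpha> + \<gamma>) powr \<kappa> * (\<beta> + \<gamma>) powr (1 - \<kappa>))\<^sup>2 \<le> (2 * e)\<^sup>2 * ((\<alpha> + \<gamma>) powr \<kappa> * (\<beta> + \<gamma>) powr (1 - \<kappa>))\<^sup>2"
        by (rule mult_right_mono) simp
      then show ?thesis unfolding T_def e_def[symmetric] power_mult_distrib[of "2 * e"] by simp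
    qed
    finally have "?S \<le> (2 * exp (C * (M powr (2/3) + 1)) * ((\<alpha> + \<gamma>) powr \<kappa> * (\<beta> + \<gamma>) powr (1 - \<kappa>)))\<^sup>2" .
    then show "sqrt ?S \<le> 2 * exp (C * (Linf_norm \<Omega> P powr (2/3) + 1)) *
      ((L2_norm (ball a r\<^sub>1) \<phi> + L2_norm (ball a R) ?q) powr \<kappa> * (L2_norm (ball a R) \<phi> + L2_norm (ball a R) ?q) powr (1 - \<kappa>))"
      unfolding M_def \<alpha>_def \<beta>_def \<gamma>_def by (intro real_le_lsqrt) auto
  qed
qed

section \<open>Translated kernels and the mollified equation\<close>

lemma L2_norm_translate:
  fixes \<kappa> :: "real^'n \<Rightarrow> complex"
  assumes "continuous_on UNIV \<kappa>"
  shows "L2_norm UNIV (\<lambda>y. \<kappa> (y - x)) = L2_norm UNIV \<kappa>"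
proof -
  have m: "(\<lambda>y. (cmod (\<kappa> y))\<^sup>2) \<in> borel_measurable borel"
    by (intro borel_measurable_continuous_onI continuous_intros assms)
  have m': "(\<lambda>y. (cmod (\<kappa> (y - x)))\<^sup>2) \<in> borel_measurable borel"
    by (intro borel_measurable_continuous_onI continuous_intros continuous_shift assms)
  have d: "distr lborel borel ((+) (- x)) = (lborel :: (real^'n) measure)" by (rule lborel_distr_plus)
  have "(\<integral>y. (cmod (\<kappa> y))\<^sup>2 \<partial>lborel) = (\<integral>y. (cmod (\<kappa> (y - x)))\<^sup>2 \<partial>lborel)"
    using integral_distr[of "(+) (- x)" lborel borel "\<lambda>y. (cmod (\<kappa> y))\<^sup>2"] m unfolding d by simp
  then show ?thesis
    unfolding L2_norm_UNIV
    using integral_completion[of "\<lambda>y. (cmod (\<kappa> y))\<^sup>2" lborel] integral_completion[of "\<lambda>y. (cmod (\<kappa> (y - x)))\<^sup>2" lborel] m m'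
    by simp
qed

lemma L2_norm_le_tnorm: "L2_norm UNIV \<phi> \<le> tnorm \<phi>" "L2_norm UNIV (partial i \<phi>) \<le> tnorm \<phi>"
proof -
  have s: "0 \<le> (\<Sum>i\<in>UNIV. (L2_norm UNIV (partial i \<phi>))\<^sup>2)" by (intro sum_nonneg) simp
  show "L2_norm UNIV \<phi> \<le> tnorm \<phi>" unfolding tnorm_def using s by (intro real_le_rsqrt) simp
  have "(L2_norm UNIV (partial i \<phi>))\<^sup>2 \<le> (\<Sum>i\<in>UNIV. (L2_norm UNIV (partial i \<phi>))\<^sup>2)"
    by (rule member_le_sum) auto
  then show "L2_norm UNIV (partial i \<phi>) \<le> tnorm \<phi>" unfolding tnorm_def by (intro real_le_rsqrt) (simp add: add_increasing)
qed

lemma tnorm_translate: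
  assumes "\<kappa> \<in> test_functions UNIV" shows "tnorm (\<lambda>y. \<kappa> (y - x)) = tnorm \<kappa>"
  unfolding tnorm_def partial_translate[OF test_functions_differentiable[OF assms]]
    L2_norm_translate[OF test_functions_continuous[OF assms]]
    L2_norm_translate[OF test_functions_continuous[OF test_functions_partial[OF assms]]] ..

lemma moll_test_function:
  assumes "0 < \<delta>" "cball x \<delta> \<subseteq> \<Omega>"
  shows "(\<lambda>y. mollifier \<delta> (y - x)) \<in> test_functions \<Omega>"
proof (rule test_functions_translate[OF mollifier_test_function[OF assms(1)] _ assms(2)])
  show "norm z \<le> \<delta>" if "mollifier \<delta> z \<noteq> 0" for z :: "real^'a"
    using that eta_outside[OF assms(1), of z] by (cases "\<delta> \<le> norm z") (auto simp: mollifier_def)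
qed

text \<open>Derivatives in x fall on the kernel, where the weak identities for u and w apply. The
  last bracket is the representation error tested with one kernel, which is how an error in the dual
  space becomes a number at each x.\<close>

lemma moll_equation:
  fixes \<Omega> :: "(real^'n) set" and u w :: "real^'n \<Rightarrow> complex" and \<delta> :: real
  defines "f \<equiv> \<lambda>y. zext \<Omega> u y - w y" and "\<psi> \<equiv> \<lambda>x y. mollifier \<delta> (y - x)"
  assumes \<Omega>: "open \<Omega>" and P: "P \<in> Linf \<Omega>" and u: "u \<in> H1 \<Omega>" and w: "w \<in> test_functions \<Omega>"
    and \<delta>: "0 < \<delta>" "cball x \<delta> \<subseteq> \<Omega>"
  shows "partial i (moll \<delta> f) x = moll \<delta> (zext \<Omega> (weak_partial \<Omega> i u)) x - moll \<delta> (partial i w) x"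
    and "laplacian (moll \<delta> f) x = moll \<delta> (zext \<Omega> (\<lambda>x. of_real (P x) * u x)) x - moll \<delta> w x
      - (schroedinger \<Omega> P u (\<psi> x) - test_form w (\<lambda>i. partial i w) (\<psi> x))"
proof -
  note Om = open_lebesgue[OF \<Omega>]
  let ?G = "\<lambda>i. zext \<Omega> (weak_partial \<Omega> i u)"
  let ?Q = "zext \<Omega> (\<lambda>x. of_real (P x) * u x)"
  have U: "zext \<Omega> u \<in> L2 UNIV" using H1_D(1)[OF u \<Omega>] Om by (simp add: zext_L2_UNIV_iff)
  have G: "?G i \<in> L2 UNIV" for i using H1_D(3)[OF u \<Omega>] Om by (simp add: zext_L2_UNIV_iff)
  have Q: "?Q \<in> L2 UNIV" using Linf_mult_L2(1)[OF P H1_D(1)[OF u \<Omega>]] Om by (simp add: zext_L2_UNIV_iff)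
  have W: "w \<in> L2 UNIV" "partial i w \<in> L2 UNIV" for i
    using test_L2_UNIV w test_functions_partial[OF w] by blast+
  have f: "f \<in> L2 UNIV" unfolding f_def by (rule L2_diff[OF U W(1)])
  note lf = loc_int_L2[OF f]
  note k = mollifier_test_function[OF \<delta>(1), where 'n='n]
  have \<psi>: "\<psi> x \<in> test_functions \<Omega>" unfolding \<psi>_def by (rule moll_test_function[OF \<delta>])
  have p1: "partial i (\<psi> x) = (\<lambda>y. partial i (mollifier \<delta>) (y - x))" for i
    unfolding \<psi>_def by (rule partial_translate[OF test_functions_differentiable[OF k]])
  have p2: "partial i (partial i (\<psi> x)) = (\<lambda>y. partial i (partial i (mollifier \<delta>)) (y - x))" for i
    unfolding p1 by (rule partial_translate[OF test_functions_differentiable[OF test_functions_partial[OF k]]])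
  \<comment> \<open>The extension by zero may jump at the boundary of \<Omega>; test functions
    supported in \<Omega> do not see this.\<close>
  have weak: "(\<integral>y. f y * partial i \<theta> y \<partial>lebesgue) = - ((\<integral>y. ?G i y * \<theta> y \<partial>lebesgue) - (\<integral>y. partial i w y * \<theta> y \<partial>lebesgue))"
    if \<theta>: "\<theta> \<in> test_functions \<Omega>" for \<theta> i
  proof -
    note pt = test_functions_partial[OF \<theta>, of i]
    have z: "(\<lambda>y. zext \<Omega> v y * \<xi> y) = (\<lambda>y. v y * \<xi> y)" if "\<xi> \<in> test_functions \<Omega>" for v \<xi> :: "real^'n \<Rightarrow> complex"
      using test_functions_zero_outside[OF that] by (intro ext) (auto simp: zext_def split: split_indicator)
    have "(\<integral>y. f y * partial i \<theta> y \<partial>lebesgue) =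
        (\<integral>y. zext \<Omega> u y * partial i \<theta> y \<partial>lebesgue) - (\<integral>y. w y * partial i \<theta> y \<partial>lebesgue)"
      unfolding f_def left_diff_distrib
      by (intro Bochner_Integration.integral_diff L2_pairing_UNIV U W test_L2_UNIV[OF pt])
    also have "(\<integral>y. zext \<Omega> u y * partial i \<theta> y \<partial>lebesgue) = - (\<integral>y. ?G i y * \<theta> y \<partial>lebesgue)"
      using has_weak_partialD(3)[OF H1_D(2)[OF u \<Omega>] \<theta>, of i]
      unfolding integral_mult_test_eq[OF \<Omega> \<theta>] integral_mult_test_eq[OF \<Omega> pt] z[OF \<theta>] z[OF pt] .
    also have "(\<integral>y. w y * partial i \<theta> y \<partial>lebesgue) = - (\<integral>y. partial i w y * \<theta> y \<partial>lebesgue)"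
      using has_weak_partialD(3)[OF has_weak_partial_test[OF \<Omega> w] \<theta>, of i]
      unfolding integral_mult_test_eq[OF \<Omega> \<theta>] integral_mult_test_eq[OF \<Omega> pt] .
    finally show ?thesis by simp
  qed
  have mo: "moll \<delta> v x = (\<integral>y. v y * \<psi> x y \<partial>lebesgue)" for v
    unfolding conv_def \<psi>_def by (simp add: mult.commute)
  have "partial i (moll \<delta> f) x = - (\<integral>y. f y * partial i (\<psi> x) y \<partial>lebesgue)" for i
    unfolding partial_conv[OF lf k] p1 by (simp add: conv_def mult.commute)
  then show "partial i (moll \<delta> f) x = moll \<delta> (?G i) x - moll \<delta> (partial i w) x"
    unfolding weak[OF \<psi>] mo by simp
  have "partial i (partial i (moll \<delta> f)) x = (\<integral>y. f y * partial i (partial i (\<psi> x)) y \<partial>lebesgue)" for i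
    unfolding partial_partial_moll[OF lf \<delta>(1)] p2 by (simp add: conv_def mult.commute)
  then have "laplacian (moll \<delta> f) x = - (\<Sum>i\<in>UNIV. \<integral>y. ?G i y * partial i (\<psi> x) y \<partial>lebesgue)
      + (\<Sum>i\<in>UNIV. \<integral>y. partial i w y * partial i (\<psi> x) y \<partial>lebesgue)"
    unfolding laplacian_def weak[OF test_functions_partial[OF \<psi>]]
    by (simp add: sum_subtractf sum_negf)
  then show "laplacian (moll \<delta> f) x = moll \<delta> ?Q x - moll \<delta> w x
      - (schroedinger \<Omega> P u (\<psi> x) - test_form w (\<lambda>i. partial i w) (\<psi> x))"
    unfolding schroedinger_test[OF \<Omega> P u \<psi>] test_form_def mo by simp
qed

lemma L2_norm_cong: "(\<And>x. x \<in> S \<Longrightarrow> f x = g x) \<Longrightarrow> L2_norm S f = L2_norm S g"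
  unfolding L2_norm_def by (intro arg_cong[where f=sqrt] Bochner_Integration.integral_cong) (auto simp: space_restrict_space)

lemma L2_norm_le_sup:
  fixes E :: "real^'n \<Rightarrow> complex"
  assumes S: "bounded S" "S \<in> sets lebesgue" and E: "\<And>x. x \<in> S \<Longrightarrow> cmod (E x) \<le> c" and c: "0 \<le> c"
  shows "L2_norm S E \<le> c * sqrt (measure lebesgue S)"
proof -
  have Sl: "S \<in> lmeasurable" using bounded_set_imp_lmeasurable[OF S] .
  have i: "integrable lebesgue (\<lambda>x. c\<^sup>2 * indicator S x)"
    using Sl lmeasurable_iff_integrable by (intro integrable_mult_right) blast
  have "(\<integral>x. (cmod (zext S E x))\<^sup>2 \<partial>lebesgue) \<le> (\<integral>x. c\<^sup>2 * indicator S x \<partial>lebesgue)"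
  proof (rule integral_mono'[OF i])
    fix x show "(cmod (zext S E x))\<^sup>2 \<le> c\<^sup>2 * indicator S x"
      using power_mono[OF E[of x] norm_ge_zero, of 2] by (cases "x \<in> S") (auto simp: zext_def)
  qed auto
  also have "\<dots> = c\<^sup>2 * measure lebesgue S" using S by simp
  finally have "L2_norm UNIV (zext S E) \<le> sqrt (c\<^sup>2 * measure lebesgue S)"
    unfolding L2_norm_UNIV by (rule real_sqrt_le_mono)
  then show ?thesis using c by (simp add: L2_norm_zext[OF S(2)] real_sqrt_mult)
qed

lemma L2_norm_sum3: "L2_norm S (\<lambda>x. a x + b x - c x) \<le> L2_norm S a + L2_norm S b + L2_norm S c"
  if "a \<in> L2 S" "b \<in> L2 S" "c \<in> L2 S"
  using L2_norm_diff[OF L2_add[OF that(1,2)] that(3)] L2_norm_triangle[OF that(1,2)] by linarith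

lemma sqrt_square_sum_le:
  fixes b :: "'i::finite \<Rightarrow> real"
  assumes "0 \<le> a" "\<And>i. 0 \<le> b i" "a \<le> X" "\<And>i. b i \<le> X"
  shows "sqrt (a\<^sup>2 + (\<Sum>i\<in>UNIV. (b i)\<^sup>2)) \<le> (real CARD('i) + 1) * X"
proof -
  have "sqrt (a\<^sup>2 + (\<Sum>i\<in>UNIV. (b i)\<^sup>2)) \<le> sqrt (a\<^sup>2) + sqrt (\<Sum>i\<in>UNIV. (b i)\<^sup>2)"
    by (intro sqrt_add_le_add_sqrt sum_nonneg) auto
  also have "\<dots> \<le> a + (\<Sum>i\<in>UNIV. b i)"
    using L2_set_le_sum[of UNIV b] assms by (simp add: L2_set_def)
  also have "\<dots> \<le> X + (\<Sum>i\<in>(UNIV::'i set). X)" using assms by (intro add_mono sum_mono) auto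
  finally show ?thesis by (simp add: algebra_simps)
qed

text \<open>The ball is connected and contains a point of \<Omega>; if it left \<Omega>, it would
  meet the frontier at distance less than R.\<close>

lemma ball_subset_of_boundary_dist:
  fixes x\<^sub>0 :: "real^'n"
  assumes "x\<^sub>0 \<in> \<Omega>" "ereal R < boundary_dist x\<^sub>0 \<Omega>"
  shows "ball x\<^sub>0 R \<subseteq> \<Omega>"
proof (rule ccontr)
  assume n: "\<not> ?thesis"
  then have "0 < R" by (metis ball_empty empty_subsetI not_less)
  then have "x\<^sub>0 \<in> ball x\<^sub>0 R" by simp
  then have "ball x\<^sub>0 R \<inter> \<Omega> \<noteq> {}" using assms(1) by blast
  then obtain z where z: "z \<in> ball x\<^sub>0 R" "z \<in> frontier \<Omega>"
    using connected_Int_frontier[of "ball x\<^sub>0 R" \<Omega>] n by auto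
  have "boundary_dist x\<^sub>0 \<Omega> \<le> ereal (dist x\<^sub>0 z)"
    unfolding boundary_dist_def by (rule INF_lower[OF z(2)])
  then have "ereal R < ereal (dist x\<^sub>0 z)" using assms(2) by (rule order_less_le_trans[rotated])
  then show False using z(1) by simp
qed

lemma moll_converges_finite:
  fixes f :: "'i::finite \<Rightarrow> real^'n \<Rightarrow> complex"
  assumes "\<And>i. f i \<in> L2 UNIV" "0 < e"
  shows "\<exists>d>0. \<forall>\<delta>. 0 < \<delta> \<and> \<delta> < d \<longrightarrow> (\<forall>i. L2_norm UNIV (\<lambda>x. moll \<delta> (f i) x - f i x) < e)"
proof -
  have "\<forall>i. \<exists>d. d > 0 \<and> (\<forall>\<delta>. 0 < \<delta> \<and> \<delta> < d \<longrightarrow> L2_norm UNIV (\<lambda>x. moll \<delta> (f i) x - f i x) < e)"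
    using moll_converges[OF assms(1) assms(2)] by blast
  from choice[OF this] obtain d where d: "\<And>i. d i > 0"
    "\<And>i \<delta>. 0 < \<delta> \<Longrightarrow> \<delta> < d i \<Longrightarrow> L2_norm UNIV (\<lambda>x. moll \<delta> (f i) x - f i x) < e" by blast
  have "Min (range d) > 0" using d(1) by (subst Min_gr_iff) auto
  moreover have "L2_norm UNIV (\<lambda>x. moll \<delta> (f i) x - f i x) < e" if "0 < \<delta>" "\<delta> < Min (range d)" for \<delta> i
  proof -
    have "Min (range d) \<le> d i" by (intro Min_le) auto
    then show ?thesis using d(2)[OF that(1)] that(2) by (meson order_less_le_trans)
  qed
  ultimately show ?thesis by blast
qed

text \<open>The scale, the accuracy \<eta> and \<open>w\<close> all depend on \<epsilon>, but
  \<open>K\<close> and \<kappa> do not, so \<epsilon> can tend to 0 afterwards. \<open>main\<close>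
  is applied to the mollification of u - w, from which u and its weak derivatives are recovered up
  to errors N + \<eta> + \<epsilon> in norm.\<close>

lemma three_ball_approximate:
  fixes \<Omega> :: "(real^'n) set" and x\<^sub>0 :: "real^'n" and u :: "real^'n \<Rightarrow> complex" and P :: "real^'n \<Rightarrow> real" and \<kappa> K r\<^sub>1 r\<^sub>2 R R' \<epsilon> :: real
  defines "M \<equiv> Linf_norm \<Omega> P" and "N \<equiv> Hm1_norm \<Omega> (schroedinger \<Omega> P u)"
  assumes \<kappa>: "0 < \<kappa>" "\<kappa> < 1" and K: "0 \<le> K"
    and main: "\<And>\<phi> :: real^'n \<Rightarrow> complex. (\<And>k. Ck k \<phi>) \<Longrightarrow> (\<And>i j. partial i (partial j \<phi>) = partial j (partial i \<phi>)) \<Longrightarrow>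
      (\<lambda>x. laplacian \<phi> x - of_real (P x) * \<phi> x) \<in> L2 (ball x\<^sub>0 R) \<and>
      sqrt ((L2_norm (ball x\<^sub>0 r\<^sub>2) \<phi>)\<^sup>2 + (\<Sum>i\<in>UNIV. (L2_norm (ball x\<^sub>0 r\<^sub>2) (partial i \<phi>))\<^sup>2)) \<le>
      K * ((L2_norm (ball x\<^sub>0 r\<^sub>1) \<phi> + L2_norm (ball x\<^sub>0 R) (\<lambda>x. laplacian \<phi> x - of_real (P x) * \<phi> x)) powr \<kappa> *
       (L2_norm (ball x\<^sub>0 R) \<phi> + L2_norm (ball x\<^sub>0 R) (\<lambda>x. laplacian \<phi> x - of_real (P x) * \<phi> x)) powr (1 - \<kappa>))"
    and \<Omega>: "open \<Omega>" "ball x\<^sub>0 R' \<subseteq> \<Omega>" and r: "r\<^sub>1 < r\<^sub>2" "r\<^sub>2 < R" "R < R'"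
    and P: "P \<in> Linf \<Omega>" and u: "u \<in> H1 \<Omega>" and \<epsilon>: "0 < \<epsilon>"
  shows "H1_norm (ball x\<^sub>0 r\<^sub>2) u \<le> (real CARD('n) + 1) * (K * (5 + 2 * M) + 2) *
      ((L2_norm (ball x\<^sub>0 r\<^sub>1) u + N + \<epsilon>) powr \<kappa> * (L2_norm \<Omega> u + N + \<epsilon>) powr (1 - \<kappa>))"
proof -
  note Om = open_lebesgue[OF \<Omega>(1)]
  define U where "U = zext \<Omega> u"
  define G where "G i = zext \<Omega> (weak_partial \<Omega> i u)" for i
  define Q where "Q = zext \<Omega> (\<lambda>x. of_real (P x) * u x)"
  have N0: "0 \<le> N" unfolding N_def by (rule Hm1_norm_nonneg[OF \<Omega>(1) P u])
  have M0: "0 \<le> M" unfolding M_def by (rule Linf_norm_nonneg)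
  have U: "U \<in> L2 UNIV" using H1_D(1)[OF u \<Omega>(1)] Om by (simp add: zext_L2_UNIV_iff U_def)
  have G: "G i \<in> L2 UNIV" for i using H1_D(3)[OF u \<Omega>(1)] Om by (simp add: zext_L2_UNIV_iff G_def)
  have Q: "Q \<in> L2 UNIV" using Linf_mult_L2(1)[OF P H1_D(1)[OF u \<Omega>(1)]] Om by (simp add: zext_L2_UNIV_iff Q_def)
  have BL: "ball x\<^sub>0 t \<in> sets lebesgue" for t by auto
  have LB: "v \<in> L2 (ball x\<^sub>0 t)" "L2_norm (ball x\<^sub>0 t) v \<le> L2_norm UNIV v" if "v \<in> L2 UNIV" for v t
    using L2_subset[OF that subset_UNIV BL] by auto
  have BO: "ball x\<^sub>0 t \<subseteq> \<Omega>" if "t \<le> R'" for t using \<Omega>(2) that by auto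
  obtain dU where dU: "dU > 0" "\<And>\<delta>. 0 < \<delta> \<Longrightarrow> \<delta> < dU \<Longrightarrow> L2_norm UNIV (\<lambda>x. moll \<delta> U x - U x) < \<epsilon>"
    using moll_converges[OF U \<epsilon>] by blast
  obtain dQ where dQ: "dQ > 0" "\<And>\<delta>. 0 < \<delta> \<Longrightarrow> \<delta> < dQ \<Longrightarrow> L2_norm UNIV (\<lambda>x. moll \<delta> Q x - Q x) < \<epsilon>"
    using moll_converges[OF Q \<epsilon>] by blast
  obtain dG where dG: "dG > 0" "\<And>\<delta> i. 0 < \<delta> \<Longrightarrow> \<delta> < dG \<Longrightarrow> L2_norm UNIV (\<lambda>x. moll \<delta> (G i) x - G i x) < \<epsilon>"
    using moll_converges_finite[of G, OF G \<epsilon>] by blast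
  \<comment> \<open>The margin R' - R keeps every kernel centred in the ball of radius R inside
    \<Omega>, where the equation may be tested.\<close>
  have "0 < min (min dU dQ) (min dG (R' - R))" using dU(1) dQ(1) dG(1) r by simp
  then obtain \<delta> where "0 < \<delta>" "\<delta> < min (min dU dQ) (min dG (R' - R))" using dense by blast
  then have \<delta>: "0 < \<delta>" "\<delta> < dU" "\<delta> < dQ" "\<delta> < dG" "\<delta> < R' - R" by auto
  define T where "T = tnorm (mollifier \<delta> :: real^'n \<Rightarrow> complex)"
  define V where "V = sqrt (measure lebesgue (ball x\<^sub>0 R))"
  have T0: "0 \<le> T" and V0: "0 \<le> V" by (auto simp: T_def V_def tnorm_nonneg)
  \<comment> \<open>The pointwise error is at most 2 \<eta> T, hence 2 \<eta> T V in norm over the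
    ball; this choice makes that error and \<eta> itself at most \<epsilon>.\<close>
  define \<eta> where "\<eta> = \<epsilon> / (1 + 2 * T * V)"
  have TV: "1 \<le> 1 + 2 * T * V" using T0 V0 by simp
  have \<eta>0: "0 < \<eta>" unfolding \<eta>_def using TV \<epsilon> by (intro divide_pos_pos) linarith+
  have "\<eta> * (1 + 2 * T * V) = \<epsilon>" unfolding \<eta>_def using TV by simp
  then have "\<eta> + 2 * \<eta> * T * V = \<epsilon>" by (simp add: algebra_simps)
  moreover have "0 \<le> 2 * \<eta> * T * V" using \<eta>0 T0 V0 by simp
  ultimately have \<eta>: "0 < \<eta>" "\<eta> \<le> \<epsilon>" "2 * \<eta> * T * V \<le> \<epsilon>" using \<eta>0 by linarith+
  have "\<exists>w\<in>test_functions \<Omega>. tnorm w \<le> N + \<eta> \<and>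
    (\<forall>\<phi>\<in>test_functions \<Omega>. cmod (test_form Q G \<phi> - test_form w (\<lambda>i. partial i w) \<phi>) \<le> 2 * \<eta> * tnorm \<phi>)"
  proof (rule test_approximate_Riesz[OF Q G N0 _ \<eta>(1)])
    show "cmod (test_form Q G \<phi>) \<le> N * tnorm \<phi>" if "\<phi> \<in> test_functions \<Omega>" for \<phi>
      using Hm1_norm_test[OF \<Omega>(1) P u that] schroedinger_test[OF \<Omega>(1) P u that] by (simp add: N_def Q_def G_def [abs_def])
  qed
  then obtain w where w: "w \<in> test_functions \<Omega>" "tnorm w \<le> N + \<eta>"
    and we: "\<And>\<phi>. \<phi> \<in> test_functions \<Omega> \<Longrightarrow> cmod (test_form Q G \<phi> - test_form w (\<lambda>i. partial i w) \<phi>) \<le> 2 * \<eta> * tnorm \<phi>"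
    by blast
  have W: "w \<in> L2 UNIV" "partial i w \<in> L2 UNIV" for i
    using test_L2_UNIV w(1) test_functions_partial[OF w(1)] by blast+
  note m = moll_contraction[OF _ \<delta>(1)]
  have wn: "L2_norm UNIV (moll \<delta> w) \<le> N + \<eta>" "L2_norm UNIV (moll \<delta> (partial i w)) \<le> N + \<eta>" for i
    using order_trans[OF m(2)[OF W(1)] order_trans[OF L2_norm_le_tnorm(1) w(2)]]
      order_trans[OF m(2)[OF W(2)] order_trans[OF L2_norm_le_tnorm(2) w(2)]] by auto
  define f where "f y = U y - w y" for y
  define h where "h = moll \<delta> f"
  have f: "f \<in> L2 UNIV" unfolding f_def [abs_def] by (rule L2_diff[OF U W(1)])
  have heq: "h x = moll \<delta> U x - moll \<delta> w x" for x
    unfolding h_def f_def [abs_def] by (rule moll_diff[OF loc_int_L2[OF U] loc_int_L2[OF W(1)] \<delta>(1)])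
  have hC: "Ck k h" for k unfolding h_def by (rule Ck_conv[OF loc_int_L2[OF f] mollifier_test_function[OF \<delta>(1)]])
  have hsym: "partial i (partial j h) = partial j (partial i h)" for i j
    unfolding h_def by (rule symmetric_partial_moll[OF loc_int_L2[OF f] \<delta>(1)])
  define \<psi> where "\<psi> x = (\<lambda>y. mollifier \<delta> (y - x))" for x :: "real^'n"
  have cb: "cball x \<delta> \<subseteq> \<Omega>" if "x \<in> ball x\<^sub>0 R" for x
  proof -
    have "cball x \<delta> \<subseteq> ball x\<^sub>0 R'"
    proof
      fix y assume "y \<in> cball x \<delta>"
      then show "y \<in> ball x\<^sub>0 R'" using that \<delta>(5) dist_triangle[of x\<^sub>0 y x] by simp
    qed
    then show ?thesis using \<Omega>(2) by blast
  qed
  \<comment> \<open>The residual of the mollified equation; its value at x is the representation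
    error tested with the kernel centred at x.\<close>
  define e where "e x = moll \<delta> Q x - moll \<delta> w x - laplacian h x" for x
  have ep: "cmod (e x) \<le> 2 * \<eta> * T" if x: "x \<in> ball x\<^sub>0 R" for x
  proof -
    have t: "\<psi> x \<in> test_functions \<Omega>" unfolding \<psi>_def by (rule moll_test_function[OF \<delta>(1) cb[OF x]])
    have "e x = test_form Q G (\<psi> x) - test_form w (\<lambda>i. partial i w) (\<psi> x)"
      using moll_equation(2)[OF \<Omega>(1) P u w(1) \<delta>(1) cb[OF x]] schroedinger_test[OF \<Omega>(1) P u t]
      by (simp add: e_def h_def f_def [abs_def] U_def Q_def G_def [abs_def] \<psi>_def)
    moreover have "tnorm (\<psi> x) = T" unfolding \<psi>_def T_def by (rule tnorm_translate[OF mollifier_test_function[OF \<delta>(1)]])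
    ultimately show ?thesis using we[OF t] by simp
  qed
  have cm: "continuous_on UNIV (moll \<delta> v)" if "v \<in> L2 UNIV" for v :: "real^'n \<Rightarrow> complex"
    by (rule continuous_moll[OF loc_int_L2[OF that] \<delta>(1)])
  have ce: "continuous_on UNIV e" unfolding e_def [abs_def]
    by (intro continuous_intros cm Q W(1) continuous_laplacian hC)
  have eL: "e \<in> L2 (ball x\<^sub>0 R)" by (rule continuous_L2[OF ce _ BL]) simp
  have en: "L2_norm (ball x\<^sub>0 R) e \<le> \<epsilon>"
  proof -
    have "L2_norm (ball x\<^sub>0 R) e \<le> (2 * \<eta> * T) * sqrt (measure lebesgue (ball x\<^sub>0 R))"
      by (rule L2_norm_le_sup[OF _ BL ep]) (use \<eta>(1) T0 in auto)
    then show ?thesis using \<eta>(3) by (simp add: V_def)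
  qed
  have PL: "(\<lambda>x. of_real (P x) * v x) \<in> L2 (ball x\<^sub>0 R)"
    "L2_norm (ball x\<^sub>0 R) (\<lambda>x. of_real (P x) * v x) \<le> M * L2_norm UNIV v" if v: "v \<in> L2 UNIV" for v
  proof -
    have vO: "v \<in> L2 \<Omega>" "L2_norm \<Omega> v \<le> L2_norm UNIV v" using L2_subset[OF v subset_UNIV Om] by auto
    note s = L2_subset[OF Linf_mult_L2(1)[OF P vO(1)] BO[of R] BL Om]
    show "(\<lambda>x. of_real (P x) * v x) \<in> L2 (ball x\<^sub>0 R)" using s(1) r by simp
    have "L2_norm (ball x\<^sub>0 R) (\<lambda>x. of_real (P x) * v x) \<le> M * L2_norm \<Omega> v"
      using s(2) r Linf_mult_L2(2)[OF P vO(1)] unfolding M_def by (meson less_imp_le order_trans)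
    also have "\<dots> \<le> M * L2_norm UNIV v" using vO(2) M0 by (rule mult_left_mono)
    finally show "L2_norm (ball x\<^sub>0 R) (\<lambda>x. of_real (P x) * v x) \<le> M * L2_norm UNIV v" .
  qed
  define q where "q x = laplacian h x - of_real (P x) * h x" for x
  define \<gamma> where "\<gamma> = L2_norm (ball x\<^sub>0 R) q"
  have dUL: "(\<lambda>x. moll \<delta> U x - U x) \<in> L2 UNIV" by (intro L2_diff m(1) U)
  have dQL: "(\<lambda>x. moll \<delta> Q x - Q x) \<in> L2 UNIV" by (intro L2_diff m(1) Q)
  have mw: "moll \<delta> w \<in> L2 UNIV" by (intro m(1) W)
  have \<gamma>: "\<gamma> \<le> (2 + M) * \<epsilon> + (1 + M) * (N + \<eta>)"
  proof -
    \<comment> \<open>P does not commute with mollification. Comparing both the mollified P u and P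
      times the mollified u with P u itself costs \<epsilon> and M \<epsilon>; what remains is the
      residual and two terms with the mollified w.\<close>
    let ?a1 = "\<lambda>x. moll \<delta> Q x - Q x" and ?a2 = "\<lambda>x. of_real (P x) * (moll \<delta> U x - U x)"
      and ?a4 = "\<lambda>x. of_real (P x) * moll \<delta> w x"
    have "\<gamma> = L2_norm (ball x\<^sub>0 R) (\<lambda>x. (?a1 x + ?a4 x - moll \<delta> w x) - (e x + ?a2 x))"
      unfolding \<gamma>_def
    proof (rule L2_norm_cong)
      fix x assume "x \<in> ball x\<^sub>0 R"
      then have "x \<in> \<Omega>" using BO[of R] r by auto
      then have "Q x = of_real (P x) * U x" by (simp add: Q_def U_def zext_def)
      then show "q x = (?a1 x + ?a4 x - moll \<delta> w x) - (e x + ?a2 x)"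
        by (simp add: q_def e_def heq algebra_simps)
    qed
    also have "\<dots> \<le> L2_norm (ball x\<^sub>0 R) (\<lambda>x. ?a1 x + ?a4 x - moll \<delta> w x) + L2_norm (ball x\<^sub>0 R) (\<lambda>x. e x + ?a2 x)"
      by (intro L2_norm_diff L2_diff L2_add LB(1) PL(1) dQL dUL mw eL)
    also have "L2_norm (ball x\<^sub>0 R) (\<lambda>x. ?a1 x + ?a4 x - moll \<delta> w x) \<le>
        L2_norm (ball x\<^sub>0 R) ?a1 + L2_norm (ball x\<^sub>0 R) ?a4 + L2_norm (ball x\<^sub>0 R) (moll \<delta> w)"
      by (intro L2_norm_sum3 LB(1) PL(1) dQL mw)
    also have "L2_norm (ball x\<^sub>0 R) (\<lambda>x. e x + ?a2 x) \<le> L2_norm (ball x\<^sub>0 R) e + L2_norm (ball x\<^sub>0 R) ?a2"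
      by (intro L2_norm_triangle PL(1) dUL eL)
    also have "L2_norm (ball x\<^sub>0 R) ?a1 \<le> \<epsilon>" using LB(2)[OF dQL, of R] dQ(2)[OF \<delta>(1,3)] by linarith
    also have "L2_norm (ball x\<^sub>0 R) ?a4 \<le> M * (N + \<eta>)"
      using PL(2)[OF mw] mult_left_mono[OF wn(1) M0] by linarith
    also have "L2_norm (ball x\<^sub>0 R) (moll \<delta> w) \<le> N + \<eta>" using LB(2)[OF mw, of R] wn(1) by linarith
    also have "L2_norm (ball x\<^sub>0 R) e \<le> \<epsilon>" by (rule en)
    also have "L2_norm (ball x\<^sub>0 R) ?a2 \<le> M * \<epsilon>"
      using PL(2)[OF dUL] mult_left_mono[OF less_imp_le[OF dU(2)[OF \<delta>(1,2)]] M0] by linarith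
    finally show ?thesis by (simp add: algebra_simps)
  qed
  have hn: "L2_norm (ball x\<^sub>0 t) h \<le> L2_norm (ball x\<^sub>0 t) u + \<epsilon> + (N + \<eta>)" if t: "t \<le> R'" for t
  proof -
    have "L2_norm (ball x\<^sub>0 t) h = L2_norm (ball x\<^sub>0 t) (\<lambda>x. U x + (moll \<delta> U x - U x) - moll \<delta> w x)"
      by (rule L2_norm_cong) (simp add: heq)
    also have "\<dots> \<le> L2_norm (ball x\<^sub>0 t) U + L2_norm (ball x\<^sub>0 t) (\<lambda>x. moll \<delta> U x - U x) + L2_norm (ball x\<^sub>0 t) (moll \<delta> w)"
      by (intro L2_norm_sum3 LB(1) U dUL mw)
    also have "L2_norm (ball x\<^sub>0 t) U = L2_norm (ball x\<^sub>0 t) u"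
      by (rule L2_norm_cong) (use BO[OF t] in \<open>auto simp: U_def zext_def\<close>)
    also have "L2_norm (ball x\<^sub>0 t) (\<lambda>x. moll \<delta> U x - U x) \<le> \<epsilon>" using LB(2)[OF dUL, of t] dU(2)[OF \<delta>(1,2)] by linarith
    also have "L2_norm (ball x\<^sub>0 t) (moll \<delta> w) \<le> N + \<eta>" using LB(2)[OF mw, of t] wn(1) by linarith
    finally show ?thesis by simp
  qed
  define A where "A = L2_norm (ball x\<^sub>0 r\<^sub>1) u + N + \<epsilon>"
  define B where "B = L2_norm \<Omega> u + N + \<epsilon>"
  have uB: "L2_norm (ball x\<^sub>0 t) u \<le> L2_norm \<Omega> u" if "t \<le> R'" for t
    by (rule L2_subset(2)[OF H1_D(1)[OF u \<Omega>(1)] BO[OF that] BL Om])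
  have A0: "0 < A" and AB: "A \<le> B" using N0 \<epsilon> L2_norm_nonneg[of "ball x\<^sub>0 r\<^sub>1" u] uB[of r\<^sub>1] r by (auto simp: A_def B_def)
  \<comment> \<open>After \<eta> is replaced by \<epsilon>, the coefficient of \<epsilon> is 1 + 1 +
    (2 + M) + (1 + M), the largest one that occurs.\<close>
  define F where "F = 5 + 2 * M"
  have F0: "0 \<le> F" using M0 by (simp add: F_def)
  have bnd: "a + \<epsilon> + (N + \<eta>) + \<gamma> \<le> F * (a + N + \<epsilon>)" if "0 \<le> a" for a
  proof -
    have "(1 + M) * \<eta> \<le> (1 + M) * \<epsilon>" using \<eta>(2) M0 by (intro mult_left_mono) auto
    moreover have "0 \<le> M * a" "0 \<le> M * N" "0 \<le> M * \<epsilon>" using M0 that N0 \<epsilon> by auto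
    ultimately show ?thesis using \<gamma> \<eta>(2) that N0 \<epsilon> by (simp add: F_def algebra_simps)
  qed
  have \<gamma>0: "0 \<le> \<gamma>" by (simp add: \<gamma>_def L2_norm_nonneg)
  have al: "L2_norm (ball x\<^sub>0 r\<^sub>1) h + \<gamma> \<le> F * A"
    using hn[of r\<^sub>1] bnd[of "L2_norm (ball x\<^sub>0 r\<^sub>1) u"] L2_norm_nonneg[of "ball x\<^sub>0 r\<^sub>1" u] r by (simp add: A_def)
  have be: "L2_norm (ball x\<^sub>0 R) h + \<gamma> \<le> F * B"
    using hn[of R] uB[of R] bnd[of "L2_norm \<Omega> u"] L2_norm_nonneg[of \<Omega> u] r by (simp add: B_def)
  define D where "D = A powr \<kappa> * B powr (1 - \<kappa>)"
  define H where "H = sqrt ((L2_norm (ball x\<^sub>0 r\<^sub>2) h)\<^sup>2 + (\<Sum>i\<in>UNIV. (L2_norm (ball x\<^sub>0 r\<^sub>2) (partial i h))\<^sup>2))"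
  have "H \<le> K * ((L2_norm (ball x\<^sub>0 r\<^sub>1) h + \<gamma>) powr \<kappa> * (L2_norm (ball x\<^sub>0 R) h + \<gamma>) powr (1 - \<kappa>))"
    unfolding H_def \<gamma>_def q_def using main[OF hC hsym] by blast
  also have "\<dots> \<le> K * ((F * A) powr \<kappa> * (F * B) powr (1 - \<kappa>))"
    using al be \<kappa> K \<gamma>0 by (intro mult_left_mono mult_mono powr_mono2) (auto simp: L2_norm_nonneg)
  also have "(F * A) powr \<kappa> * (F * B) powr (1 - \<kappa>) = F * D"
  proof -
    have "F powr \<kappa> * F powr (1 - \<kappa>) = F" using M0 by (simp add: F_def flip: powr_add)
    then show ?thesis using F0 A0 AB by (simp add: powr_mult D_def mult_ac)
  qed
  finally have HD: "H \<le> K * F * D" by simp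
  \<comment> \<open>Since A \<le> B, the geometric mean dominates A, and with it the additive errors
    of undoing the mollification and the subtraction of w.\<close>
  have AD: "A \<le> D"
  proof -
    have "A = A powr \<kappa> * A powr (1 - \<kappa>)" using A0 by (simp flip: powr_add)
    also have "\<dots> \<le> D" unfolding D_def using A0 AB \<kappa> by (intro mult_left_mono powr_mono2) auto
    finally show ?thesis .
  qed
  have Xn: "N + \<eta> + \<epsilon> \<le> 2 * D" using AD \<eta>(2) N0 \<epsilon> L2_norm_nonneg[of "ball x\<^sub>0 r\<^sub>1" u] by (simp add: A_def)
  have hs: "0 \<le> (\<Sum>i\<in>UNIV. (L2_norm (ball x\<^sub>0 r\<^sub>2) (partial i h))\<^sup>2)" by (intro sum_nonneg) simp
  have H1: "L2_norm (ball x\<^sub>0 r\<^sub>2) h \<le> H" unfolding H_def using hs by (intro real_le_rsqrt) simp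
  have H2: "L2_norm (ball x\<^sub>0 r\<^sub>2) (partial i h) \<le> H" for i
  proof -
    have "(L2_norm (ball x\<^sub>0 r\<^sub>2) (partial i h))\<^sup>2 \<le> (\<Sum>i\<in>UNIV. (L2_norm (ball x\<^sub>0 r\<^sub>2) (partial i h))\<^sup>2)"
      by (rule member_le_sum) auto
    then show ?thesis unfolding H_def by (intro real_le_rsqrt) (simp add: add_increasing)
  qed
  have hL: "h \<in> L2 (ball x\<^sub>0 r\<^sub>2)" "partial i h \<in> L2 (ball x\<^sub>0 r\<^sub>2)" for i
    using hC[of "Suc 0"] Ck_Suc_imp[OF hC[of "Suc 0"]] BL[of r\<^sub>2] by (auto intro: continuous_L2)
  have u1: "L2_norm (ball x\<^sub>0 r\<^sub>2) u \<le> H + (N + \<eta> + \<epsilon>)"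
  proof -
    have "L2_norm (ball x\<^sub>0 r\<^sub>2) u = L2_norm (ball x\<^sub>0 r\<^sub>2) (\<lambda>x. h x + moll \<delta> w x - (moll \<delta> U x - U x))"
      by (rule L2_norm_cong) (use BO[of r\<^sub>2] r in \<open>auto simp: heq U_def zext_def\<close>)
    also have "\<dots> \<le> L2_norm (ball x\<^sub>0 r\<^sub>2) h + L2_norm (ball x\<^sub>0 r\<^sub>2) (moll \<delta> w) + L2_norm (ball x\<^sub>0 r\<^sub>2) (\<lambda>x. moll \<delta> U x - U x)"
      by (intro L2_norm_sum3 hL LB(1) mw dUL)
    finally show ?thesis using H1 LB(2)[OF mw, of r\<^sub>2] wn(1) LB(2)[OF dUL, of r\<^sub>2] dU(2)[OF \<delta>(1,2)] by linarith
  qed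
  have u2: "L2_norm (ball x\<^sub>0 r\<^sub>2) (weak_partial \<Omega> i u) \<le> H + (N + \<eta> + \<epsilon>)" for i
  proof -
    have mwi: "moll \<delta> (partial i w) \<in> L2 UNIV" by (intro m(1) W)
    have dGL: "(\<lambda>x. moll \<delta> (G i) x - G i x) \<in> L2 UNIV" by (intro L2_diff m(1) G)
    have "L2_norm (ball x\<^sub>0 r\<^sub>2) (weak_partial \<Omega> i u) =
        L2_norm (ball x\<^sub>0 r\<^sub>2) (\<lambda>x. partial i h x + moll \<delta> (partial i w) x - (moll \<delta> (G i) x - G i x))"
    proof (rule L2_norm_cong)
      fix x assume x: "x \<in> ball x\<^sub>0 r\<^sub>2"
      then have "x \<in> ball x\<^sub>0 R" using r by auto
      from moll_equation(1)[OF \<Omega>(1) P u w(1) \<delta>(1) cb[OF this], of i]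
      have "partial i h x = moll \<delta> (G i) x - moll \<delta> (partial i w) x"
        by (simp add: h_def f_def [abs_def] U_def G_def)
      moreover have "G i x = weak_partial \<Omega> i u x" using x BO[of r\<^sub>2] r by (auto simp: G_def zext_def)
      ultimately show "weak_partial \<Omega> i u x = partial i h x + moll \<delta> (partial i w) x - (moll \<delta> (G i) x - G i x)" by simp
    qed
    also have "\<dots> \<le> L2_norm (ball x\<^sub>0 r\<^sub>2) (partial i h) + L2_norm (ball x\<^sub>0 r\<^sub>2) (moll \<delta> (partial i w))
        + L2_norm (ball x\<^sub>0 r\<^sub>2) (\<lambda>x. moll \<delta> (G i) x - G i x)"
      by (intro L2_norm_sum3 hL LB(1) mwi dGL)
    finally show ?thesis using H2[of i] LB(2)[OF mwi, of r\<^sub>2] wn(2)[of i] LB(2)[OF dGL, of r\<^sub>2] dG(2)[OF \<delta>(1,4), of i] by linarith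
  qed
  have "H1_norm (ball x\<^sub>0 r\<^sub>2) u = sqrt ((L2_norm (ball x\<^sub>0 r\<^sub>2) u)\<^sup>2 + (\<Sum>i\<in>UNIV. (L2_norm (ball x\<^sub>0 r\<^sub>2) (weak_partial \<Omega> i u))\<^sup>2))"
    using r by (intro H1_norm_subset[OF u \<Omega>(1)] BO) auto
  also have "\<dots> \<le> (real CARD('n) + 1) * (H + (N + \<eta> + \<epsilon>))"
    by (intro sqrt_square_sum_le L2_norm_nonneg u1 u2)
  also have "\<dots> \<le> (real CARD('n) + 1) * (K * F * D + 2 * D)"
    using HD Xn by (intro mult_left_mono) auto
  also have "\<dots> = (real CARD('n) + 1) * (K * F + 2) * D" by (simp add: algebra_simps)
  finally show ?thesis unfolding F_def D_def A_def B_def .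
qed

theorem corollary2p5:
  fixes \<Omega> :: "(real^'n) set" and x\<^sub>0 :: "real^'n" and r\<^sub>1 r\<^sub>2 :: real
  assumes "open \<Omega>" and "connected \<Omega>" and "x\<^sub>0 \<in> \<Omega>"
    and "0 < r\<^sub>1" and "r\<^sub>1 < r\<^sub>2" and "ereal r\<^sub>2 < boundary_dist x\<^sub>0 \<Omega>"
  shows "\<exists>\<kappa>::real. 0 < \<kappa> \<and> \<kappa> < 1 \<and>
    (\<forall>P\<in>Linf \<Omega>. \<exists>C\<^sub>P>0. \<forall>u\<in>H1 \<Omega>.
       H1_norm (ball x\<^sub>0 r\<^sub>2) u
         \<le> C\<^sub>P * (L2_norm (ball x\<^sub>0 r\<^sub>1) u + Hm1_norm \<Omega> (schroedinger \<Omega> P u)) powr \<kappa>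
              * (L2_norm \<Omega> u + Hm1_norm \<Omega> (schroedinger \<Omega> P u)) powr (1 - \<kappa>)) \<and>
    (\<forall>\<epsilon>::real. 0 < \<epsilon> \<and> \<epsilon> < 1 \<longrightarrow> (\<exists>C>0. \<forall>P\<in>Linf \<Omega>. (AE x in lebesgue_on \<Omega>. 0 \<le> P x) \<longrightarrow>
       (\<forall>u\<in>H1 \<Omega>.
          H1_norm (ball x\<^sub>0 r\<^sub>2) u
            \<le> exp (C * \<kappa> powr (1 - \<epsilon>) * (Linf_norm \<Omega> P powr (2/3) + 1))
                 * (L2_norm (ball x\<^sub>0 r\<^sub>1) u + Hm1_norm \<Omega> (schroedinger \<Omega> P u)) powr \<kappa>
                 * (L2_norm \<Omega> u + Hm1_norm \<Omega> (schroedinger \<Omega> P u)) powr (1 - \<kappa>))))"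
proof -
  \<comment> \<open>Two radii beyond \<open>r\<^sub>2\<close> are needed: the smooth estimate uses
    the ball of radius R, and mollification needs the margin up to R'. Density yields a real R' even
    when the boundary is empty.\<close>
  obtain R' where R': "ereal r\<^sub>2 < ereal R'" "ereal R' < boundary_dist x\<^sub>0 \<Omega>"
    using ereal_dense2[OF assms(6)] by blast
  define R where "R = (r\<^sub>2 + R') / 2"
  have r: "0 < r\<^sub>1" "r\<^sub>1 < r\<^sub>2" "r\<^sub>2 < R" "R < R'" using assms(4,5) R'(1) by (auto simp: R_def)
  have B: "ball x\<^sub>0 R' \<subseteq> \<Omega>" by (rule ball_subset_of_boundary_dist[OF assms(3) R'(2)])
  then have BR: "ball x\<^sub>0 R \<subseteq> \<Omega>" using r(4) by force
  obtain \<kappa> C where \<kappa>: "0 < \<kappa>" "\<kappa> < 1" and C: "0 < C" and main: "\<And>(\<phi> :: real^'n \<Rightarrow> complex) (\<Omega> :: (real^'n) set) P.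
    (\<And>k. Ck k \<phi>) \<Longrightarrow> (\<And>i j. partial i (partial j \<phi>) = partial j (partial i \<phi>)) \<Longrightarrow>
    open \<Omega> \<Longrightarrow> ball x\<^sub>0 R \<subseteq> \<Omega> \<Longrightarrow> P \<in> Linf \<Omega> \<Longrightarrow>
    (\<lambda>x. laplacian \<phi> x - of_real (P x) * \<phi> x) \<in> L2 (ball x\<^sub>0 R) \<and>
    sqrt ((L2_norm (ball x\<^sub>0 r\<^sub>2) \<phi>)\<^sup>2 + (\<Sum>i\<in>UNIV. (L2_norm (ball x\<^sub>0 r\<^sub>2) (partial i \<phi>))\<^sup>2)) \<le>
      2 * exp (C * (Linf_norm \<Omega> P powr (2/3) + 1)) *
      ((L2_norm (ball x\<^sub>0 r\<^sub>1) \<phi> + L2_norm (ball x\<^sub>0 R) (\<lambda>x. laplacian \<phi> x - of_real (P x) * \<phi> x)) powr \<kappa> *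
       (L2_norm (ball x\<^sub>0 R) \<phi> + L2_norm (ball x\<^sub>0 R) (\<lambda>x. laplacian \<phi> x - of_real (P x) * \<phi> x)) powr (1 - \<kappa>))"
    using three_ball_smooth_complex[OF r(1-3), of x\<^sub>0] by blast
  \<comment> \<open>The first summand absorbs the factor 12 (n + 1) through x \<le> exp x; C + 3
    covers the exponents C (t + 1) and 3 t + 2.\<close>
  define C' where "C' = 12 * (real CARD('n) + 1) + C + 3"
  have C': "0 < C'" using C by (simp add: C'_def)
  have est: "H1_norm (ball x\<^sub>0 r\<^sub>2) u \<le> exp (C' * (Linf_norm \<Omega> P powr (2/3) + 1)) *
      (L2_norm (ball x\<^sub>0 r\<^sub>1) u + Hm1_norm \<Omega> (schroedinger \<Omega> P u)) powr \<kappa> *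
      (L2_norm \<Omega> u + Hm1_norm \<Omega> (schroedinger \<Omega> P u)) powr (1 - \<kappa>)"
    if P: "P \<in> Linf \<Omega>" and u: "u \<in> H1 \<Omega>" for P u
  proof -
    define M where "M = Linf_norm \<Omega> P"
    define t where "t = M powr (2/3)"
    define a where "a = L2_norm (ball x\<^sub>0 r\<^sub>1) u + Hm1_norm \<Omega> (schroedinger \<Omega> P u)"
    define b where "b = L2_norm \<Omega> u + Hm1_norm \<Omega> (schroedinger \<Omega> P u)"
    have ab: "0 \<le> a" "0 \<le> b"
      using Hm1_norm_nonneg[OF assms(1) P u] by (auto simp: a_def b_def L2_norm_nonneg)
    have M: "0 \<le> M" by (simp add: M_def Linf_norm_nonneg)
    have t: "0 \<le> t" by (simp add: t_def)
    define K where "K = (real CARD('n) + 1) * (2 * exp (C * (t + 1)) * (5 + 2 * M) + 2)"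
    have e: "H1_norm (ball x\<^sub>0 r\<^sub>2) u \<le> K * ((a + \<epsilon>) powr \<kappa> * (b + \<epsilon>) powr (1 - \<kappa>))" if \<epsilon>: "0 < \<epsilon>" for \<epsilon>
      unfolding K_def t_def M_def a_def b_def
      by (rule three_ball_approximate[OF \<kappa> _ main[OF _ _ assms(1) BR P] assms(1) B r(2-4) P u \<epsilon>]) auto
    \<comment> \<open>Both exponents are positive, so \<open>powr\<close> is continuous even at a =
      0 or b = 0, and the additive error disappears in the limit.\<close>
    have "((\<lambda>\<epsilon>. K * ((a + \<epsilon>) powr \<kappa> * (b + \<epsilon>) powr (1 - \<kappa>))) \<longlongrightarrow> K * ((a + 0) powr \<kappa> * (b + 0) powr (1 - \<kappa>))) (at_right 0)"
      using \<kappa> ab by (intro tendsto_intros tendsto_powr') (auto simp: eventually_at_right_field intro!: exI[of _ 1])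
    moreover have "eventually (\<lambda>\<epsilon>. H1_norm (ball x\<^sub>0 r\<^sub>2) u \<le> K * ((a + \<epsilon>) powr \<kappa> * (b + \<epsilon>) powr (1 - \<kappa>))) (at_right 0)"
      using e by (auto simp: eventually_at_right_field intro!: exI[of _ 1])
    ultimately have "H1_norm (ball x\<^sub>0 r\<^sub>2) u \<le> K * ((a + 0) powr \<kappa> * (b + 0) powr (1 - \<kappa>))"
      by (intro tendsto_lowerbound) auto
    also have "\<dots> \<le> exp (C' * (t + 1)) * (a powr \<kappa> * b powr (1 - \<kappa>))"
    proof -
      define n where "n = real CARD('n) + 1"
      define E where "E = exp (C * (t + 1)) * exp (3 * t + 2)"
      have n: "0 \<le> n" by (simp add: n_def)
      have E1: "1 \<le> E" using C t by (simp add: E_def flip: exp_add)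
      have "exp (C * (t + 1)) * (5 + 2 * M) \<le> exp (C * (t + 1)) * (5 * exp (3 * t + 2))"
        using one_plus_le_exp_powr[OF M] M by (intro mult_left_mono) (auto simp: t_def)
      then have "exp (C * (t + 1)) * (5 + 2 * M) \<le> 5 * E" by (simp add: E_def)
      then have "2 * exp (C * (t + 1)) * (5 + 2 * M) + 2 \<le> 12 * E" using E1 by linarith
      then have "K \<le> n * (12 * E)" unfolding K_def n_def[symmetric] using n by (rule mult_left_mono)
      also have "\<dots> = (12 * n) * E" by simp
      also have "\<dots> \<le> exp (12 * n) * E" using exp_ge_add_one_self[of "12 * n"] E1 by (intro mult_right_mono) linarith+
      also have "\<dots> = exp (12 * n + C * (t + 1) + (3 * t + 2))" by (simp add: E_def exp_add)
      also have "\<dots> \<le> exp (C' * (t + 1))"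
        using mult_nonneg_nonneg[OF t n] by (simp add: C'_def n_def algebra_simps)
      finally show ?thesis using mult_right_mono[of K _ "a powr \<kappa> * b powr (1 - \<kappa>)"] by simp
    qed
    finally show ?thesis unfolding a_def b_def t_def M_def by (simp add: mult.assoc)
  qed
  show ?thesis
  proof (rule exI[of _ \<kappa>], intro conjI ballI allI impI \<kappa>)
    fix P assume "P \<in> Linf \<Omega>"
    then show "\<exists>C\<^sub>P>0. \<forall>u\<in>H1 \<Omega>. H1_norm (ball x\<^sub>0 r\<^sub>2) u
         \<le> C\<^sub>P * (L2_norm (ball x\<^sub>0 r\<^sub>1) u + Hm1_norm \<Omega> (schroedinger \<Omega> P u)) powr \<kappa>
              * (L2_norm \<Omega> u + Hm1_norm \<Omega> (schroedinger \<Omega> P u)) powr (1 - \<kappa>)"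
      using est by (intro exI[of _ "exp (C' * (Linf_norm \<Omega> P powr (2/3) + 1))"]) auto
  next
    fix \<epsilon> :: real
    have eq: "C' / \<kappa> powr (1 - \<epsilon>) * \<kappa> powr (1 - \<epsilon>) = C'" using \<kappa> by simp
    show "\<exists>C>0. \<forall>P\<in>Linf \<Omega>. (AE x in lebesgue_on \<Omega>. 0 \<le> P x) \<longrightarrow> (\<forall>u\<in>H1 \<Omega>.
          H1_norm (ball x\<^sub>0 r\<^sub>2) u
            \<le> exp (C * \<kappa> powr (1 - \<epsilon>) * (Linf_norm \<Omega> P powr (2/3) + 1))
                 * (L2_norm (ball x\<^sub>0 r\<^sub>1) u + Hm1_norm \<Omega> (schroedinger \<Omega> P u)) powr \<kappa>
                 * (L2_norm \<Omega> u + Hm1_norm \<Omega> (schroedinger \<Omega> P u)) powr (1 - \<kappa>))"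
      using C' \<kappa> est by (intro exI[of _ "C' / \<kappa> powr (1 - \<epsilon>)"]) (simp only: eq, simp)
  qed
qed

end
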